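(* Let $Y(t)=\int_{t_1(t)D_1\times t_2(t)D_2}\varphi(B_x)\,dx$ be the additive functional described in the context, where the covariance function $C$ of $B$ is of Gneiting type with factors $C_1,C_2$ and the rate condition $\lim_{t\to\infty}t_1(t)\,c_2(t_2(t))^{1/d_1}=+\infty$ holds. Let $R\ge 2$ be the Hermite rank of $\varphi$. Suppose that $C_1\notin L^R(\mathbb R^{d_1})$, but $C_1$ is asymptotically power-law with exponent $-\rho_1<0$ such that $R\rho_1<d_1$, and that $C_2\in L^{R(1-\rho_1/d_1)}(\mathbb R^{d_2})$. Then, as $t\to\infty$, $\widetilde Y(t)$ converges in distribution to $\mathcal N(0,1)$. Moreover, $\mathrm{Var}(Y(t))\sim \ell''\,t_2(t)^{d_2}\,t_1(t)^{2d_1-R\rho_1}$ for some constant $\ell''>0$.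
   Context: Setting. Let $d_1,d_2\ge1$, $d=d_1+d_2$. $B=(B_x)_{x\in\mathbb R^d}$ is a continuous, stationary, centered Gaussian field with unit variance and covariance function $C(x)=\mathrm{Cov}(B_x,B_0)$. $\varphi:\mathbb R\to\mathbb R$ is a non-constant function with $\mathbb E[\varphi(N)^2]<\infty$, $N\sim\mathcal N(0,1)$. With $H_q$ the $q$-th (probabilists') Hermite polynomial, $\varphi=\sum_{q\ge 0}a_qH_q$ in $L^2$ of the standard Gaussian measure, where $a_q=\frac1{q!}\mathbb E[H_q(N)\varphi(N)]$. The Hermite rank of $\varphi$ is the smallest $q\ge1$ with $a_q\ne0$. For $i=1,2$, $D_i\subset\mathbb R^{d_i}$ is a convex body (convex compact set with non-empty interior), and $t_i(t)>0$ satisfies $t_i(t)\to\infty$ as $t\to\infty$. $\widetilde Y(t)=(Y(t)-\mathbb E[Y(t)])/\sqrt{\mathrm{Var}(Y(t))}$. We write $f(t)\sim g(t)$ if $f(t)/g(t)\to1$ as $t\to\infty$. Gneiting type. $C$ is of Gneiting type with factors $C_1,C_2$ if $$C(x_1,x_2)=C_2(x_2)\,C_1\big(x_1\,C_2(x_2)^{1/d_1}\big),\qquad (x_1,x_2)\in\mathbb R^{d_1}\times\mathbb R^{d_2},$$ where $C_i:\mathbb R^{d_i}\to\mathbb R$ are radial, $C_i(x_i)=c_i(\|x_i\|)$ with $c_i:[0,\infty)\to\mathbb R$; $c_1$ is completely monotone (in particular $C_1\ge0$); $C_2>0$ and $1/c_2$ has a completely monotone derivative. A function $f:[0,\infty)\to\mathbb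 R$ is completely monotone if it is $C^\infty$ and $(-1)^nf^{(n)}(x)\ge0$ for all $x>0$ and $n\ge 0$. Power laws. A radial function $G(x)=g(\|x\|)$ is asymptotically power-law with exponent $-\rho<0$ if $r^{\rho}g(r)\to M$ as $r\to\infty$ for some finite constant $M\neq0$. *)

theory Defs
  imports "HOL-Probability.Probability" "HOL-Library.Landau_Symbols"
begin

section \<open>Gaussian fields\<close>

text \<open>A Gaussian variable may be degenerate: \<open>\<sigma> = 0\<close> gives the Dirac mass at \<open>\<mu>\<close>.\<close>

definition gaussian_rv :: "'w measure \<Rightarrow> ('w \<Rightarrow> real) \<Rightarrow> bool" where
  "gaussian_rv M X \<longleftrightarrow> X \<in> borel_measurable M \<and>
     (\<exists>\<mu> \<sigma>. \<sigma> \<ge> 0 \<and> distr M borel X =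
        (if \<sigma> = 0 then return borel \<mu> else density lborel (normal_density \<mu> \<sigma>)))"

definition gaussian_field :: "'w measure \<Rightarrow> ('x \<Rightarrow> 'w \<Rightarrow> real) \<Rightarrow> bool" where
  "gaussian_field M B \<longleftrightarrow>
     (\<forall>J a. finite J \<longrightarrow> gaussian_rv M (\<lambda>\<omega>. \<Sum>x\<in>J. a x * B x \<omega>))"

text \<open>Strict stationarity: all finite-dimensional distributions are shift invariant.\<close>

definition stationary_field :: "'w measure \<Rightarrow> ('x::ab_group_add \<Rightarrow> 'w \<Rightarrow> real) \<Rightarrow> bool" where
  "stationary_field M B \<longleftrightarrow>
     (\<forall>h J. finite J \<longrightarrow>
        distr M (\<Pi>\<^sub>M x\<in>J. borel) (\<lambda>\<omega>. \<lambda>x\<in>J. B (x + h) \<omega>) =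
        distr M (\<Pi>\<^sub>M x\<in>J. borel) (\<lambda>\<omega>. \<lambda>x\<in>J. B x \<omega>))"

definition centered_field :: "'w measure \<Rightarrow> ('x \<Rightarrow> 'w \<Rightarrow> real) \<Rightarrow> bool" where
  "centered_field M B \<longleftrightarrow> (\<forall>x. prob_space.expectation M (B x) = 0)"

definition unit_variance_field :: "'w measure \<Rightarrow> ('x \<Rightarrow> 'w \<Rightarrow> real) \<Rightarrow> bool" where
  "unit_variance_field M B \<longleftrightarrow> (\<forall>x. prob_space.variance M (B x) = 1)"

definition continuous_field :: "'w measure \<Rightarrow> ('x::topological_space \<Rightarrow> 'w \<Rightarrow> real) \<Rightarrow> bool" where
  "continuous_field M B \<longleftrightarrow> (\<forall>\<omega>\<in>space M. continuous_on UNIV (\<lambda>x. B x \<omega>))"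

definition covariance :: "'w measure \<Rightarrow> ('w \<Rightarrow> real) \<Rightarrow> ('w \<Rightarrow> real) \<Rightarrow> real" where
  "covariance M X Y = prob_space.expectation M
     (\<lambda>\<omega>. (X \<omega> - prob_space.expectation M X) * (Y \<omega> - prob_space.expectation M Y))"


section \<open>Hermite expansion\<close>

text \<open>Probabilists' Hermite polynomials.\<close>

fun hermite :: "nat \<Rightarrow> real \<Rightarrow> real" where
  "hermite 0 x = 1"
| "hermite (Suc 0) x = x"
| "hermite (Suc (Suc n)) x = x * hermite (Suc n) x - real (Suc n) * hermite n x"

definition hermite_coeff :: "(real \<Rightarrow> real) \<Rightarrow> nat \<Rightarrow> real" where
  "hermite_coeff \<phi> q = (LINT x|std_normal_distribution. hermite q x * \<phi> x) / fact q"

definition has_hermite_rank :: "(real \<Rightarrow> real) \<Rightarrow> nat \<Rightarrow> bool" where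
  "has_hermite_rank \<phi> R \<longleftrightarrow>
     1 \<le> R \<and> hermite_coeff \<phi> R \<noteq> 0 \<and> (\<forall>q. 1 \<le> q \<and> q < R \<longrightarrow> hermite_coeff \<phi> q = 0)"


section \<open>Covariance functions of Gneiting type\<close>

text \<open>Functions on \<open>[0,\<infinity>)\<close> are represented by total functions whose values on the negative
  half-line are irrelevant. Smoothness is required on \<open>(0,\<infinity>)\<close> only, so that functions such as
  \<open>exp (- sqrt r)\<close>, which are not differentiable at the origin, are included.\<close>

definition completely_monotone :: "(real \<Rightarrow> real) \<Rightarrow> bool" where
  "completely_monotone f \<longleftrightarrow>
     (\<forall>n. \<forall>x>0. (deriv ^^ n) f differentiable (at x) \<and> (- 1) ^ n * (deriv ^^ n) f x \<ge> 0)"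

definition gneiting_type ::
  "('a::euclidean_space \<times> 'b::euclidean_space \<Rightarrow> real) \<Rightarrow> ('a \<Rightarrow> real) \<Rightarrow> ('b \<Rightarrow> real) \<Rightarrow>
   (real \<Rightarrow> real) \<Rightarrow> (real \<Rightarrow> real) \<Rightarrow> bool" where
  "gneiting_type C C1 C2 c1 c2 \<longleftrightarrow>
     (\<forall>x1 x2. C (x1, x2) = C2 x2 * C1 ((C2 x2 powr (1 / real DIM('a))) *\<^sub>R x1)) \<and>
     (\<forall>x1. C1 x1 = c1 (norm x1)) \<and> (\<forall>x2. C2 x2 = c2 (norm x2)) \<and>
     completely_monotone c1 \<and>
     (\<forall>x2. C2 x2 > 0) \<and>
     (\<forall>r>0. (\<lambda>s. 1 / c2 s) differentiable (at r)) \<and>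
     completely_monotone (deriv (\<lambda>s. 1 / c2 s))"

definition asymp_power_law :: "('a::euclidean_space \<Rightarrow> real) \<Rightarrow> real \<Rightarrow> bool" where
  "asymp_power_law G \<rho> \<longleftrightarrow> \<rho> > 0 \<and>
     (\<exists>g M. (\<forall>x. G x = g (norm x)) \<and> M \<noteq> 0 \<and> ((\<lambda>r. r powr \<rho> * g r) \<longlongrightarrow> M) at_top)"

text \<open>Membership in \<open>L\<^sup>p\<close> of Lebesgue measure, for a real exponent \<open>p > 0\<close>.\<close>

definition in_Lp :: "real \<Rightarrow> ('a::euclidean_space \<Rightarrow> real) \<Rightarrow> bool" where
  "in_Lp p f \<longleftrightarrow> f \<in> borel_measurable lborel \<and> integrable lborel (\<lambda>x. \<bar>f x\<bar> powr p)"


section \<open>The additive functional\<close>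

definition convex_body :: "'a::euclidean_space set \<Rightarrow> bool" where
  "convex_body D \<longleftrightarrow> convex D \<and> compact D \<and> interior D \<noteq> {}"

definition additive_functional ::
  "('a::euclidean_space \<times> 'b::euclidean_space \<Rightarrow> 'w \<Rightarrow> real) \<Rightarrow> (real \<Rightarrow> real) \<Rightarrow>
   'a set \<Rightarrow> 'b set \<Rightarrow> (real \<Rightarrow> real) \<Rightarrow> (real \<Rightarrow> real) \<Rightarrow> real \<Rightarrow> 'w \<Rightarrow> real" where
  "additive_functional B \<phi> D1 D2 t1 t2 t \<omega> =
     (LINT x:((\<lambda>y. t1 t *\<^sub>R y) ` D1) \<times> ((\<lambda>y. t2 t *\<^sub>R y) ` D2)|lborel. \<phi> (B x \<omega>))"

definition normalized :: "'w measure \<Rightarrow> ('w \<Rightarrow> real) \<Rightarrow> 'w \<Rightarrow> real" where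
  "normalized M X \<omega> = (X \<omega> - prob_space.expectation M X) / sqrt (prob_space.variance M X)"

text \<open>Convergence in distribution along an arbitrary filter; the library predicate
  \<^const>\<open>weak_conv_m\<close> is the case of sequences.\<close>

definition converges_in_distribution ::
  "'w measure \<Rightarrow> ('i \<Rightarrow> 'w \<Rightarrow> real) \<Rightarrow> real measure \<Rightarrow> 'i filter \<Rightarrow> bool" where
  "converges_in_distribution M X \<nu> F \<longleftrightarrow>
     (\<forall>x. isCont (cdf \<nu>) x \<longrightarrow> ((\<lambda>i. cdf (distr M borel (X i)) x) \<longlongrightarrow> cdf \<nu> x) F)"

lemma converges_in_distribution_sequentially:
  "converges_in_distribution M X \<nu> sequentially \<longleftrightarrow> weak_conv_m (\<lambda>n. distr M borel (X n)) \<nu>"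
  by (simp add: converges_in_distribution_def weak_conv_m_def weak_conv_def)

end

theory Submission
  imports Defs "HOL-Real_Asymp.Real_Asymp"
begin

text \<open>
  Expand the functional in Hermite chaoses. By Parseval its variance is the sum over $q \ge 1$ of
  $a_q^2 q!$ times the double integral of $C(x - y)^q$, and $0 \le C \le 1$. The Gneiting structure and
  the power law give $C(z, w) \le K h(w) |z|^{-\rho}$ with $h = C_2^{1 - \rho / d_1}$, where $h^R$ is
  integrable by hypothesis. After rescaling the first coordinate, dominated convergence yields the
  exact growth of the double integral of $C^R$ and shows that the one of $C^{R+1}$ is negligible, so
  only the $R$-th chaos $F$ matters.

  For $F$ write $B_y = C(y - x) B_x + Z_y$ with $Z_y$ independent of $B_x$. Integrating by parts in
  $B_x$ gives $E[F e^{isF}] = is E[G e^{isF}]$, where $G$ is $R$ times the double integral of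
  $C(x - y) H_{R-1}(B_x) H_{R-1}(B_y)$. Solving this as a differential equation in $s$ yields
  $|E[e^{isF}] - e^{-s^2 v / 2}| \le s^2 E|G - v|$ with $v = E[F^2] = E[G]$. A recursion for fourth
  moments of Hermite polynomials bounds the variance of $G$ by contraction integrals over four points.
  These are negligible against $v^2$ because the kernel is long-range in the first coordinate only:
  $v^2$ leaves two pairs of second coordinates free to move independently, whereas a contraction ties
  all four of them together.
\<close>

section \<open>Hermite polynomials under the Gaussian measure\<close>

text \<open>In the power-law regime C_2(w) C_1(C_2(w)^(1/d_1) z) is about M C_2(w)
  C_2(w)^(-rho_1/d_1) |z|^(-rho_1), which is where the exponent 1 - rho_1/d_1 comes from. The
  variance constant is a_R^2 R! M^R |D_2| times the integral of h^R times the Riesz energy of D_1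
  with exponent R rho_1, and R rho_1 < d_1 makes that energy finite. G is the Malliavin-Stein factor
  <DF, -D L^(-1) F>. The obstacle to reaching it by one-dimensional calculus is that F depends on
  the whole sample path: B_x has to be independent of all residuals Z_y jointly, hence of a
  sigma-algebra, and F has to be rewritten by the Hermite addition formula as a polynomial in B_x
  whose coefficients are measurable for that algebra. Since C is nonnegative, every Wick diagram
  contributes a nonnegative term, so crude counting constants suffice and no cancellation has to be
  tracked. The Hermite expansion rests on the fact that a function orthogonal to all polynomials has
  vanishing Fourier transform under the Gaussian measure.\<close>

lemma hermite_Suc: "hermite (Suc n) x = x * hermite n x - real n * hermite (n - 1) x"
  by (cases n) auto

text \<open>Differentiating the three-term recursion and applying the recursion once more recombines
  the terms. For n = 0 the truncated predecessor is harmless because its factor is 0.\<close>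

lemma hermite_deriv: "(hermite n has_real_derivative real n * hermite (n - 1) x) (at x)"
proof (induction n arbitrary: x rule: less_induct)
  case (less n)
  show ?case
  proof (cases n)
    case 0
    have "hermite 0 = (\<lambda>_. 1)" by (simp add: fun_eq_iff)
    then show ?thesis using 0 by simp
  next
    case (Suc m)
    have e: "hermite n = (\<lambda>x. x * hermite m x - real m * hermite (m - 1) x)"
      unfolding Suc fun_eq_iff by (auto simp: hermite_Suc simp del: hermite.simps)
    have "((\<lambda>x. x * hermite m x - real m * hermite (m - 1) x) has_real_derivative
        (1 * hermite m x + (real m * hermite (m - 1) x) * x
          - real m * (real (m - 1) * hermite (m - 1 - 1) x))) (at x)"
      by (intro DERIV_diff DERIV_mult DERIV_ident DERIV_cmult less) (use Suc in auto)
    moreover have "1 * hermite m x + (real m * hermite (m - 1) x) * x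
          - real m * (real (m - 1) * hermite (m - 1 - 1) x) = real n * hermite (n - 1) x"
    proof (cases m)
      case 0 then show ?thesis using Suc by simp
    next
      case (Suc k)
      show ?thesis using Suc \<open>n = Suc m\<close>
        by (simp add: hermite_Suc[of k x] algebra_simps del: hermite.simps)
    qed
    ultimately show ?thesis unfolding e by simp
  qed
qed

lemma hermite_deriv' [derivative_intros]:
  "(f has_real_derivative f') (at x) \<Longrightarrow>
    ((\<lambda>x. hermite n (f x)) has_real_derivative (real n * hermite (n - 1) (f x)) * f') (at x)"
  using DERIV_chain2[OF hermite_deriv] by blast

lemma isCont_hermite: "isCont (hermite n) x"
  using hermite_deriv DERIV_isCont by blast

lemma continuous_on_hermite [continuous_intros]:
  "continuous_on A f \<Longrightarrow> continuous_on A (\<lambda>x. hermite n (f x))"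
  by (rule continuous_on_compose2[of UNIV "hermite n"])
    (auto intro: continuous_at_imp_continuous_on isCont_hermite)

lemma borel_measurable_hermite [measurable]: "hermite n \<in> borel_measurable borel"
  by (rule borel_measurable_continuous_onI) (rule continuous_on_hermite, rule continuous_on_id)

section \<open>Functions of polynomial growth and their Gaussian integrals\<close>

definition poly_growth :: "(real \<Rightarrow> 'b::real_normed_vector) \<Rightarrow> bool" where
  "poly_growth f \<longleftrightarrow> (\<exists>K k. \<forall>x. norm (f x) \<le> K * (1 + x\<^sup>2) ^ k)"

lemma poly_growthI: "(\<And>x. norm (f x) \<le> K * (1 + x\<^sup>2) ^ k) \<Longrightarrow> poly_growth f"
  unfolding poly_growth_def by blast

lemma poly_growthE:
  assumes "poly_growth f"
  obtains K k where "K \<ge> 0" "\<And>x. norm (f x) \<le> K * (1 + x\<^sup>2) ^ k"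
proof -
  obtain K k where K: "\<And>x. norm (f x) \<le> K * (1 + x\<^sup>2) ^ k"
    using assms unfolding poly_growth_def by blast
  have "0 \<le> norm (f 0)" by simp
  also have "\<dots> \<le> K" using K[of 0] by simp
  finally show thesis using K that by blast
qed

lemma poly_growth_mono:
  assumes "poly_growth g" "\<And>x. norm (f x) \<le> norm (g x)"
  shows "poly_growth f"
  using assms unfolding poly_growth_def by (meson order_trans)

lemma poly_growth_const [simp]: "poly_growth (\<lambda>_. c)"
  by (rule poly_growthI[of _ "norm c" 0]) simp

lemma poly_growth_ident: "poly_growth (\<lambda>x. x)"
proof (rule poly_growthI[of _ 1 1])
  fix x :: real
  have "0 \<le> (\<bar>x\<bar> - 1)\<^sup>2" by simp
  then show "norm x \<le> 1 * (1 + x\<^sup>2) ^ 1" by (simp add: power2_eq_square algebra_simps)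
qed

lemma poly_growth_add:
  assumes "poly_growth f" "poly_growth g" shows "poly_growth (\<lambda>x. f x + g x)"
proof -
  obtain K k where K: "K \<ge> 0" "\<And>x. norm (f x) \<le> K * (1 + x\<^sup>2) ^ k"
    using poly_growthE[OF assms(1)] by blast
  obtain L l where L: "L \<ge> 0" "\<And>x. norm (g x) \<le> L * (1 + x\<^sup>2) ^ l"
    using poly_growthE[OF assms(2)] by blast
  show ?thesis
  proof (rule poly_growthI[of _ "K + L" "k + l"])
    fix x :: real
    have "norm (f x + g x) \<le> K * (1 + x\<^sup>2) ^ k + L * (1 + x\<^sup>2) ^ l"
      using norm_triangle_ineq[of "f x" "g x"] K(2)[of x] L(2)[of x] by simp
    also have "\<dots> \<le> K * (1 + x\<^sup>2) ^ (k + l) + L * (1 + x\<^sup>2) ^ (k + l)"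
      by (intro add_mono mult_left_mono power_increasing K L) auto
    finally show "norm (f x + g x) \<le> (K + L) * (1 + x\<^sup>2) ^ (k + l)" by (simp add: algebra_simps)
  qed
qed

lemma poly_growth_scaleR:
  assumes "poly_growth f" "poly_growth g" shows "poly_growth (\<lambda>x. f x *\<^sub>R g x)"
proof -
  obtain K k where K: "K \<ge> 0" "\<And>x. norm (f x) \<le> K * (1 + x\<^sup>2) ^ k"
    using poly_growthE[OF assms(1)] by blast
  obtain L l where L: "L \<ge> 0" "\<And>x. norm (g x) \<le> L * (1 + x\<^sup>2) ^ l"
    using poly_growthE[OF assms(2)] by blast
  show ?thesis
  proof (rule poly_growthI[of _ "K * L" "k + l"])
    fix x :: real
    have "norm (f x) * norm (g x) \<le> (K * (1 + x\<^sup>2) ^ k) * (L * (1 + x\<^sup>2) ^ l)"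
      by (intro mult_mono K L) (auto intro: mult_nonneg_nonneg K L)
    then show "norm (f x *\<^sub>R g x) \<le> K * L * (1 + x\<^sup>2) ^ (k + l)" by (simp add: power_add algebra_simps)
  qed
qed

lemma poly_growth_mult:
  fixes f g :: "real \<Rightarrow> real"
  assumes "poly_growth f" "poly_growth g" shows "poly_growth (\<lambda>x. f x * g x)"
  using poly_growth_scaleR[OF assms] by simp

lemma poly_growth_power:
  fixes f :: "real \<Rightarrow> real"
  assumes "poly_growth f" shows "poly_growth (\<lambda>x. f x ^ n)"
  by (induction n) (auto intro: poly_growth_mult assms)

text \<open>With the residual z frozen, B_y is the affine function c u + z of the value u of B_x;
  this is the form in which growth conditions are needed.\<close>

lemma poly_growth_affine:
  assumes "poly_growth f" shows "poly_growth (\<lambda>x. f (c * x + z))"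
proof -
  obtain K k where K: "K \<ge> 0" "\<And>x. norm (f x) \<le> K * (1 + x\<^sup>2) ^ k"
    using poly_growthE[OF assms(1)] by blast
  let ?A = "1 + 2 * c\<^sup>2 + 2 * z\<^sup>2"
  show ?thesis
  proof (rule poly_growthI[of _ "K * ?A ^ k" "k"])
    fix x :: real
    have "0 \<le> (c * x - z)\<^sup>2" by simp
    then have "1 + (c * x + z)\<^sup>2 \<le> 1 + 2 * (c * x)\<^sup>2 + 2 * z\<^sup>2"
      by (simp add: power2_eq_square algebra_simps)
    \<comment> \<open>The added nonnegative terms complete the sum to the product
      \<open>?A * (1 + x\<^sup>2)\<close>.\<close>
    also have "\<dots> \<le> 1 + 2 * (c * x)\<^sup>2 + 2 * z\<^sup>2 + (2 * c\<^sup>2 + x\<^sup>2 + 2 * z\<^sup>2 * x\<^sup>2)" by simp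
    also have "\<dots> = ?A * (1 + x\<^sup>2)" by (simp add: power2_eq_square algebra_simps)
    finally have "(1 + (c * x + z)\<^sup>2) ^ k \<le> (?A * (1 + x\<^sup>2)) ^ k" by (intro power_mono) auto
    then have "K * (1 + (c * x + z)\<^sup>2) ^ k \<le> K * (?A * (1 + x\<^sup>2)) ^ k" using K by (intro mult_left_mono)
    then show "norm (f (c * x + z)) \<le> K * ?A ^ k * (1 + x\<^sup>2) ^ k"
      using order_trans[OF K(2)[of "c * x + z"]] by (simp only: power_mult_distrib mult.assoc)
  qed
qed

lemma poly_growth_hermite: "poly_growth (hermite n)"
proof (induction n rule: less_induct)
  case (less n)
  show ?case
  proof (cases n)
    case 0
    have "hermite 0 = (\<lambda>_. 1)" by (simp add: fun_eq_iff)
    then show ?thesis using 0 by simp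
  next
    case (Suc m)
    have e: "hermite n = (\<lambda>x. x * hermite m x + (- real m) * hermite (m - 1) x)"
      unfolding Suc fun_eq_iff by (auto simp: hermite_Suc simp del: hermite.simps)
    have "poly_growth (hermite m)" "poly_growth (hermite (m - 1))" using less Suc by auto
    then show ?thesis unfolding e
      by (intro poly_growth_add poly_growth_mult poly_growth_ident poly_growth_const)
  qed
qed

abbreviation (input) \<gamma> :: "real measure" where "\<gamma> \<equiv> std_normal_distribution"

lemma prob_space_gamma: "prob_space \<gamma>"
  using real_dist_normal_dist by (simp add: real_distribution_def)

lemma integrable_poly_growth:
  fixes f :: "real \<Rightarrow> 'b::{banach, second_countable_topology}"
  assumes "poly_growth f" and [measurable]: "f \<in> borel_measurable borel"
  shows "integrable \<gamma> f"
proof -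
  obtain K k where K: "K \<ge> 0" "\<And>x. norm (f x) \<le> K * (1 + x\<^sup>2) ^ k"
    using poly_growthE[OF assms(1)] by blast
  have "integrable \<gamma> (\<lambda>x. (\<Sum>i\<le>k. real (k choose i) * x ^ (2 * i)))"
    by (intro Bochner_Integration.integrable_sum integrable_mult_right
        integrable_std_normal_distribution_moment)
  moreover have "(1 + x\<^sup>2) ^ k = (\<Sum>i\<le>k. real (k choose i) * x ^ (2 * i))" for x :: real
    using binomial_ring[of "x\<^sup>2" 1 k] by (simp add: add.commute power_mult)
  ultimately have "integrable \<gamma> (\<lambda>x. K * (1 + x\<^sup>2) ^ k)" by simp
  then show ?thesis
    by (rule Bochner_Integration.integrable_bound) (auto intro!: AE_I2 K(2) order_trans[OF K(2)] simp: K(1))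
qed

text \<open>These are the boundary terms of integration by parts. Only the divergence of the square
  is asked of \<open>F\<close>, so one argument serves both ends of the line.\<close>

lemma poly_growth_density_tendsto_0:
  assumes "poly_growth f" and F: "filterlim (\<lambda>x::real. x\<^sup>2) at_top F"
  shows "((\<lambda>x. std_normal_density x *\<^sub>R f x) \<longlongrightarrow> 0) F"
proof -
  obtain K k where K: "K \<ge> 0" "\<And>x. norm (f x) \<le> K * (1 + x\<^sup>2) ^ k"
    using poly_growthE[OF assms(1)] by blast
  \<comment> \<open>With v = (1 + x^2)/2 the bound becomes a constant times v^k / exp v.\<close>
  have "filterlim (\<lambda>x::real. (1 + x\<^sup>2) / 2) at_top F"
    using F by (intro filterlim_tendsto_pos_mult_at_top[where f="\<lambda>_. 1/2", OF tendsto_const, simplified]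
        filterlim_tendsto_add_at_top[OF tendsto_const]) auto
  from filterlim_compose[OF tendsto_power_div_exp_0 this]
  have 1: "((\<lambda>x. ((1 + x\<^sup>2) / 2) ^ k / exp ((1 + x\<^sup>2) / 2)) \<longlongrightarrow> 0) F" .
  have 2: "((\<lambda>x. (K * 2 ^ k * exp (1/2) / sqrt (2 * pi)) * (((1 + x\<^sup>2) / 2) ^ k / exp ((1 + x\<^sup>2) / 2))) \<longlongrightarrow> 0) F"
    using tendsto_mult_right_zero[OF 1] .
  show ?thesis
  proof (rule Lim_null_comparison[OF _ 2], rule eventuallyI)
    fix x :: real
    have "exp (- x\<^sup>2 / 2) = exp (1/2) / exp ((1 + x\<^sup>2) / 2)"
      by (simp add: exp_diff[symmetric] field_simps)
    then have e: "std_normal_density x = exp (1/2) / (sqrt (2 * pi) * exp ((1 + x\<^sup>2) / 2))"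
      by (simp add: std_normal_density_def)
    have "norm (std_normal_density x *\<^sub>R f x) \<le> std_normal_density x * (K * (1 + x\<^sup>2) ^ k)"
      using K(2)[of x] by (simp add: mult_left_mono)
    also have "\<dots> = (K * 2 ^ k * exp (1/2) / sqrt (2 * pi)) * (((1 + x\<^sup>2) / 2) ^ k / exp ((1 + x\<^sup>2) / 2))"
      unfolding e by (simp add: power_divide)
    finally show "norm (std_normal_density x *\<^sub>R f x)
      \<le> (K * 2 ^ k * exp (1/2) / sqrt (2 * pi)) * (((1 + x\<^sup>2) / 2) ^ k / exp ((1 + x\<^sup>2) / 2))" .
  qed
qed

lemma std_normal_density_deriv:
  "(std_normal_density has_real_derivative - x * std_normal_density x) (at x)"
proof -
  have "((\<lambda>x. (1 / sqrt (2 * pi)) * exp (- x\<^sup>2 / 2)) has_real_derivative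
      (1 / sqrt (2 * pi)) * (exp (- x\<^sup>2 / 2) * (- x))) (at x)"
    by (intro DERIV_cmult) (auto intro!: derivative_eq_intros)
  moreover have "std_normal_density = (\<lambda>x. (1 / sqrt (2 * pi)) * exp (- x\<^sup>2 / 2))"
    by (simp add: std_normal_density_def fun_eq_iff)
  ultimately show ?thesis by (simp add: mult.commute)
qed

lemma integral_UNIV_FTC_zero:
  fixes F f :: "real \<Rightarrow> 'b::euclidean_space"
  assumes "\<And>x. (F has_vector_derivative f x) (at x)" "continuous_on UNIV f" "integrable lborel f"
    and "(F \<longlongrightarrow> 0) at_top" "(F \<longlongrightarrow> 0) at_bot"
  shows "(LINT x|lborel. f x) = 0"
proof -
  have "(LBINT x=-\<infinity>..\<infinity>. f x) = 0 - 0"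
    by (rule interval_integral_FTC_integrable[where F=F])
      (use assms in \<open>auto simp: ereal_tendsto_simps1 set_integrable_def continuous_on_eq_continuous_at\<close>)
  then show ?thesis
    by (simp add: interval_lebesgue_integral_def set_lebesgue_integral_def)
qed

text \<open>The product of the density, H_n and G has derivative density times (H_n G' - H_(n+1) G),
  because H_(n+1) = x H_n - H_n', and it vanishes at both ends. Vector values are allowed because G
  will also be a complex exponential.\<close>

lemma gaussian_ibp:
  fixes G G' :: "real \<Rightarrow> 'b::euclidean_space"
  assumes der: "\<And>x. (G has_vector_derivative G' x) (at x)"
    and cont: "continuous_on UNIV G'" and gr: "poly_growth G" "poly_growth G'"
  shows "(LINT x|\<gamma>. hermite (Suc n) x *\<^sub>R G x) = (LINT x|\<gamma>. hermite n x *\<^sub>R G' x)"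
proof -
  have contG: "continuous_on UNIV G"
    using der by (auto intro!: continuous_at_imp_continuous_on has_vector_derivative_continuous)
  have [measurable]: "G \<in> borel_measurable borel" "G' \<in> borel_measurable borel"
    using contG cont by (auto intro: borel_measurable_continuous_onI)
  have int1: "integrable \<gamma> (\<lambda>x. hermite (Suc n) x *\<^sub>R G x)" "integrable \<gamma> (\<lambda>x. hermite n x *\<^sub>R G' x)"
    by (auto intro!: integrable_poly_growth poly_growth_scaleR gr poly_growth_hermite simp del: hermite.simps)
  then have int2: "integrable lborel (\<lambda>x. std_normal_density x *\<^sub>R (hermite (Suc n) x *\<^sub>R G x))"
     "integrable lborel (\<lambda>x. std_normal_density x *\<^sub>R (hermite n x *\<^sub>R G' x))"
    by (auto simp: integrable_density simp del: hermite.simps)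
  have sq: "filterlim (\<lambda>x::real. x\<^sup>2) at_top at_top" "filterlim (\<lambda>x::real. x\<^sup>2) at_top at_bot"
    by real_asymp+
  have "(LINT x|lborel. std_normal_density x *\<^sub>R (hermite n x *\<^sub>R G' x) - std_normal_density x *\<^sub>R (hermite (Suc n) x *\<^sub>R G x)) = 0"
  proof (rule integral_UNIV_FTC_zero[where F="\<lambda>x. std_normal_density x *\<^sub>R (hermite n x *\<^sub>R G x)"])
    fix x
    have "((\<lambda>x. (std_normal_density x * hermite n x) *\<^sub>R G x) has_vector_derivative
      (std_normal_density x * hermite n x) *\<^sub>R G' x + ((- x * std_normal_density x) * hermite n x
         + (real n * hermite (n - 1) x) * std_normal_density x) *\<^sub>R G x) (at x)"
      by (rule has_vector_derivative_scaleR[OF DERIV_mult[OF std_normal_density_deriv hermite_deriv] der])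
    moreover have "(std_normal_density x * hermite n x) *\<^sub>R G' x + ((- x * std_normal_density x) * hermite n x
         + (real n * hermite (n - 1) x) * std_normal_density x) *\<^sub>R G x
       = std_normal_density x *\<^sub>R hermite n x *\<^sub>R G' x - std_normal_density x *\<^sub>R hermite (Suc n) x *\<^sub>R G x"
      by (simp add: hermite_Suc algebra_simps del: hermite.simps)
    ultimately show "((\<lambda>x. std_normal_density x *\<^sub>R hermite n x *\<^sub>R G x) has_vector_derivative
          std_normal_density x *\<^sub>R hermite n x *\<^sub>R G' x - std_normal_density x *\<^sub>R hermite (Suc n) x *\<^sub>R G x) (at x)"
      by simp
  next
    have "continuous_on UNIV std_normal_density"
      using std_normal_density_deriv by (meson DERIV_isCont continuous_at_imp_continuous_on)
    then show "continuous_on UNIV (\<lambda>x. std_normal_density x *\<^sub>R hermite n x *\<^sub>R G' x - std_normal_density x *\<^sub>R hermite (Suc n) x *\<^sub>R G x)"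
      by (intro continuous_intros contG cont)
  next
    show "((\<lambda>x. std_normal_density x *\<^sub>R hermite n x *\<^sub>R G x) \<longlongrightarrow> 0) at_top"
      "((\<lambda>x. std_normal_density x *\<^sub>R hermite n x *\<^sub>R G x) \<longlongrightarrow> 0) at_bot"
      by (intro poly_growth_density_tendsto_0 poly_growth_scaleR poly_growth_hermite gr sq)+
  qed (use int2 in auto)
  then show ?thesis using int2 by (simp add: integral_density del: hermite.simps)
qed

lemma hermite_orthogonal:
  "(LINT x|\<gamma>. hermite p x * hermite q x) = (if p = q then fact q else 0)"
proof (induction p arbitrary: q)
  case 0
  show ?case
  proof (cases q)
    case 0 then show ?thesis using prob_space.prob_space[OF prob_space_gamma] by simp
  next
    case (Suc m)
    have "(LINT x|\<gamma>. hermite (Suc m) x *\<^sub>R (1::real)) = (LINT x|\<gamma>. hermite m x *\<^sub>R (0::real))"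
      by (rule gaussian_ibp) auto
    then show ?thesis using Suc by (simp del: hermite.simps(3))
  qed
next
  case (Suc p)
  have "(LINT x|\<gamma>. hermite (Suc p) x *\<^sub>R hermite q x) = (LINT x|\<gamma>. hermite p x *\<^sub>R (real q * hermite (q - 1) x))"
    by (rule gaussian_ibp)
      (use hermite_deriv in \<open>auto intro!: continuous_intros poly_growth_mult poly_growth_hermite
        simp: has_real_derivative_iff_has_vector_derivative[symmetric]\<close>)
  also have "\<dots> = real q * (LINT x|\<gamma>. hermite p x * hermite (q - 1) x)"
    by (simp add: mult.left_commute)
  also have "\<dots> = (if Suc p = q then fact q else 0)"
    unfolding Suc by (cases q) auto
  finally show ?case by simp
qed

section \<open>Square-integrable functions and the Cauchy-Schwarz inequality\<close>

lemma integrable_L2_mult: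
  fixes f g :: "'w \<Rightarrow> real"
  assumes [measurable]: "f \<in> borel_measurable M" "g \<in> borel_measurable M"
    and "integrable M (\<lambda>x. (f x)\<^sup>2)" "integrable M (\<lambda>x. (g x)\<^sup>2)"
  shows "integrable M (\<lambda>x. f x * g x)"
proof (rule Bochner_Integration.integrable_bound)
  show "integrable M (\<lambda>x. (f x)\<^sup>2 + (g x)\<^sup>2)" using assms by simp
  show "AE x in M. norm (f x * g x) \<le> norm ((f x)\<^sup>2 + (g x)\<^sup>2)"
  proof (rule AE_I2)
    fix x
    have "0 \<le> (\<bar>f x\<bar> - \<bar>g x\<bar>)\<^sup>2" by simp
    then have "2 * (\<bar>f x\<bar> * \<bar>g x\<bar>) \<le> (f x)\<^sup>2 + (g x)\<^sup>2" by (simp add: power2_eq_square algebra_simps)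
    moreover have "0 \<le> \<bar>f x\<bar> * \<bar>g x\<bar>" by simp
    ultimately have "\<bar>f x\<bar> * \<bar>g x\<bar> \<le> (f x)\<^sup>2 + (g x)\<^sup>2" by linarith
    then show "norm (f x * g x) \<le> norm ((f x)\<^sup>2 + (g x)\<^sup>2)" by (simp add: abs_mult)
  qed
qed measurable

lemma integrable_L2_add:
  fixes f g :: "'w \<Rightarrow> real"
  assumes "f \<in> borel_measurable M" "g \<in> borel_measurable M"
    and "integrable M (\<lambda>x. (f x)\<^sup>2)" "integrable M (\<lambda>x. (g x)\<^sup>2)"
  shows "integrable M (\<lambda>x. (f x + g x)\<^sup>2)"
  using integrable_L2_mult[OF assms] assms by (simp add: power2_sum mult.assoc)

lemma integrable_L2_diff:
  fixes f g :: "'w \<Rightarrow> real"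
  assumes "f \<in> borel_measurable M" "g \<in> borel_measurable M"
    and "integrable M (\<lambda>x. (f x)\<^sup>2)" "integrable M (\<lambda>x. (g x)\<^sup>2)"
  shows "integrable M (\<lambda>x. (f x - g x)\<^sup>2)"
  using integrable_L2_mult[OF assms] assms by (simp add: power2_diff mult.assoc)

lemma Cauchy_Schwarz_integral:
  fixes f g :: "'w \<Rightarrow> real"
  assumes [measurable]: "f \<in> borel_measurable M" "g \<in> borel_measurable M"
    and f2: "integrable M (\<lambda>x. (f x)\<^sup>2)" and g2: "integrable M (\<lambda>x. (g x)\<^sup>2)"
  shows "(LINT x|M. f x * g x)\<^sup>2 \<le> (LINT x|M. (f x)\<^sup>2) * (LINT x|M. (g x)\<^sup>2)"
proof -
  have fg: "integrable M (\<lambda>x. f x * g x)" by (rule integrable_L2_mult) fact+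
  let ?a = "LINT x|M. (f x)\<^sup>2" and ?b = "LINT x|M. f x * g x" and ?c = "LINT x|M. (g x)\<^sup>2"
  have c0: "?c \<ge> 0" by simp
  have q: "0 \<le> ?a - 2 * t * ?b + t\<^sup>2 * ?c" for t
  proof -
    have "0 \<le> (LINT x|M. (f x - t * g x)\<^sup>2)" by simp
    also have "\<dots> = (LINT x|M. (f x)\<^sup>2 - 2 * t * (f x * g x) + t\<^sup>2 * (g x)\<^sup>2)"
      by (rule Bochner_Integration.integral_cong) (auto simp: power2_eq_square algebra_simps)
    also have "\<dots> = ?a - 2 * t * ?b + t\<^sup>2 * ?c" using f2 g2 fg by simp
    finally show ?thesis .
  qed
  show ?thesis
  proof (cases "?c = 0")
    case True
    then have "AE x in M. (g x)\<^sup>2 = 0" using integral_nonneg_eq_0_iff_AE[OF g2] by auto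
    then have "AE x in M. f x * g x = 0" by auto
    then have "?b = 0" by (rule integral_eq_zero_AE)
    then show ?thesis using True by simp
  next
    case False
    then have cp: "?c > 0" using c0 by linarith
    have "0 \<le> ?c * (?a - 2 * (?b / ?c) * ?b + (?b / ?c)\<^sup>2 * ?c)"
      using q[of "?b / ?c"] cp by (intro mult_nonneg_nonneg) auto
    also have "\<dots> = ?a * ?c - ?b\<^sup>2" using cp by (simp add: field_simps power2_eq_square)
    finally show ?thesis by linarith
  qed
qed

lemma (in prob_space) expectation_abs_le_sqrt:
  fixes f :: "'a \<Rightarrow> real"
  assumes [measurable]: "f \<in> borel_measurable M" and f2: "integrable M (\<lambda>x. (f x)\<^sup>2)"
  shows "expectation (\<lambda>x. \<bar>f x\<bar>) \<le> sqrt (expectation (\<lambda>x. (f x)\<^sup>2))"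
proof -
  have "(expectation (\<lambda>x. \<bar>f x\<bar> * 1))\<^sup>2 \<le> expectation (\<lambda>x. \<bar>f x\<bar>\<^sup>2) * expectation (\<lambda>x. 1\<^sup>2)"
    by (rule Cauchy_Schwarz_integral) (use f2 in auto)
  then show ?thesis by (intro real_le_rsqrt) (simp add: prob_space)
qed

text \<open>Hypothesis and conclusion both express that the conditional expectation of
  \<open>W\<close> given \<open>Z\<close> is zero. The positive and negative parts of
  \<open>W\<close>, taken as densities, push forward under \<open>Z\<close> to measures with the
  same characteristic function, and the uniqueness theorem identifies these.\<close>

lemma fourier_zero_imp_zero:
  fixes W Z :: "'w \<Rightarrow> real"
  assumes W: "integrable M W" and [measurable]: "Z \<in> borel_measurable M"
    and four: "\<And>v. (LINT w|M. W w *\<^sub>R iexp (v * Z w)) = 0" and A [measurable]: "A \<in> sets borel"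
  shows "(LINT w|M. W w * indicator A (Z w)) = 0"
proof -
  have [measurable]: "W \<in> borel_measurable M" using W by simp
  define P where "P = (\<lambda>w. max 0 (W w))"
  define N where "N = (\<lambda>w. max 0 (- W w))"
  have [measurable]: "P \<in> borel_measurable M" "N \<in> borel_measurable M"
    by (auto simp: P_def N_def)
  have P0: "P w \<ge> 0" "N w \<ge> 0" "W w = P w - N w" for w by (auto simp: P_def N_def)
  have iP: "integrable M P" "integrable M N"
    by (auto intro!: Bochner_Integration.integrable_bound[OF W] simp: P_def N_def)
  have bI: "integrable M (\<lambda>w. Q w *\<^sub>R g (Z w))" if "integrable M Q" "\<And>w. norm (g w) \<le> 1" "g \<in> borel_measurable borel"
    for Q :: "'w \<Rightarrow> real" and g :: "real \<Rightarrow> 'c::{banach,second_countable_topology}"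
  proof (rule Bochner_Integration.integrable_bound[OF that(1)])
    have [measurable]: "Q \<in> borel_measurable M" using that by simp
    note that(3)[measurable]
    show "(\<lambda>w. Q w *\<^sub>R g (Z w)) \<in> borel_measurable M" by measurable
    show "AE x in M. norm (Q x *\<^sub>R g (Z x)) \<le> norm (Q x)"
      using that(2) by (auto intro!: mult_left_le)
  qed
  have Peq: "(LINT w|M. P w *\<^sub>R iexp (v * Z w)) = (LINT w|M. N w *\<^sub>R iexp (v * Z w))" for v
  proof -
    have "(LINT w|M. P w *\<^sub>R iexp (v * Z w)) - (LINT w|M. N w *\<^sub>R iexp (v * Z w))
       = (LINT w|M. P w *\<^sub>R iexp (v * Z w) - N w *\<^sub>R iexp (v * Z w))"
      using bI[OF iP(1), of "\<lambda>z. iexp (v * z)"] bI[OF iP(2), of "\<lambda>z. iexp (v * z)"] by simp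
    also have "\<dots> = 0" using four[of v] by (simp add: P0(3) scaleR_diff_left)
    finally show ?thesis by simp
  qed
  let ?p = "LINT w|M. P w"
  have pn: "?p = (LINT w|M. N w)"
  proof -
    have "(LINT w|M. complex_of_real (P w)) = (LINT w|M. complex_of_real (N w))"
      using Peq[of 0] by (simp add: scaleR_conv_of_real)
    then show ?thesis by (simp add: integral_complex_of_real)
  qed
  have PNA: "(LINT w|M. P w * indicator A (Z w)) = (LINT w|M. N w * indicator A (Z w))"
  \<comment> \<open>Both parts have the same mass \<open>?p\<close>. If it is 0 they cannot be
    normalized to probability measures, but then both vanish almost everywhere.\<close>
  proof (cases "?p = 0")
    case True
    then have "AE w in M. P w = 0" "AE w in M. N w = 0"
      using integral_nonneg_eq_0_iff_AE[OF iP(1)] integral_nonneg_eq_0_iff_AE[OF iP(2)] P0 pn by auto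
    then have "AE w in M. P w * indicator A (Z w) = 0" "AE w in M. N w * indicator A (Z w) = (0::real)" by auto
    then show ?thesis by (simp add: integral_eq_zero_AE)
  next
    case False
    have "?p \<ge> 0" using P0 by simp
    with False have pp: "?p > 0" by linarith
    define D where "D = (\<lambda>Q. distr (density M (\<lambda>w. ennreal (Q w / ?p))) borel Z)"
    have D: "real_distribution (D Q)"
      "char (D Q) v = (LINT w|M. Q w *\<^sub>R iexp (v * Z w)) / ?p"
      "(LINT z|D Q. indicator A z) = (LINT w|M. Q w * indicator A (Z w)) / ?p"
      if Q: "integrable M Q" "\<And>w. Q w \<ge> 0" "integral\<^sup>L M Q = ?p" for Q v
    proof -
      have [measurable]: "Q \<in> borel_measurable M" using Q by simp
      have "emeasure (density M (\<lambda>w. ennreal (Q w / ?p))) (space M) = (\<integral>\<^sup>+w. ennreal (Q w / ?p) \<partial>M)"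
        by (subst emeasure_density) (auto intro!: nn_integral_cong)
      also have "\<dots> = ennreal (LINT w|M. Q w / ?p)"
        using Q pp by (intro nn_integral_eq_integral) auto
      also have "\<dots> = 1" using Q pp by simp
      finally have "prob_space (density M (\<lambda>w. ennreal (Q w / ?p)))" by (intro prob_spaceI) simp
      then show "real_distribution (D Q)" unfolding D_def
        by (intro prob_space.real_distribution_distr) auto
      show "char (D Q) v = (LINT w|M. Q w *\<^sub>R iexp (v * Z w)) / ?p"
      proof -
        have "char (D Q) v = (LINT w|M. (Q w / ?p) *\<^sub>R iexp (v * Z w))"
          unfolding char_def D_def using Q pp
          by (subst integral_distr, simp, simp, subst integral_density) auto
        also have "\<dots> = (LINT w|M. (Q w *\<^sub>R iexp (v * Z w)) / complex_of_real ?p)"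
          by (rule Bochner_Integration.integral_cong) (auto simp: scaleR_conv_of_real)
        also have "\<dots> = (LINT w|M. Q w *\<^sub>R iexp (v * Z w)) / ?p"
          by (rule Bochner_Integration.integral_divide_zero)
        finally show ?thesis .
      qed
      show "(LINT z|D Q. indicator A z) = (LINT w|M. Q w * indicator A (Z w)) / ?p"
        unfolding D_def using Q pp
        by (subst integral_distr, simp, simp, subst integral_density) auto
    qed
    have "D P = D N"
    proof (rule Levy_uniqueness)
      show "char (D P) = char (D N)"
        using D(2)[of P] D(2)[of N] iP P0 pn Peq by (intro ext) auto
    qed (use D(1) iP P0 pn in auto)
    then have "(LINT z|D P. indicator A z :: real) = (LINT z|D N. indicator A z)" by simp
    then show ?thesis
      using D(3)[of P] D(3)[of N] iP P0 pn pp by (auto simp: field_simps)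
  qed
  have "(LINT w|M. W w * indicator A (Z w)) = (LINT w|M. P w * indicator A (Z w) - N w * indicator A (Z w))"
    by (simp add: P0(3) left_diff_distrib)
  also have "\<dots> = 0"
    using PNA bI[OF iP(1), of "indicat_real A"] bI[OF iP(2), of "indicat_real A"]
    by (simp add: indicator_le_1)
  finally show ?thesis .
qed

text \<open>Taking \<open>Z\<close> to be the identity and testing on the sets where g > 0 and where
  g < 0 forces both to be null.\<close>

lemma fourier_zero_imp_AE_zero:
  fixes g :: "real \<Rightarrow> real"
  assumes M: "sets M = sets borel" and W: "integrable M g"
    and four: "\<And>v. (LINT x|M. g x *\<^sub>R iexp (v * x)) = 0"
  shows "AE x in M. g x = 0"
proof -
  have [measurable]: "g \<in> borel_measurable M" using W by simp
  have id[measurable]: "(\<lambda>x. x) \<in> borel_measurable M" using M by (simp add: measurable_ident_sets)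
  have gb: "g \<in> borel_measurable borel" using W M measurable_cong_sets by blast
  have pos: "AE x in M. h x \<le> 0" if h: "integrable M h" "h \<in> borel_measurable borel"
     "\<And>A. A \<in> sets borel \<Longrightarrow> (LINT w|M. h w * indicator A w) = 0" for h :: "real \<Rightarrow> real"
  proof -
    have A: "{x. h x > 0} \<in> sets borel" using h(2) by measurable
    have e: "h x * indicator {x. h x > 0} x = max 0 (h x)" for x by (auto simp: indicator_def)
    have "(LINT w|M. max 0 (h w)) = 0" using h(3)[OF A] by (simp add: e)
    moreover have "integrable M (\<lambda>x. max 0 (h x))" using h(1) by simp
    ultimately have "AE x in M. max 0 (h x) = 0"
      using integral_nonneg_eq_0_iff_AE[of M "\<lambda>x. max 0 (h x)"] by auto
    then show ?thesis by (auto simp: max_def elim!: eventually_mono split: if_splits)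
  qed
  have z: "(LINT w|M. g w * indicator A w) = 0" if "A \<in> sets borel" for A
    by (rule fourier_zero_imp_zero[OF W id four that])
  have "AE x in M. g x \<le> 0" by (rule pos) (use W gb z in auto)
  moreover have "AE x in M. - g x \<le> 0" by (rule pos) (use W gb z in auto)
  ultimately show ?thesis by eventually_elim auto
qed

text \<open>Completing the square turns exp (c x) times the standard density into exp (c^2/2) times
  the normal density with mean c.\<close>

lemma integrable_exp_gamma: "integrable \<gamma> (\<lambda>x. exp (c * x))"
proof -
  have "integrable lborel (\<lambda>x. exp (c\<^sup>2 / 2) * normal_density c 1 x)" by simp
  moreover have "exp (c\<^sup>2 / 2) * normal_density c 1 x = std_normal_density x * exp (c * x)" for x
  proof -
    have "c\<^sup>2 / 2 + - (x - c)\<^sup>2 / 2 = - x\<^sup>2 / 2 + c * x"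
      by (simp add: power2_eq_square field_simps)
    then have "exp (c\<^sup>2 / 2) * exp (- (x - c)\<^sup>2 / 2) = exp (- x\<^sup>2 / 2) * exp (c * x)"
      by (simp only: exp_add[symmetric])
    then show ?thesis by (simp add: normal_density_def)
  qed
  ultimately show ?thesis by (simp add: integrable_density)
qed

lemma integrable_exp_abs_gamma: "integrable \<gamma> (\<lambda>x. exp (\<bar>c * x\<bar>))"
proof (rule Bochner_Integration.integrable_bound)
  show "integrable \<gamma> (\<lambda>x. exp (c * x) + exp ((- c) * x))"
    by (intro Bochner_Integration.integrable_add integrable_exp_gamma)
  show "AE x in \<gamma>. norm (exp \<bar>c * x\<bar>) \<le> norm (exp (c * x) + exp (- c * x))"
  proof (rule AE_I2)
    fix x
    have "exp \<bar>c * x\<bar> \<le> exp (c * x) + exp (- c * x)" by (cases "c * x \<ge> 0") auto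
    then show "norm (exp \<bar>c * x\<bar>) \<le> norm (exp (c * x) + exp (- c * x))" by simp
  qed
qed simp

text \<open>Orthogonality to the Hermite polynomials gives orthogonality to all monomials, hence to
  every partial sum of the exponential series. The exponential moments of the Gaussian measure allow
  passing to the limit.\<close>

lemma iexp_integral_zero_of_hermite:
  fixes g :: "real \<Rightarrow> real"
  assumes [measurable]: "g \<in> borel_measurable borel" and g2: "integrable \<gamma> (\<lambda>x. (g x)\<^sup>2)"
    and orth: "\<And>q. (LINT x|\<gamma>. hermite q x * g x) = 0"
  shows "(LINT x|\<gamma>. g x *\<^sub>R iexp (v * x)) = 0"
proof -
  have iH: "integrable \<gamma> (\<lambda>x. (x ^ k * hermite q x) * g x)" for k q
    by (intro integrable_L2_mult g2) (auto intro!: integrable_poly_growth poly_growth_power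
         poly_growth_mult poly_growth_ident poly_growth_hermite)
  \<comment> \<open>The power is lowered by x H_q = H_(q+1) + q H_(q-1), so the induction on
    \<open>k\<close> has to run over all \<open>q\<close> at once.\<close>
  have mom: "(LINT x|\<gamma>. (x ^ k * hermite q x) * g x) = 0" for k q
  proof (induction k arbitrary: q)
    case 0 then show ?case using orth by simp
  next
    case (Suc k)
    have e: "x * hermite q x = hermite (Suc q) x + real q * hermite (q - 1) x" for x
      by (simp add: hermite_Suc del: hermite.simps)
    have "(LINT x|\<gamma>. (x ^ Suc k * hermite q x) * g x)
      = (LINT x|\<gamma>. (x ^ k * hermite (Suc q) x) * g x + real q * ((x ^ k * hermite (q - 1) x) * g x))"
    proof (rule Bochner_Integration.integral_cong)
      fix x
      have "x ^ Suc k * hermite q x * g x = x ^ k * (x * hermite q x) * g x" by simp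
      also have "\<dots> = (x ^ k * hermite (Suc q) x) * g x + real q * ((x ^ k * hermite (q - 1) x) * g x)"
        unfolding e by (simp add: algebra_simps)
      finally show "x ^ Suc k * hermite q x * g x = (x ^ k * hermite (Suc q) x) * g x + real q * ((x ^ k * hermite (q - 1) x) * g x)" .
    qed simp
    also have "\<dots> = 0" using iH Suc by (simp del: hermite.simps)
    finally show ?case .
  qed
  have mom1: "(LINT x|\<gamma>. x ^ k * g x) = 0" "integrable \<gamma> (\<lambda>x. x ^ k * g x)" for k
    using mom[of k 0] iH[of k 0] by simp_all
  let ?s = "\<lambda>n x. (\<Sum>k<n. (\<i> * complex_of_real (v * x)) ^ k /\<^sub>R fact k) * complex_of_real (g x)"
  have s0: "(LINT x|\<gamma>. ?s n x) = 0" for n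
  proof -
    have e: "?s n x = (\<Sum>k<n. (\<i> * complex_of_real v) ^ k /\<^sub>R fact k * complex_of_real (x ^ k * g x))" for x
      by (simp add: sum_distrib_left sum_distrib_right power_mult_distrib scaleR_conv_of_real mult_ac)
    have "(LINT x|\<gamma>. ?s n x) = (\<Sum>k<n. (LINT x|\<gamma>. (\<i> * complex_of_real v) ^ k /\<^sub>R fact k * complex_of_real (x ^ k * g x)))"
      unfolding e using mom1(2) by (intro Bochner_Integration.integral_sum) (auto intro!: integrable_mult_right integrable_of_real simp del: of_real_mult of_real_power)
    also have "\<dots> = 0"
    proof (rule sum.neutral, rule ballI)
      fix k
      have "(LINT x|\<gamma>. (\<i> * complex_of_real v) ^ k /\<^sub>R fact k * complex_of_real (x ^ k * g x))
        = (\<i> * complex_of_real v) ^ k /\<^sub>R fact k * (LINT x|\<gamma>. complex_of_real (x ^ k * g x))"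
        by (rule Bochner_Integration.integral_mult_right_zero)
      also have "\<dots> = 0" by (simp only: integral_complex_of_real mom1) simp
      finally show "(LINT x|\<gamma>. (\<i> * complex_of_real v) ^ k /\<^sub>R fact k * complex_of_real (x ^ k * g x)) = 0" .
    qed
    finally show ?thesis .
  qed
  \<comment> \<open>The partial sums are dominated by exp |v x| |g|, a product of two
    square-integrable functions.\<close>
  have "(\<lambda>n. LINT x|\<gamma>. ?s n x) \<longlonglongrightarrow> (LINT x|\<gamma>. g x *\<^sub>R iexp (v * x))"
  proof (rule integral_dominated_convergence[where w="\<lambda>x. exp \<bar>v * x\<bar> * \<bar>g x\<bar>"])
    have "(exp \<bar>v * x\<bar>)\<^sup>2 = exp \<bar>(2 * v) * x\<bar>" for x
    proof -
      have "\<bar>(2 * v) * x\<bar> = \<bar>v * x\<bar> + \<bar>v * x\<bar>" by (simp add: abs_mult)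
      then show ?thesis by (simp only: exp_add power2_eq_square)
    qed
    then have "integrable \<gamma> (\<lambda>x. (exp \<bar>v * x\<bar>)\<^sup>2)" using integrable_exp_abs_gamma[of "2 * v"] by simp
    then show "integrable \<gamma> (\<lambda>x. exp \<bar>v * x\<bar> * \<bar>g x\<bar>)"
      by (intro integrable_L2_mult) (use g2 in auto)
    show "AE x in \<gamma>. (\<lambda>n. ?s n x) \<longlonglongrightarrow> g x *\<^sub>R iexp (v * x)"
    proof (rule AE_I2)
      fix x
      have "(\<lambda>n. \<Sum>k<n. (\<i> * complex_of_real (v * x)) ^ k /\<^sub>R fact k) \<longlonglongrightarrow> iexp (v * x)"
        using exp_converges[of "\<i> * complex_of_real (v * x)"] by (simp add: sums_def)
      then have "(\<lambda>n. ?s n x) \<longlonglongrightarrow> iexp (v * x) * complex_of_real (g x)" by (rule tendsto_mult_right)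
      then show "(\<lambda>n. ?s n x) \<longlonglongrightarrow> g x *\<^sub>R iexp (v * x)" by (simp add: scaleR_conv_of_real mult.commute)
    qed
    show "AE x in \<gamma>. norm (?s n x) \<le> exp \<bar>v * x\<bar> * \<bar>g x\<bar>" for n
    proof (rule AE_I2)
      fix x
      have "norm (\<Sum>k<n. (\<i> * complex_of_real (v * x)) ^ k /\<^sub>R fact k)
         \<le> (\<Sum>k<n. \<bar>v * x\<bar> ^ k /\<^sub>R fact k)"
        by (rule order_trans[OF norm_sum]) (simp add: norm_power norm_mult abs_mult)
      also have "\<dots> \<le> exp \<bar>v * x\<bar>"
        unfolding exp_def by (intro sum_le_suminf summable_exp_generic) auto
      finally show "norm (?s n x) \<le> exp \<bar>v * x\<bar> * \<bar>g x\<bar>"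
        by (simp only: norm_mult norm_of_real real_norm_def) (rule mult_right_mono, auto)
    qed
  qed measurable
  then show ?thesis unfolding s0 using LIMSEQ_unique tendsto_const by blast
qed

section \<open>The Hermite expansion in L2\<close>

definition hermite_sum :: "(nat \<Rightarrow> real) \<Rightarrow> nat set \<Rightarrow> real \<Rightarrow> real" where
  "hermite_sum a I x = (\<Sum>q\<in>I. a q * hermite q x)"

lemma hermite_sum_measurable [measurable]: "hermite_sum a I \<in> borel_measurable borel"
  unfolding hermite_sum_def by measurable

lemma poly_growth_sum:
  assumes "\<And>i. i \<in> I \<Longrightarrow> poly_growth (f i)" shows "poly_growth (\<lambda>x. \<Sum>i\<in>I. f i x)"
  using assms by (induction I rule: infinite_finite_induct) (auto intro!: poly_growth_add)

lemma poly_growth_hermite_sum: "poly_growth (hermite_sum a I)"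
  unfolding hermite_sum_def by (intro poly_growth_sum poly_growth_mult poly_growth_hermite poly_growth_const)

lemma hermite_sum_L2: "integrable \<gamma> (\<lambda>x. (hermite_sum a I x)\<^sup>2)"
  by (intro integrable_poly_growth poly_growth_power poly_growth_hermite_sum) simp

lemma integral_hermite_sum_mult:
  assumes "finite I" and [measurable]: "f \<in> borel_measurable borel" and f2: "integrable \<gamma> (\<lambda>x. (f x)\<^sup>2)"
  shows "(LINT x|\<gamma>. hermite_sum a I x * f x) = (\<Sum>q\<in>I. a q * hermite_coeff f q * fact q)"
proof -
  have i: "integrable \<gamma> (\<lambda>x. hermite q x * f x)" for q
    by (intro integrable_L2_mult f2 integrable_poly_growth poly_growth_power poly_growth_hermite) auto
  have "(LINT x|\<gamma>. hermite_sum a I x * f x) = (LINT x|\<gamma>. (\<Sum>q\<in>I. a q * (hermite q x * f x)))"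
    unfolding hermite_sum_def by (simp add: sum_distrib_right mult.assoc)
  also have "\<dots> = (\<Sum>q\<in>I. a q * (LINT x|\<gamma>. hermite q x * f x))"
    using i by (subst Bochner_Integration.integral_sum) auto
  also have "\<dots> = (\<Sum>q\<in>I. a q * hermite_coeff f q * fact q)"
    by (simp add: hermite_coeff_def)
  finally show ?thesis .
qed

lemma hermite_coeff_hermite: "hermite_coeff (hermite p) q = (if p = q then 1 else 0)"
  using hermite_orthogonal[of q p] by (auto simp: hermite_coeff_def)

lemma hermite_coeff_add:
  assumes [measurable]: "f \<in> borel_measurable borel" "g \<in> borel_measurable borel"
    and f2: "integrable \<gamma> (\<lambda>x. (f x)\<^sup>2)" "integrable \<gamma> (\<lambda>x. (g x)\<^sup>2)"
  shows "hermite_coeff (\<lambda>x. f x + c * g x) q = hermite_coeff f q + c * hermite_coeff g q"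
proof -
  have i: "integrable \<gamma> (\<lambda>x. hermite q x * f x)" "integrable \<gamma> (\<lambda>x. hermite q x * g x)"
    by (intro integrable_L2_mult f2 integrable_poly_growth poly_growth_power poly_growth_hermite, auto)+
  have "(LINT x|\<gamma>. hermite q x * (f x + c * g x)) = (LINT x|\<gamma>. hermite q x * f x + c * (hermite q x * g x))"
    by (simp add: algebra_simps)
  then show ?thesis using i by (simp add: hermite_coeff_def add_divide_distrib)
qed

lemma hermite_coeff_hermite_sum:
  assumes "finite I"
  shows "hermite_coeff (hermite_sum a I) q = (if q \<in> I then a q else 0)"
proof -
  have "hermite_coeff (hermite_sum a I) q = (LINT x|\<gamma>. hermite_sum a I x * hermite q x) / fact q"
    by (simp add: hermite_coeff_def mult.commute)
  also have "\<dots> = (\<Sum>p\<in>I. a p * hermite_coeff (hermite q) p * fact p) / fact q"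
    using assms by (subst integral_hermite_sum_mult)
      (auto intro!: integrable_poly_growth poly_growth_power poly_growth_hermite)
  also have "\<dots> = (if q \<in> I then a q else 0)"
  proof -
    have "(\<Sum>p\<in>I. a p * hermite_coeff (hermite q) p * fact p) = (\<Sum>p\<in>I. if q = p then a p * fact p else 0)"
      by (intro sum.cong) (auto simp: hermite_coeff_hermite)
    then show ?thesis using assms by simp
  qed
  finally show ?thesis .
qed

lemma integral_hermite_sum_sq:
  assumes "finite I"
  shows "(LINT x|\<gamma>. (hermite_sum a I x)\<^sup>2) = (\<Sum>q\<in>I. (a q)\<^sup>2 * fact q)"
proof -
  have "(LINT x|\<gamma>. (hermite_sum a I x)\<^sup>2) = (LINT x|\<gamma>. hermite_sum a I x * hermite_sum a I x)"
    by (simp add: power2_eq_square)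
  also have "\<dots> = (\<Sum>q\<in>I. a q * a q * fact q)"
    using assms by (subst integral_hermite_sum_mult[OF assms]) (auto simp: hermite_sum_L2 hermite_coeff_hermite_sum)
  finally show ?thesis by (simp add: power2_eq_square)
qed

lemma integral_hermite_residual:
  assumes "finite I" and [measurable]: "f \<in> borel_measurable borel" and f2: "integrable \<gamma> (\<lambda>x. (f x)\<^sup>2)"
  shows "(LINT x|\<gamma>. (f x - hermite_sum (hermite_coeff f) I x)\<^sup>2)
    = (LINT x|\<gamma>. (f x)\<^sup>2) - (\<Sum>q\<in>I. (hermite_coeff f q)\<^sup>2 * fact q)"
proof -
  let ?S = "hermite_sum (hermite_coeff f) I"
  have "(LINT x|\<gamma>. (f x - ?S x)\<^sup>2) = (LINT x|\<gamma>. (f x)\<^sup>2 - 2 * (?S x * f x) + (?S x)\<^sup>2)"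
    by (simp add: power2_diff algebra_simps)
  also have "\<dots> = (LINT x|\<gamma>. (f x)\<^sup>2) - 2 * (LINT x|\<gamma>. ?S x * f x) + (LINT x|\<gamma>. (?S x)\<^sup>2)"
    using f2 hermite_sum_L2[of "hermite_coeff f" I]
      integrable_L2_mult[of ?S \<gamma> f] by (simp add: hermite_sum_L2)
  also have "\<dots> = (LINT x|\<gamma>. (f x)\<^sup>2) - (\<Sum>q\<in>I. (hermite_coeff f q)\<^sup>2 * fact q)"
    using integral_hermite_sum_mult[OF assms(1,2) f2, of "hermite_coeff f"]
       integral_hermite_sum_sq[OF assms(1), of "hermite_coeff f"]
    by (simp add: power2_eq_square)
  finally show ?thesis .
qed

text \<open>By Bessel's inequality the partial sums are Cauchy. Their limit \<open>L\<close> has the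
  same coefficients as \<open>f\<close>, so the difference is orthogonal to every Hermite polynomial
  and therefore vanishes by Fourier uniqueness.\<close>

theorem hermite_expansion_L2:
  fixes f :: "real \<Rightarrow> real"
  assumes [measurable]: "f \<in> borel_measurable borel" and f2: "integrable \<gamma> (\<lambda>x. (f x)\<^sup>2)"
  shows "(\<lambda>N. LINT x|\<gamma>. (f x - hermite_sum (hermite_coeff f) {..<N} x)\<^sup>2) \<longlonglongrightarrow> 0"
proof -
  define a where "a = hermite_coeff f"
  define S where "S N = hermite_sum a {..<N}" for N
  define b where "b q = (a q)\<^sup>2 * fact q" for q
  \<comment> \<open>\<open>T N\<close>, the tail of the Bessel series, is the common bound for all
    squared L2 distances below.\<close>
  define T where "T N = (\<Sum>q. b (q + N))" for N
  have [measurable]: "S N \<in> borel_measurable borel" for N by (simp add: S_def)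
  have S2: "integrable \<gamma> (\<lambda>x. (S N x)\<^sup>2)" for N by (simp add: S_def hermite_sum_L2)
  have b0: "b q \<ge> 0" for q by (simp add: b_def)
  have sb: "summable b"
  proof (rule summableI_nonneg_bounded)
    fix n
    have "0 \<le> (LINT x|\<gamma>. (f x - hermite_sum a {..<n} x)\<^sup>2)" by simp
    also have "\<dots> = (LINT x|\<gamma>. (f x)\<^sup>2) - (\<Sum>q<n. b q)"
      unfolding a_def b_def by (rule integral_hermite_residual) (use f2 in auto)
    finally show "(\<Sum>q<n. b q) \<le> (LINT x|\<gamma>. (f x)\<^sup>2)" by simp
  qed (rule b0)
  have sbN: "summable (\<lambda>q. b (q + N))" for N using sb by (simp add: summable_iff_shift)
  have T0: "T \<longlonglongrightarrow> 0" unfolding T_def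
    using suminf_exist_split2[OF sb] by simp
  have T_nonneg: "T N \<ge> 0" for N unfolding T_def by (intro suminf_nonneg sbN b0)
  have T_mono: "T N \<le> T M" if "M \<le> N" for M N
  proof -
    have "T M = (\<Sum>q. b (q + (N - M) + M)) + (\<Sum>q<N - M. b (q + M))"
      unfolding T_def using suminf_split_initial_segment[OF sbN[of M], of "N - M"] by simp
    also have "(\<Sum>q. b (q + (N - M) + M)) = T N" using that by (simp add: T_def add.assoc)
    finally show ?thesis using sum_nonneg[of "{..<N-M}" "\<lambda>q. b (q + M)"] b0 by simp
  qed
  have diffT: "(LINT x|\<gamma>. (S N x - S M x)\<^sup>2) \<le> T M" if "M \<le> N" for M N
  proof -
    have "S N x - S M x = hermite_sum a {M..<N} x" for x
    proof -
      show ?thesis unfolding S_def hermite_sum_def lessThan_atLeast0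
        using sum.atLeastLessThan_concat[of 0 M N "\<lambda>q. a q * hermite q x"] that by simp
    qed
    then have "(LINT x|\<gamma>. (S N x - S M x)\<^sup>2) = (\<Sum>q\<in>{M..<N}. b q)"
      by (simp add: integral_hermite_sum_sq b_def)
    also have "\<dots> = (\<Sum>q<N - M. b (q + M))"
      by (rule sum.reindex_bij_witness[of _ "\<lambda>q. q + M" "\<lambda>q. q - M"]) auto
    also have "\<dots> \<le> T M" unfolding T_def by (intro sum_le_suminf sbN) (auto simp: b0)
    finally show ?thesis .
  qed
  \<comment> \<open>The limit is built from an almost everywhere convergent subsequence, and the
    criterion for one asks for a Cauchy sequence in L1.\<close>
  have L1: "(LINT x|\<gamma>. norm (S i x - S j x)) \<le> sqrt (T N)" if "i \<ge> N" "j \<ge> N" for i j N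
  proof -
    have "(LINT x|\<gamma>. norm (S i x - S j x)) \<le> sqrt (LINT x|\<gamma>. (S i x - S j x)\<^sup>2)"
      unfolding real_norm_def
      by (intro prob_space.expectation_abs_le_sqrt[OF prob_space_gamma] integrable_L2_diff S2) auto
    also have "(LINT x|\<gamma>. (S i x - S j x)\<^sup>2) \<le> T N"
    proof (cases "i \<le> j")
      case True
      then show ?thesis using diffT[OF True] T_mono[OF that(1)]
        by (simp add: power2_commute[of "S i _"])
    next
      case False
      then have "j \<le> i" by simp
      from diffT[OF this] T_mono[OF that(2)] show ?thesis by simp
    qed
    finally show ?thesis by simp
  qed
  obtain r where r: "strict_mono r" and cau: "AE x in \<gamma>. Cauchy (\<lambda>i. S (r i) x)"
  proof (rule cauchy_L1_AE_cauchy_subseq[of \<gamma> S])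
    show "integrable \<gamma> (S n)" for n
      unfolding S_def by (intro integrable_poly_growth poly_growth_hermite_sum) simp
    fix e :: real assume e: "e > 0"
    have "(\<lambda>N. sqrt (T N)) \<longlonglongrightarrow> sqrt 0" by (intro tendsto_real_sqrt T0)
    then have "eventually (\<lambda>N. sqrt (T N) < e) sequentially" using e by (auto dest: order_tendstoD)
    then obtain N where "sqrt (T N) < e" by (auto simp: eventually_sequentially)
    then show "\<exists>N. \<forall>i\<ge>N. \<forall>j\<ge>N. (LINT x|\<gamma>. norm (S i x - S j x)) < e"
      using L1[of N] by (meson le_less_trans)
  qed blast
  define L where "L x = lim (\<lambda>i. S (r i) x)" for x
  have [measurable]: "L \<in> borel_measurable borel" unfolding L_def by (rule borel_measurable_lim_metric) measurable
  have lim: "AE x in \<gamma>. (\<lambda>i. S (r i) x) \<longlonglongrightarrow> L x"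
    using cau by eventually_elim (auto simp: L_def convergent_LIMSEQ_iff[symmetric] Cauchy_convergent_iff[symmetric])
  \<comment> \<open>Fatou's lemma along the subsequence carries the Cauchy estimate over to the
    limit.\<close>
  have LN: "integrable \<gamma> (\<lambda>x. (L x - S N x)\<^sup>2)" "(LINT x|\<gamma>. (L x - S N x)\<^sup>2) \<le> T N" for N
  proof -
    have "(\<integral>\<^sup>+x. ennreal ((L x - S N x)\<^sup>2) \<partial>\<gamma>)
       = (\<integral>\<^sup>+x. liminf (\<lambda>i. ennreal ((S (r i) x - S N x)\<^sup>2)) \<partial>\<gamma>)"
    proof (rule nn_integral_cong_AE)
      show "AE x in \<gamma>. ennreal ((L x - S N x)\<^sup>2) = liminf (\<lambda>i. ennreal ((S (r i) x - S N x)\<^sup>2))"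
        using lim
      proof eventually_elim
        case (elim x)
        then have "(\<lambda>i. ennreal ((S (r i) x - S N x)\<^sup>2)) \<longlonglongrightarrow> ennreal ((L x - S N x)\<^sup>2)"
          by (intro tendsto_intros tendsto_ennrealI)
        then show ?case by (rule lim_imp_Liminf[OF sequentially_bot, symmetric])
      qed
    qed
    also have "\<dots> \<le> liminf (\<lambda>i. \<integral>\<^sup>+x. ennreal ((S (r i) x - S N x)\<^sup>2) \<partial>\<gamma>)"
      by (rule nn_integral_liminf) measurable
    also have "\<dots> \<le> limsup (\<lambda>i. \<integral>\<^sup>+x. ennreal ((S (r i) x - S N x)\<^sup>2) \<partial>\<gamma>)"
      by (rule Liminf_le_Limsup) simp
    also have "\<dots> \<le> ennreal (T N)"
    proof (rule Limsup_bounded)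
      show "\<forall>\<^sub>F i in sequentially. (\<integral>\<^sup>+x. ennreal ((S (r i) x - S N x)\<^sup>2) \<partial>\<gamma>) \<le> ennreal (T N)"
        unfolding eventually_sequentially
      proof (intro exI[of _ N] allI impI)
        fix i assume "N \<le> i"
        also have "i \<le> r i" using r by (rule strict_mono_imp_increasing)
        finally have "N \<le> r i" .
        have "(\<integral>\<^sup>+x. ennreal ((S (r i) x - S N x)\<^sup>2) \<partial>\<gamma>) = ennreal (LINT x|\<gamma>. (S (r i) x - S N x)\<^sup>2)"
          by (intro nn_integral_eq_integral integrable_L2_diff S2) auto
        also have "\<dots> \<le> ennreal (T N)" by (intro ennreal_leI diffT) fact
        finally show "(\<integral>\<^sup>+x. ennreal ((S (r i) x - S N x)\<^sup>2) \<partial>\<gamma>) \<le> ennreal (T N)" .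
      qed
    qed
    finally have le: "(\<integral>\<^sup>+x. ennreal ((L x - S N x)\<^sup>2) \<partial>\<gamma>) \<le> ennreal (T N)" .
    show i: "integrable \<gamma> (\<lambda>x. (L x - S N x)\<^sup>2)"
    proof (rule integrableI_bounded)
      show "(\<integral>\<^sup>+ x. ennreal (norm ((L x - S N x)\<^sup>2)) \<partial>\<gamma>) < \<infinity>"
        using le_less_trans[OF le ennreal_less_top] by simp
    qed measurable
    have "ennreal (LINT x|\<gamma>. (L x - S N x)\<^sup>2) \<le> ennreal (T N)"
      using le nn_integral_eq_integral[OF i] by simp
    then show "(LINT x|\<gamma>. (L x - S N x)\<^sup>2) \<le> T N" using T_nonneg by (simp add: ennreal_le_iff)
  qed
  define g where "g x = f x - L x" for x
  have [measurable]: "g \<in> borel_measurable borel" unfolding g_def by measurable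
  have g2: "integrable \<gamma> (\<lambda>x. (g x)\<^sup>2)"
    unfolding g_def using LN(1)[of 0] by (intro integrable_L2_diff f2) (auto simp: S_def hermite_sum_def)
  have fS2: "integrable \<gamma> (\<lambda>x. (f x - S N x)\<^sup>2)" for N by (intro integrable_L2_diff f2 S2) auto
  have H2: "integrable \<gamma> (\<lambda>x. (hermite q x)\<^sup>2)" for q
    by (intro integrable_poly_growth poly_growth_power poly_growth_hermite) simp
  \<comment> \<open>For N > q the difference f - S_N is already orthogonal to H_q, so only L - S_N
    contributes, and its norm tends to 0.\<close>
  have orth: "(LINT x|\<gamma>. hermite q x * g x) = 0" for q
  proof -
    have *: "(LINT x|\<gamma>. hermite q x * g x)\<^sup>2 \<le> fact q * T N" if "q < N" for N
    proof -
      have "hermite_coeff (\<lambda>x. f x + (- 1) * S N x) q = 0"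
        using that by (subst hermite_coeff_add) (auto simp: f2 S2 S_def hermite_coeff_hermite_sum a_def hermite_sum_L2)
      then have z: "(LINT x|\<gamma>. hermite q x * (f x - S N x)) = 0" by (simp add: hermite_coeff_def)
      have "(LINT x|\<gamma>. hermite q x * g x) = (LINT x|\<gamma>. hermite q x * (f x - S N x) - hermite q x * (L x - S N x))"
        by (simp add: g_def algebra_simps)
      also have "\<dots> = - (LINT x|\<gamma>. hermite q x * (L x - S N x))"
        using z by (subst Bochner_Integration.integral_diff) (auto intro!: integrable_L2_mult H2 fS2 LN)
      finally have "(LINT x|\<gamma>. hermite q x * g x)\<^sup>2 = (LINT x|\<gamma>. hermite q x * (L x - S N x))\<^sup>2" by simp
      also have "\<dots> \<le> (LINT x|\<gamma>. (hermite q x)\<^sup>2) * (LINT x|\<gamma>. (L x - S N x)\<^sup>2)"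
        by (intro Cauchy_Schwarz_integral H2 LN) auto
      also have "(LINT x|\<gamma>. (hermite q x)\<^sup>2) = fact q"
        using hermite_orthogonal[of q q] by (simp add: power2_eq_square)
      finally show ?thesis using LN(2)[of N] by (simp add: mult_left_mono order_trans)
    qed
    have "(\<lambda>N. fact q * T N) \<longlonglongrightarrow> fact q * 0" by (intro tendsto_intros T0)
    then have "(LINT x|\<gamma>. hermite q x * g x)\<^sup>2 \<le> fact q * 0"
      by (rule LIMSEQ_le_const) (use * in \<open>auto intro!: exI[of _ "Suc q"]\<close>)
    then show ?thesis by simp
  qed
  have gi: "integrable \<gamma> g"
    using integrable_L2_mult[of g \<gamma> "\<lambda>_. 1"] g2 by (simp add: prob_space.finite_measure[OF prob_space_gamma] finite_measure.integrable_const)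
  have "AE x in \<gamma>. g x = 0"
    by (intro fourier_zero_imp_AE_zero iexp_integral_zero_of_hermite g2 gi orth) auto
  then have "(LINT x|\<gamma>. (f x - S N x)\<^sup>2) = (LINT x|\<gamma>. (L x - S N x)\<^sup>2)" for N
    by (intro integral_cong_AE) (auto simp: g_def elim!: eventually_mono)
  then have "(LINT x|\<gamma>. (f x - S N x)\<^sup>2) \<le> T N" for N using LN(2) by simp
  then show ?thesis
    unfolding S_def[symmetric] a_def[symmetric]
    by (intro tendsto_sandwich[OF _ _ tendsto_const T0]) auto
qed

section \<open>Integration by parts for a Gaussian field\<close>

text \<open>Conjugating the hypothesis at -v shows that the conjugate of \<open>W\<close> satisfies
  it too. Hence so do the real and the imaginary part, to which the real version applies.\<close>

lemma fourier_zero_imp_zero_complex: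
  fixes W :: "'w \<Rightarrow> complex" and Z :: "'w \<Rightarrow> real"
  assumes W: "integrable M W" and [measurable]: "Z \<in> borel_measurable M"
    and four: "\<And>v. (LINT w|M. W w * iexp (v * Z w)) = 0" and A [measurable]: "A \<in> sets borel"
  shows "(LINT w|M. indicat_real A (Z w) *\<^sub>R W w) = 0"
proof -
  have [measurable]: "W \<in> borel_measurable M" using W by simp
  have iW: "integrable M (\<lambda>w. W w * iexp (v * Z w))" for v
    by (rule Bochner_Integration.integrable_bound[OF W]) (auto simp: norm_mult)
  have iA: "integrable M (\<lambda>w. indicat_real A (Z w) *\<^sub>R W w)"
    by (rule Bochner_Integration.integrable_bound[OF W]) (auto simp: indicator_def)
  have cW: "(LINT w|M. cnj (W w) * iexp (v * Z w)) = 0" "integrable M (\<lambda>w. cnj (W w) * iexp (v * Z w))" for v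
  proof -
    have e: "cnj (W w) * iexp (v * Z w) = cnj (W w * iexp ((- v) * Z w))" for w by (simp add: exp_cnj)
    show "(LINT w|M. cnj (W w) * iexp (v * Z w)) = 0"
      unfolding e Bochner_Integration.integral_cnj using four[of "-v"] by simp
    show "integrable M (\<lambda>w. cnj (W w) * iexp (v * Z w))"
      unfolding e using iW[of "-v"] by (simp only: integrable_cnj)
  qed
  have "(LINT w|M. Re (W w) *\<^sub>R iexp (v * Z w)) = 0" for v
  proof -
    have "(LINT w|M. Re (W w) *\<^sub>R iexp (v * Z w))
       = (LINT w|M. (1/2) * (W w * iexp (v * Z w) + cnj (W w) * iexp (v * Z w)))"
      by (intro Bochner_Integration.integral_cong)
        (auto simp: scaleR_conv_of_real complex_add_cnj distrib_right[symmetric])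
    also have "\<dots> = 0" using four[of v] cW[of v] iW[of v] by (simp add: Bochner_Integration.integral_add)
    finally show ?thesis .
  qed
  then have re: "(LINT w|M. Re (W w) * indicat_real A (Z w)) = 0"
    by (intro fourier_zero_imp_zero) (use W in auto)
  have "(LINT w|M. Im (W w) *\<^sub>R iexp (v * Z w)) = 0" for v
  proof -
    have "(LINT w|M. Im (W w) *\<^sub>R iexp (v * Z w))
       = (LINT w|M. (- \<i>/2) * (W w * iexp (v * Z w) - cnj (W w) * iexp (v * Z w)))"
      by (intro Bochner_Integration.integral_cong)
        (simp_all add: scaleR_conv_of_real complex_diff_cnj left_diff_distrib[symmetric], simp add: mult_ac)
    also have "\<dots> = 0" using four[of v] cW[of v] iW[of v] by (simp add: Bochner_Integration.integral_diff)
    finally show ?thesis .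
  qed
  then have im: "(LINT w|M. Im (W w) * indicat_real A (Z w)) = 0"
    by (intro fourier_zero_imp_zero) (use W in auto)
  show ?thesis
  proof (rule complex_eqI)
    show "Re (LINT w|M. indicat_real A (Z w) *\<^sub>R W w) = Re 0"
      using re by (subst integral_Re[OF iA, symmetric]) (simp add: mult.commute)
    show "Im (LINT w|M. indicat_real A (Z w) *\<^sub>R W w) = Im 0"
      using im by (subst integral_Im[OF iA, symmetric]) (simp add: mult.commute)
  qed
qed

text \<open>Caratheodory functions are jointly measurable: replacing x by a nearby point of a
  countable dense set gives a measurable approximation, and continuity in x makes it
  converge.\<close>

lemma measurable_of_continuous_sections:
  fixes f :: "'x::{second_countable_topology, metric_space} \<Rightarrow> 'w \<Rightarrow> real"
  assumes [measurable]: "\<And>x. f x \<in> borel_measurable N"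
    and cont: "\<And>\<omega>. \<omega> \<in> space N \<Longrightarrow> continuous_on UNIV (\<lambda>x. f x \<omega>)"
  shows "(\<lambda>z. f (fst z) (snd z)) \<in> borel_measurable (borel \<Otimes>\<^sub>M N)"
proof -
  obtain D :: "'x set" where D: "countable D" "\<And>X. open X \<Longrightarrow> X \<noteq> {} \<Longrightarrow> \<exists>d\<in>D. d \<in> X"
    using countable_dense_setE by blast
  have Dne: "D \<noteq> {}" using D(2)[of UNIV] by auto
  define d where "d = from_nat_into D"
  \<comment> \<open>Taking the least admissible index makes the choice of the nearby point
    measurable in \<open>x\<close>.\<close>
  define k where "k n x = (LEAST k. dist x (d k) < 1 / real (Suc n))" for n :: nat and x
  have kn: "dist x (d (k n x)) < 1 / real (Suc n)" for n x
  proof -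
    have "ball x (1 / real (Suc n)) \<noteq> {}" by (auto simp: ball_eq_empty)
    then obtain e where "e \<in> D" "e \<in> ball x (1 / real (Suc n))"
      using D(2)[of "ball x (1 / real (Suc n))"] by auto
    then obtain j where "dist x (d j) < 1 / real (Suc n)"
      using from_nat_into_surj[OF D(1)] by (auto simp: d_def)
    then show ?thesis unfolding k_def by (rule LeastI)
  qed
  have [measurable]: "k n \<in> measurable borel (count_space UNIV)" for n
    unfolding k_def by measurable
  show ?thesis
  proof (rule borel_measurable_LIMSEQ_real)
    fix n
    show "(\<lambda>z. f (d (k n (fst z))) (snd z)) \<in> borel_measurable (borel \<Otimes>\<^sub>M N)"
      by (rule measurable_compose_countable[where f="\<lambda>i z. f (d i) (snd z)"]) measurable
  next
    fix z :: "'x \<times> 'w" assume "z \<in> space (borel \<Otimes>\<^sub>M N)"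
    then have z: "snd z \<in> space N" by (auto simp: space_pair_measure)
    have "(\<lambda>n. d (k n (fst z))) \<longlonglongrightarrow> fst z"
    proof (rule tendstoI)
      fix e :: real assume "e > 0"
      then obtain m where m: "inverse (real (Suc m)) < e" using reals_Archimedean by blast
      show "\<forall>\<^sub>F n in sequentially. dist (d (k n (fst z))) (fst z) < e"
        unfolding eventually_sequentially
      proof (intro exI[of _ m] allI impI)
        fix n assume "m \<le> n"
        have "dist (d (k n (fst z))) (fst z) < 1 / real (Suc n)" using kn by (simp add: dist_commute)
        also have "\<dots> \<le> 1 / real (Suc m)" using \<open>m \<le> n\<close> by (simp add: frac_le)
        finally show "dist (d (k n (fst z))) (fst z) < e" using m by (simp add: inverse_eq_divide)
      qed
    qed
    then show "(\<lambda>n. f (d (k n (fst z))) (snd z)) \<longlonglongrightarrow> f (fst z) (snd z)"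
      using cont[OF z] by (auto intro: continuous_on_tendsto_compose)
  qed
qed

section \<open>The Gaussian field, its linear span and its covariance\<close>

locale gauss_field = prob_space M for M :: "'w measure" +
  fixes B :: "'x::euclidean_space \<Rightarrow> 'w \<Rightarrow> real" and C :: "'x \<Rightarrow> real"
  assumes gauss: "gaussian_field M B"
    and contB: "continuous_field M B"
    and cent: "\<And>x. expectation (B x) = 0"
    and unit: "\<And>x. expectation (\<lambda>\<omega>. (B x \<omega>)\<^sup>2) = 1"
    and cov: "\<And>x y. expectation (\<lambda>\<omega>. B x \<omega> * B y \<omega>) = C (x - y)"
    and C_nonneg: "\<And>x. 0 \<le> C x"
begin

definition lin :: "('w \<Rightarrow> real) \<Rightarrow> bool" where
  "lin f \<longleftrightarrow> (\<exists>J a. finite J \<and> f = (\<lambda>\<omega>. \<Sum>x\<in>J. a x * B x \<omega>))"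

lemma lin_B: "lin (B x)"
  unfolding lin_def by (intro exI[of _ "{x}"] exI[of _ "\<lambda>_. 1"]) auto

lemma lin_scale:
  assumes "lin f" shows "lin (\<lambda>\<omega>. c * f \<omega>)"
proof -
  obtain J a where J: "finite J" "f = (\<lambda>\<omega>. \<Sum>x\<in>J. a x * B x \<omega>)" using assms unfolding lin_def by blast
  show ?thesis unfolding lin_def
    by (intro exI[of _ J] exI[of _ "\<lambda>x. c * a x"]) (simp add: J sum_distrib_left mult.assoc)
qed

lemma lin_add:
  assumes "lin f" "lin g" shows "lin (\<lambda>\<omega>. f \<omega> + g \<omega>)"
proof -
  obtain J a where J: "finite J" "f = (\<lambda>\<omega>. \<Sum>x\<in>J. a x * B x \<omega>)" using assms unfolding lin_def by blast
  obtain K b where K: "finite K" "g = (\<lambda>\<omega>. \<Sum>x\<in>K. b x * B x \<omega>)" using assms unfolding lin_def by blast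
  let ?c = "\<lambda>x. (if x \<in> J then a x else 0) + (if x \<in> K then b x else 0)"
  have "f \<omega> + g \<omega> = (\<Sum>x\<in>J \<union> K. ?c x * B x \<omega>)" for \<omega>
  proof -
    have "(\<Sum>x\<in>J \<union> K. ?c x * B x \<omega>) = (\<Sum>x\<in>J \<union> K. (if x \<in> J then a x * B x \<omega> else 0))
       + (\<Sum>x\<in>J \<union> K. (if x \<in> K then b x * B x \<omega> else 0))"
      unfolding sum.distrib[symmetric] by (rule sum.cong) (auto simp: distrib_right)
    moreover have "(\<Sum>x\<in>J \<union> K. (if x \<in> J then a x * B x \<omega> else 0)) = f \<omega>"
      unfolding J(2) using J(1) K(1) by (intro sum.mono_neutral_cong_right) auto
    moreover have "(\<Sum>x\<in>J \<union> K. (if x \<in> K then b x * B x \<omega> else 0)) = g \<omega>"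
      unfolding K(2) using J(1) K(1) by (intro sum.mono_neutral_cong_right) auto
    ultimately show ?thesis by simp
  qed
  then show ?thesis unfolding lin_def using J(1) K(1)
    by (intro exI[of _ "J \<union> K"] exI[of _ ?c]) auto
qed

lemma lin_diff: "lin f \<Longrightarrow> lin g \<Longrightarrow> lin (\<lambda>\<omega>. f \<omega> - g \<omega>)"
  using lin_add[of f "\<lambda>\<omega>. (- 1) * g \<omega>"] lin_scale[of g "-1"] by simp

lemma lin_gaussian: "lin f \<Longrightarrow> gaussian_rv M f"
  using gauss unfolding lin_def gaussian_field_def by blast

lemma lin_measurable: "lin f \<Longrightarrow> f \<in> borel_measurable M"
  using lin_gaussian unfolding gaussian_rv_def by blast

lemma B_measurable [measurable]: "B x \<in> borel_measurable M"
  using lin_B lin_measurable by blast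

lemma lin_L2_aux:
  assumes "lin f" shows "integrable M f" "integrable M (\<lambda>\<omega>. (f \<omega>)\<^sup>2)"
proof -
  have [measurable]: "f \<in> borel_measurable M" using assms by (rule lin_measurable)
  obtain \<mu> \<sigma> where s: "\<sigma> \<ge> 0" and d: "distr M borel f = (if \<sigma> = 0 then return borel \<mu> else density lborel (normal_density \<mu> \<sigma>))"
    using lin_gaussian[OF assms] unfolding gaussian_rv_def by blast
  have "integrable (distr M borel f) (\<lambda>x. x) \<and> integrable (distr M borel f) (\<lambda>x. x\<^sup>2)"
  proof (cases "\<sigma> = 0")
    case True
    then have d0: "distr M borel f = return borel \<mu>" using d by simp
    have r: "integrable (return borel \<mu>) g" if [measurable]: "g \<in> borel_measurable borel" for g :: "real \<Rightarrow> real"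
    proof (rule integrableI_bounded)
      show "(\<integral>\<^sup>+ x. ennreal (norm (g x)) \<partial>return borel \<mu>) < \<infinity>"
        by (subst nn_integral_return) auto
    qed simp
    show ?thesis unfolding d0 by (intro conjI r) measurable
  next
    case False
    then have s: "\<sigma> > 0" using s by simp
    have 1: "integrable lborel (\<lambda>x. normal_density \<mu> \<sigma> x * (x - \<mu>) ^ k)" for k
      using integrable_normal_moment[OF s] by simp
    have "integrable lborel (\<lambda>x. normal_density \<mu> \<sigma> x * (x - \<mu>) ^ 1 + \<mu> * normal_density \<mu> \<sigma> x)"
      using 1[of 1] s by (intro Bochner_Integration.integrable_add integrable_mult_right) auto
    moreover have "integrable lborel (\<lambda>x. normal_density \<mu> \<sigma> x * (x - \<mu>) ^ 2 + (2 * \<mu>) * (normal_density \<mu> \<sigma> x * (x - \<mu>) ^ 1) + \<mu>\<^sup>2 * normal_density \<mu> \<sigma> x)"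
      using 1[of 2] 1[of 1] s by (intro Bochner_Integration.integrable_add integrable_mult_right) auto
    moreover have "normal_density \<mu> \<sigma> x * (x - \<mu>) ^ 1 + \<mu> * normal_density \<mu> \<sigma> x = normal_density \<mu> \<sigma> x * x" for x
      by (simp add: algebra_simps)
    moreover have "normal_density \<mu> \<sigma> x * (x - \<mu>) ^ 2 + (2 * \<mu>) * (normal_density \<mu> \<sigma> x * (x - \<mu>) ^ 1) + \<mu>\<^sup>2 * normal_density \<mu> \<sigma> x
        = normal_density \<mu> \<sigma> x * x\<^sup>2" for x
      by (simp add: algebra_simps power2_eq_square)
    ultimately show ?thesis unfolding d using False s by (simp add: integrable_density)
  qed
  then show "integrable M f" "integrable M (\<lambda>\<omega>. (f \<omega>)\<^sup>2)"
    by (simp_all add: integrable_distr_eq)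
qed

lemma lin_mean:
  assumes "lin f" shows "expectation f = 0"
proof -
  obtain J a where J: "finite J" "f = (\<lambda>\<omega>. \<Sum>x\<in>J. a x * B x \<omega>)" using assms unfolding lin_def by blast
  show ?thesis unfolding J(2) using lin_L2_aux(1)[OF lin_B]
    by (subst Bochner_Integration.integral_sum) (auto simp: cent)
qed

text \<open>A centred Gaussian law is determined by its second moment. The formula for the
  characteristic function includes the degenerate law at 0, which does occur for linear
  combinations.\<close>

lemma lin_law:
  assumes "lin f"
  shows "(LINT \<omega>|M. iexp (f \<omega>)) = complex_of_real (exp (- (expectation (\<lambda>\<omega>. (f \<omega>)\<^sup>2)) / 2))"
    and "expectation (\<lambda>\<omega>. (f \<omega>)\<^sup>2) = 1 \<Longrightarrow> distr M borel f = \<gamma>"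
proof -
  have [measurable]: "f \<in> borel_measurable M" using assms by (rule lin_measurable)
  obtain \<mu> \<sigma> where s: "\<sigma> \<ge> 0" and d: "distr M borel f = (if \<sigma> = 0 then return borel \<mu> else density lborel (normal_density \<mu> \<sigma>))"
    using lin_gaussian[OF assms] unfolding gaussian_rv_def by blast
  have ef: "expectation f = (LINT x|distr M borel f. x)" "expectation (\<lambda>\<omega>. (f \<omega>)\<^sup>2) = (LINT x|distr M borel f. x\<^sup>2)"
    "(LINT \<omega>|M. iexp (f \<omega>)) = (LINT x|distr M borel f. iexp x)"
    by (simp_all add: integral_distr)
  have "(LINT \<omega>|M. iexp (f \<omega>)) = complex_of_real (exp (- (expectation (\<lambda>\<omega>. (f \<omega>)\<^sup>2)) / 2))
    \<and> (expectation (\<lambda>\<omega>. (f \<omega>)\<^sup>2) = 1 \<longrightarrow> distr M borel f = \<gamma>)"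
  proof (cases "\<sigma> = 0")
    case True
    have "\<mu> = 0" using ef(1) lin_mean[OF assms] True d by (simp add: integral_return)
    then show ?thesis using True ef d by (simp add: integral_return)
  next
    case False
    then have s: "\<sigma> > 0" using s by simp
    have ds: "distributed M lborel f (normal_density \<mu> \<sigma>)"
      unfolding distributed_def using d False by (auto cong: distr_cong)
    have m: "\<mu> = 0" using normal_distributed_expectation[OF s ds] lin_mean[OF assms] by simp
    have v: "expectation (\<lambda>\<omega>. (f \<omega>)\<^sup>2) = \<sigma>\<^sup>2"
      using normal_distributed_variance[OF s ds] lin_mean[OF assms] by simp
    have "distributed M lborel (\<lambda>x. (f x - 0) / \<sigma>) std_normal_density"
      using ds s m normal_standard_normal_convert[of \<sigma> f \<mu>] by simp
    then have dn: "distr M lborel (\<lambda>x. f x / \<sigma>) = \<gamma>" unfolding distributed_def by simp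
    have "(LINT \<omega>|M. iexp (f \<omega>)) = (LINT \<omega>|M. iexp (\<sigma> * (f \<omega> / \<sigma>)))" using s by simp
    also have "\<dots> = (LINT x|distr M lborel (\<lambda>x. f x / \<sigma>). iexp (\<sigma> * x))"
      by (subst integral_distr) auto
    also have "\<dots> = char \<gamma> \<sigma>" unfolding dn char_def ..
    also have "\<dots> = complex_of_real (exp (- \<sigma>\<^sup>2 / 2))" by (simp add: char_std_normal_distribution)
    finally have 1: "(LINT \<omega>|M. iexp (f \<omega>)) = complex_of_real (exp (- \<sigma>\<^sup>2 / 2))" .
    have "\<sigma> = 1" if "\<sigma>\<^sup>2 = 1" using that s by (simp add: power2_eq_1_iff)
    then show ?thesis using 1 v d m False by auto
  qed
  then show "(LINT \<omega>|M. iexp (f \<omega>)) = complex_of_real (exp (- (expectation (\<lambda>\<omega>. (f \<omega>)\<^sup>2)) / 2))"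
    and "expectation (\<lambda>\<omega>. (f \<omega>)\<^sup>2) = 1 \<Longrightarrow> distr M borel f = \<gamma>" by blast+
qed

lemma B_law: "distr M borel (B x) = \<gamma>"
  using lin_law(2)[OF lin_B] unit by blast

lemma B_integrable_iff:
  fixes f :: "real \<Rightarrow> 'b::{banach, second_countable_topology}"
  assumes "f \<in> borel_measurable borel"
  shows "integrable M (\<lambda>\<omega>. f (B x \<omega>)) \<longleftrightarrow> integrable \<gamma> f"
  using integrable_distr_eq[of "B x" M borel f] assms by (simp add: B_law)

lemma B_integral:
  fixes f :: "real \<Rightarrow> 'b::{banach, second_countable_topology}"
  assumes "f \<in> borel_measurable borel"
  shows "(LINT \<omega>|M. f (B x \<omega>)) = integral\<^sup>L \<gamma> f"
  using integral_distr[of "B x" M borel f] assms by (simp add: B_law)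

lemma C_0 [simp]: "C 0 = 1"
  using cov[of x x for x] unit by (simp add: power2_eq_square)

lemma C_sym: "C (x - y) = C (y - x)"
  using cov[of x y] cov[of y x] by (simp add: mult.commute)

lemma C_minus [simp]: "C (- x) = C x"
  using C_sym[of x 0] by simp

lemma B_L2: "integrable M (\<lambda>\<omega>. (B x \<omega>)\<^sup>2)" by (rule lin_L2_aux lin_B)+

lemma lin_mult_integrable: "lin f \<Longrightarrow> lin g \<Longrightarrow> integrable M (\<lambda>\<omega>. f \<omega> * g \<omega>)"
  by (intro integrable_L2_mult lin_L2_aux lin_measurable)

lemma C_le_1: "C x \<le> 1"
proof -
  have "(C x)\<^sup>2 \<le> expectation (\<lambda>\<omega>. (B x \<omega>)\<^sup>2) * expectation (\<lambda>\<omega>. (B 0 \<omega>)\<^sup>2)"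
    using Cauchy_Schwarz_integral[of "B x" M "B 0"] B_L2 cov[of x 0] by simp
  then show ?thesis using unit C_nonneg[of x] by (simp add: power_le_one_iff abs_square_le_1)
qed

lemma continuous_sample: "\<omega> \<in> space M \<Longrightarrow> continuous_on A (\<lambda>x. B x \<omega>)"
  using contB unfolding continuous_field_def by (auto intro: continuous_on_subset)

text \<open>Path continuity gives pointwise convergence of B but no convergence of products. The
  expectation of the bounded variable cos (B_x - B_0) equals exp (C x - 1) and is continuous by
  bounded convergence; the logarithm returns C.\<close>

lemma continuous_C: "continuous_on A C"
proof -
  define h where "h x = expectation (\<lambda>\<omega>. cos (B x \<omega> - B 0 \<omega>))" for x
  have h: "h x = exp (C x - 1)" for x
  proof -
    have l: "lin (\<lambda>\<omega>. B x \<omega> - B 0 \<omega>)" by (intro lin_diff lin_B)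
    have "expectation (\<lambda>\<omega>. (B x \<omega> - B 0 \<omega>)\<^sup>2) = expectation (\<lambda>\<omega>. (B x \<omega>)\<^sup>2 + (B 0 \<omega>)\<^sup>2 - 2 * (B x \<omega> * B 0 \<omega>))"
      by (simp add: power2_diff mult.assoc)
    also have "\<dots> = 2 - 2 * C x"
      using B_L2 lin_mult_integrable[OF lin_B lin_B, of x 0] cov[of x 0] by (simp add: unit)
    finally have v: "- expectation (\<lambda>\<omega>. (B x \<omega> - B 0 \<omega>)\<^sup>2) / 2 = C x - 1" by simp
    have "Re (LINT \<omega>|M. iexp (B x \<omega> - B 0 \<omega>)) = exp (C x - 1)"
      using lin_law(1)[OF l] unfolding v by simp
    moreover have "Re (LINT \<omega>|M. iexp (B x \<omega> - B 0 \<omega>)) = h x"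
    proof -
      have i: "integrable M (\<lambda>\<omega>. iexp (B x \<omega> - B 0 \<omega>))"
        by (rule integrable_const_bound[of _ 1]) auto
      show ?thesis unfolding h_def by (subst integral_Re[OF i, symmetric]) (simp add: Re_exp)
    qed
    ultimately show ?thesis by simp
  qed
  have "continuous_on UNIV h"
    unfolding continuous_on_sequentially comp_def
  proof (intro allI impI ballI, elim conjE)
    fix s :: "nat \<Rightarrow> 'x" and a assume s: "s \<longlonglongrightarrow> a"
    show "(\<lambda>n. h (s n)) \<longlonglongrightarrow> h a"
      unfolding h_def
    proof (rule integral_dominated_convergence[where w="\<lambda>_. 1"])
      show "AE \<omega> in M. (\<lambda>n. cos (B (s n) \<omega> - B 0 \<omega>)) \<longlonglongrightarrow> cos (B a \<omega> - B 0 \<omega>)"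
      proof (rule AE_I2)
        fix \<omega> assume "\<omega> \<in> space M"
        then have "(\<lambda>n. B (s n) \<omega>) \<longlonglongrightarrow> B a \<omega>"
          using continuous_on_tendsto_compose[OF continuous_sample[of \<omega> UNIV] s] by simp
        then show "(\<lambda>n. cos (B (s n) \<omega> - B 0 \<omega>)) \<longlonglongrightarrow> cos (B a \<omega> - B 0 \<omega>)" by (intro tendsto_intros)
      qed
    qed auto
  qed
  then have "continuous_on UNIV (\<lambda>x. 1 + ln (h x))"
    by (intro continuous_intros) (simp_all add: h)
  then have "continuous_on UNIV C" by (simp add: h)
  then show ?thesis by (rule continuous_on_subset) auto
qed

lemma C_measurable [measurable]: "C \<in> borel_measurable borel"
  by (rule borel_measurable_continuous_onI) (rule continuous_C)

lemma B_joint_measurable: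
  "(\<lambda>z. B (fst z) (snd z)) \<in> borel_measurable (borel \<Otimes>\<^sub>M M)"
  by (rule measurable_of_continuous_sections) (auto intro: continuous_sample)

section \<open>Independence of B_x and the residuals\<close>

definition Z :: "'x \<Rightarrow> 'x \<Rightarrow> 'w \<Rightarrow> real" where
  "Z x y \<omega> = B y \<omega> - C (y - x) * B x \<omega>"

text \<open>
  The residual sigma-algebra at $x$ is generated by all $B_y - C(y - x) B_x$. Being
  uncorrelated with $B_x$, these are jointly independent of it.
\<close>

definition cyl :: "'x \<Rightarrow> 'x set \<Rightarrow> ('x \<Rightarrow> real set) \<Rightarrow> 'w set" where
  "cyl x J A = {\<omega> \<in> space M. \<forall>y\<in>J. Z x y \<omega> \<in> A y}"

definition cyls :: "'x \<Rightarrow> 'w set set" where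
  "cyls x = {cyl x J A |J A. finite J \<and> (\<forall>y. A y \<in> sets borel)}"

definition residual_algebra :: "'x \<Rightarrow> 'w measure" where
  "residual_algebra x = sigma (space M) (cyls x)"

lemma lin_Z: "lin (Z x y)"
  unfolding Z_def by (intro lin_diff lin_scale lin_B)

lemma Z_measurable [measurable]: "Z x y \<in> borel_measurable M"
  using lin_Z lin_measurable by blast

lemma cyls_subset: "cyls x \<subseteq> Pow (space M)"
  by (auto simp: cyls_def cyl_def)

lemma space_residual_algebra [simp]: "space (residual_algebra x) = space M"
  unfolding residual_algebra_def using cyls_subset by (simp add: space_measure_of)

lemma sets_residual_algebra: "sets (residual_algebra x) = sigma_sets (space M) (cyls x)"
  unfolding residual_algebra_def using cyls_subset by (simp add: sets_measure_of)

lemma Z_residual_algebra [measurable]: "Z x y \<in> borel_measurable (residual_algebra x)"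
proof (rule measurableI)
  fix A :: "real set" assume A: "A \<in> sets borel"
  have "Z x y -` A \<inter> space (residual_algebra x) = cyl x {y} (\<lambda>_. A)" by (auto simp: cyl_def)
  also have "\<dots> \<in> cyls x" unfolding cyls_def using A
    by (intro CollectI exI[of _ "{y}"] exI[of _ "\<lambda>_. A"]) auto
  finally show "Z x y -` A \<inter> space (residual_algebra x) \<in> sets (residual_algebra x)" unfolding sets_residual_algebra by (rule sigma_sets.Basic)
qed simp

lemma cyl_sets:
  assumes "finite J" "\<And>y. A y \<in> sets borel" shows "cyl x J A \<in> sets M"
proof -
  have "(\<forall>y\<in>J. {\<omega> \<in> space M. Z x y \<omega> \<in> A y} \<in> sets M)"
  proof
    fix y
    have "{\<omega> \<in> space M. Z x y \<omega> \<in> A y} = Z x y -` A y \<inter> space M" by auto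
    then show "{\<omega> \<in> space M. Z x y \<omega> \<in> A y} \<in> sets M" using measurable_sets[OF Z_measurable assms(2)] by simp
  qed
  then show ?thesis unfolding cyl_def using assms(1) by (intro sets.sets_Collect_finite_All) auto
qed

lemma cyls_events: "cyls x \<subseteq> events"
  using cyl_sets by (auto simp: cyls_def)

lemma Z_joint_measurable: "(\<lambda>z. Z x (fst z) (snd z)) \<in> borel_measurable (borel \<Otimes>\<^sub>M residual_algebra x)"
proof (rule measurable_of_continuous_sections)
  fix \<omega> assume "\<omega> \<in> space (residual_algebra x)"
  then show "continuous_on UNIV (\<lambda>y. Z x y \<omega>)" unfolding Z_def
    by (intro continuous_intros continuous_sample continuous_on_compose2[OF continuous_C[of UNIV]]) auto
qed simp

lemma Z_orth: "expectation (\<lambda>\<omega>. Z x y \<omega> * B x \<omega>) = 0"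
proof -
  have "expectation (\<lambda>\<omega>. Z x y \<omega> * B x \<omega>) = expectation (\<lambda>\<omega>. B y \<omega> * B x \<omega> - C (y - x) * (B x \<omega>)\<^sup>2)"
    by (simp add: Z_def algebra_simps power2_eq_square)
  also have "\<dots> = 0" using B_L2 lin_mult_integrable[OF lin_B lin_B] by (simp add: cov unit)
  finally show ?thesis .
qed

definition orth :: "'x \<Rightarrow> ('w \<Rightarrow> real) \<Rightarrow> bool" where
  "orth x L \<longleftrightarrow> lin L \<and> expectation (\<lambda>\<omega>. L \<omega> * B x \<omega>) = 0"

lemma orth_add_Z:
  assumes "orth x L" shows "orth x (\<lambda>\<omega>. L \<omega> + v * Z x y \<omega>)"
proof -
  have L: "lin L" "expectation (\<lambda>\<omega>. L \<omega> * B x \<omega>) = 0" using assms by (auto simp: orth_def)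
  have "expectation (\<lambda>\<omega>. (L \<omega> + v * Z x y \<omega>) * B x \<omega>) = expectation (\<lambda>\<omega>. L \<omega> * B x \<omega> + v * (Z x y \<omega> * B x \<omega>))"
    by (simp add: algebra_simps)
  also have "\<dots> = 0" using L lin_mult_integrable[OF L(1) lin_B] lin_mult_integrable[OF lin_Z lin_B, of x y x]
    by (simp add: Z_orth)
  finally show ?thesis using L by (auto simp: orth_def intro!: lin_add lin_scale lin_Z)
qed

lemma orth_zero: "orth x (\<lambda>_. 0)"
  unfolding orth_def using lin_scale[OF lin_B, of 0] by simp

text \<open>
  The exponent $L$ makes the induction over the coordinates of the cylinder work: the hypothesis is
  applied to $L + v Z_y$ for all $v$, and Fourier uniqueness brings in the coordinate $y$.
\<close>

lemma char_cyl:
  assumes "finite J" "\<And>y. A y \<in> sets borel" "orth x L"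
  shows "(LINT \<omega>|M. indicat_real (cyl x J A) \<omega> *\<^sub>R iexp (u * B x \<omega> + L \<omega>))
     = complex_of_real (exp (- u\<^sup>2 / 2)) * (LINT \<omega>|M. indicat_real (cyl x J A) \<omega> *\<^sub>R iexp (L \<omega>))"
  using assms(1,3)
proof (induction J arbitrary: L rule: finite_induct)
  case empty
  have L: "lin L" "expectation (\<lambda>\<omega>. L \<omega> * B x \<omega>) = 0" using empty by (auto simp: orth_def)
  have l: "lin (\<lambda>\<omega>. u * B x \<omega> + L \<omega>)" by (intro lin_add lin_scale lin_B L)
  have "expectation (\<lambda>\<omega>. (u * B x \<omega> + L \<omega>)\<^sup>2)
      = expectation (\<lambda>\<omega>. u\<^sup>2 * (B x \<omega>)\<^sup>2 + (L \<omega>)\<^sup>2 + (2 * u) * (L \<omega> * B x \<omega>))"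
    by (rule Bochner_Integration.integral_cong) (auto simp: power2_eq_square algebra_simps)
  also have "\<dots> = u\<^sup>2 + expectation (\<lambda>\<omega>. (L \<omega>)\<^sup>2)"
    using L B_L2[of x] lin_L2_aux(2)[OF L(1)] lin_mult_integrable[OF L(1) lin_B, of x] by (simp add: unit)
  finally have v: "expectation (\<lambda>\<omega>. (u * B x \<omega> + L \<omega>)\<^sup>2) = u\<^sup>2 + expectation (\<lambda>\<omega>. (L \<omega>)\<^sup>2)" .
  have e: "(LINT \<omega>|M. indicat_real (cyl x {} A) \<omega> *\<^sub>R iexp (f \<omega>)) = (LINT \<omega>|M. iexp (f \<omega>))" for f :: "'w \<Rightarrow> real"
    by (rule Bochner_Integration.integral_cong) (auto simp: cyl_def)
  show ?case
    unfolding e lin_law(1)[OF l] lin_law(1)[OF L(1)] v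
    by (simp add: exp_add[symmetric] of_real_mult[symmetric] add_divide_distrib del: of_real_mult of_real_exp)
next
  case (insert y J)
  have [measurable]: "L \<in> borel_measurable M" using insert.prems lin_measurable by (auto simp: orth_def)
  have [measurable]: "cyl x J A \<in> sets M" using cyl_sets assms insert by auto
  let ?c = "complex_of_real (exp (- u\<^sup>2 / 2))"
  define W where "W \<omega> = indicat_real (cyl x J A) \<omega> *\<^sub>R (iexp (u * B x \<omega> + L \<omega>) - ?c * iexp (L \<omega>))" for \<omega>
  have i1: "integrable M (\<lambda>\<omega>. indicat_real (cyl x J A) \<omega> *\<^sub>R iexp (f \<omega>))" if "f \<in> borel_measurable M" for f
    using that by (intro integrable_const_bound[of _ 1]) (auto simp: indicator_def)
  have We: "W \<omega> = indicat_real (cyl x J A) \<omega> *\<^sub>R iexp (u * B x \<omega> + L \<omega>) - ?c * (indicat_real (cyl x J A) \<omega> *\<^sub>R iexp (L \<omega>))" for \<omega>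
    unfolding W_def by (simp add: scaleR_diff_right)
  have WZ: "W \<omega> * iexp (v * Z x y \<omega>) = indicat_real (cyl x J A) \<omega> *\<^sub>R iexp (u * B x \<omega> + (L \<omega> + v * Z x y \<omega>))
      - ?c * (indicat_real (cyl x J A) \<omega> *\<^sub>R iexp (L \<omega> + v * Z x y \<omega>))" for v \<omega>
    unfolding We left_diff_distrib mult.assoc mult_scaleR_left mult_exp_exp
    by (simp add: algebra_simps)
  have W0: "(LINT \<omega>|M. indicat_real (A y) (Z x y \<omega>) *\<^sub>R W \<omega>) = 0"
  proof (rule fourier_zero_imp_zero_complex)
    show "integrable M W"
      unfolding We by (intro Bochner_Integration.integrable_diff integrable_mult_right i1) measurable
    fix v
    have "(LINT \<omega>|M. W \<omega> * iexp (v * Z x y \<omega>))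
      = (LINT \<omega>|M. indicat_real (cyl x J A) \<omega> *\<^sub>R iexp (u * B x \<omega> + (L \<omega> + v * Z x y \<omega>)))
        - ?c * (LINT \<omega>|M. indicat_real (cyl x J A) \<omega> *\<^sub>R iexp (L \<omega> + v * Z x y \<omega>))"
      unfolding WZ
      by (subst Bochner_Integration.integral_diff, rule i1, measurable, rule integrable_mult_right, rule i1, measurable)
        (simp only: integral_mult_right_zero)
    also have "\<dots> = 0" using insert.IH[OF orth_add_Z[OF insert.prems, of v y]] by simp
    finally show "(LINT \<omega>|M. W \<omega> * iexp (v * Z x y \<omega>)) = 0" .
  qed (use assms in auto)
  have ind: "indicat_real (cyl x (insert y J) A) \<omega> = indicat_real (A y) (Z x y \<omega>) * indicat_real (cyl x J A) \<omega>" for \<omega>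
    by (auto simp: cyl_def indicator_def)
  have [measurable]: "cyl x (insert y J) A \<in> sets M" using cyl_sets assms insert by auto
  have i2: "integrable M (\<lambda>\<omega>. indicat_real (cyl x (insert y J) A) \<omega> *\<^sub>R iexp (f \<omega>))" if "f \<in> borel_measurable M" for f
    using that by (intro integrable_const_bound[of _ 1]) (auto simp: indicator_def)
  have "(LINT \<omega>|M. indicat_real (A y) (Z x y \<omega>) *\<^sub>R W \<omega>)
    = (LINT \<omega>|M. indicat_real (cyl x (insert y J) A) \<omega> *\<^sub>R iexp (u * B x \<omega> + L \<omega>)
        - ?c * (indicat_real (cyl x (insert y J) A) \<omega> *\<^sub>R iexp (L \<omega>)))"
    unfolding We ind by (simp add: scaleR_diff_right)
  also have "\<dots> = (LINT \<omega>|M. indicat_real (cyl x (insert y J) A) \<omega> *\<^sub>R iexp (u * B x \<omega> + L \<omega>))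
        - ?c * (LINT \<omega>|M. indicat_real (cyl x (insert y J) A) \<omega> *\<^sub>R iexp (L \<omega>))"
    by (subst Bochner_Integration.integral_diff, rule i2, measurable, rule integrable_mult_right, rule i2, measurable)
      (simp only: integral_mult_right_zero)
  finally show ?case using W0 by simp
qed

lemma char_B: "(LINT \<omega>|M. iexp (u * B x \<omega>)) = complex_of_real (exp (- u\<^sup>2 / 2))"
proof -
  have "expectation (\<lambda>\<omega>. (u * B x \<omega>)\<^sup>2) = u\<^sup>2" by (simp add: power_mult_distrib unit)
  then show ?thesis using lin_law(1)[OF lin_scale[OF lin_B], of u x] by simp
qed

text \<open>By \<open>char_cyl\<close> with exponent 0, the centred indicator of a cylinder
  integrates to zero against every exponential of B_x. Fourier uniqueness replaces the exponentials
  by indicators of Borel sets.\<close>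

lemma indep_B_cyls: "indep_set {B x -` A \<inter> space M |A. A \<in> sets borel} (cyls x)"
  unfolding indep_sets2_eq
proof (intro conjI cyls_events ballI)
  show "{B x -` A \<inter> space M |A. A \<in> sets borel} \<subseteq> events" by (auto intro: measurable_sets)
next
  fix a b assume "a \<in> {B x -` A \<inter> space M |A. A \<in> sets borel}" and b: "b \<in> cyls x"
  then obtain S where S: "S \<in> sets borel" "a = B x -` S \<inter> space M" by auto
  obtain J A where J: "finite J" "\<And>y. A y \<in> sets borel" "b = cyl x J A" using b by (auto simp: cyls_def)
  have [measurable]: "b \<in> events" "a \<in> events" "S \<in> sets borel"
    using b cyls_events S by (auto intro: measurable_sets)
  define W where "W \<omega> = indicat_real b \<omega> - prob b" for \<omega>
  have ib: "integrable M (\<lambda>\<omega>. indicat_real b \<omega> *\<^sub>R iexp (v * B x \<omega>))" for v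
    by (intro integrable_const_bound[of _ 1]) (auto simp: indicator_def)
  have ie: "integrable M (\<lambda>\<omega>. iexp (v * B x \<omega>))" for v
    by (intro integrable_const_bound[of _ 1]) auto
  have "(LINT \<omega>|M. W \<omega> * indicator S (B x \<omega>)) = 0"
  proof (rule fourier_zero_imp_zero)
    show "integrable M W" unfolding W_def by (intro integrable_const_bound[of _ 1]) (auto simp: indicator_def)
    fix v
    have "(LINT \<omega>|M. W \<omega> *\<^sub>R iexp (v * B x \<omega>)) = (LINT \<omega>|M. indicat_real b \<omega> *\<^sub>R iexp (v * B x \<omega>) - prob b *\<^sub>R iexp (v * B x \<omega>))"
      unfolding W_def by (simp only: scaleR_diff_left)
    also have "\<dots> = (LINT \<omega>|M. indicat_real b \<omega> *\<^sub>R iexp (v * B x \<omega>)) - prob b *\<^sub>R (LINT \<omega>|M. iexp (v * B x \<omega>))"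
      by (subst Bochner_Integration.integral_diff, rule ib, rule integrable_scaleR_right, rule ie)
        (simp only: integral_scaleR_right)
    also have "(LINT \<omega>|M. indicat_real b \<omega> *\<^sub>R iexp (v * B x \<omega>)) = prob b *\<^sub>R (LINT \<omega>|M. iexp (v * B x \<omega>))"
    proof -
      have "(LINT \<omega>|M. indicat_real b \<omega> *\<^sub>R (1::complex)) = complex_of_real (prob b)"
        by (simp add: scaleR_conv_of_real)
      then show ?thesis
        using char_cyl[of J A x "\<lambda>_. 0" v, OF J(1) J(2) orth_zero] unfolding J(3)[symmetric] char_B
        by (simp add: scaleR_conv_of_real mult.commute)
    qed
    finally show "(LINT \<omega>|M. W \<omega> *\<^sub>R iexp (v * B x \<omega>)) = 0" by simp
  qed auto
  moreover have "(LINT \<omega>|M. W \<omega> * indicator S (B x \<omega>)) = prob (a \<inter> b) - prob b * prob a"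
  proof -
    have "(LINT \<omega>|M. W \<omega> * indicator S (B x \<omega>)) = (LINT \<omega>|M. indicat_real (a \<inter> b) \<omega> - prob b * indicat_real a \<omega>)"
      by (rule Bochner_Integration.integral_cong) (auto simp: W_def S indicator_def)
    moreover have "integrable M (indicat_real a)" "integrable M (indicat_real (a \<inter> b))"
      by (auto intro!: integrable_const_bound[of _ 1] simp: indicator_def)
    ultimately show ?thesis by (simp add: sets.Int_space_eq2)
  qed
  ultimately show "prob (a \<inter> b) = prob a * prob b" by (simp add: mult.commute)
qed

lemma Int_stable_cyls: "Int_stable (cyls x)"
proof (rule Int_stableI)
  fix a b assume "a \<in> cyls x" "b \<in> cyls x"
  then obtain J A K D where J: "finite J" "\<And>y. A y \<in> sets borel" "a = cyl x J A"
    and K: "finite K" "\<And>y. D y \<in> sets borel" "b = cyl x K D" by (auto simp: cyls_def)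
  \<comment> \<open>A coordinate constrained by only one of the two cylinders receives
    \<open>UNIV\<close> from the other.\<close>
  let ?E = "\<lambda>y. (if y \<in> J then A y else UNIV) \<inter> (if y \<in> K then D y else UNIV)"
  have "a \<inter> b = cyl x (J \<union> K) ?E" unfolding J(3) K(3) cyl_def by auto
  then show "a \<inter> b \<in> cyls x" unfolding cyls_def using J K
    by (intro CollectI exI[of _ "J \<union> K"] exI[of _ ?E]) auto
qed

lemma id_residual_algebra [measurable]: "(\<lambda>\<omega>. \<omega>) \<in> measurable M (residual_algebra x)"
proof (rule measurableI)
  fix A assume "A \<in> sets (residual_algebra x)"
  then have "A \<in> sets M" unfolding sets_residual_algebra using sets.sigma_sets_subset[OF cyls_events] by auto
  then show "(\<lambda>\<omega>. \<omega>) -` A \<inter> space M \<in> sets M" by (simp add: sets.Int)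
qed simp

text \<open>The identity map into \<open>residual_algebra x\<close> restricts M to the
  sub-sigma-algebra. Independence thus becomes an equality of measures on pairs, to which Fubini's
  theorem applies.\<close>

lemma indep_B_residual_algebra:
  "distr M (borel \<Otimes>\<^sub>M residual_algebra x) (\<lambda>\<omega>. (B x \<omega>, \<omega>)) = \<gamma> \<Otimes>\<^sub>M distr M (residual_algebra x) (\<lambda>\<omega>. \<omega>)"
proof -
  have st: "Int_stable {B x -` A \<inter> space M |A. A \<in> sets borel}"
  proof (rule Int_stableI, clarify)
    fix A D :: "real set" assume "A \<in> sets borel" "D \<in> sets borel"
    then show "\<exists>E. B x -` A \<inter> space M \<inter> (B x -` D \<inter> space M) = B x -` E \<inter> space M \<and> E \<in> sets borel"
      by (intro exI[of _ "A \<inter> D"]) auto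
  qed
  interpret N: prob_space "distr M (residual_algebra x) (\<lambda>\<omega>. \<omega>)" by (rule prob_space_distr) simp
  interpret g: prob_space \<gamma> by (rule prob_space_gamma)
  have ind: "indep_set (sigma_sets (space M) {B x -` A \<inter> space M |A. A \<in> sets borel}) (sigma_sets (space M) (cyls x))"
    by (intro indep_set_sigma_sets indep_B_cyls st Int_stable_cyls)
  show ?thesis
  proof (rule pair_measure_eqI[symmetric])
    fix A E assume A: "A \<in> sets \<gamma>" and E: "E \<in> sets (distr M (residual_algebra x) (\<lambda>\<omega>. \<omega>))"
    have A': "A \<in> sets borel" and E': "E \<in> sets (residual_algebra x)" using A E by auto
    have EM: "E \<in> sets M" "E \<subseteq> space M"
      using measurable_sets[OF id_residual_algebra E'] sets.sets_into_space[OF E'] by (auto simp: Int_absorb2)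
    have "prob ((B x -` A \<inter> space M) \<inter> E) = prob (B x -` A \<inter> space M) * prob E"
      using A' E' by (intro indep_setD[OF ind]) (auto simp: sets_residual_algebra)
    moreover have "(B x -` A \<inter> space M) \<inter> E = (\<lambda>\<omega>. (B x \<omega>, \<omega>)) -` (A \<times> E) \<inter> space M" using EM by auto
    moreover have "emeasure \<gamma> A = emeasure M (B x -` A \<inter> space M)"
      unfolding B_law[symmetric, of x] using A' by (simp add: emeasure_distr)
    moreover have "emeasure (distr M (residual_algebra x) (\<lambda>\<omega>. \<omega>)) E = emeasure M E"
      using EM E' by (subst emeasure_distr[OF id_residual_algebra]) (auto simp: Int_absorb2)
    moreover have "emeasure (distr M (borel \<Otimes>\<^sub>M residual_algebra x) (\<lambda>\<omega>. (B x \<omega>, \<omega>))) (A \<times> E)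
       = emeasure M ((\<lambda>\<omega>. (B x \<omega>, \<omega>)) -` (A \<times> E) \<inter> space M)"
      using A' E' by (intro emeasure_distr) auto
    ultimately show "emeasure \<gamma> A * emeasure (distr M (residual_algebra x) (\<lambda>\<omega>. \<omega>)) E
      = emeasure (distr M (borel \<Otimes>\<^sub>M residual_algebra x) (\<lambda>\<omega>. (B x \<omega>, \<omega>))) (A \<times> E)"
      by (simp add: emeasure_eq_measure ennreal_mult'')
  qed (auto intro: g.sigma_finite_measure_axioms N.sigma_finite_measure_axioms)
qed

text \<open>B_x may be replaced by an independent standard Gaussian variable as long as the
  remaining dependence on the sample point goes through the residuals.\<close>

lemma integral_B_split:
  fixes f :: "real \<times> 'w \<Rightarrow> 'b::{banach, second_countable_topology}"
  assumes f[measurable]: "f \<in> borel_measurable (borel \<Otimes>\<^sub>M residual_algebra x)" and i: "integrable M (\<lambda>\<omega>. f (B x \<omega>, \<omega>))"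
  shows "(LINT \<omega>|M. f (B x \<omega>, \<omega>)) = (LINT \<omega>|M. LINT u|\<gamma>. f (u, \<omega>))"
proof -
  let ?N = "distr M (residual_algebra x) (\<lambda>\<omega>. \<omega>)"
  interpret N: prob_space ?N by (rule prob_space_distr) simp
  interpret g: prob_space \<gamma> by (rule prob_space_gamma)
  interpret P: pair_sigma_finite \<gamma> ?N ..
  have m: "(\<lambda>\<omega>. (B x \<omega>, \<omega>)) \<in> measurable M (borel \<Otimes>\<^sub>M residual_algebra x)" by measurable
  have i2: "integrable (\<gamma> \<Otimes>\<^sub>M ?N) (\<lambda>(u, \<omega>). f (u, \<omega>))"
    unfolding indep_B_residual_algebra[symmetric] using i integrable_distr_eq[OF m f] by simp
  have "(LINT \<omega>|M. f (B x \<omega>, \<omega>)) = integral\<^sup>L (\<gamma> \<Otimes>\<^sub>M ?N) f"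
    unfolding indep_B_residual_algebra[symmetric] using integral_distr[OF m f] by simp
  also have "\<dots> = (LINT \<omega>|?N. LINT u|\<gamma>. f (u, \<omega>))"
    using P.integral_snd[OF i2] by simp
  also have "\<dots> = (LINT \<omega>|M. LINT u|\<gamma>. f (u, \<omega>))"
  proof (rule integral_distr[OF id_residual_algebra])
    have "(\<lambda>z. f (snd z, fst z)) \<in> borel_measurable (residual_algebra x \<Otimes>\<^sub>M \<gamma>)" by measurable
    then show "(\<lambda>\<omega>. LINT u|\<gamma>. f (u, \<omega>)) \<in> borel_measurable (residual_algebra x)"
      by (intro g.borel_measurable_lebesgue_integral) (simp add: case_prod_beta')
  qed
  finally show ?thesis .
qed

text \<open>\<open>G u \<omega>\<close> stands for a functional of the field in which B_x has the
  value u and all residuals are frozen, so \<open>G'\<close> is its Malliavin derivative in the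
  direction of B_x. After freezing, the identity is one-dimensional for each sample point.\<close>

theorem field_ibp:
  fixes G G' :: "real \<Rightarrow> 'w \<Rightarrow> 'b::euclidean_space"
  assumes [measurable]: "(\<lambda>z. G (fst z) (snd z)) \<in> borel_measurable (borel \<Otimes>\<^sub>M residual_algebra x)"
      "(\<lambda>z. G' (fst z) (snd z)) \<in> borel_measurable (borel \<Otimes>\<^sub>M residual_algebra x)"
    and der: "\<And>u \<omega>. \<omega> \<in> space M \<Longrightarrow> ((\<lambda>u. G u \<omega>) has_vector_derivative G' u \<omega>) (at u)"
    and cont: "\<And>\<omega>. \<omega> \<in> space M \<Longrightarrow> continuous_on UNIV (\<lambda>u. G' u \<omega>)"
    and gr: "\<And>\<omega>. \<omega> \<in> space M \<Longrightarrow> poly_growth (\<lambda>u. G u \<omega>)" "\<And>\<omega>. \<omega> \<in> space M \<Longrightarrow> poly_growth (\<lambda>u. G' u \<omega>)"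
    and int: "integrable M (\<lambda>\<omega>. hermite (Suc n) (B x \<omega>) *\<^sub>R G (B x \<omega>) \<omega>)"
      "integrable M (\<lambda>\<omega>. hermite n (B x \<omega>) *\<^sub>R G' (B x \<omega>) \<omega>)"
  shows "(LINT \<omega>|M. hermite (Suc n) (B x \<omega>) *\<^sub>R G (B x \<omega>) \<omega>)
     = (LINT \<omega>|M. hermite n (B x \<omega>) *\<^sub>R G' (B x \<omega>) \<omega>)"
proof -
  have "(LINT \<omega>|M. hermite (Suc n) (B x \<omega>) *\<^sub>R G (B x \<omega>) \<omega>)
     = (LINT \<omega>|M. LINT u|\<gamma>. hermite (Suc n) u *\<^sub>R G u \<omega>)"
    using integral_B_split[of "\<lambda>z. hermite (Suc n) (fst z) *\<^sub>R G (fst z) (snd z)" x] int(1)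
    by (simp del: hermite.simps)
  also have "\<dots> = (LINT \<omega>|M. LINT u|\<gamma>. hermite n u *\<^sub>R G' u \<omega>)"
    by (intro Bochner_Integration.integral_cong gaussian_ibp der cont gr) auto
  also have "\<dots> = (LINT \<omega>|M. hermite n (B x \<omega>) *\<^sub>R G' (B x \<omega>) \<omega>)"
    using integral_B_split[of "\<lambda>z. hermite n (fst z) *\<^sub>R G' (fst z) (snd z)" x] int(2) by simp
  finally show ?thesis .
qed

end

section \<open>Fourth moments of Hermite polynomials\<close>

context
  fixes e12 e13 e14 e23 e24 e34 :: real
begin

text \<open>
  The value of $E[H_p(X_1) H_q(X_2) H_r(X_3) H_s(X_4)]$ for standard Gaussian variables with covariances
  $e_{ij}$; the recursion is integration by parts in the first variable of positive degree. The
  truncated predecessors only occur with a vanishing factor.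
\<close>

fun wick :: "nat \<Rightarrow> nat \<Rightarrow> nat \<Rightarrow> nat \<Rightarrow> real" where
  "wick (Suc p) q r s = e12 * real q * wick p (q - 1) r s + e13 * real r * wick p q (r - 1) s
      + e14 * real s * wick p q r (s - 1)"
| "wick 0 (Suc q) r s = e23 * real r * wick 0 q (r - 1) s + e24 * real s * wick 0 q r (s - 1)"
| "wick 0 0 (Suc r) s = e34 * real s * wick 0 0 r (s - 1)"
| "wick 0 0 0 (Suc s) = 0"
| "wick 0 0 0 0 = 1"

text \<open>
  Wick diagrams: $a, a', b, b', c, c'$ count the edges 12, 34, 13, 24, 14, 23, and at least $k$ edges join
  $\{1, 2\}$ to $\{3, 4\}$. The covariance of the two pairs only involves diagrams with $k = 1$.
\<close>

definition diag_index :: "nat \<Rightarrow> nat \<Rightarrow> nat \<Rightarrow> nat \<Rightarrow> nat \<Rightarrow> (nat \<times> nat \<times> nat \<times> nat \<times> nat \<times> nat) set" where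
  "diag_index k p q r s = {(a, a', b, b', c, c'). a + b + c = p \<and> a + b' + c' = q \<and> a' + b + c' = r
      \<and> a' + b' + c = s \<and> k \<le> b + b' + c + c'}"

definition diag_mono :: "nat \<times> nat \<times> nat \<times> nat \<times> nat \<times> nat \<Rightarrow> real" where
  "diag_mono = (\<lambda>(a, a', b, b', c, c'). e12 ^ a * e34 ^ a' * e13 ^ b * e24 ^ b' * e14 ^ c * e23 ^ c')"

definition diag_sum :: "nat \<Rightarrow> nat \<Rightarrow> nat \<Rightarrow> nat \<Rightarrow> nat \<Rightarrow> real" where
  "diag_sum k p q r s = (\<Sum>i\<in>diag_index k p q r s. diag_mono i)"

lemma finite_diag_index: "finite (diag_index k p q r s)"
proof (rule finite_subset)
  show "diag_index k p q r s \<subseteq> {..p} \<times> {..r} \<times> {..p} \<times> {..q} \<times> {..p} \<times> {..q}"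
    by (auto simp: diag_index_def)
qed auto

definition wick_cov :: "nat \<Rightarrow> nat \<Rightarrow> nat \<Rightarrow> nat \<Rightarrow> real" where
  "wick_cov p q r s = wick p q r s - wick p q 0 0 * wick 0 0 r s"

text \<open>For R = \<open>Suc m\<close> the terms are the integrands of the squared norms of the
  r-th contractions in the fourth moment theorem. The range is 1 <= r <= R - 1: the edges 12 and 34
  are always present through the factor C(x - y) in G, and at least one edge crosses between the two
  pairs.\<close>

definition contraction_sum :: "nat \<Rightarrow> real" where
  "contraction_sum m = (\<Sum>r\<in>{1..m}. (e12 * e34) ^ r * (e13 * e24) ^ (Suc m - r)
      + (e12 * e34) ^ r * (e14 * e23) ^ (Suc m - r))"

context
  assumes e_nonneg: "0 \<le> e12" "0 \<le> e13" "0 \<le> e14" "0 \<le> e23" "0 \<le> e24" "0 \<le> e34"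
begin

lemma diag_mono_nonneg: "0 \<le> diag_mono i"
  using e_nonneg by (cases i) (auto simp: diag_mono_def intro!: mult_nonneg_nonneg)

lemma diag_sum_nonneg: "0 \<le> diag_sum k p q r s"
  unfolding diag_sum_def by (intro sum_nonneg diag_mono_nonneg)

text \<open>Adding an edge embeds the diagrams of lower degree injectively into those of higher
  degree. As all monomials are nonnegative, the sum over the image is at most the full sum.\<close>

lemma diag_sum_shift:
  assumes "\<And>i. i \<in> diag_index k p q r s \<Longrightarrow> f i \<in> diag_index k' p' q' r' s'"
    and "inj f" and "\<And>i. e * diag_mono i = diag_mono (f i)"
  shows "e * diag_sum k p q r s \<le> diag_sum k' p' q' r' s'"
proof -
  have "e * diag_sum k p q r s = (\<Sum>i\<in>diag_index k p q r s. diag_mono (f i))"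
    unfolding diag_sum_def sum_distrib_left assms(3) ..
  also have "\<dots> = sum diag_mono (f ` diag_index k p q r s)"
    using assms(2) by (subst sum.reindex) (auto intro: inj_on_subset)
  also have "\<dots> \<le> diag_sum k' p' q' r' s'" unfolding diag_sum_def
    using assms(1) by (intro sum_mono2 finite_diag_index) (auto intro: diag_mono_nonneg)
  finally show ?thesis .
qed

lemma diag_sum_12: "e12 * diag_sum k p q r s \<le> diag_sum k (Suc p) (Suc q) r s"
  by (rule diag_sum_shift[where f="\<lambda>(a, a', b, b', c, c'). (Suc a, a', b, b', c, c')"])
    (auto simp: diag_index_def diag_mono_def inj_on_def)

lemma diag_sum_34: "e34 * diag_sum k p q r s \<le> diag_sum k p q (Suc r) (Suc s)"
  by (rule diag_sum_shift[where f="\<lambda>(a, a', b, b', c, c'). (a, Suc a', b, b', c, c')"])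
    (auto simp: diag_index_def diag_mono_def inj_on_def)

lemma diag_sum_13: "k' \<le> Suc k \<Longrightarrow> e13 * diag_sum k p q r s \<le> diag_sum k' (Suc p) q (Suc r) s"
  by (rule diag_sum_shift[where f="\<lambda>(a, a', b, b', c, c'). (a, a', Suc b, b', c, c')"])
    (auto simp: diag_index_def diag_mono_def inj_on_def)

lemma diag_sum_24: "k' \<le> Suc k \<Longrightarrow> e24 * diag_sum k p q r s \<le> diag_sum k' p (Suc q) r (Suc s)"
  by (rule diag_sum_shift[where f="\<lambda>(a, a', b, b', c, c'). (a, a', b, Suc b', c, c')"])
    (auto simp: diag_index_def diag_mono_def inj_on_def)

lemma diag_sum_14: "k' \<le> Suc k \<Longrightarrow> e14 * diag_sum k p q r s \<le> diag_sum k' (Suc p) q r (Suc s)"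
  by (rule diag_sum_shift[where f="\<lambda>(a, a', b, b', c, c'). (a, a', b, b', Suc c, c')"])
    (auto simp: diag_index_def diag_mono_def inj_on_def)

lemma diag_sum_23: "k' \<le> Suc k \<Longrightarrow> e23 * diag_sum k p q r s \<le> diag_sum k' p (Suc q) (Suc r) s"
  by (rule diag_sum_shift[where f="\<lambda>(a, a', b, b', c, c'). (a, a', b, b', c, Suc c')"])
    (auto simp: diag_index_def diag_mono_def inj_on_def)

text \<open>One summand of the recursion: \<open>F'\<close> is the factorial supplied by the
  induction hypothesis, \<open>F\<close> the one common to all summands. The bounds are only
  required for n > 0, where the truncated predecessor is the true one.\<close>

lemma wick_step:
  fixes w S S' e F :: real
  assumes "n > 0 \<Longrightarrow> w \<le> F' * S" "n > 0 \<Longrightarrow> e * S \<le> S'" "n > 0 \<Longrightarrow> 0 \<le> F' \<and> F' \<le> F" "0 \<le> e" "0 \<le> S'"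
  shows "e * real n * w \<le> real n * F * S'"
proof (cases "n = 0")
  case False
  then have n: "n > 0" by simp
  have "e * w \<le> e * (F' * S)" using assms(1)[OF n] assms(4) by (rule mult_left_mono)
  also have "\<dots> = F' * (e * S)" by simp
  also have "\<dots> \<le> F' * S'" using assms(2)[OF n] assms(3)[OF n] by (intro mult_left_mono) auto
  also have "\<dots> \<le> F * S'" using assms(3)[OF n] assms(5) by (intro mult_right_mono) auto
  finally have "real n * (e * w) \<le> real n * (F * S')" by (intro mult_left_mono) auto
  then show ?thesis by (simp add: mult_ac)
qed auto

lemma wick_nonneg: "0 \<le> wick p q r s"
  by (induction p q r s rule: wick.induct) (use e_nonneg in \<open>auto intro!: add_nonneg_nonneg mult_nonneg_nonneg\<close>)

text \<open>The multiplicities of one recursion step add up to at most n + 1, which turns n! into (n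
  + 1)!.\<close>

lemma wick_total:
  fixes F S :: real
  assumes "A \<le> real q * F * S" "A' \<le> real r * F * S" "A'' \<le> real s * F * S"
    "q + r + s \<le> n" "0 \<le> S" "F = fact n"
  shows "A + A' + A'' \<le> fact (Suc n) * S"
proof -
  have "A + A' + A'' \<le> real (q + r + s) * (F * S)" using assms(1-3) by (simp add: algebra_simps)
  also have "\<dots> \<le> real (Suc n) * (F * S)" using assms(4-6) by (intro mult_right_mono) auto
  finally show ?thesis using assms(6) by (simp add: algebra_simps)
qed

text \<open>An exact diagram formula has multinomial coefficients. Here it is enough that each step
  of the recursion costs at most the total degree, which leads to the factorial.\<close>

lemma wick_le: "wick p q r s \<le> fact (p + q + r + s) * diag_sum 0 p q r s"
proof (induction p q r s rule: wick.induct)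
  case (1 p q r s)
  let ?S = "diag_sum 0 (Suc p) q r s"
  have "wick (Suc p) q r s \<le> fact (Suc (p + q + r + s)) * ?S"
    unfolding wick.simps
  proof (rule wick_total[OF _ _ _ _ diag_sum_nonneg refl])
    show "e12 * real q * wick p (q - 1) r s \<le> real q * fact (p + q + r + s) * ?S"
      using 1(1) diag_sum_12[of 0 p "q - 1" r s] e_nonneg
      by (intro wick_step[where F'="fact (p + (q - 1) + r + s)"]) (auto intro: fact_mono diag_sum_nonneg)
    show "e13 * real r * wick p q (r - 1) s \<le> real r * fact (p + q + r + s) * ?S"
      using 1(2) diag_sum_13[of 0 0 p q "r - 1" s] e_nonneg
      by (intro wick_step[where F'="fact (p + q + (r - 1) + s)"]) (auto intro: fact_mono diag_sum_nonneg)
    show "e14 * real s * wick p q r (s - 1) \<le> real s * fact (p + q + r + s) * ?S"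
      using 1(3) diag_sum_14[of 0 0 p q r "s - 1"] e_nonneg
      by (intro wick_step[where F'="fact (p + q + r + (s - 1))"]) (auto intro: fact_mono diag_sum_nonneg)
  qed auto
  then show ?case by simp
next
  case (2 q r s)
  let ?S = "diag_sum 0 0 (Suc q) r s"
  have "0 + e23 * real r * wick 0 q (r - 1) s + e24 * real s * wick 0 q r (s - 1) \<le> fact (Suc (q + r + s)) * ?S"
  proof (rule wick_total[OF _ _ _ _ diag_sum_nonneg refl, of _ 0])
    show "e23 * real r * wick 0 q (r - 1) s \<le> real r * fact (q + r + s) * ?S"
      using 2(1) diag_sum_23[of 0 0 0 q "r - 1" s] e_nonneg
      by (intro wick_step[where F'="fact (q + (r - 1) + s)"]) (auto intro: fact_mono diag_sum_nonneg)
    show "e24 * real s * wick 0 q r (s - 1) \<le> real s * fact (q + r + s) * ?S"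
      using 2(2) diag_sum_24[of 0 0 0 q r "s - 1"] e_nonneg
      by (intro wick_step[where F'="fact (q + r + (s - 1))"]) (auto intro: fact_mono diag_sum_nonneg)
  qed auto
  then show ?case by simp
next
  case (3 r s)
  let ?S = "diag_sum 0 0 0 (Suc r) s"
  have "0 + 0 + e34 * real s * wick 0 0 r (s - 1) \<le> fact (Suc (r + s)) * ?S"
  proof (rule wick_total[OF _ _ _ _ diag_sum_nonneg refl, of _ 0 _ 0])
    show "e34 * real s * wick 0 0 r (s - 1) \<le> real s * fact (r + s) * ?S"
      using 3(1) diag_sum_34[of 0 0 0 r "s - 1"] e_nonneg
      by (intro wick_step[where F'="fact (r + (s - 1))"]) (auto intro: fact_mono diag_sum_nonneg)
  qed auto
  then show ?case by simp
next
  case (4 s)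
  then show ?case by (auto intro!: mult_nonneg_nonneg diag_sum_nonneg)
next
  case 5
  have "diag_index 0 0 0 0 0 = {(0, 0, 0, 0, 0, 0)}" by (auto simp: diag_index_def)
  then show ?case by (simp add: diag_sum_def diag_mono_def)
qed

lemma wick_cov_Suc: "wick_cov (Suc p) q r s = e12 * real q * wick_cov p (q - 1) r s
   + e13 * real r * wick p q (r - 1) s + e14 * real s * wick p q r (s - 1)"
  by (simp add: wick_cov_def algebra_simps)

lemma wick_cov_0_Suc: "wick_cov 0 (Suc q) r s = wick 0 (Suc q) r s"
  by (simp add: wick_cov_def)

lemma wick_cov_0_0: "wick_cov 0 0 r s = 0"
  by (simp add: wick_cov_def)

text \<open>An edge 12 leaves a covariance of lower degree. An edge 13 or 14 already crosses between
  the pairs, so the plain bound \<open>wick_le\<close> may be used from there on. Once the first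
  degree is used up, the second point can only be joined to 3 or 4, so every remaining diagram has a
  crossing.\<close>

lemma wick_cov_le: "wick_cov p q r s \<le> fact (p + q + r + s) * diag_sum 1 p q r s"
proof (induction p q r s rule: wick.induct)
  case (1 p q r s)
  let ?S = "diag_sum 1 (Suc p) q r s"
  have "wick_cov (Suc p) q r s \<le> fact (Suc (p + q + r + s)) * ?S"
    unfolding wick_cov_Suc
  proof (rule wick_total[OF _ _ _ _ diag_sum_nonneg refl])
    show "e12 * real q * wick_cov p (q - 1) r s \<le> real q * fact (p + q + r + s) * ?S"
      using 1(1) diag_sum_12[of 1 p "q - 1" r s] e_nonneg
      by (intro wick_step[where F'="fact (p + (q - 1) + r + s)"]) (auto intro: fact_mono diag_sum_nonneg)
    show "e13 * real r * wick p q (r - 1) s \<le> real r * fact (p + q + r + s) * ?S"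
      using wick_le[of p q "r - 1" s] diag_sum_13[of 1 0 p q "r - 1" s] e_nonneg
      by (intro wick_step[where F'="fact (p + q + (r - 1) + s)"]) (auto intro: fact_mono diag_sum_nonneg)
    show "e14 * real s * wick p q r (s - 1) \<le> real s * fact (p + q + r + s) * ?S"
      using wick_le[of p q r "s - 1"] diag_sum_14[of 1 0 p q r "s - 1"] e_nonneg
      by (intro wick_step[where F'="fact (p + q + r + (s - 1))"]) (auto intro: fact_mono diag_sum_nonneg)
  qed auto
  then show ?case by simp
next
  case (2 q r s)
  let ?S = "diag_sum 1 0 (Suc q) r s"
  have "0 + e23 * real r * wick 0 q (r - 1) s + e24 * real s * wick 0 q r (s - 1) \<le> fact (Suc (q + r + s)) * ?S"
  proof (rule wick_total[OF _ _ _ _ diag_sum_nonneg refl, of _ 0])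
    show "e23 * real r * wick 0 q (r - 1) s \<le> real r * fact (q + r + s) * ?S"
      using wick_le[of 0 q "r - 1" s] diag_sum_23[of 1 0 0 q "r - 1" s] e_nonneg
      by (intro wick_step[where F'="fact (q + (r - 1) + s)"]) (auto intro: fact_mono diag_sum_nonneg)
    show "e24 * real s * wick 0 q r (s - 1) \<le> real s * fact (q + r + s) * ?S"
      using wick_le[of 0 q r "s - 1"] diag_sum_24[of 1 0 0 q r "s - 1"] e_nonneg
      by (intro wick_step[where F'="fact (q + r + (s - 1))"]) (auto intro: fact_mono diag_sum_nonneg)
  qed auto
  then show ?case by (simp add: wick_cov_0_Suc)
qed (auto simp: wick_cov_0_0 simp del: wick.simps intro!: mult_nonneg_nonneg diag_sum_nonneg)

lemma power_mult_power_le_add: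
  fixes u v :: real
  assumes "0 \<le> u" "0 \<le> v" shows "u ^ b * v ^ c \<le> u ^ (b + c) + v ^ (b + c)"
proof (cases "u \<le> v")
  case True
  then have "u ^ b * v ^ c \<le> v ^ b * v ^ c" using assms by (intro mult_right_mono power_mono) auto
  then show ?thesis using assms by (simp add: power_add add_increasing)
next
  case False
  then have "u ^ b * v ^ c \<le> u ^ b * u ^ c" using assms by (intro mult_left_mono power_mono) auto
  then show ?thesis using assms by (simp add: power_add add_increasing2)
qed

text \<open>For four equal degrees the diagrams are symmetric, and the extra edges 12 and 34 raise
  the multiplicity a to r = a + 1. Separating the two kinds of crossing pairs then leaves exactly
  the contraction terms.\<close>

lemma wick_cov_diag_le:
  "e12 * e34 * wick_cov m m m m \<le> fact (4 * m) * real (card (diag_index 1 m m m m)) * contraction_sum m"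
proof -
  have "e12 * e34 * diag_mono i \<le> contraction_sum m" if i: "i \<in> diag_index 1 m m m m" for i
  proof -
    obtain a a' b b' c c' where ie: "i = (a, a', b, b', c, c')" by (cases i) auto
    have eq: "a + b + c = m" "a + b' + c' = m" "a' + b + c' = m" "a' + b' + c = m" "1 \<le> b + b' + c + c'"
      using i by (auto simp: ie diag_index_def)
    \<comment> \<open>Comparing the four degree equations shows that opposite edges have equal
      multiplicity.\<close>
    then have eq': "a' = a" "b' = b" "c' = c" by linarith+
    let ?u = "e13 * e24" and ?v = "e14 * e23" and ?w = "e12 * e34"
    have nn: "0 \<le> ?u" "0 \<le> ?v" "0 \<le> ?w" using e_nonneg by auto
    \<comment> \<open>A crossing edge forces b + c >= 1, hence a < m; this excludes the disconnected
      term r = m + 1.\<close>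
    have r: "Suc a \<in> {1..m}" using eq unfolding eq' by auto
    have bc: "b + c = Suc m - Suc a" using eq by auto
    have "e12 * e34 * diag_mono i = ?w ^ Suc a * (?u ^ b * ?v ^ c)"
      unfolding ie eq' by (simp add: diag_mono_def power_mult_distrib mult_ac)
    also have "\<dots> \<le> ?w ^ Suc a * (?u ^ (b + c) + ?v ^ (b + c))"
      using nn by (intro mult_left_mono power_mult_power_le_add) auto
    also have "\<dots> = ?w ^ Suc a * ?u ^ (Suc m - Suc a) + ?w ^ Suc a * ?v ^ (Suc m - Suc a)"
      unfolding bc by (simp add: distrib_left)
    also have "\<dots> \<le> contraction_sum m" unfolding contraction_sum_def
      using nn by (intro member_le_sum[OF r]) (auto intro!: add_nonneg_nonneg mult_nonneg_nonneg simp del: power_Suc)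
    finally show ?thesis .
  qed
  then have s: "e12 * e34 * diag_sum 1 m m m m \<le> real (card (diag_index 1 m m m m)) * contraction_sum m"
    unfolding diag_sum_def sum_distrib_left by (intro sum_bounded_above)
  have "e12 * e34 * wick_cov m m m m \<le> e12 * e34 * (fact (m + m + m + m) * diag_sum 1 m m m m)"
    using e_nonneg by (intro mult_left_mono wick_cov_le) auto
  also have "\<dots> = fact (m + m + m + m) * (e12 * e34 * diag_sum 1 m m m m)" by simp
  also have "\<dots> \<le> fact (m + m + m + m) * (real (card (diag_index 1 m m m m)) * contraction_sum m)"
    by (intro mult_left_mono s) auto
  also have "m + m + m + m = 4 * m" by simp
  finally show ?thesis by simp
qed

end

end

definition contraction_kernel :: "('x::minus \<Rightarrow> real) \<Rightarrow> nat \<Rightarrow> ('x \<times> 'x) \<times> ('x \<times> 'x) \<Rightarrow> real" where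
  "contraction_kernel C m q = contraction_sum (C (fst (fst q) - snd (fst q))) (C (fst (fst q) - fst (snd q))) (C (fst (fst q) - snd (snd q)))
     (C (snd (fst q) - fst (snd q))) (C (snd (fst q) - snd (snd q))) (C (fst (snd q) - snd (snd q))) m"

lemma binomial_derivative_sum:
  fixes u :: real and A :: "nat \<Rightarrow> real"
  shows "(\<Sum>k\<le>Suc n. real (Suc n choose k) * (real k * u ^ (k - 1)) * A k)
     = real (Suc n) * (\<Sum>j\<le>n. real (n choose j) * u ^ j * A (Suc j))"
proof -
  have "(\<Sum>k\<le>Suc n. real (Suc n choose k) * (real k * u ^ (k - 1)) * A k)
     = (\<Sum>j\<le>n. real (Suc n choose Suc j) * (real (Suc j) * u ^ j) * A (Suc j))"
    by (subst sum.atMost_Suc_shift) simp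
  also have "\<dots> = (\<Sum>j\<le>n. real (Suc n) * (real (n choose j) * u ^ j * A (Suc j)))"
  proof (rule sum.cong[OF refl])
    fix j
    have "real (Suc n choose Suc j) * real (Suc j) = real (Suc n) * real (n choose j)"
      using Suc_times_binomial_eq[of n j] by (simp only: of_nat_mult[symmetric])
    then show "real (Suc n choose Suc j) * (real (Suc j) * u ^ j) * A (Suc j)
       = real (Suc n) * (real (n choose j) * u ^ j * A (Suc j))"
      by (simp only: mult.assoc[symmetric])
  qed
  finally show ?thesis by (simp only: sum_distrib_left)
qed

lemma binomial_poly_deriv:
  "((\<lambda>u. \<Sum>k\<le>n. real (n choose k) * u ^ k * A k) has_real_derivative
     real n * (\<Sum>j\<le>n - 1. real ((n - 1) choose j) * u ^ j * A (Suc j))) (at u)"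
proof (cases n)
  case 0 then show ?thesis by simp
next
  case (Suc m)
  have "((\<lambda>u. \<Sum>k\<le>n. real (n choose k) * u ^ k * A k) has_real_derivative
     (\<Sum>k\<le>n. real (n choose k) * (real k * u ^ (k - 1)) * A k)) (at u)"
    by (auto intro!: derivative_eq_intros sum.cong)
  then show ?thesis unfolding Suc binomial_derivative_sum by simp
qed

text \<open>Both sides have the same derivative in a by induction and the same value at a = 0, where
  only the summand k = 0 survives. The formula exposes a Hermite polynomial of B_y as a polynomial
  in B_x.\<close>

lemma hermite_add: "hermite n (a + b) = (\<Sum>k\<le>n. real (n choose k) * a ^ k * hermite (n - k) b)"
proof (induction n arbitrary: a)
  case 0 show ?case by simp
next
  case (Suc n)
  let ?d = "\<lambda>a. hermite (Suc n) (a + b) - (\<Sum>k\<le>Suc n. real (Suc n choose k) * a ^ k * hermite (Suc n - k) b)"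
  have "(?d has_real_derivative 0) (at a)" for a
  proof -
    have "((\<lambda>a. hermite (Suc n) (a + b)) has_real_derivative real (Suc n) * hermite n (a + b) * 1) (at a)"
      using hermite_deriv'[of "\<lambda>a. a + b" 1 a "Suc n"] by (auto intro!: derivative_eq_intros simp del: hermite.simps)
    moreover have "((\<lambda>a. \<Sum>k\<le>Suc n. real (Suc n choose k) * a ^ k * hermite (Suc n - k) b) has_real_derivative
        real (Suc n) * hermite n (a + b)) (at a)"
      using binomial_poly_deriv[of "Suc n" "\<lambda>k. hermite (Suc n - k) b" a] unfolding Suc
      by (simp del: hermite.simps)
    ultimately show ?thesis using DERIV_diff by fastforce
  qed
  then have "?d a = ?d 0" by (rule DERIV_isconst_all[rule_format])
  also have "?d 0 = 0"
  proof -
    have "(\<Sum>k\<le>Suc n. real (Suc n choose k) * 0 ^ k * hermite (Suc n - k) b) = hermite (Suc n) b"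
      by (subst sum.atMost_Suc_shift) (simp del: hermite.simps)
    then show ?thesis by (simp del: hermite.simps)
  qed
  finally show ?case by simp
qed

section \<open>Fubini's theorem for integrals of random variables with bounded second
  moments\<close>

context prob_space
begin

context
  fixes N :: "'z measure" and \<xi> :: "'z \<Rightarrow> 'a \<Rightarrow> real" and K :: real
  assumes N: "finite_measure N"
    and meas[measurable]: "(\<lambda>z. \<xi> (fst z) (snd z)) \<in> borel_measurable (N \<Otimes>\<^sub>M M)"
    and sq: "\<And>z. z \<in> space N \<Longrightarrow> integrable M (\<lambda>\<omega>. (\<xi> z \<omega>)\<^sup>2)"
    and bound: "\<And>z. z \<in> space N \<Longrightarrow> expectation (\<lambda>\<omega>. (\<xi> z \<omega>)\<^sup>2) \<le> K"
begin

lemma section_measurable: "z \<in> space N \<Longrightarrow> \<xi> z \<in> borel_measurable M"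
  using measurable_compose[OF measurable_Pair1' meas, of z] by simp

lemma abs_section_le: "z \<in> space N \<Longrightarrow> expectation (\<lambda>\<omega>. \<bar>\<xi> z \<omega>\<bar>) \<le> sqrt K"
  using expectation_abs_le_sqrt[OF section_measurable sq, of z] bound[of z]
  by (meson order_trans real_sqrt_le_mono)

lemma section_integrable: "z \<in> space N \<Longrightarrow> integrable M (\<xi> z)"
  using integrable_L2_mult[of "\<xi> z" M "\<lambda>_. 1"] section_measurable sq by simp

text \<open>A uniform second moment bound controls the first absolute moments, and \<open>N\<close>
  is finite. The bounded factor \<open>g\<close> will be the exponential of the functional
  itself.\<close>

lemma integrable_fubini_bounded:
  fixes g :: "'a \<Rightarrow> 'b::{banach, second_countable_topology}"
  assumes g[measurable]: "g \<in> borel_measurable M" and g1: "\<And>\<omega>. norm (g \<omega>) \<le> 1"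
  shows "integrable (N \<Otimes>\<^sub>M M) (\<lambda>z. \<xi> (fst z) (snd z) *\<^sub>R g (snd z))"
proof -
  interpret N: finite_measure N by fact
  interpret P: pair_sigma_finite N M ..
  have [measurable]: "(\<lambda>z. \<xi> (fst z) (snd z) *\<^sub>R g (snd z)) \<in> borel_measurable (N \<Otimes>\<^sub>M M)" by measurable
  show "integrable (N \<Otimes>\<^sub>M M) (\<lambda>z. \<xi> (fst z) (snd z) *\<^sub>R g (snd z))"
  proof (rule P.Fubini_integrable)
    show "AE x in N. integrable M (\<lambda>y. \<xi> (fst (x, y)) (snd (x, y)) *\<^sub>R g (snd (x, y)))"
    proof (rule AE_I2)
      fix x assume x: "x \<in> space N"
      note section_measurable[OF x, measurable]
      show "integrable M (\<lambda>y. \<xi> (fst (x, y)) (snd (x, y)) *\<^sub>R g (snd (x, y)))"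
        by (rule Bochner_Integration.integrable_bound[OF section_integrable[OF x]])
          (auto intro!: mult_left_le g1)
    qed
    show "integrable N (\<lambda>x. LINT y|M. norm (\<xi> (fst (x, y)) (snd (x, y)) *\<^sub>R g (snd (x, y))))"
    proof (rule N.integrable_const_bound[of _ "sqrt K"])
      show "AE x in N. norm (LINT y|M. norm (\<xi> (fst (x, y)) (snd (x, y)) *\<^sub>R g (snd (x, y)))) \<le> sqrt K"
      proof (rule AE_I2)
        fix x assume x: "x \<in> space N"
        note section_measurable[OF x, measurable]
        have "(LINT y|M. norm (\<xi> x y *\<^sub>R g y)) \<le> (LINT y|M. \<bar>\<xi> x y\<bar>)"
        proof (rule integral_mono)
          show "integrable M (\<lambda>y. norm (\<xi> x y *\<^sub>R g y))"
            by (rule Bochner_Integration.integrable_bound[OF section_integrable[OF x]])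
              (auto intro!: mult_left_le g1)
          show "integrable M (\<lambda>y. \<bar>\<xi> x y\<bar>)" using section_integrable[OF x] by simp
        qed (auto intro!: mult_left_le g1)
        then show "norm (LINT y|M. norm (\<xi> (fst (x, y)) (snd (x, y)) *\<^sub>R g (snd (x, y)))) \<le> sqrt K"
          using abs_section_le[OF x] by simp
      qed
    qed measurable
  qed measurable
qed

lemma AE_integrable_section: "AE \<omega> in M. integrable N (\<lambda>z. \<xi> z \<omega>)"
proof -
  interpret N: finite_measure N by fact
  interpret P: pair_sigma_finite N M ..
  show ?thesis
    using P.AE_integrable_snd[of "\<lambda>z \<omega>. \<xi> z \<omega>"] integrable_fubini_bounded[of "\<lambda>_. 1::real"]
    by (simp add: case_prod_beta')
qed

lemma
  fixes g :: "'a \<Rightarrow> 'b::{banach, second_countable_topology}"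
  assumes g[measurable]: "g \<in> borel_measurable M" and g1: "\<And>\<omega>. norm (g \<omega>) \<le> 1"
  shows integrable_expectation_section: "integrable N (\<lambda>z. LINT \<omega>|M. \<xi> z \<omega> *\<^sub>R g \<omega>)"
    and integral_expectation_section: "(LINT z|N. LINT \<omega>|M. \<xi> z \<omega> *\<^sub>R g \<omega>) = (LINT \<omega>|M. (LINT z|N. \<xi> z \<omega>) *\<^sub>R g \<omega>)"
proof -
  interpret N: finite_measure N by fact
  interpret P: pair_sigma_finite N M ..
  note i = integrable_fubini_bounded[OF g g1]
  show "integrable N (\<lambda>z. LINT \<omega>|M. \<xi> z \<omega> *\<^sub>R g \<omega>)"
    using P.integrable_fst'[OF i] by simp
  have "(LINT z|N. LINT \<omega>|M. \<xi> z \<omega> *\<^sub>R g \<omega>) = (LINT \<omega>|M. LINT z|N. \<xi> z \<omega> *\<^sub>R g \<omega>)"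
    using P.Fubini_integral[of "\<lambda>z \<omega>. \<xi> z \<omega> *\<^sub>R g \<omega>"] i by (simp add: case_prod_beta')
  also have "\<dots> = (LINT \<omega>|M. (LINT z|N. \<xi> z \<omega>) *\<^sub>R g \<omega>)"
  proof (rule integral_cong_AE)
    \<comment> \<open>Pulling the factor out of the inner integral is justified where the section is
      integrable, which is almost everywhere.\<close>
    show "AE \<omega> in M. (LINT z|N. \<xi> z \<omega> *\<^sub>R g \<omega>) = (LINT z|N. \<xi> z \<omega>) *\<^sub>R g \<omega>"
      using AE_integrable_section by eventually_elim (auto intro: integral_scaleR_left)
    have m: "(\<lambda>z. \<xi> (snd z) (fst z)) \<in> borel_measurable (M \<Otimes>\<^sub>M N)"
      using measurable_compose[OF _ meas, of "\<lambda>x. (snd x, fst x)"] by simp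
    then have "(\<lambda>\<omega>. LINT z|N. \<xi> z \<omega>) \<in> borel_measurable M"
      by (intro N.borel_measurable_lebesgue_integral) (simp add: case_prod_beta')
    then show "(\<lambda>\<omega>. (LINT z|N. \<xi> z \<omega>) *\<^sub>R g \<omega>) \<in> borel_measurable M" by measurable
    have "(\<lambda>z. \<xi> (snd z) (fst z) *\<^sub>R g (fst z)) \<in> borel_measurable (M \<Otimes>\<^sub>M N)"
      using m by measurable
    then show "(\<lambda>\<omega>. LINT z|N. \<xi> z \<omega> *\<^sub>R g \<omega>) \<in> borel_measurable M"
      by (intro N.borel_measurable_lebesgue_integral) (simp add: case_prod_beta')
  qed
  finally show "(LINT z|N. LINT \<omega>|M. \<xi> z \<omega> *\<^sub>R g \<omega>) = (LINT \<omega>|M. (LINT z|N. \<xi> z \<omega>) *\<^sub>R g \<omega>)" .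
qed

lemma integral_section_measurable [measurable]: "(\<lambda>\<omega>. LINT z|N. \<xi> z \<omega>) \<in> borel_measurable M"
proof -
  interpret N: finite_measure N by fact
  have "(\<lambda>x. \<xi> (snd x) (fst x)) \<in> borel_measurable (M \<Otimes>\<^sub>M N)"
    using measurable_compose[OF _ meas, of "\<lambda>x. (snd x, fst x)"] by simp
  then show ?thesis by (intro N.borel_measurable_lebesgue_integral) (simp add: case_prod_beta')
qed

lemma expectation_integral_section: "expectation (\<lambda>\<omega>. LINT z|N. \<xi> z \<omega>) = (LINT z|N. expectation (\<xi> z))"
  using integral_expectation_section[of "\<lambda>_. 1::real"] by simp

lemma integrable_integral_section: "integrable M (\<lambda>\<omega>. LINT z|N. \<xi> z \<omega>)"
proof -
  interpret N: finite_measure N by fact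
  interpret P: pair_sigma_finite N M ..
  show ?thesis
    using P.integrable_snd[of "\<lambda>z \<omega>. \<xi> z \<omega>"] integrable_fubini_bounded[of "\<lambda>_. 1::real"]
    by (simp add: case_prod_beta')
qed

end

text \<open>The square of the integral is an integral over pairs. The arithmetic mean of the two
  squares dominates the product, with the same uniform bound, so Fubini applies again.\<close>

lemma
  fixes N :: "'z measure" and \<xi> :: "'z \<Rightarrow> 'a \<Rightarrow> real" and K :: real
  assumes N: "finite_measure N"
    and meas[measurable]: "(\<lambda>z. \<xi> (fst z) (snd z)) \<in> borel_measurable (N \<Otimes>\<^sub>M M)"
    and four: "\<And>z. z \<in> space N \<Longrightarrow> integrable M (\<lambda>\<omega>. (\<xi> z \<omega>)\<^sup>2)"
    and bound: "\<And>z. z \<in> space N \<Longrightarrow> expectation (\<lambda>\<omega>. (\<xi> z \<omega>)\<^sup>2) \<le> K"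
  shows second_moment_integrable: "integrable M (\<lambda>\<omega>. (LINT z|N. \<xi> z \<omega>)\<^sup>2)"
    and second_moment_eq: "expectation (\<lambda>\<omega>. (LINT z|N. \<xi> z \<omega>)\<^sup>2)
      = (LINT p|(N \<Otimes>\<^sub>M N). expectation (\<lambda>\<omega>. \<xi> (fst p) \<omega> * \<xi> (snd p) \<omega>))"
    and second_moment_integrable_cov: "integrable (N \<Otimes>\<^sub>M N) (\<lambda>p. expectation (\<lambda>\<omega>. \<xi> (fst p) \<omega> * \<xi> (snd p) \<omega>))"
proof -
  interpret N: finite_measure N by fact
  interpret P: pair_sigma_finite N M ..
  interpret NN: pair_sigma_finite N N ..
  have NNf: "finite_measure (N \<Otimes>\<^sub>M N)" by (rule finite_measure_pair_measure[OF N N])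
  interpret NN': finite_measure "N \<Otimes>\<^sub>M N" by (rule NNf)
  interpret Q: pair_sigma_finite "N \<Otimes>\<^sub>M N" M ..
  note sm = section_measurable[OF N meas four bound]
  let ?\<eta> = "\<lambda>p \<omega>. \<xi> (fst p) \<omega> * \<xi> (snd p) \<omega>"
  have abs_cov: "integrable M (?\<eta> p)" "expectation (\<lambda>\<omega>. \<bar>?\<eta> p \<omega>\<bar>) \<le> K" if p: "p \<in> space (N \<Otimes>\<^sub>M N)" for p
  proof -
    have z: "fst p \<in> space N" "snd p \<in> space N" using p by (auto simp: space_pair_measure)
    show i: "integrable M (?\<eta> p)" by (intro integrable_L2_mult sm z four)
    have "expectation (\<lambda>\<omega>. \<bar>?\<eta> p \<omega>\<bar>) \<le> expectation (\<lambda>\<omega>. ((\<xi> (fst p) \<omega>)\<^sup>2 + (\<xi> (snd p) \<omega>)\<^sup>2) / 2)"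
    proof (rule integral_mono)
      show "\<bar>?\<eta> p \<omega>\<bar> \<le> ((\<xi> (fst p) \<omega>)\<^sup>2 + (\<xi> (snd p) \<omega>)\<^sup>2) / 2" for \<omega>
        using sum_squares_bound[of "\<bar>\<xi> (fst p) \<omega>\<bar>" "\<bar>\<xi> (snd p) \<omega>\<bar>"] by (simp add: abs_mult)
    qed (use i four z in auto)
    also have "\<dots> \<le> K" using four z bound[OF z(1)] bound[OF z(2)] by simp
    finally show "expectation (\<lambda>\<omega>. \<bar>?\<eta> p \<omega>\<bar>) \<le> K" .
  qed
  have mm[measurable]: "(\<lambda>q. ?\<eta> (fst q) (snd q)) \<in> borel_measurable ((N \<Otimes>\<^sub>M N) \<Otimes>\<^sub>M M)"
  proof -
    have m1: "(\<lambda>q. (fst (fst q), snd q)) \<in> measurable ((N \<Otimes>\<^sub>M N) \<Otimes>\<^sub>M M) (N \<Otimes>\<^sub>M M)"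
      and m2: "(\<lambda>q. (snd (fst q), snd q)) \<in> measurable ((N \<Otimes>\<^sub>M N) \<Otimes>\<^sub>M M) (N \<Otimes>\<^sub>M M)" by measurable
    have "(\<lambda>q. \<xi> (fst (fst q)) (snd q)) \<in> borel_measurable ((N \<Otimes>\<^sub>M N) \<Otimes>\<^sub>M M)"
      "(\<lambda>q. \<xi> (snd (fst q)) (snd q)) \<in> borel_measurable ((N \<Otimes>\<^sub>M N) \<Otimes>\<^sub>M M)"
      using measurable_compose[OF m1 meas] measurable_compose[OF m2 meas] by simp_all
    then show ?thesis by measurable
  qed
  have i: "integrable ((N \<Otimes>\<^sub>M N) \<Otimes>\<^sub>M M) (\<lambda>q. ?\<eta> (fst q) (snd q))"
  proof (rule Q.Fubini_integrable)
    show "AE x in (N \<Otimes>\<^sub>M N). integrable M (\<lambda>y. ?\<eta> (fst (x, y)) (snd (x, y)))"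
      using abs_cov by auto
    show "integrable (N \<Otimes>\<^sub>M N) (\<lambda>x. LINT y|M. norm (?\<eta> (fst (x, y)) (snd (x, y))))"
    proof (rule NN'.integrable_const_bound[of _ K])
      show "AE x in (N \<Otimes>\<^sub>M N). norm (LINT y|M. norm (?\<eta> (fst (x, y)) (snd (x, y)))) \<le> K"
        using abs_cov by auto
    qed (use mm in measurable)
  qed (rule mm)
  have AEeq: "AE \<omega> in M. (LINT p|(N \<Otimes>\<^sub>M N). ?\<eta> p \<omega>) = (LINT z|N. \<xi> z \<omega>)\<^sup>2"
  proof -
    have "AE \<omega> in M. integrable (N \<Otimes>\<^sub>M N) (\<lambda>p. ?\<eta> p \<omega>)"
      using Q.AE_integrable_snd[of ?\<eta>] i by (simp add: case_prod_beta')
    then show ?thesis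
    proof eventually_elim
      case (elim \<omega>)
      have "(LINT p|(N \<Otimes>\<^sub>M N). ?\<eta> p \<omega>) = (LINT z|N. LINT z'|N. \<xi> z \<omega> * \<xi> z' \<omega>)"
        using NN.integral_fst'[OF elim] by simp
      then show ?case by (simp add: power2_eq_square)
    qed
  qed
  have ii: "integrable M (\<lambda>\<omega>. LINT p|(N \<Otimes>\<^sub>M N). ?\<eta> p \<omega>)"
    using Q.integrable_snd[of ?\<eta>] i by (simp add: case_prod_beta')
  note sms[measurable] = integral_section_measurable[OF N meas four bound]
  show "integrable M (\<lambda>\<omega>. (LINT z|N. \<xi> z \<omega>)\<^sup>2)"
    by (rule integrable_cong_AE_imp[OF ii]) (use AEeq in \<open>auto elim: eventually_mono\<close>)
  have "expectation (\<lambda>\<omega>. (LINT z|N. \<xi> z \<omega>)\<^sup>2) = expectation (\<lambda>\<omega>. LINT p|(N \<Otimes>\<^sub>M N). ?\<eta> p \<omega>)"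
    by (rule integral_cong_AE) (use AEeq ii in \<open>auto elim: eventually_mono\<close>)
  also have "\<dots> = (LINT p|(N \<Otimes>\<^sub>M N). expectation (?\<eta> p))"
    using Q.Fubini_integral[of ?\<eta>] i by (simp add: case_prod_beta')
  finally show "expectation (\<lambda>\<omega>. (LINT z|N. \<xi> z \<omega>)\<^sup>2) = (LINT p|(N \<Otimes>\<^sub>M N). expectation (?\<eta> p))" .
  show "integrable (N \<Otimes>\<^sub>M N) (\<lambda>p. expectation (?\<eta> p))"
    using Q.integrable_fst'[OF i] by simp
qed

end

section \<open>Mixed moments of Hermite polynomials of the field\<close>

context gauss_field
begin

lemma hermite_B_power_integrable: "integrable M (\<lambda>\<omega>. hermite p (B x \<omega>) ^ k)"
  using B_integrable_iff[of "\<lambda>u. hermite p u ^ k" x]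
  by (simp add: integrable_poly_growth poly_growth_power poly_growth_hermite)

lemma hermite_B_integrable: "integrable M (\<lambda>\<omega>. hermite p (B x \<omega>))"
  using hermite_B_power_integrable[of p x 1] by simp

lemma hermite_B_pair_L2: "integrable M (\<lambda>\<omega>. (hermite p (B x \<omega>) * hermite q (B y \<omega>))\<^sup>2)"
proof -
  have *: "(t\<^sup>2)\<^sup>2 = t ^ 4" for t :: real by (simp add: power_mult[symmetric])
  have "integrable M (\<lambda>\<omega>. (hermite p (B x \<omega>))\<^sup>2 * (hermite q (B y \<omega>))\<^sup>2)"
    by (rule integrable_L2_mult) (auto simp: * hermite_B_power_integrable)
  then show ?thesis by (simp add: power_mult_distrib)
qed

lemma hermite_B4_integrable:
  "integrable M (\<lambda>\<omega>. hermite p (B x1 \<omega>) * (hermite q (B x2 \<omega>) * hermite r (B x3 \<omega>) * hermite s (B x4 \<omega>)))"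
proof -
  have "integrable M (\<lambda>\<omega>. (hermite p (B x1 \<omega>) * hermite q (B x2 \<omega>)) * (hermite r (B x3 \<omega>) * hermite s (B x4 \<omega>)))"
    by (rule integrable_L2_mult) (auto simp: hermite_B_pair_L2)
  then show ?thesis by (simp add: mult.assoc)
qed

text \<open>The bracketing separates the variable in which one integrates by parts from the other
  three.\<close>

definition mom4 :: "'x \<Rightarrow> 'x \<Rightarrow> 'x \<Rightarrow> 'x \<Rightarrow> nat \<Rightarrow> nat \<Rightarrow> nat \<Rightarrow> nat \<Rightarrow> real" where
  "mom4 x1 x2 x3 x4 p q r s = expectation (\<lambda>\<omega>. hermite p (B x1 \<omega>) *
     (hermite q (B x2 \<omega>) * hermite r (B x3 \<omega>) * hermite s (B x4 \<omega>)))"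

text \<open>Integration by parts at x1 is applied to the product of the other three factors.
  Differentiating the factor at x_j with respect to B_x1 lowers its degree and produces C (x_j -
  x1).\<close>

lemma mom4_Suc:
  "mom4 x1 x2 x3 x4 (Suc p) q r s = C (x1 - x2) * real q * mom4 x1 x2 x3 x4 p (q - 1) r s
     + C (x1 - x3) * real r * mom4 x1 x2 x3 x4 p q (r - 1) s
     + C (x1 - x4) * real s * mom4 x1 x2 x3 x4 p q r (s - 1)"
proof -
  \<comment> \<open>\<open>h n y u\<close> is H_n(B_y) with the value of B at x1 replaced by u and
    the residual kept.\<close>
  define h where "h n y u \<omega> = hermite n (C (y - x1) * u + Z x1 y \<omega>)" for n y u \<omega>
  have hB: "h n y (B x1 \<omega>) \<omega> = hermite n (B y \<omega>)" for n y \<omega> by (simp add: h_def Z_def)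
  have hm[measurable]: "(\<lambda>z. h n y (fst z) (snd z)) \<in> borel_measurable (borel \<Otimes>\<^sub>M residual_algebra x1)" for n y
    unfolding h_def by measurable
  have hd: "((\<lambda>u. h n y u \<omega>) has_real_derivative real n * h (n - 1) y u \<omega> * C (y - x1)) (at u)" for n y u \<omega>
    unfolding h_def by (rule hermite_deriv') (auto intro!: derivative_eq_intros)
  have hc: "continuous_on UNIV (\<lambda>u. h n y u \<omega>)" for n y \<omega>
    unfolding h_def by (intro continuous_intros)
  have hg: "poly_growth (\<lambda>u. h n y u \<omega>)" for n y \<omega>
    unfolding h_def by (intro poly_growth_affine poly_growth_hermite)
  define G where "G u \<omega> = h q x2 u \<omega> * h r x3 u \<omega> * h s x4 u \<omega>" for u \<omega>
  define G' where "G' u \<omega> = (C (x2 - x1) * real q) * (h (q - 1) x2 u \<omega> * h r x3 u \<omega> * h s x4 u \<omega>)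
     + (C (x3 - x1) * real r) * (h q x2 u \<omega> * h (r - 1) x3 u \<omega> * h s x4 u \<omega>)
     + (C (x4 - x1) * real s) * (h q x2 u \<omega> * h r x3 u \<omega> * h (s - 1) x4 u \<omega>)" for u \<omega>
  have e': "hermite p (B x1 \<omega>) * G' (B x1 \<omega>) \<omega>
     = (C (x2 - x1) * real q) * (hermite p (B x1 \<omega>) * (hermite (q - 1) (B x2 \<omega>) * hermite r (B x3 \<omega>) * hermite s (B x4 \<omega>)))
      + (C (x3 - x1) * real r) * (hermite p (B x1 \<omega>) * (hermite q (B x2 \<omega>) * hermite (r - 1) (B x3 \<omega>) * hermite s (B x4 \<omega>)))
      + (C (x4 - x1) * real s) * (hermite p (B x1 \<omega>) * (hermite q (B x2 \<omega>) * hermite r (B x3 \<omega>) * hermite (s - 1) (B x4 \<omega>)))" for \<omega>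
    unfolding G'_def hB by (simp only: distrib_left mult.left_commute[of "hermite p (B x1 \<omega>)"])
  have int': "integrable M (\<lambda>\<omega>. hermite p (B x1 \<omega>) * G' (B x1 \<omega>) \<omega>)"
    unfolding e' by (intro Bochner_Integration.integrable_add integrable_mult_right hermite_B4_integrable)
  have "expectation (\<lambda>\<omega>. hermite (Suc p) (B x1 \<omega>) *\<^sub>R G (B x1 \<omega>) \<omega>) = expectation (\<lambda>\<omega>. hermite p (B x1 \<omega>) *\<^sub>R G' (B x1 \<omega>) \<omega>)"
  proof (rule field_ibp)
    show "((\<lambda>u. G u \<omega>) has_vector_derivative G' u \<omega>) (at u)" for u \<omega>
    proof -
      have "((\<lambda>u. G u \<omega>) has_real_derivative
         (real q * h (q - 1) x2 u \<omega> * C (x2 - x1) * h r x3 u \<omega> + real r * h (r - 1) x3 u \<omega> * C (x3 - x1) * h q x2 u \<omega>) * h s x4 u \<omega>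
          + real s * h (s - 1) x4 u \<omega> * C (x4 - x1) * (h q x2 u \<omega> * h r x3 u \<omega>)) (at u)"
        unfolding G_def by (intro DERIV_mult hd)
      then show ?thesis unfolding has_real_derivative_iff_has_vector_derivative[symmetric]
        by (rule DERIV_cong) (simp add: G'_def algebra_simps)
    qed
    show "integrable M (\<lambda>\<omega>. hermite (Suc p) (B x1 \<omega>) *\<^sub>R G (B x1 \<omega>) \<omega>)"
      unfolding G_def hB using hermite_B4_integrable by (simp del: hermite.simps)
    show "integrable M (\<lambda>\<omega>. hermite p (B x1 \<omega>) *\<^sub>R G' (B x1 \<omega>) \<omega>)" using int' by simp
  qed (auto simp: G_def G'_def intro!: continuous_intros hc poly_growth_add poly_growth_mult hg)
  also have "\<dots> = (C (x2 - x1) * real q) * mom4 x1 x2 x3 x4 p (q - 1) r s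
     + (C (x3 - x1) * real r) * mom4 x1 x2 x3 x4 p q (r - 1) s
     + (C (x4 - x1) * real s) * mom4 x1 x2 x3 x4 p q r (s - 1)"
    unfolding real_scaleR_def e' mom4_def
    by (simp only: Bochner_Integration.integral_add integral_mult_right_zero integrable_mult_right
        Bochner_Integration.integrable_add hermite_B4_integrable)
  finally show ?thesis unfolding mom4_def G_def hB
    by (simp add: C_sym[of x2 x1] C_sym[of x3 x1] C_sym[of x4 x1] del: hermite.simps)
qed

lemma mom4_swap: "mom4 x1 x2 x3 x4 p q r s = mom4 x2 x1 x3 x4 q p r s"
  "mom4 x1 x2 x3 x4 p q r s = mom4 x3 x2 x1 x4 r q p s"
  "mom4 x1 x2 x3 x4 p q r s = mom4 x4 x2 x3 x1 s q r p"
  unfolding mom4_def by (intro Bochner_Integration.integral_cong refl; simp add: mult_ac)+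

text \<open>Both sides obey the same recursion. The swaps bring the first variable of positive
  degree into the slot where integration by parts is available.\<close>

lemma mom4_wick: "mom4 x1 x2 x3 x4 p q r s
  = wick (C (x1 - x2)) (C (x1 - x3)) (C (x1 - x4)) (C (x2 - x3)) (C (x2 - x4)) (C (x3 - x4)) p q r s"
proof (induction p q r s rule: wick.induct)
  case (1 p q r s)
  then show ?case by (cases "q = 0"; cases "r = 0"; cases "s = 0") (simp_all add: mom4_Suc del: hermite.simps)
next
  case (2 q r s)
  have "mom4 x1 x2 x3 x4 0 (Suc q) r s = C (x2 - x3) * real r * mom4 x2 x1 x3 x4 q 0 (r - 1) s
     + C (x2 - x4) * real s * mom4 x2 x1 x3 x4 q 0 r (s - 1)"
    by (subst mom4_swap(1)) (simp add: mom4_Suc)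
  then show ?case using 2 by (cases "r = 0"; cases "s = 0") (simp_all add: mom4_swap(1)[of x2 x1])
next
  case (3 r s)
  have "mom4 x1 x2 x3 x4 0 0 (Suc r) s = C (x3 - x4) * real s * mom4 x3 x2 x1 x4 r 0 0 (s - 1)"
    by (subst mom4_swap(2)) (simp add: mom4_Suc)
  then show ?case using 3 by (cases "s = 0") (simp_all add: mom4_swap(2)[of x3 x2 x1])
next
  case (4 s)
  show ?case by (subst mom4_swap(3)) (simp add: mom4_Suc)
next
  case 5
  show ?case by (simp add: mom4_def prob_space)
qed

lemma wick_pair: "wick e12 e13 e14 e23 e24 e34 p q 0 0 = (if p = q then fact p * e12 ^ p else 0)"
proof (induction p arbitrary: q)
  case 0 then show ?case by (cases q) auto
next
  case (Suc p) then show ?case by (cases q) auto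
qed

lemma wick_pair': "wick e12 e13 e14 e23 e24 e34 0 0 p q = (if p = q then fact p * e34 ^ p else 0)"
proof (induction p arbitrary: q)
  case 0 then show ?case by (cases q) auto
next
  case (Suc p) then show ?case by (cases q) auto
qed

lemma hermite_B_pair: "expectation (\<lambda>\<omega>. hermite p (B x \<omega>) * hermite q (B y \<omega>))
   = (if p = q then fact p * C (x - y) ^ p else 0)"
  using mom4_wick[of x y x y p q 0 0] unfolding wick_pair by (simp add: mom4_def)

end

section \<open>Characteristic functions and a Stein-type bound\<close>

lemma norm_integral_le:
  fixes f :: "'a \<Rightarrow> 'b::{banach, second_countable_topology}" and g :: "'a \<Rightarrow> real"
  assumes "integrable M f" "integrable M g" "\<And>x. norm (f x) \<le> g x"
  shows "norm (LINT x|M. f x) \<le> (LINT x|M. g x)"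
  by (rule order_trans[OF integral_norm_bound integral_mono]) (use assms in auto)

text \<open>The first-order Taylor remainder of the exponential is at most h^2 F^2, which is
  integrable; dividing by h gives the derivative without dominated convergence.\<close>

lemma (in prob_space) char_has_vector_derivative:
  fixes F :: "'a \<Rightarrow> real"
  assumes [measurable]: "F \<in> borel_measurable M" and F2: "integrable M (\<lambda>\<omega>. (F \<omega>)\<^sup>2)"
  shows "((\<lambda>s. LINT \<omega>|M. iexp (s * F \<omega>)) has_vector_derivative
     (\<i> * (LINT \<omega>|M. F \<omega> *\<^sub>R iexp (s * F \<omega>)))) (at s)"
proof -
  have F1: "integrable M F" using integrable_L2_mult[of F M "\<lambda>_. 1"] F2 by simp
  have ie: "integrable M (\<lambda>\<omega>. iexp (t * F \<omega>))" for t by (intro integrable_const_bound[of _ 1]) auto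
  have iFe: "integrable M (\<lambda>\<omega>. F \<omega> *\<^sub>R iexp (t * F \<omega>))" for t
    by (rule Bochner_Integration.integrable_bound[OF F1]) auto
  let ?\<phi> = "\<lambda>s. LINT \<omega>|M. iexp (s * F \<omega>)" and ?d = "\<i> * (LINT \<omega>|M. F \<omega> *\<^sub>R iexp (s * F \<omega>))"
  let ?K = "expectation (\<lambda>\<omega>. (F \<omega>)\<^sup>2)"
  have le: "norm (?\<phi> (s + h) - ?\<phi> s - h *\<^sub>R ?d) \<le> h\<^sup>2 * ?K" for h
  proof -
    have "?\<phi> (s + h) - ?\<phi> s - h *\<^sub>R ?d
      = (LINT \<omega>|M. iexp ((s + h) * F \<omega>) - iexp (s * F \<omega>) - (\<i> * complex_of_real h) * (F \<omega> *\<^sub>R iexp (s * F \<omega>)))"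
    proof -
      have *: "(LINT \<omega>|M. f \<omega> - g \<omega> - c * k \<omega>) = (LINT \<omega>|M. f \<omega>) - (LINT \<omega>|M. g \<omega>) - c * (LINT \<omega>|M. k \<omega>)"
        if "integrable M f" "integrable M g" "integrable M k" for f g k :: "'a \<Rightarrow> complex" and c
        using that by simp
      show ?thesis unfolding *[OF ie ie iFe] by (simp add: scaleR_conv_of_real)
    qed
    also have "norm \<dots> \<le> (LINT \<omega>|M. h\<^sup>2 * (F \<omega>)\<^sup>2)"
    proof (rule norm_integral_le)
      fix \<omega>
      have q: "\<bar>t\<bar> ^ Suc 1 / fact (Suc 1) \<le> t\<^sup>2" for t :: real
      proof -
        have "\<bar>t\<bar> ^ Suc 1 / fact (Suc 1) = t\<^sup>2 / 2" by (simp add: power2_eq_square fact_numeral)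
        then show ?thesis by simp
      qed
      have e: "iexp ((s + h) * F \<omega>) - iexp (s * F \<omega>) - (\<i> * complex_of_real h) * (F \<omega> *\<^sub>R iexp (s * F \<omega>))
        = iexp (s * F \<omega>) * (iexp (h * F \<omega>) - (\<Sum>k\<le>1. (\<i> * complex_of_real (h * F \<omega>)) ^ k / fact k))"
        by (simp add: distrib_right distrib_left exp_add scaleR_conv_of_real algebra_simps)
      have "norm (iexp ((s + h) * F \<omega>) - iexp (s * F \<omega>) - (\<i> * complex_of_real h) * (F \<omega> *\<^sub>R iexp (s * F \<omega>)))
         \<le> \<bar>h * F \<omega>\<bar> ^ Suc 1 / fact (Suc 1)"
        unfolding e norm_mult using iexp_approx1[of "h * F \<omega>" 1] by simp
      also have "\<dots> \<le> (h * F \<omega>)\<^sup>2" by (rule q)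
      also have "\<dots> = h\<^sup>2 * (F \<omega>)\<^sup>2" by (rule power_mult_distrib)
      finally show "norm (iexp ((s + h) * F \<omega>) - iexp (s * F \<omega>) - (\<i> * complex_of_real h) * (F \<omega> *\<^sub>R iexp (s * F \<omega>)))
         \<le> h\<^sup>2 * (F \<omega>)\<^sup>2" .
    next
      show "integrable M (\<lambda>\<omega>. iexp ((s + h) * F \<omega>) - iexp (s * F \<omega>) - (\<i> * complex_of_real h) * (F \<omega> *\<^sub>R iexp (s * F \<omega>)))"
        by (intro Bochner_Integration.integrable_diff integrable_mult_right ie iFe)
      show "integrable M (\<lambda>\<omega>. h\<^sup>2 * (F \<omega>)\<^sup>2)" using F2 by simp
    qed
    finally show ?thesis by simp
  qed
  show ?thesis
    unfolding has_vector_derivative_def has_derivative_at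
  proof (intro conjI bounded_linear_scaleR_left)
    show "(\<lambda>h. norm (?\<phi> (s + h) - ?\<phi> s - h *\<^sub>R ?d) / norm h) \<midarrow>0\<rightarrow> 0"
    proof (rule Lim_null_comparison)
      show "\<forall>\<^sub>F h in at 0. norm (norm (?\<phi> (s + h) - ?\<phi> s - h *\<^sub>R ?d) / norm h) \<le> \<bar>h\<bar> * ?K"
      proof (rule eventuallyI)
        fix h :: real
        show "norm (norm (?\<phi> (s + h) - ?\<phi> s - h *\<^sub>R ?d) / norm h) \<le> \<bar>h\<bar> * ?K"
        proof (cases "h = 0")
          case False
          have "norm (?\<phi> (s + h) - ?\<phi> s - h *\<^sub>R ?d) / \<bar>h\<bar> \<le> h\<^sup>2 * ?K / \<bar>h\<bar>"
            by (intro divide_right_mono le) auto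
          also have "\<dots> = \<bar>h\<bar> * ?K" using False by (simp add: field_simps power2_eq_square)
          finally show ?thesis by simp
        qed simp
      qed
      show "((\<lambda>h. \<bar>h\<bar> * ?K) \<longlongrightarrow> 0) (at 0)"
        by (auto intro!: tendsto_eq_intros)
    qed
  qed
qed

text \<open>For G = v the hypothesis reads phi' = - r v phi. Multiplying phi by the integrating
  factor exp (r^2 v / 2) leaves a derivative that contains only v - G, and the mean value inequality
  from 0 to s finishes the comparison.\<close>

lemma (in prob_space) char_gaussian_bound:
  fixes F G :: "'a \<Rightarrow> real" and v :: real
  assumes [measurable]: "F \<in> borel_measurable M" and F2: "integrable M (\<lambda>\<omega>. (F \<omega>)\<^sup>2)"
    and G: "integrable M G" and v: "v \<ge> 0"
    and stein: "\<And>s. (LINT \<omega>|M. F \<omega> *\<^sub>R iexp (s * F \<omega>)) = (\<i> * complex_of_real s) * (LINT \<omega>|M. G \<omega> *\<^sub>R iexp (s * F \<omega>))"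
  shows "norm ((LINT \<omega>|M. iexp (s * F \<omega>)) - complex_of_real (exp (- (s\<^sup>2 * v / 2)))) \<le> s\<^sup>2 * expectation (\<lambda>\<omega>. \<bar>G \<omega> - v\<bar>)"
proof -
  have [measurable]: "G \<in> borel_measurable M" using G by simp
  let ?\<phi> = "\<lambda>s. LINT \<omega>|M. iexp (s * F \<omega>)" and ?\<Delta> = "expectation (\<lambda>\<omega>. \<bar>G \<omega> - v\<bar>)"
  have ie: "integrable M (\<lambda>\<omega>. iexp (t * F \<omega>))" for t by (intro integrable_const_bound[of _ 1]) auto
  have iGe: "integrable M (\<lambda>\<omega>. G \<omega> *\<^sub>R iexp (t * F \<omega>))" for t
    by (rule Bochner_Integration.integrable_bound[OF G]) auto
  define h where "h r = exp (r\<^sup>2 * v / 2) *\<^sub>R ?\<phi> r" for r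
  define h' where "h' r = exp (r\<^sup>2 * v / 2) *\<^sub>R (\<i> * (LINT \<omega>|M. F \<omega> *\<^sub>R iexp (r * F \<omega>))) + (exp (r\<^sup>2 * v / 2) * (r * v)) *\<^sub>R ?\<phi> r" for r
  have hd: "(h has_vector_derivative h' r) (at r)" for r
    unfolding h_def[abs_def] h'_def
  proof (rule has_vector_derivative_scaleR[OF _ char_has_vector_derivative])
    show "((\<lambda>r. exp (r\<^sup>2 * v / 2)) has_real_derivative exp (r\<^sup>2 * v / 2) * (r * v)) (at r)"
      by (auto intro!: derivative_eq_intros)
  qed (use F2 in auto)
  have h'_eq: "h' r = (r * exp (r\<^sup>2 * v / 2)) *\<^sub>R (LINT \<omega>|M. (v - G \<omega>) *\<^sub>R iexp (r * F \<omega>))" for r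
  proof -
    have "(LINT \<omega>|M. (v - G \<omega>) *\<^sub>R iexp (r * F \<omega>)) = (LINT \<omega>|M. v *\<^sub>R iexp (r * F \<omega>) - G \<omega> *\<^sub>R iexp (r * F \<omega>))"
      by (simp only: scaleR_diff_left)
    also have "\<dots> = v *\<^sub>R ?\<phi> r - (LINT \<omega>|M. G \<omega> *\<^sub>R iexp (r * F \<omega>))"
      by (subst Bochner_Integration.integral_diff, rule integrable_scaleR_right, rule ie, rule iGe)
        (simp only: integral_scaleR_right)
    finally have X: "(LINT \<omega>|M. (v - G \<omega>) *\<^sub>R iexp (r * F \<omega>)) = v *\<^sub>R ?\<phi> r - (LINT \<omega>|M. G \<omega> *\<^sub>R iexp (r * F \<omega>))" .
    show ?thesis unfolding h'_def stein X
      by (simp add: scaleR_conv_of_real algebra_simps)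
  qed
  have h'_le: "norm (h' r) \<le> \<bar>s\<bar> * exp (s\<^sup>2 * v / 2) * ?\<Delta>" if r: "\<bar>r\<bar> \<le> \<bar>s\<bar>" for r
  proof -
    have "norm (LINT \<omega>|M. (v - G \<omega>) *\<^sub>R iexp (r * F \<omega>)) \<le> ?\<Delta>"
    proof (rule norm_integral_le)
      show "integrable M (\<lambda>\<omega>. \<bar>G \<omega> - v\<bar>)" using G by auto
      then show "integrable M (\<lambda>\<omega>. (v - G \<omega>) *\<^sub>R iexp (r * F \<omega>))"
        by (rule Bochner_Integration.integrable_bound) auto
    qed (auto simp: abs_minus_commute)
    moreover have "\<bar>r\<bar> * exp (r\<^sup>2 * v / 2) \<le> \<bar>s\<bar> * exp (s\<^sup>2 * v / 2)"
      using r v by (intro mult_mono) (auto intro!: mult_right_mono simp: abs_le_square_iff)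
    ultimately have "(\<bar>r\<bar> * exp (r\<^sup>2 * v / 2)) * norm (LINT \<omega>|M. (v - G \<omega>) *\<^sub>R iexp (r * F \<omega>))
       \<le> \<bar>s\<bar> * exp (s\<^sup>2 * v / 2) * ?\<Delta>"
      by - (rule mult_mono, auto)
    moreover have "norm (h' r) = (\<bar>r\<bar> * exp (r\<^sup>2 * v / 2)) * norm (LINT \<omega>|M. (v - G \<omega>) *\<^sub>R iexp (r * F \<omega>))"
      unfolding h'_eq by (simp only: norm_scaleR abs_mult abs_exp_cancel)
    ultimately show ?thesis by simp
  qed
  have h0: "h 0 = 1" by (simp add: h_def prob_space)
  \<comment> \<open>The symmetric interval contains both 0 and s whatever the sign of s.\<close>
  have "norm (h s - h 0) \<le> (\<bar>s\<bar> * exp (s\<^sup>2 * v / 2) * ?\<Delta>) * norm (s - 0)"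
  proof (rule differentiable_bound[where S="{-\<bar>s\<bar>..\<bar>s\<bar>}" and f'="\<lambda>r t. t *\<^sub>R h' r"])
    show "(h has_derivative (\<lambda>t. t *\<^sub>R h' r)) (at r within {-\<bar>s\<bar>..\<bar>s\<bar>})" for r
      using hd[of r] unfolding has_vector_derivative_def by (rule has_derivative_at_withinI)
    fix r assume "r \<in> {-\<bar>s\<bar>..\<bar>s\<bar>}"
    then have "norm (h' r) \<le> \<bar>s\<bar> * exp (s\<^sup>2 * v / 2) * ?\<Delta>" by (intro h'_le) auto
    then show "onorm (\<lambda>t. t *\<^sub>R h' r) \<le> \<bar>s\<bar> * exp (s\<^sup>2 * v / 2) * ?\<Delta>"
      by (simp add: onorm_scaleR_left[OF bounded_linear_ident] onorm_id[simplified id_def])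
  qed (auto simp: convex_real_interval)
  then have b: "norm (h s - 1) \<le> s\<^sup>2 * exp (s\<^sup>2 * v / 2) * ?\<Delta>"
    by (simp add: h0 power2_eq_square algebra_simps)
  have ee: "exp (- (s\<^sup>2 * v / 2)) * exp (s\<^sup>2 * v / 2) = 1" by (simp add: exp_minus)
  have "?\<phi> s - complex_of_real (exp (- (s\<^sup>2 * v / 2))) = exp (- (s\<^sup>2 * v / 2)) *\<^sub>R (h s - 1)"
    by (simp only: h_def scaleR_diff_right scaleR_scaleR ee scaleR_one) (simp add: scaleR_conv_of_real)
  then have "norm (?\<phi> s - complex_of_real (exp (- (s\<^sup>2 * v / 2)))) \<le> exp (- (s\<^sup>2 * v / 2)) * (s\<^sup>2 * exp (s\<^sup>2 * v / 2) * ?\<Delta>)"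
    using b by (simp add: mult_left_mono)
  also have "\<dots> = s\<^sup>2 * ?\<Delta>" using ee by (simp add: mult.left_commute mult.assoc[symmetric])
  finally show ?thesis .
qed

section \<open>Hermite functionals of a Gaussian field\<close>

text \<open>Lebesgue measure on D is encoded as a density on the whole space, so that its underlying
  space is \<open>UNIV\<close> and its sets are the Borel sets for every D.\<close>

definition mu :: "'x::euclidean_space set \<Rightarrow> 'x measure" where
  "mu D = density lborel (\<lambda>x. indicator D x)"

lemma sets_mu [measurable_cong, simp]: "sets (mu D) = sets borel"
  by (simp add: mu_def)

lemma space_mu [simp]: "space (mu D) = UNIV"
  by (simp add: mu_def)

lemma emeasure_mu: "D \<in> sets borel \<Longrightarrow> A \<in> sets borel \<Longrightarrow> emeasure (mu D) A = emeasure lborel (D \<inter> A)"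
  unfolding mu_def by (subst emeasure_density) (auto simp: nn_integral_set_ennreal[symmetric] indicator_inter_arith[symmetric])

lemma finite_measure_mu: "compact D \<Longrightarrow> finite_measure (mu D)"
  by (rule finite_measureI)
    (use emeasure_mu[of D UNIV] emeasure_bounded_finite[of D] in \<open>auto simp: compact_imp_bounded borel_compact\<close>)

lemma integral_mu:
  fixes f :: "'x::euclidean_space \<Rightarrow> 'b::{banach, second_countable_topology}"
  assumes "D \<in> sets borel" "f \<in> borel_measurable borel"
  shows "(LINT x|mu D. f x) = (LINT x:D|lborel. f x)"
proof -
  have e: "mu D = density lborel (\<lambda>x. ennreal (indicator D x))" unfolding mu_def by (simp add: ennreal_indicator)
  show ?thesis unfolding e set_lebesgue_integral_def using assms by (subst integral_density) auto
qed

lemma integrable_mu_continuous: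
  fixes f :: "'x::euclidean_space \<Rightarrow> real"
  assumes "compact D" "continuous_on UNIV f"
  shows "integrable (mu D) f"
proof -
  have e: "mu D = density lborel (\<lambda>x. ennreal (indicator D x))" unfolding mu_def by (simp add: ennreal_indicator)
  have [measurable]: "D \<in> sets borel" using assms(1) by (rule borel_compact)
  have f: "f \<in> borel_measurable borel" using assms(2) by (rule borel_measurable_continuous_onI)
  have "integrable lborel (\<lambda>x. indicator D x *\<^sub>R f x)"
    using borel_integrable_compact[OF assms(1)] assms(2) continuous_on_subset by blast
  then show ?thesis unfolding e using assms f
    by (subst integrable_density) (auto simp: borel_compact)
qed

section \<open>Covariances of nonlinear functions of the field\<close>

context gauss_field
begin

lemma measurable_B [measurable (raw)]:
  assumes "f \<in> measurable L borel" "g \<in> measurable L M"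
  shows "(\<lambda>w. B (f w) (g w)) \<in> borel_measurable L"
  using measurable_compose[OF measurable_Pair[OF assms] B_joint_measurable] by simp

lemma measurable_Z [measurable (raw)]:
  assumes "f \<in> measurable L borel" "g \<in> measurable L (residual_algebra x)"
  shows "(\<lambda>w. Z x (f w) (g w)) \<in> borel_measurable L"
  using measurable_compose[OF measurable_Pair[OF assms] Z_joint_measurable] by simp

lemma B_L2_comp:
  fixes f :: "real \<Rightarrow> real"
  assumes "f \<in> borel_measurable borel" "integrable \<gamma> (\<lambda>u. (f u)\<^sup>2)"
  shows "integrable M (\<lambda>\<omega>. (f (B x \<omega>))\<^sup>2)" "expectation (\<lambda>\<omega>. (f (B x \<omega>))\<^sup>2) = (LINT u|\<gamma>. (f u)\<^sup>2)"
  using assms by (simp_all add: B_integrable_iff[of "\<lambda>u. (f u)\<^sup>2"] B_integral[of "\<lambda>u. (f u)\<^sup>2"])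

text \<open>This is Mehler's formula. It is exact for Hermite sums by orthogonality, and replacing f
  by a partial sum costs at most the L2 truncation error in each of the two factors.\<close>

theorem field_covariance_sums:
  fixes f :: "real \<Rightarrow> real"
  assumes f[measurable]: "f \<in> borel_measurable borel" and f2: "integrable \<gamma> (\<lambda>u. (f u)\<^sup>2)"
  shows "(\<lambda>q. (hermite_coeff f q)\<^sup>2 * fact q * C (x - y) ^ q) sums expectation (\<lambda>\<omega>. f (B x \<omega>) * f (B y \<omega>))"
proof -
  define a where "a = hermite_coeff f"
  define S where "S N = hermite_sum a {..<N}" for N
  have [measurable]: "S N \<in> borel_measurable borel" for N by (simp add: S_def)
  define d where "d N = (LINT u|\<gamma>. (f u - S N u)\<^sup>2)" for N
  define n where "n = (LINT u|\<gamma>. (f u)\<^sup>2)"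
  have d0: "d \<longlonglongrightarrow> 0" unfolding d_def S_def a_def by (rule hermite_expansion_L2[OF f f2])
  have S2: "integrable \<gamma> (\<lambda>u. (S N u)\<^sup>2)" for N by (simp add: S_def hermite_sum_L2)
  have fS2: "integrable \<gamma> (\<lambda>u. (f u - S N u)\<^sup>2)" for N by (intro integrable_L2_diff f2 S2) auto
  have Sn: "(LINT u|\<gamma>. (S N u)\<^sup>2) \<le> n" for N
  proof -
    have "0 \<le> (LINT u|\<gamma>. (f u - S N u)\<^sup>2)" by simp
    then show ?thesis unfolding S_def a_def n_def
      using integral_hermite_residual[OF _ f f2, of "{..<N}"] by (simp add: integral_hermite_sum_sq)
  qed
  have ES: "expectation (\<lambda>\<omega>. S N (B x \<omega>) * S N (B y \<omega>)) = (\<Sum>q<N. (a q)\<^sup>2 * fact q * C (x - y) ^ q)" for N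
  proof -
    have iH: "integrable M (\<lambda>\<omega>. hermite p (B x \<omega>) * hermite q (B y \<omega>))" for p q
      by (rule integrable_L2_mult) (auto simp: hermite_B_power_integrable)
    have "expectation (\<lambda>\<omega>. S N (B x \<omega>) * S N (B y \<omega>))
      = expectation (\<lambda>\<omega>. \<Sum>p<N. \<Sum>q<N. (a p * a q) * (hermite p (B x \<omega>) * hermite q (B y \<omega>)))"
      unfolding S_def hermite_sum_def sum_product by (simp add: mult_ac)
    also have "\<dots> = (\<Sum>p<N. \<Sum>q<N. (a p * a q) * expectation (\<lambda>\<omega>. hermite p (B x \<omega>) * hermite q (B y \<omega>)))"
      using iH by (simp add: Bochner_Integration.integral_sum Bochner_Integration.integrable_sum)
    also have "\<dots> = (\<Sum>p<N. \<Sum>q<N. if p = q then (a p)\<^sup>2 * fact p * C (x - y) ^ p else 0)"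
      unfolding hermite_B_pair by (intro sum.cong) (auto simp: power2_eq_square)
    also have "\<dots> = (\<Sum>q<N. (a q)\<^sup>2 * fact q * C (x - y) ^ q)" by simp
    finally show ?thesis .
  qed
  have i1: "integrable M (\<lambda>\<omega>. g (B x \<omega>) * h (B y \<omega>))"
    and cs: "\<bar>expectation (\<lambda>\<omega>. g (B x \<omega>) * h (B y \<omega>))\<bar> \<le> sqrt ((LINT u|\<gamma>. (g u)\<^sup>2) * (LINT u|\<gamma>. (h u)\<^sup>2))"
    if [measurable]: "g \<in> borel_measurable borel" "h \<in> borel_measurable borel"
      and g2: "integrable \<gamma> (\<lambda>u. (g u)\<^sup>2)" "integrable \<gamma> (\<lambda>u. (h u)\<^sup>2)" for g h
  proof -
    show "integrable M (\<lambda>\<omega>. g (B x \<omega>) * h (B y \<omega>))"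
      by (rule integrable_L2_mult) (auto intro: B_L2_comp that)
    have "(expectation (\<lambda>\<omega>. g (B x \<omega>) * h (B y \<omega>)))\<^sup>2 \<le> expectation (\<lambda>\<omega>. (g (B x \<omega>))\<^sup>2) * expectation (\<lambda>\<omega>. (h (B y \<omega>))\<^sup>2)"
      by (rule Cauchy_Schwarz_integral) (auto intro: B_L2_comp that)
    then show "\<bar>expectation (\<lambda>\<omega>. g (B x \<omega>) * h (B y \<omega>))\<bar> \<le> sqrt ((LINT u|\<gamma>. (g u)\<^sup>2) * (LINT u|\<gamma>. (h u)\<^sup>2))"
      by (intro real_le_rsqrt) (simp add: B_L2_comp that)
  qed
  have le: "norm (expectation (\<lambda>\<omega>. f (B x \<omega>) * f (B y \<omega>)) - (\<Sum>q<N. (a q)\<^sup>2 * fact q * C (x - y) ^ q)) \<le> 2 * sqrt (d N * n)" for N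
  proof -
    have "expectation (\<lambda>\<omega>. f (B x \<omega>) * f (B y \<omega>)) - (\<Sum>q<N. (a q)\<^sup>2 * fact q * C (x - y) ^ q)
      = expectation (\<lambda>\<omega>. f (B x \<omega>) * f (B y \<omega>) - S N (B x \<omega>) * S N (B y \<omega>))"
      unfolding ES[symmetric] using i1[of f f] i1[of "S N" "S N"] f2 S2 by simp
    \<comment> \<open>The difference of the products is split so that each part contains one
      truncation error, to be estimated by Cauchy-Schwarz.\<close>
    also have "\<dots> = expectation (\<lambda>\<omega>. (f (B x \<omega>) - S N (B x \<omega>)) * f (B y \<omega>) + S N (B x \<omega>) * (f (B y \<omega>) - S N (B y \<omega>)))"
      by (simp add: algebra_simps)
    also have "\<dots> = expectation (\<lambda>\<omega>. (f (B x \<omega>) - S N (B x \<omega>)) * f (B y \<omega>)) + expectation (\<lambda>\<omega>. S N (B x \<omega>) * (f (B y \<omega>) - S N (B y \<omega>)))"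
      using i1[of "\<lambda>u. f u - S N u" f] i1[of "S N" "\<lambda>u. f u - S N u"] f2 S2 fS2 by simp
    also have "norm \<dots> \<le> sqrt (d N * n) + sqrt (d N * n)"
    proof (intro norm_triangle_le add_mono)
      show "norm (expectation (\<lambda>\<omega>. (f (B x \<omega>) - S N (B x \<omega>)) * f (B y \<omega>))) \<le> sqrt (d N * n)"
        using cs[of "\<lambda>u. f u - S N u" f] f2 fS2 by (simp add: d_def n_def)
      have "norm (expectation (\<lambda>\<omega>. S N (B x \<omega>) * (f (B y \<omega>) - S N (B y \<omega>)))) \<le> sqrt ((LINT u|\<gamma>. (S N u)\<^sup>2) * d N)"
        using cs[of "S N" "\<lambda>u. f u - S N u"] S2 fS2 by (simp add: d_def)
      also have "\<dots> \<le> sqrt (n * d N)"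
        by (intro real_sqrt_le_mono mult_right_mono Sn) (simp add: d_def)
      finally show "norm (expectation (\<lambda>\<omega>. S N (B x \<omega>) * (f (B y \<omega>) - S N (B y \<omega>)))) \<le> sqrt (d N * n)"
        by (simp add: mult.commute)
    qed
    finally show ?thesis by simp
  qed
  have lim: "(\<lambda>N. 2 * sqrt (d N * n)) \<longlonglongrightarrow> 0"
    using tendsto_mult[OF tendsto_const[of 2] tendsto_real_sqrt[OF tendsto_mult[OF d0 tendsto_const[of n]]]] by simp
  have "(\<lambda>N. expectation (\<lambda>\<omega>. f (B x \<omega>) * f (B y \<omega>)) - (\<Sum>q<N. (a q)\<^sup>2 * fact q * C (x - y) ^ q)) \<longlonglongrightarrow> 0"
    by (rule Lim_null_comparison[OF _ lim], rule eventuallyI, rule le)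
  from tendsto_minus[OF this] have "(\<lambda>N. (\<Sum>q<N. (a q)\<^sup>2 * fact q * C (x - y) ^ q) - expectation (\<lambda>\<omega>. f (B x \<omega>) * f (B y \<omega>))) \<longlonglongrightarrow> 0"
    by simp
  then show ?thesis unfolding sums_def a_def by (rule LIM_zero_cancel)
qed

text \<open>All terms of the series are nonnegative, and for q >= k the power C^q is at most C^k
  because 0 <= C <= 1.\<close>

lemma field_covariance_le:
  fixes f :: "real \<Rightarrow> real"
  assumes f[measurable]: "f \<in> borel_measurable borel" and f2: "integrable \<gamma> (\<lambda>u. (f u)\<^sup>2)"
    and rank: "\<And>q. q < k \<Longrightarrow> hermite_coeff f q = 0"
  shows "0 \<le> expectation (\<lambda>\<omega>. f (B x \<omega>) * f (B y \<omega>))"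
    and "expectation (\<lambda>\<omega>. f (B x \<omega>) * f (B y \<omega>)) \<le> C (x - y) ^ k * (LINT u|\<gamma>. (f u)\<^sup>2)"
proof -
  note s = field_covariance_sums[OF f f2]
  show "0 \<le> expectation (\<lambda>\<omega>. f (B x \<omega>) * f (B y \<omega>))"
    by (rule sums_le[OF _ sums_zero s[of x y]]) (intro mult_nonneg_nonneg, auto intro: zero_le_power C_nonneg)
  \<comment> \<open>At coinciding points C = 1, so the series without powers of C sums to the second
    moment.\<close>
  have "(\<lambda>q. (hermite_coeff f q)\<^sup>2 * fact q) sums (LINT u|\<gamma>. (f u)\<^sup>2)"
    using s[of x x] B_L2_comp(2)[OF f f2] by (simp add: power2_eq_square)
  then have "(\<lambda>q. C (x - y) ^ k * ((hermite_coeff f q)\<^sup>2 * fact q)) sums (C (x - y) ^ k * (LINT u|\<gamma>. (f u)\<^sup>2))"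
    by (rule sums_mult)
  then show "expectation (\<lambda>\<omega>. f (B x \<omega>) * f (B y \<omega>)) \<le> C (x - y) ^ k * (LINT u|\<gamma>. (f u)\<^sup>2)"
  proof (rule sums_le[OF _ s[of x y], rotated])
    fix q
    show "(hermite_coeff f q)\<^sup>2 * fact q * C (x - y) ^ q \<le> C (x - y) ^ k * ((hermite_coeff f q)\<^sup>2 * fact q)"
    proof (cases "q < k")
      case False
      then have "C (x - y) ^ q \<le> C (x - y) ^ k" by (intro power_decreasing C_nonneg C_le_1) auto
      then show ?thesis by (simp add: mult_left_mono mult_right_mono mult.commute)
    qed (simp add: rank)
  qed
qed

section \<open>The functional of a single Hermite order and its derivatives\<close>

context
  fixes D :: "'x set" and m :: nat
begin

text \<open>The order is written \<open>Suc m\<close> because integration by parts lowers it exactly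
  once; \<open>m\<close> is the degree that remains.\<close>

definition hermite_functional :: "'w \<Rightarrow> real" where
  "hermite_functional \<omega> = (LINT y|mu D. hermite (Suc m) (B y \<omega>))"

text \<open>Times \<open>Suc m\<close>, this is the Malliavin derivative of the Hermite functional
  in the direction of B_x.\<close>

definition smoothed_hermite :: "'x \<Rightarrow> 'w \<Rightarrow> real" where
  "smoothed_hermite x \<omega> = (LINT y|mu D. C (y - x) * hermite m (B y \<omega>))"

definition hermite_product :: "'x \<times> 'x \<Rightarrow> 'w \<Rightarrow> real" where
  "hermite_product p \<omega> = hermite m (B (fst p) \<omega>) * hermite m (B (snd p) \<omega>)"

text \<open>In Malliavin terms this is the squared norm of DF divided by (m + 1)^2. Hence
  \<open>Suc m\<close> times it is the factor <DF, -D L^(-1) F> of the Stein identity.\<close>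

definition carre_du_champ :: "'w \<Rightarrow> real" where
  "carre_du_champ \<omega> = (LINT p|(mu D \<Otimes>\<^sub>M mu D). C (fst p - snd p) * hermite_product p \<omega>)"

context
  assumes D: "compact D"
begin

lemma finite_mu: "finite_measure (mu D)"
  by (rule finite_measure_mu) (rule D)

lemma finite_mu2: "finite_measure (mu D \<Otimes>\<^sub>M mu D)"
  by (intro finite_measure_pair_measure finite_mu)

lemma measurable_mu_pair [measurable (raw)]:
  "f \<in> borel_measurable (borel \<Otimes>\<^sub>M M) \<Longrightarrow> f \<in> borel_measurable (mu D \<Otimes>\<^sub>M M)"
  by (simp cong: measurable_cong_sets[OF sets_pair_measure_cong[OF sets_mu refl] refl])

lemma
  fixes g :: "'w \<Rightarrow> complex"
  shows hermite_functional_measurable: "hermite_functional \<in> borel_measurable M" and hermite_functional_L2: "integrable M (\<lambda>\<omega>. (hermite_functional \<omega>)\<^sup>2)"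
    and hermite_functional_mult: "g \<in> borel_measurable M \<Longrightarrow> (\<And>\<omega>. norm (g \<omega>) \<le> 1) \<Longrightarrow>
      (LINT \<omega>|M. hermite_functional \<omega> *\<^sub>R g \<omega>) = (LINT x|mu D. LINT \<omega>|M. hermite (Suc m) (B x \<omega>) *\<^sub>R g \<omega>)"
proof -
  have m: "(\<lambda>z. hermite (Suc m) (B (fst z) (snd z))) \<in> borel_measurable (mu D \<Otimes>\<^sub>M M)"
    by measurable
  have b: "integrable M (\<lambda>\<omega>. (hermite (Suc m) (B x \<omega>))\<^sup>2)"
    "expectation (\<lambda>\<omega>. (hermite (Suc m) (B x \<omega>))\<^sup>2) \<le> fact (Suc m)" for x
    using hermite_B_power_integrable[of "Suc m" x 2] hermite_B_pair[of "Suc m" x "Suc m" x]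
    by (simp_all add: power2_eq_square del: hermite.simps)
  show "hermite_functional \<in> borel_measurable M" unfolding hermite_functional_def
    by (rule integral_section_measurable[OF finite_mu m b])
  show "integrable M (\<lambda>\<omega>. (hermite_functional \<omega>)\<^sup>2)" unfolding hermite_functional_def
    by (rule second_moment_integrable[OF finite_mu m b])
  show "(LINT \<omega>|M. hermite_functional \<omega> *\<^sub>R g \<omega>) = (LINT x|mu D. LINT \<omega>|M. hermite (Suc m) (B x \<omega>) *\<^sub>R g \<omega>)"
    if "g \<in> borel_measurable M" "\<And>\<omega>. norm (g \<omega>) \<le> 1"
    unfolding hermite_functional_def by (rule integral_expectation_section[OF finite_mu m b that, symmetric])
qed

lemma hermite_product_bound:
  "integrable M (\<lambda>\<omega>. (C (fst p - snd p) * hermite_product p \<omega>)\<^sup>2)"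
  "expectation (\<lambda>\<omega>. (C (fst p - snd p) * hermite_product p \<omega>)\<^sup>2) \<le> (LINT u|\<gamma>. hermite m u ^ 4)"
proof -
  let ?p = "\<lambda>\<omega>. (hermite m (B (fst p) \<omega>))\<^sup>2 * (hermite m (B (snd p) \<omega>))\<^sup>2"
  have e: "(C (fst p - snd p) * hermite_product p \<omega>)\<^sup>2 = (C (fst p - snd p))\<^sup>2 * ?p \<omega>" for \<omega>
    by (simp add: hermite_product_def power_mult_distrib)
  have *: "(t\<^sup>2)\<^sup>2 = t ^ 4" for t :: real by (simp add: power_mult[symmetric])
  have i: "integrable M ?p"
    by (rule integrable_L2_mult) (auto simp: * hermite_B_power_integrable)
  show "integrable M (\<lambda>\<omega>. (C (fst p - snd p) * hermite_product p \<omega>)\<^sup>2)" unfolding e using i by simp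
  have E4: "expectation (\<lambda>\<omega>. hermite m (B x \<omega>) ^ 4) = (LINT u|\<gamma>. hermite m u ^ 4)" for x
    by (rule B_integral[of "\<lambda>u. hermite m u ^ 4"]) simp
  have "(expectation ?p)\<^sup>2 \<le> expectation (\<lambda>\<omega>. ((hermite m (B (fst p) \<omega>))\<^sup>2)\<^sup>2) * expectation (\<lambda>\<omega>. ((hermite m (B (snd p) \<omega>))\<^sup>2)\<^sup>2)"
    by (rule Cauchy_Schwarz_integral) (auto simp: * hermite_B_power_integrable)
  also have "\<dots> = (LINT u|\<gamma>. hermite m u ^ 4)\<^sup>2" unfolding * E4 by (simp add: power2_eq_square)
  finally have p: "expectation ?p \<le> (LINT u|\<gamma>. hermite m u ^ 4)"
    by (rule power2_le_imp_le) simp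
  have "expectation (\<lambda>\<omega>. (C (fst p - snd p) * hermite_product p \<omega>)\<^sup>2) = (C (fst p - snd p))\<^sup>2 * expectation ?p"
    unfolding e by simp
  also have "\<dots> \<le> 1 * expectation ?p"
    using C_nonneg C_le_1 by (intro mult_right_mono) (auto simp: power_le_one)
  finally show "expectation (\<lambda>\<omega>. (C (fst p - snd p) * hermite_product p \<omega>)\<^sup>2) \<le> (LINT u|\<gamma>. hermite m u ^ 4)"
    using p by simp
qed

lemma hermite_product_measurable [measurable]:
  "(\<lambda>z. hermite_product (fst z) (snd z)) \<in> borel_measurable ((mu D \<Otimes>\<^sub>M mu D) \<Otimes>\<^sub>M M)"
  unfolding hermite_product_def by measurable

lemma hermite_product_C_measurable:
  "(\<lambda>z. C (fst (fst z) - snd (fst z)) * hermite_product (fst z) (snd z)) \<in> borel_measurable ((mu D \<Otimes>\<^sub>M mu D) \<Otimes>\<^sub>M M)"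
  by measurable

lemma
  fixes g :: "'w \<Rightarrow> complex"
  shows carre_du_champ_measurable: "carre_du_champ \<in> borel_measurable M" and carre_du_champ_integrable: "integrable M carre_du_champ"
    and carre_du_champ_mult: "g \<in> borel_measurable M \<Longrightarrow> (\<And>\<omega>. norm (g \<omega>) \<le> 1) \<Longrightarrow>
      (LINT \<omega>|M. carre_du_champ \<omega> *\<^sub>R g \<omega>) = (LINT x|mu D. LINT \<omega>|M. (smoothed_hermite x \<omega> * hermite m (B x \<omega>)) *\<^sub>R g \<omega>)"
proof -
  note pm = hermite_product_C_measurable
  show "carre_du_champ \<in> borel_measurable M" unfolding carre_du_champ_def
    by (rule integral_section_measurable[OF finite_mu2 pm hermite_product_bound])
  show "integrable M carre_du_champ" unfolding carre_du_champ_def[abs_def]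
    by (rule integrable_integral_section[OF finite_mu2 pm hermite_product_bound])
  assume g: "g \<in> borel_measurable M" "\<And>\<omega>. norm (g \<omega>) \<le> 1"
  interpret N: finite_measure "mu D" by (rule finite_mu)
  interpret NN: pair_sigma_finite "mu D" "mu D" ..
  have "(LINT \<omega>|M. carre_du_champ \<omega> *\<^sub>R g \<omega>) = (LINT p|(mu D \<Otimes>\<^sub>M mu D). LINT \<omega>|M. (C (fst p - snd p) * hermite_product p \<omega>) *\<^sub>R g \<omega>)"
    unfolding carre_du_champ_def by (rule integral_expectation_section[OF finite_mu2 pm hermite_product_bound g, symmetric])
  also have "\<dots> = (LINT x|mu D. LINT y|mu D. LINT \<omega>|M. (C (x - y) * hermite_product (x, y) \<omega>) *\<^sub>R g \<omega>)"
    using NN.integral_fst'[OF integrable_expectation_section[OF finite_mu2 pm hermite_product_bound g], symmetric] by simp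
  also have "\<dots> = (LINT x|mu D. LINT \<omega>|M. (smoothed_hermite x \<omega> * hermite m (B x \<omega>)) *\<^sub>R g \<omega>)"
  proof (rule Bochner_Integration.integral_cong[OF refl])
    fix x
    have m: "(\<lambda>z. C (x - fst z) * hermite_product (x, fst z) (snd z)) \<in> borel_measurable (mu D \<Otimes>\<^sub>M M)"
      unfolding hermite_product_def by measurable
    have b: "integrable M (\<lambda>\<omega>. (C (x - y) * hermite_product (x, y) \<omega>)\<^sup>2)"
      "expectation (\<lambda>\<omega>. (C (x - y) * hermite_product (x, y) \<omega>)\<^sup>2) \<le> (LINT u|\<gamma>. hermite m u ^ 4)" for y
      using hermite_product_bound[of "(x, y)"] by simp_all
    have "(LINT y|mu D. LINT \<omega>|M. (C (x - y) * hermite_product (x, y) \<omega>) *\<^sub>R g \<omega>)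
       = (LINT \<omega>|M. (LINT y|mu D. C (x - y) * hermite_product (x, y) \<omega>) *\<^sub>R g \<omega>)"
      by (rule integral_expectation_section[OF finite_mu m b g])
    also have "\<dots> = (LINT \<omega>|M. (smoothed_hermite x \<omega> * hermite m (B x \<omega>)) *\<^sub>R g \<omega>)"
    proof (rule Bochner_Integration.integral_cong[OF refl])
      fix \<omega>
      have "(LINT y|mu D. C (x - y) * hermite_product (x, y) \<omega>) = (LINT y|mu D. (C (y - x) * hermite m (B y \<omega>)) * hermite m (B x \<omega>))"
        by (intro Bochner_Integration.integral_cong) (auto simp: hermite_product_def C_sym[of x])
      then show "(LINT y|mu D. C (x - y) * hermite_product (x, y) \<omega>) *\<^sub>R g \<omega> = (smoothed_hermite x \<omega> * hermite m (B x \<omega>)) *\<^sub>R g \<omega>"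
        by (simp add: smoothed_hermite_def)
    qed
    finally show "(LINT y|mu D. LINT \<omega>|M. (C (x - y) * hermite_product (x, y) \<omega>) *\<^sub>R g \<omega>)
       = (LINT \<omega>|M. (smoothed_hermite x \<omega> * hermite m (B x \<omega>)) *\<^sub>R g \<omega>)" .
  qed
  finally show "(LINT \<omega>|M. carre_du_champ \<omega> *\<^sub>R g \<omega>) = (LINT x|mu D. LINT \<omega>|M. (smoothed_hermite x \<omega> * hermite m (B x \<omega>)) *\<^sub>R g \<omega>)" .
qed

lemma smoothed_hermite_L2: "smoothed_hermite x \<in> borel_measurable M" "integrable M (\<lambda>\<omega>. (smoothed_hermite x \<omega>)\<^sup>2)"
proof -
  have m: "(\<lambda>z. C (fst z - x) * hermite m (B (fst z) (snd z))) \<in> borel_measurable (mu D \<Otimes>\<^sub>M M)"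
    by measurable
  have b: "integrable M (\<lambda>\<omega>. (C (y - x) * hermite m (B y \<omega>))\<^sup>2)"
    "expectation (\<lambda>\<omega>. (C (y - x) * hermite m (B y \<omega>))\<^sup>2) \<le> fact m" for y
  proof -
    have h2: "expectation (\<lambda>\<omega>. (hermite m (B y \<omega>))\<^sup>2) = fact m"
      using hermite_B_pair[of m y m y] by (simp add: power2_eq_square)
    have "(C (y - x))\<^sup>2 * fact m \<le> 1 * fact m"
      using C_nonneg C_le_1 by (intro mult_right_mono) (auto simp: power_le_one)
    then show "integrable M (\<lambda>\<omega>. (C (y - x) * hermite m (B y \<omega>))\<^sup>2)"
      "expectation (\<lambda>\<omega>. (C (y - x) * hermite m (B y \<omega>))\<^sup>2) \<le> fact m"
      using hermite_B_power_integrable[of m y 2] h2 unfolding power_mult_distrib by simp_all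
  qed
  show "smoothed_hermite x \<in> borel_measurable M" unfolding smoothed_hermite_def[abs_def]
    by (rule integral_section_measurable[OF finite_mu m b])
  show "integrable M (\<lambda>\<omega>. (smoothed_hermite x \<omega>)\<^sup>2)" unfolding smoothed_hermite_def
    by (rule second_moment_integrable[OF finite_mu m b])
qed

text \<open>By the addition formula the functional is a polynomial in B_x whose coefficients depend
  on the residuals only. This makes its exponential an admissible integrand for
  \<open>field_ibp\<close>, and the chain rule produces the smoothed functional.\<close>

lemma hermite_iexp_ibp:
  "(LINT \<omega>|M. hermite (Suc m) (B x \<omega>) *\<^sub>R iexp (s * hermite_functional \<omega>))
    = (\<i> * complex_of_real (s * real (Suc m))) * (LINT \<omega>|M. (smoothed_hermite x \<omega> * hermite m (B x \<omega>)) *\<^sub>R iexp (s * hermite_functional \<omega>))"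
proof -
  interpret N: finite_measure "mu D" by (rule finite_mu)
  note hermite_functional_measurable[measurable] smoothed_hermite_L2(1)[measurable]
  \<comment> \<open>\<open>A k\<close> collects the part of the addition formula that does not
    involve B_x, integrated over the window.\<close>
  define A where "A k \<omega> = (LINT y|mu D. C (y - x) ^ k * hermite (Suc m - k) (Z x y \<omega>))" for k \<omega>
  define P where "P u \<omega> = (\<Sum>k\<le>Suc m. real (Suc m choose k) * u ^ k * A k \<omega>)" for u \<omega>
  define P' where "P' u \<omega> = real (Suc m) * (\<Sum>j\<le>m. real (m choose j) * u ^ j * A (Suc j) \<omega>)" for u \<omega>
  have [measurable]: "A k \<in> borel_measurable (residual_algebra x)" for k
  proof -
    have "(\<lambda>z. C (snd z - x) ^ k * hermite (Suc m - k) (Z x (snd z) (fst z))) \<in> borel_measurable (residual_algebra x \<Otimes>\<^sub>M mu D)"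
      by measurable
    then show ?thesis unfolding A_def[abs_def]
      by (intro N.borel_measurable_lebesgue_integral) (simp add: case_prod_beta')
  qed
  have contZ: "continuous_on UNIV (\<lambda>y. Z x y \<omega>)" if "\<omega> \<in> space M" for \<omega>
    unfolding Z_def using that
    by (intro continuous_intros continuous_sample continuous_on_compose2[OF continuous_C[of UNIV]]) auto
  have contC: "continuous_on UNIV (\<lambda>y. C (y - x))"
    by (intro continuous_intros continuous_on_compose2[OF continuous_C[of UNIV]]) auto
  have iA: "integrable (mu D) (\<lambda>y. C (y - x) ^ k * hermite j (Z x y \<omega>))" if "\<omega> \<in> space M" for k j \<omega>
    by (intro integrable_mu_continuous D continuous_intros contZ contC that)
  have BZ: "B y \<omega> = C (y - x) * B x \<omega> + Z x y \<omega>" for y \<omega> by (simp add: Z_def)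
  have HB: "hermite n (B y \<omega>) = (\<Sum>k\<le>n. real (n choose k) * (C (y - x) * B x \<omega>) ^ k * hermite (n - k) (Z x y \<omega>))" for n y \<omega>
    by (subst hermite_add[symmetric]) (simp only: BZ[symmetric])
  have FP: "hermite_functional \<omega> = P (B x \<omega>) \<omega>" if w: "\<omega> \<in> space M" for \<omega>
  proof -
    have "hermite_functional \<omega> = (LINT y|mu D. (\<Sum>k\<le>Suc m. (real (Suc m choose k) * (B x \<omega>) ^ k) * (C (y - x) ^ k * hermite (Suc m - k) (Z x y \<omega>))))"
      unfolding hermite_functional_def HB by (simp only: power_mult_distrib mult_ac)
    also have "\<dots> = P (B x \<omega>) \<omega>"
      unfolding P_def A_def using iA[OF w]
      by (subst Bochner_Integration.integral_sum) (auto simp del: sum.atMost_Suc hermite.simps)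
    finally show ?thesis .
  qed
  \<comment> \<open>The derivative of the polynomial \<open>P\<close> at B_x is recognized as
    \<open>Suc m\<close> times the smoothed functional by the addition formula in degree m.\<close>
  have UP: "real (Suc m) * smoothed_hermite x \<omega> = P' (B x \<omega>) \<omega>" if w: "\<omega> \<in> space M" for \<omega>
  proof -
    have "smoothed_hermite x \<omega> = (LINT y|mu D. C (y - x) * (\<Sum>j\<le>m. real (m choose j) * (C (y - x) * B x \<omega>) ^ j * hermite (m - j) (Z x y \<omega>)))"
      unfolding smoothed_hermite_def HB ..
    also have "\<dots> = (LINT y|mu D. (\<Sum>j\<le>m. (real (m choose j) * (B x \<omega>) ^ j) * (C (y - x) ^ Suc j * hermite (Suc m - Suc j) (Z x y \<omega>))))"
      by (simp add: sum_distrib_left power_mult_distrib mult_ac)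
    also have "\<dots> = (\<Sum>j\<le>m. real (m choose j) * (B x \<omega>) ^ j * A (Suc j) \<omega>)"
      unfolding A_def using iA[OF w]
      by (subst Bochner_Integration.integral_sum) (auto simp del: power_Suc diff_Suc_Suc hermite.simps)
    finally show ?thesis unfolding P'_def by simp
  qed
  have Pd: "((\<lambda>u. P u \<omega>) has_real_derivative P' u \<omega>) (at u)" for u \<omega>
    unfolding P_def P'_def using binomial_poly_deriv[of "Suc m" "\<lambda>k. A k \<omega>" u] by simp
  have P'g: "poly_growth (\<lambda>u. P' u \<omega>)" for \<omega>
    unfolding P'_def by (intro poly_growth_mult poly_growth_sum poly_growth_const poly_growth_power poly_growth_ident)
  have P'c: "continuous_on UNIV (\<lambda>u. P' u \<omega>)" for \<omega> unfolding P'_def by (intro continuous_intros)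
  have Pc: "continuous_on UNIV (\<lambda>u. P u \<omega>)" for \<omega> unfolding P_def by (intro continuous_intros)
  define G where "G u \<omega> = iexp (s * P u \<omega>)" for u \<omega>
  define G' where "G' u \<omega> = (s * P' u \<omega>) *\<^sub>R (\<i> * iexp (s * P u \<omega>))" for u \<omega>
  have GB: "G (B x \<omega>) \<omega> = iexp (s * hermite_functional \<omega>)" if "\<omega> \<in> space M" for \<omega> by (simp add: G_def FP[OF that])
  have GB': "hermite m (B x \<omega>) *\<^sub>R G' (B x \<omega>) \<omega> = (\<i> * complex_of_real (s * real (Suc m))) * ((smoothed_hermite x \<omega> * hermite m (B x \<omega>)) *\<^sub>R iexp (s * hermite_functional \<omega>))"
    if "\<omega> \<in> space M" for \<omega>
    unfolding G'_def UP[OF that, symmetric] FP[OF that, symmetric] by (simp add: scaleR_conv_of_real mult_ac)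
  have iUH: "integrable M (\<lambda>\<omega>. smoothed_hermite x \<omega> * hermite m (B x \<omega>))"
    by (rule integrable_L2_mult) (auto simp: smoothed_hermite_L2 hermite_B_power_integrable)
  have "(LINT \<omega>|M. hermite (Suc m) (B x \<omega>) *\<^sub>R G (B x \<omega>) \<omega>) = (LINT \<omega>|M. hermite m (B x \<omega>) *\<^sub>R G' (B x \<omega>) \<omega>)"
  proof (rule field_ibp)
    show "(\<lambda>z. G (fst z) (snd z)) \<in> borel_measurable (borel \<Otimes>\<^sub>M residual_algebra x)"
      unfolding G_def P_def by measurable
    show "(\<lambda>z. G' (fst z) (snd z)) \<in> borel_measurable (borel \<Otimes>\<^sub>M residual_algebra x)"
      unfolding G'_def P_def P'_def by measurable
    show "((\<lambda>u. G u \<omega>) has_vector_derivative G' u \<omega>) (at u)" for u \<omega>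
    proof -
      have "((\<lambda>u. s * P u \<omega>) has_vector_derivative s * P' u \<omega>) (at u)"
        using DERIV_cmult[OF Pd] by (simp add: has_real_derivative_iff_has_vector_derivative)
      from vector_diff_chain_at[OF this has_vector_derivative_iexp]
      show ?thesis unfolding G_def G'_def by (simp add: comp_def)
    qed
    show "continuous_on UNIV (\<lambda>u. G' u \<omega>)" for \<omega>
      unfolding G'_def by (intro continuous_intros P'c Pc)
    show "poly_growth (\<lambda>u. G u \<omega>)" for \<omega>
      by (rule poly_growth_mono[OF poly_growth_const[of "1::real"]]) (simp add: G_def)
    show "poly_growth (\<lambda>u. G' u \<omega>)" for \<omega>
      by (rule poly_growth_mono[OF poly_growth_mult[OF poly_growth_const[of s] P'g[of \<omega>]]]) (simp add: G'_def norm_mult)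
    show "integrable M (\<lambda>\<omega>. hermite (Suc m) (B x \<omega>) *\<^sub>R G (B x \<omega>) \<omega>)"
    proof -
      have "integrable M (\<lambda>\<omega>. hermite (Suc m) (B x \<omega>) *\<^sub>R iexp (s * hermite_functional \<omega>))"
        by (rule Bochner_Integration.integrable_bound[OF hermite_B_integrable[of "Suc m" x]]) (auto simp del: hermite.simps)
      then show ?thesis by (rule Bochner_Integration.integrable_cong[THEN iffD1, OF refl, rotated]) (simp add: GB)
    qed
    show "integrable M (\<lambda>\<omega>. hermite m (B x \<omega>) *\<^sub>R G' (B x \<omega>) \<omega>)"
    proof -
      have "integrable M (\<lambda>\<omega>. (\<i> * complex_of_real (s * real (Suc m))) * ((smoothed_hermite x \<omega> * hermite m (B x \<omega>)) *\<^sub>R iexp (s * hermite_functional \<omega>)))"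
        by (intro integrable_mult_right, rule Bochner_Integration.integrable_bound[OF iUH]) auto
      then show ?thesis by (rule Bochner_Integration.integrable_cong[THEN iffD1, OF refl, rotated]) (simp only: GB')
    qed
  qed
  also have "(LINT \<omega>|M. hermite (Suc m) (B x \<omega>) *\<^sub>R G (B x \<omega>) \<omega>) = (LINT \<omega>|M. hermite (Suc m) (B x \<omega>) *\<^sub>R iexp (s * hermite_functional \<omega>))"
    by (intro Bochner_Integration.integral_cong refl) (simp only: GB)
  also have "(LINT \<omega>|M. hermite m (B x \<omega>) *\<^sub>R G' (B x \<omega>) \<omega>)
    = (LINT \<omega>|M. (\<i> * complex_of_real (s * real (Suc m))) * ((smoothed_hermite x \<omega> * hermite m (B x \<omega>)) *\<^sub>R iexp (s * hermite_functional \<omega>)))"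
    by (intro Bochner_Integration.integral_cong refl) (simp only: GB')
  finally show ?thesis by (simp only: integral_mult_right_zero)
qed

end

end

section \<open>Normal approximation in a fixed chaos and functionals of general f\<close>

context
  fixes D :: "'x set" and m :: nat
begin

text \<open>By orthogonality this is at the same time the second moment of the Hermite functional
  and the mean of \<open>Suc m\<close> times \<open>carre_du_champ\<close>; the Gaussian comparison
  needs both.\<close>

definition functional_variance :: real where
  "functional_variance = fact (Suc m) * (LINT p|(mu D \<Otimes>\<^sub>M mu D). C (fst p - snd p) ^ Suc m)"

text \<open>The square comes from the factor \<open>Suc m\<close> in front of
  \<open>carre_du_champ\<close>, the rest from \<open>wick_cov_diag_le\<close>.\<close>

definition contraction_const :: real where
  "contraction_const = (real (Suc m))\<^sup>2 * (fact (4 * m) * real (card (diag_index 1 m m m m)))"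

definition field_functional :: "(real \<Rightarrow> real) \<Rightarrow> 'w \<Rightarrow> real" where
  "field_functional f \<omega> = (LINT x|mu D. f (B x \<omega>))"

context
  assumes D: "compact D"
begin

text \<open>The pointwise identity at x is integrated over the window; Fubini reassembles the
  functional on one side and the carre du champ on the other.\<close>

lemma stein_identity:
  "(LINT \<omega>|M. hermite_functional D m \<omega> *\<^sub>R iexp (s * hermite_functional D m \<omega>))
    = (\<i> * complex_of_real s) * (LINT \<omega>|M. (real (Suc m) * carre_du_champ D m \<omega>) *\<^sub>R iexp (s * hermite_functional D m \<omega>))"
proof -
  note hermite_functional_measurable[OF D, measurable] carre_du_champ_measurable[OF D, measurable]
  let ?g = "\<lambda>\<omega>. iexp (s * hermite_functional D m \<omega>)"
  have g: "?g \<in> borel_measurable M" "\<And>\<omega>. norm (?g \<omega>) \<le> 1" by auto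
  have "(LINT \<omega>|M. hermite_functional D m \<omega> *\<^sub>R ?g \<omega>) = (LINT x|mu D. LINT \<omega>|M. hermite (Suc m) (B x \<omega>) *\<^sub>R ?g \<omega>)"
    by (rule hermite_functional_mult[OF D g])
  also have "\<dots> = (LINT x|mu D. (\<i> * complex_of_real (s * real (Suc m))) * (LINT \<omega>|M. (smoothed_hermite D m x \<omega> * hermite m (B x \<omega>)) *\<^sub>R ?g \<omega>))"
    unfolding hermite_iexp_ibp[OF D] ..
  also have "\<dots> = (\<i> * complex_of_real (s * real (Suc m))) * (LINT x|mu D. LINT \<omega>|M. (smoothed_hermite D m x \<omega> * hermite m (B x \<omega>)) *\<^sub>R ?g \<omega>)"
    by (rule integral_mult_right_zero)
  also have "(LINT x|mu D. LINT \<omega>|M. (smoothed_hermite D m x \<omega> * hermite m (B x \<omega>)) *\<^sub>R ?g \<omega>) = (LINT \<omega>|M. carre_du_champ D m \<omega> *\<^sub>R ?g \<omega>)"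
    by (rule carre_du_champ_mult[OF D g, symmetric])
  also have "(\<i> * complex_of_real (s * real (Suc m))) * (LINT \<omega>|M. carre_du_champ D m \<omega> *\<^sub>R ?g \<omega>)
     = (\<i> * complex_of_real s) * (real (Suc m) *\<^sub>R (LINT \<omega>|M. carre_du_champ D m \<omega> *\<^sub>R ?g \<omega>))"
    by (simp only: scaleR_conv_of_real of_real_mult mult.assoc)
  also have "real (Suc m) *\<^sub>R (LINT \<omega>|M. carre_du_champ D m \<omega> *\<^sub>R ?g \<omega>) = (LINT \<omega>|M. (real (Suc m) * carre_du_champ D m \<omega>) *\<^sub>R ?g \<omega>)"
    by (simp only: integral_scaleR_right[symmetric] scaleR_scaleR)
  finally show ?thesis .
qed

lemma C_power_bounds: "0 \<le> C x ^ k" "C x ^ k \<le> 1" "\<bar>C x\<bar> \<le> 1"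
  using C_nonneg[of x] C_le_1[of x] by (auto simp: power_le_one)

lemma C_power_integrable: "integrable (mu D \<Otimes>\<^sub>M mu D) (\<lambda>p. C (fst p - snd p) ^ k)"
proof -
  interpret finite_measure "mu D \<Otimes>\<^sub>M mu D" by (rule finite_mu2[OF D])
  show ?thesis
    by (rule integrable_const_bound[of _ 1]) (auto simp: C_power_bounds power_abs power_le_one)
qed

lemma functional_variance_nonneg: "0 \<le> functional_variance"
  unfolding functional_variance_def by (intro mult_nonneg_nonneg integral_nonneg_AE AE_I2) (auto simp: C_power_bounds simp del: power_Suc)

lemma contraction_kernel_nonneg: "0 \<le> contraction_kernel C m q"
  unfolding contraction_kernel_def contraction_sum_def
  by (intro sum_nonneg add_nonneg_nonneg mult_nonneg_nonneg zero_le_power C_nonneg)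

lemma contraction_kernel_measurable [measurable]: "contraction_kernel C m \<in> borel_measurable ((mu D \<Otimes>\<^sub>M mu D) \<Otimes>\<^sub>M (mu D \<Otimes>\<^sub>M mu D))"
  unfolding contraction_kernel_def[abs_def] contraction_sum_def by measurable

lemma contraction_kernel_le: "contraction_kernel C m q \<le> real (2 * m)"
proof -
  have "contraction_kernel C m q \<le> (\<Sum>r\<in>{1..m}. 1 + 1)"
    unfolding contraction_kernel_def contraction_sum_def
    by (intro sum_mono add_mono mult_le_one power_le_one mult_nonneg_nonneg zero_le_power C_nonneg C_le_1)
  then show ?thesis by simp
qed

lemma contraction_kernel_integrable: "integrable ((mu D \<Otimes>\<^sub>M mu D) \<Otimes>\<^sub>M (mu D \<Otimes>\<^sub>M mu D)) (contraction_kernel C m)"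
proof -
  interpret finite_measure "(mu D \<Otimes>\<^sub>M mu D) \<Otimes>\<^sub>M (mu D \<Otimes>\<^sub>M mu D)"
    by (intro finite_measure_pair_measure finite_mu2[OF D])
  show ?thesis
    by (rule integrable_const_bound[of _ "real (2 * m)"]) (use contraction_kernel_nonneg contraction_kernel_le in auto)
qed

text \<open>Centring is moved inside the double integral. The second moment then becomes a
  four-point integral of covariances of Hermite products, which \<open>wick_cov\<close>
  evaluates.\<close>

lemma carre_du_champ_variance:
  "integrable M (\<lambda>\<omega>. (real (Suc m) * carre_du_champ D m \<omega> - functional_variance)\<^sup>2)"
  "expectation (\<lambda>\<omega>. (real (Suc m) * carre_du_champ D m \<omega> - functional_variance)\<^sup>2)
     \<le> contraction_const * (LINT q|((mu D \<Otimes>\<^sub>M mu D) \<Otimes>\<^sub>M (mu D \<Otimes>\<^sub>M mu D)). contraction_kernel C m q)"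
proof -
  let ?N = "mu D \<Otimes>\<^sub>M mu D"
  interpret N: finite_measure "mu D" by (rule finite_mu[OF D])
  interpret N2: finite_measure ?N by (rule finite_mu2[OF D])
  note carre_du_champ_measurable[OF D, measurable]
  let ?c = "\<lambda>p :: 'x \<times> 'x. C (fst p - snd p)"
  define \<xi> where "\<xi> p \<omega> = ?c p * (hermite_product m p \<omega> - fact m * ?c p ^ m)" for p \<omega>
  have pm[measurable]: "(\<lambda>z. hermite_product m (fst z) (snd z)) \<in> borel_measurable (?N \<Otimes>\<^sub>M M)"
    by (rule hermite_product_measurable[OF D])
  have meas: "(\<lambda>z. \<xi> (fst z) (snd z)) \<in> borel_measurable (?N \<Otimes>\<^sub>M M)"
    unfolding \<xi>_def by measurable
  have ppm[measurable]: "hermite_product m p \<in> borel_measurable M" for p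
    unfolding hermite_product_def[abs_def] by measurable
  have pp2: "integrable M (\<lambda>\<omega>. (hermite_product m p \<omega>)\<^sup>2)" for p
    unfolding hermite_product_def by (rule hermite_B_pair_L2)
  have pp1: "integrable M (hermite_product m p)" for p
    using integrable_L2_mult[of "hermite_product m p" M "\<lambda>_. 1"] pp2 by simp
  have Epp: "expectation (hermite_product m p) = fact m * ?c p ^ m" for p
    unfolding hermite_product_def[abs_def] hermite_B_pair by simp
  have x2: "integrable M (\<lambda>\<omega>. (\<xi> p \<omega>)\<^sup>2)" for p
  proof -
    have "integrable M (\<lambda>\<omega>. (?c p)\<^sup>2 * (hermite_product m p \<omega> - fact m * ?c p ^ m)\<^sup>2)"
      by (intro integrable_mult_right integrable_L2_diff pp2) auto
    then show ?thesis unfolding \<xi>_def power_mult_distrib .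
  qed
  \<comment> \<open>A bound uniform in the pair of points: (a - b)^2 <= 2 a^2 + 2 b^2, with the
    fourth moment for the random part and C <= 1 for the mean.\<close>
  let ?K = "2 * (LINT u|\<gamma>. hermite m u ^ 4) + 2 * (fact m)\<^sup>2"
  have xb: "expectation (\<lambda>\<omega>. (\<xi> p \<omega>)\<^sup>2) \<le> ?K" for p
  proof -
    have "expectation (\<lambda>\<omega>. (\<xi> p \<omega>)\<^sup>2) \<le> expectation (\<lambda>\<omega>. 2 * (?c p * hermite_product m p \<omega>)\<^sup>2 + 2 * (fact m)\<^sup>2)"
    proof (rule integral_mono)
      fix \<omega>
      have sq: "(a - b)\<^sup>2 \<le> 2 * a\<^sup>2 + 2 * b\<^sup>2" for a b :: real
        using zero_le_power2[of "a + b"] by (simp add: power2_eq_square algebra_simps)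
      have "(fact m * ?c p ^ Suc m)\<^sup>2 \<le> (fact m * 1)\<^sup>2"
        by (intro power_mono mult_left_mono mult_nonneg_nonneg C_power_bounds) auto
      then show "(\<xi> p \<omega>)\<^sup>2 \<le> 2 * (?c p * hermite_product m p \<omega>)\<^sup>2 + 2 * (fact m)\<^sup>2"
        using sq[of "?c p * hermite_product m p \<omega>" "fact m * ?c p ^ Suc m"]
        by (simp add: \<xi>_def right_diff_distrib mult.left_commute)
    qed (use x2 hermite_product_bound(1)[OF D, of p m] in auto)
    also have "\<dots> \<le> ?K" using hermite_product_bound[OF D, of p m] by (simp add: prob_space)
    finally show ?thesis .
  qed
  \<comment> \<open>The integral splits only where the section is integrable, so the identity holds
    almost surely.\<close>
  have AEx: "AE \<omega> in M. real (Suc m) * carre_du_champ D m \<omega> - functional_variance = real (Suc m) * (LINT p|?N. \<xi> p \<omega>)"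
    using AE_integrable_section[OF finite_mu2[OF D] hermite_product_C_measurable[OF D, where m=m] hermite_product_bound[OF D, where m=m]]
  proof eventually_elim
    case (elim \<omega>)
    have "(LINT p|?N. \<xi> p \<omega>) = (LINT p|?N. ?c p * hermite_product m p \<omega> - fact m * ?c p ^ Suc m)"
      by (simp add: \<xi>_def right_diff_distrib mult.left_commute)
    also have "\<dots> = carre_du_champ D m \<omega> - fact m * (LINT p|?N. ?c p ^ Suc m)"
      unfolding carre_du_champ_def
      by (subst Bochner_Integration.integral_diff[OF elim]) (use C_power_integrable[of "Suc m"] in \<open>auto simp del: power_Suc\<close>)
    finally have L: "(LINT p|?N. \<xi> p \<omega>) = carre_du_champ D m \<omega> - fact m * (LINT p|?N. ?c p ^ Suc m)" .
    show ?case unfolding functional_variance_def L by (simp add: right_diff_distrib mult.assoc del: power_Suc of_nat_Suc)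
  qed
  have i2: "integrable M (\<lambda>\<omega>. (LINT p|?N. \<xi> p \<omega>)\<^sup>2)"
    by (rule second_moment_integrable[OF finite_mu2[OF D] meas x2 xb])
  note sm[measurable] = integral_section_measurable[OF finite_mu2[OF D] meas x2 xb]
  have AEsq: "AE \<omega> in M. (real (Suc m) * carre_du_champ D m \<omega> - functional_variance)\<^sup>2 = (real (Suc m))\<^sup>2 * (LINT p|?N. \<xi> p \<omega>)\<^sup>2"
    using AEx by eventually_elim (simp add: power_mult_distrib)
  show "integrable M (\<lambda>\<omega>. (real (Suc m) * carre_du_champ D m \<omega> - functional_variance)\<^sup>2)"
    by (rule integrable_cong_AE_imp[OF integrable_mult_right[OF i2, of "(real (Suc m))\<^sup>2"]]) (use AEsq in \<open>auto elim: eventually_mono\<close>)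
  \<comment> \<open>The two factors C (x1 - x2) and C (x3 - x4) in front of the covariance are the
    extra edges that \<open>wick_cov_diag_le\<close> expects.\<close>
  have cov: "expectation (\<lambda>\<omega>. \<xi> (fst q) \<omega> * \<xi> (snd q) \<omega>) \<le> fact (4 * m) * real (card (diag_index 1 m m m m)) * contraction_kernel C m q" for q
  proof -
    obtain x1 x2 x3 x4 where q: "q = ((x1, x2), (x3, x4))" by (cases q) auto
    let ?p = "(x1, x2)" and ?p' = "(x3, x4)"
    have ipp: "integrable M (\<lambda>\<omega>. hermite_product m ?p \<omega> * hermite_product m ?p' \<omega>)"
      by (rule integrable_L2_mult) (auto simp: pp2)
    have "expectation (\<lambda>\<omega>. \<xi> ?p \<omega> * \<xi> ?p' \<omega>)
      = expectation (\<lambda>\<omega>. (?c ?p * ?c ?p') * (hermite_product m ?p \<omega> * hermite_product m ?p' \<omega> - (fact m * ?c ?p ^ m) * hermite_product m ?p' \<omega>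
           - (fact m * ?c ?p' ^ m) * hermite_product m ?p \<omega> + (fact m * ?c ?p ^ m) * (fact m * ?c ?p' ^ m)))"
      by (rule Bochner_Integration.integral_cong) (auto simp: \<xi>_def algebra_simps)
    also have "\<dots> = (?c ?p * ?c ?p') * (expectation (\<lambda>\<omega>. hermite_product m ?p \<omega> * hermite_product m ?p' \<omega>) - (fact m * ?c ?p ^ m) * (fact m * ?c ?p' ^ m))"
      using ipp pp1[of ?p] pp1[of ?p'] Epp[of ?p] Epp[of ?p'] by (simp add: prob_space algebra_simps)
    also have "expectation (\<lambda>\<omega>. hermite_product m ?p \<omega> * hermite_product m ?p' \<omega>) = mom4 x1 x2 x3 x4 m m m m"
      unfolding mom4_def hermite_product_def by (simp add: mult.assoc)
    finally have "expectation (\<lambda>\<omega>. \<xi> (fst q) \<omega> * \<xi> (snd q) \<omega>) = C (x1 - x2) * C (x3 - x4) *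
        wick_cov (C (x1 - x2)) (C (x1 - x3)) (C (x1 - x4)) (C (x2 - x3)) (C (x2 - x4)) (C (x3 - x4)) m m m m"
      by (simp add: q mom4_wick wick_cov_def wick_pair wick_pair')
    also have "\<dots> \<le> fact (4 * m) * real (card (diag_index 1 m m m m)) * contraction_kernel C m q"
      unfolding contraction_kernel_def q fst_conv snd_conv by (intro wick_cov_diag_le C_nonneg)
    finally show ?thesis .
  qed
  have "expectation (\<lambda>\<omega>. (real (Suc m) * carre_du_champ D m \<omega> - functional_variance)\<^sup>2) = expectation (\<lambda>\<omega>. (real (Suc m))\<^sup>2 * (LINT p|?N. \<xi> p \<omega>)\<^sup>2)"
    by (rule integral_cong_AE) (use AEsq in auto)
  also have "\<dots> = (real (Suc m))\<^sup>2 * (LINT q|(?N \<Otimes>\<^sub>M ?N). expectation (\<lambda>\<omega>. \<xi> (fst q) \<omega> * \<xi> (snd q) \<omega>))"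
    using second_moment_eq[OF finite_mu2[OF D] meas x2 xb] by simp
  also have "\<dots> \<le> (real (Suc m))\<^sup>2 * (LINT q|(?N \<Otimes>\<^sub>M ?N). fact (4 * m) * real (card (diag_index 1 m m m m)) * contraction_kernel C m q)"
    by (intro mult_left_mono integral_mono cov second_moment_integrable_cov[OF finite_mu2[OF D] meas x2 xb]
        integrable_mult_right contraction_kernel_integrable) auto
  also have "\<dots> = contraction_const * (LINT q|(?N \<Otimes>\<^sub>M ?N). contraction_kernel C m q)"
    by (simp add: contraction_const_def mult.assoc)
  finally show "expectation (\<lambda>\<omega>. (real (Suc m) * carre_du_champ D m \<omega> - functional_variance)\<^sup>2) \<le> contraction_const * (LINT q|(?N \<Otimes>\<^sub>M ?N). contraction_kernel C m q)" .
qed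

theorem hermite_functional_char:
  "norm ((LINT \<omega>|M. iexp (s * hermite_functional D m \<omega>)) - complex_of_real (exp (- (s\<^sup>2 * functional_variance / 2))))
     \<le> s\<^sup>2 * sqrt (contraction_const * (LINT q|((mu D \<Otimes>\<^sub>M mu D) \<Otimes>\<^sub>M (mu D \<Otimes>\<^sub>M mu D)). contraction_kernel C m q))"
proof -
  note hermite_functional_measurable[OF D, measurable] carre_du_champ_measurable[OF D, measurable]
  have "norm ((LINT \<omega>|M. iexp (s * hermite_functional D m \<omega>)) - complex_of_real (exp (- (s\<^sup>2 * functional_variance / 2))))
     \<le> s\<^sup>2 * expectation (\<lambda>\<omega>. \<bar>real (Suc m) * carre_du_champ D m \<omega> - functional_variance\<bar>)"
    by (rule char_gaussian_bound[OF hermite_functional_measurable[OF D] hermite_functional_L2[OF D] _ functional_variance_nonneg stein_identity])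
      (intro integrable_mult_right carre_du_champ_integrable[OF D])
  also have "\<dots> \<le> s\<^sup>2 * sqrt (expectation (\<lambda>\<omega>. (real (Suc m) * carre_du_champ D m \<omega> - functional_variance)\<^sup>2))"
    by (intro mult_left_mono expectation_abs_le_sqrt carre_du_champ_variance(1)) auto
  also have "\<dots> \<le> s\<^sup>2 * sqrt (contraction_const * (LINT q|((mu D \<Otimes>\<^sub>M mu D) \<Otimes>\<^sub>M (mu D \<Otimes>\<^sub>M mu D)). contraction_kernel C m q))"
    by (intro mult_left_mono real_sqrt_le_mono carre_du_champ_variance(2)) auto
  finally show ?thesis .
qed

context
  fixes f :: "real \<Rightarrow> real"
  assumes f[measurable]: "f \<in> borel_measurable borel" and f2: "integrable \<gamma> (\<lambda>u. (f u)\<^sup>2)"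
begin

lemma field_functional_section:
  "(\<lambda>z. f (B (fst z) (snd z))) \<in> borel_measurable (mu D \<Otimes>\<^sub>M M)"
  "integrable M (\<lambda>\<omega>. (f (B x \<omega>))\<^sup>2)" "expectation (\<lambda>\<omega>. (f (B x \<omega>))\<^sup>2) \<le> (LINT u|\<gamma>. (f u)\<^sup>2)"
proof -
  show "(\<lambda>z. f (B (fst z) (snd z))) \<in> borel_measurable (mu D \<Otimes>\<^sub>M M)" by measurable
qed (simp_all add: B_L2_comp[OF f f2])

lemma field_functional_measurable: "field_functional f \<in> borel_measurable M"
  unfolding field_functional_def[abs_def] by (rule integral_section_measurable[OF finite_mu[OF D] field_functional_section])

lemma field_functional_AE_integrable: "AE \<omega> in M. integrable (mu D) (\<lambda>x. f (B x \<omega>))"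
  by (rule AE_integrable_section[OF finite_mu[OF D] field_functional_section])

lemma field_functional_L2: "integrable M (\<lambda>\<omega>. (field_functional f \<omega>)\<^sup>2)"
  unfolding field_functional_def by (rule second_moment_integrable[OF finite_mu[OF D] field_functional_section])

lemma field_functional_integrable: "integrable M (field_functional f)"
  unfolding field_functional_def[abs_def] by (rule integrable_integral_section[OF finite_mu[OF D] field_functional_section])

lemma field_functional_mean: "expectation (field_functional f) = (LINT u|\<gamma>. f u) * measure (mu D) UNIV"
  unfolding field_functional_def[abs_def] using expectation_integral_section[OF finite_mu[OF D] field_functional_section]
  by (simp add: B_integral)

lemma field_functional_sq: "expectation (\<lambda>\<omega>. (field_functional f \<omega>)\<^sup>2)
   = (LINT p|(mu D \<Otimes>\<^sub>M mu D). expectation (\<lambda>\<omega>. f (B (fst p) \<omega>) * f (B (snd p) \<omega>)))"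
  unfolding field_functional_def by (rule second_moment_eq[OF finite_mu[OF D] field_functional_section])

lemma field_functional_cov_integrable:
  "integrable (mu D \<Otimes>\<^sub>M mu D) (\<lambda>p. expectation (\<lambda>\<omega>. f (B (fst p) \<omega>) * f (B (snd p) \<omega>)))"
  by (rule second_moment_integrable_cov[OF finite_mu[OF D] field_functional_section])

lemma field_functional_sq_le:
  assumes rank: "\<And>q. q < k \<Longrightarrow> hermite_coeff f q = 0"
  shows "expectation (\<lambda>\<omega>. (field_functional f \<omega>)\<^sup>2) \<le> (LINT u|\<gamma>. (f u)\<^sup>2) * (LINT p|(mu D \<Otimes>\<^sub>M mu D). C (fst p - snd p) ^ k)"
proof -
  have "expectation (\<lambda>\<omega>. (field_functional f \<omega>)\<^sup>2) \<le> (LINT p|(mu D \<Otimes>\<^sub>M mu D). C (fst p - snd p) ^ k * (LINT u|\<gamma>. (f u)\<^sup>2))"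
    unfolding field_functional_sq by (intro integral_mono field_functional_cov_integrable integrable_mult_left C_power_integrable
        field_covariance_le(2)[OF f f2 rank])
  then show ?thesis by (simp add: mult.commute)
qed

end

end

end

end

section \<open>Kernels of Gneiting type\<close>

lemma nn_integral_lborel_affine:
  fixes f :: "'x::euclidean_space \<Rightarrow> ennreal"
  assumes [measurable]: "f \<in> borel_measurable borel" and "c \<noteq> 0"
  shows "(\<integral>\<^sup>+x. f x \<partial>lborel) = ennreal (\<bar>c\<bar> ^ DIM('x)) * (\<integral>\<^sup>+x. f (t + c *\<^sub>R x) \<partial>lborel)"
proof -
  have "(\<integral>\<^sup>+x. f x \<partial>lborel) = (\<integral>\<^sup>+x. f x \<partial>density (distr lborel borel (\<lambda>x. t + c *\<^sub>R x)) (\<lambda>_. ennreal (\<bar>c\<bar> ^ DIM('x))))"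
    using lborel_affine[OF assms(2), of t] by simp
  also have "\<dots> = (\<integral>\<^sup>+x. ennreal (\<bar>c\<bar> ^ DIM('x)) * f (t + c *\<^sub>R x) \<partial>lborel)"
    by (subst nn_integral_density, simp, simp, subst nn_integral_distr) auto
  also have "\<dots> = ennreal (\<bar>c\<bar> ^ DIM('x)) * (\<integral>\<^sup>+x. f (t + c *\<^sub>R x) \<partial>lborel)"
    by (rule nn_integral_cmult) simp
  finally show ?thesis .
qed

lemma nn_integral_lborel_scale:
  fixes f :: "'x::euclidean_space \<Rightarrow> ennreal"
  assumes "f \<in> borel_measurable borel" and "c > 0"
  shows "(\<integral>\<^sup>+x. f x \<partial>lborel) = ennreal (c ^ DIM('x)) * (\<integral>\<^sup>+x. f (c *\<^sub>R x) \<partial>lborel)"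
  using nn_integral_lborel_affine[of f c 0] assms by simp

lemma nn_integral_lborel_reflect:
  fixes f :: "'x::euclidean_space \<Rightarrow> ennreal"
  assumes "f \<in> borel_measurable borel"
  shows "(\<integral>\<^sup>+x. f x \<partial>lborel) = (\<integral>\<^sup>+x. f (t - x) \<partial>lborel)"
  using nn_integral_lborel_affine[of f "-1" t] assms by simp

lemma nn_integral_lborel_pair:
  fixes f :: "'x::euclidean_space \<times> 'y::euclidean_space \<Rightarrow> ennreal"
  assumes "f \<in> borel_measurable borel"
  shows "(\<integral>\<^sup>+p. f p \<partial>lborel) = (\<integral>\<^sup>+x. \<integral>\<^sup>+y. f (x, y) \<partial>lborel \<partial>lborel)"
proof -
  have "f \<in> borel_measurable (lborel \<Otimes>\<^sub>M lborel)" using assms by (simp add: lborel_prod)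
  from lborel.nn_integral_fst[OF this] show ?thesis by (simp add: lborel_prod)
qed

text \<open>On a dyadic shell the integrand is at most its value at the inner radius, and the shell
  lies in a ball of radius r / 2^k. The resulting series is geometric with ratio 2^(beta - d) <
  1.\<close>

lemma nn_integral_powr_ball_finite:
  fixes r \<beta> :: real
  assumes "0 < \<beta>" "\<beta> < real DIM('x::euclidean_space)" "r > 0"
  shows "(\<integral>\<^sup>+z\<in>ball (0::'x) r. ennreal (norm z powr - \<beta>) \<partial>lborel) < \<infinity>"
proof -
  let ?d = "DIM('x)"
  define a where "a k = (r / 2 ^ Suc k) powr - \<beta> * (unit_ball_vol (real ?d) * (r / 2 ^ k) ^ ?d)" for k :: nat
  have a_nonneg: "0 \<le> a k" for k using assms unfolding a_def by (intro mult_nonneg_nonneg) auto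
  have a_geom: "a k = ((r / 2) powr - \<beta> * (unit_ball_vol (real ?d) * r ^ ?d)) * (2 powr (\<beta> - real ?d)) ^ k" for k
  proof -
    have p2: "(2::real) ^ k = 2 powr real k" by (simp add: powr_realpow)
    have "(r / 2 ^ Suc k) powr - \<beta> = (r / 2) powr - \<beta> * (2 ^ k) powr \<beta>"
    proof -
      have "r / 2 ^ Suc k = (r / 2) / 2 ^ k" by simp
      then have "(r / 2 ^ Suc k) powr - \<beta> = (r / 2) powr - \<beta> / (2 ^ k) powr - \<beta>"
        using assms by (simp only: powr_divide[of "r/2" "2^k"])
      then show ?thesis by (simp only: powr_minus[of "2 ^ k"] divide_inverse inverse_inverse_eq)
    qed
    moreover have "(2 ^ k) powr \<beta> = 2 powr (real k * \<beta>)" unfolding p2 by (rule powr_powr)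
    moreover have "(r / 2 ^ k) ^ ?d = r ^ ?d * 2 powr (- (real k * real ?d))"
      unfolding p2 power_divide by (simp add: powr_minus divide_inverse powr_power mult.commute)
    moreover have "(2 powr (\<beta> - real ?d)) ^ k = 2 powr (real k * \<beta>) * 2 powr (- (real k * real ?d))"
      by (simp add: powr_power powr_add[symmetric] algebra_simps)
    ultimately show ?thesis unfolding a_def by (simp add: mult_ac)
  qed
  have "summable (\<lambda>k. (2 powr (\<beta> - real ?d)) ^ k :: real)"
    using assms by (intro summable_geometric) (simp add: powr_less_one)
  then have "summable a" unfolding a_geom[abs_def] by (rule summable_mult)
  have "(\<integral>\<^sup>+z\<in>ball (0::'x) r. ennreal (norm z powr - \<beta>) \<partial>lborel)
     \<le> (\<integral>\<^sup>+z. (\<Sum>k. ennreal ((r / 2 ^ Suc k) powr - \<beta>) * indicator (ball (0::'x) (r / 2 ^ k)) z) \<partial>lborel)"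
  proof (rule nn_integral_mono)
    fix z :: 'x
    show "ennreal (norm z powr - \<beta>) * indicator (ball 0 r) z
      \<le> (\<Sum>k. ennreal ((r / 2 ^ Suc k) powr - \<beta>) * indicator (ball 0 (r / 2 ^ k)) z)"
    \<comment> \<open>At the origin \<open>powr\<close> has the value 0, so the left side vanishes
      there as it does outside the ball.\<close>
    proof (cases "z = 0 \<or> z \<notin> ball 0 r")
      case False
      then have z: "0 < norm z" "norm z < r" by auto
      \<comment> \<open>The first dyadic radius not exceeding the norm of z has positive index
        because z lies strictly inside the ball; its predecessor is the outer radius.\<close>
      obtain n where n: "r / 2 ^ Suc n \<le> norm z" "norm z < r / 2 ^ n"
      proof -
        have "\<exists>n. r / 2 ^ n \<le> norm z"
        proof -
          obtain n where "(1/2::real) ^ n < norm z / r"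
            using real_arch_pow_inv[of "norm z / r" "1/2"] z assms by auto
          then show ?thesis using z assms by (intro exI[of _ n]) (simp add: field_simps power_one_over)
        qed
        then have ex: "r / 2 ^ (LEAST n. r / 2 ^ n \<le> norm z) \<le> norm z" by (rule LeastI_ex)
        have "(LEAST n. r / 2 ^ n \<le> norm z) \<noteq> 0"
        proof
          assume e: "(LEAST n. r / 2 ^ n \<le> norm z) = 0"
          show False using ex z unfolding e by simp
        qed
        then obtain n where n: "(LEAST n. r / 2 ^ n \<le> norm z) = Suc n" using not0_implies_Suc by blast
        then have "\<not> r / 2 ^ n \<le> norm z" using not_less_Least[of n "\<lambda>n. r / 2 ^ n \<le> norm z"] by simp
        then show thesis using that[of n] ex n by auto
      qed
      have "ennreal (norm z powr - \<beta>) * indicator (ball 0 r) z \<le> ennreal ((r / 2 ^ Suc n) powr - \<beta>) * indicator (ball 0 (r / 2 ^ n)) z"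
      proof -
        have "norm z powr - \<beta> \<le> (r / 2 ^ Suc n) powr - \<beta>"
          using n assms z by (intro powr_mono2') auto
        then show ?thesis using n z by (simp add: ennreal_leI)
      qed
      also have "\<dots> \<le> (\<Sum>k. ennreal ((r / 2 ^ Suc k) powr - \<beta>) * indicator (ball 0 (r / 2 ^ k)) z)"
      proof -
        have "f n \<le> (\<Sum>k. f k)" for f :: "nat \<Rightarrow> ennreal"
          using sum_le_suminf[of f "{n}"] by simp
        from this[of "\<lambda>k. ennreal ((r / 2 ^ Suc k) powr - \<beta>) * indicator (ball 0 (r / 2 ^ k)) z"]
        show ?thesis .
      qed
      finally show ?thesis .
    qed auto
  qed
  also have "\<dots> = (\<Sum>k. \<integral>\<^sup>+z. ennreal ((r / 2 ^ Suc k) powr - \<beta>) * indicator (ball (0::'x) (r / 2 ^ k)) z \<partial>lborel)"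
  proof (rule nn_integral_suminf)
    have [measurable]: "ball (0::'x) s \<in> sets borel" for s by simp
    have "(\<lambda>z. ennreal c * indicator (ball (0::'x) s) z) \<in> borel_measurable lborel" for c s by measurable
    then show "(\<lambda>z. ennreal ((r / 2 ^ Suc k) powr - \<beta>) * indicator (ball (0::'x) (r / 2 ^ k)) z) \<in> borel_measurable lborel" for k .
  qed
  also have "\<dots> = (\<Sum>k. ennreal (a k))"
    using assms by (intro suminf_cong)
      (auto simp: nn_integral_cmult_indicator emeasure_ball a_def ennreal_mult'' simp del: power_Suc)
  also have "\<dots> = ennreal (\<Sum>k. a k)"
    using \<open>summable a\<close> a_nonneg by (intro suminf_ennreal2) auto
  also have "\<dots> < \<infinity>" by simp
  finally show ?thesis .
qed

lemma nn_integral_mu: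
  assumes "D \<in> sets borel" "f \<in> borel_measurable borel"
  shows "(\<integral>\<^sup>+x. f x \<partial>mu D) = (\<integral>\<^sup>+x. indicator D x * f x \<partial>lborel)"
  unfolding mu_def using assms by (subst nn_integral_density) auto

text \<open>Only the first coordinates are substituted, with Jacobian T^d_1 for each point. The
  integrand sees them through their difference, while the second coordinates stay separate so that
  further restrictions can be imposed on one of them.\<close>

lemma nn_integral_mu_scaled:
  fixes D1 :: "'a::euclidean_space set" and E :: "'b::euclidean_space set"
    and g :: "'a \<times> 'b \<times> 'b \<Rightarrow> ennreal"
  assumes T: "T > 0" and [measurable]: "D1 \<in> sets borel" "E \<in> sets borel" "g \<in> borel_measurable borel"
    and TD: "((\<lambda>y. T *\<^sub>R y) ` D1) \<in> sets borel"
  shows "(\<integral>\<^sup>+x. \<integral>\<^sup>+y. g (fst x - fst y, snd x, snd y) \<partial>mu (((\<lambda>y. T *\<^sub>R y) ` D1) \<times> E) \<partial>mu (((\<lambda>y. T *\<^sub>R y) ` D1) \<times> E))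
    = ennreal (T ^ (2 * DIM('a))) * (\<integral>\<^sup>+u. \<integral>\<^sup>+v. indicator D1 u * indicator D1 v *
        (\<integral>\<^sup>+a. \<integral>\<^sup>+b. indicator E a * indicator E b * g (T *\<^sub>R (u - v), a, b) \<partial>lborel \<partial>lborel) \<partial>lborel \<partial>lborel)"
proof -
  note [measurable] = TD
  let ?D = "(\<lambda>y. T *\<^sub>R y) ` D1"
  let ?i = "\<lambda>x. indicator ?D x :: ennreal" and ?e = "\<lambda>x. indicator E x :: ennreal"
  have DE[measurable]: "?D \<times> E \<in> sets borel" by (simp add: borel_prod[symmetric])
  have [measurable]: "(fst :: 'a \<times> 'b \<Rightarrow> 'a) \<in> borel_measurable borel" "(snd :: 'a \<times> 'b \<Rightarrow> 'b) \<in> borel_measurable borel"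
    by (intro borel_measurable_continuous_onI continuous_intros)+
  have sc: "indicator ?D (T *\<^sub>R u) = (indicator D1 u :: ennreal)" for u
    using T by (auto simp: indicator_def)
  have ind: "indicator (?D \<times> E) (x1, x2) = ?i x1 * ?e x2" for x1 x2 by (auto simp: indicator_def)
  have "(\<integral>\<^sup>+x. \<integral>\<^sup>+y. g (fst x - fst y, snd x, snd y) \<partial>mu (?D \<times> E) \<partial>mu (?D \<times> E))
     = (\<integral>\<^sup>+x. indicator (?D \<times> E) x * (\<integral>\<^sup>+y. indicator (?D \<times> E) y * g (fst x - fst y, snd x, snd y) \<partial>lborel) \<partial>lborel)"
  proof -
    have "(\<integral>\<^sup>+y. g (fst x - fst y, snd x, snd y) \<partial>mu (?D \<times> E)) = (\<integral>\<^sup>+y. indicator (?D \<times> E) y * g (fst x - fst y, snd x, snd y) \<partial>lborel)" for x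
      by (rule nn_integral_mu) measurable
    then show ?thesis by (simp, subst nn_integral_mu) measurable
  qed
  also have "\<dots> = (\<integral>\<^sup>+x1. \<integral>\<^sup>+x2. ?i x1 * ?e x2 * (\<integral>\<^sup>+y1. \<integral>\<^sup>+y2. ?i y1 * ?e y2 * g (x1 - y1, x2, y2) \<partial>lborel \<partial>lborel) \<partial>lborel \<partial>lborel)"
    by (subst nn_integral_lborel_pair, measurable, subst nn_integral_lborel_pair, measurable) (simp add: ind)
  also have "\<dots> = (\<integral>\<^sup>+x1. \<integral>\<^sup>+x2. \<integral>\<^sup>+y1. ?i x1 * ?i y1 * (\<integral>\<^sup>+y2. ?e x2 * ?e y2 * g (x1 - y1, x2, y2) \<partial>lborel) \<partial>lborel \<partial>lborel \<partial>lborel)"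
  proof (intro nn_integral_cong)
    fix x1 :: 'a and x2 :: 'b
    show "?i x1 * ?e x2 * (\<integral>\<^sup>+y1. \<integral>\<^sup>+y2. ?i y1 * ?e y2 * g (x1 - y1, x2, y2) \<partial>lborel \<partial>lborel)
      = (\<integral>\<^sup>+y1. ?i x1 * ?i y1 * (\<integral>\<^sup>+y2. ?e x2 * ?e y2 * g (x1 - y1, x2, y2) \<partial>lborel) \<partial>lborel)"
      by (simp add: nn_integral_cmult mult.assoc mult.left_commute[of _ "?e x2"])
  qed
  also have "\<dots> = (\<integral>\<^sup>+x1. \<integral>\<^sup>+y1. \<integral>\<^sup>+x2. ?i x1 * ?i y1 * (\<integral>\<^sup>+y2. ?e x2 * ?e y2 * g (x1 - y1, x2, y2) \<partial>lborel) \<partial>lborel \<partial>lborel \<partial>lborel)"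
    by (intro nn_integral_cong lborel_pair.Fubini') measurable
  also have "\<dots> = (\<integral>\<^sup>+x1. \<integral>\<^sup>+y1. ?i x1 * ?i y1 * (\<integral>\<^sup>+x2. \<integral>\<^sup>+y2. ?e x2 * ?e y2 * g (x1 - y1, x2, y2) \<partial>lborel \<partial>lborel) \<partial>lborel \<partial>lborel)"
    by (simp add: nn_integral_cmult)
  also have "\<dots> = ennreal (T ^ DIM('a)) * (\<integral>\<^sup>+u. \<integral>\<^sup>+y1. ?i (T *\<^sub>R u) * ?i y1 * (\<integral>\<^sup>+x2. \<integral>\<^sup>+y2. ?e x2 * ?e y2 * g (T *\<^sub>R u - y1, x2, y2) \<partial>lborel \<partial>lborel) \<partial>lborel \<partial>lborel)"
    by (subst nn_integral_lborel_scale[OF _ T]) measurable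
  also have "\<dots> = ennreal (T ^ DIM('a)) * (\<integral>\<^sup>+u. ennreal (T ^ DIM('a)) * (\<integral>\<^sup>+v. ?i (T *\<^sub>R u) * ?i (T *\<^sub>R v) * (\<integral>\<^sup>+x2. \<integral>\<^sup>+y2. ?e x2 * ?e y2 * g (T *\<^sub>R u - T *\<^sub>R v, x2, y2) \<partial>lborel \<partial>lborel) \<partial>lborel) \<partial>lborel)"
    by (intro arg_cong2[where f="(*)"] refl nn_integral_cong nn_integral_lborel_scale[OF _ T]) measurable
  also have "\<dots> = (ennreal (T ^ DIM('a)) * ennreal (T ^ DIM('a))) * (\<integral>\<^sup>+u. \<integral>\<^sup>+v. indicator D1 u * indicator D1 v *
        (\<integral>\<^sup>+a. \<integral>\<^sup>+b. ?e a * ?e b * g (T *\<^sub>R (u - v), a, b) \<partial>lborel \<partial>lborel) \<partial>lborel \<partial>lborel)"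
    unfolding sc scaleR_diff_right[symmetric] by (subst nn_integral_cmult, measurable) (simp add: mult.assoc)
  also have "ennreal (T ^ DIM('a)) * ennreal (T ^ DIM('a)) = ennreal (T ^ (2 * DIM('a)))"
    using T by (simp add: ennreal_mult'[symmetric] mult_2 power_add)
  finally show ?thesis .
qed

lemma measurable_fst_snd_borel [measurable]:
  "(fst :: 'x::topological_space \<times> 'y::topological_space \<Rightarrow> 'x) \<in> borel_measurable borel"
  "(snd :: 'x::topological_space \<times> 'y::topological_space \<Rightarrow> 'y) \<in> borel_measurable borel"
  by (intro borel_measurable_continuous_onI continuous_intros)+

text \<open>
  In the application $h = C_2^{1 - \rho / d_1}$, so that $h^R$ is integrable, and $M$ is the constant of the
  power law of $C_1$.
\<close>

locale gneiting_kernel =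
  fixes C :: "'a::euclidean_space \<times> 'b::euclidean_space \<Rightarrow> real" and h :: "'b \<Rightarrow> real"
    and \<rho> K M :: real and R :: nat and D1 :: "'a set" and D2 :: "'b set"
  assumes C_meas: "C \<in> borel_measurable borel"
    and C_nonneg: "\<And>x. 0 \<le> C x" and C_le_1: "\<And>x. C x \<le> 1" and C_sym: "\<And>x. C (- x) = C x"
    and h_meas: "h \<in> borel_measurable borel" and h_pos: "\<And>w. 0 < h w"
    and h_int: "(\<integral>\<^sup>+w. ennreal (h w ^ R) \<partial>lborel) < \<infinity>"
    and rho_pos: "0 < \<rho>" and R_pos: "0 < R" and R_rho: "real R * \<rho> < real DIM('a)"
    and K_nonneg: "0 \<le> K" and M_pos: "0 < M"
    and C_bound: "\<And>z w. z \<noteq> 0 \<Longrightarrow> C (z, w) \<le> K * h w * norm z powr - \<rho>"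
    and C_lim: "\<And>z w. z \<noteq> 0 \<Longrightarrow> ((\<lambda>t. t powr \<rho> * C (t *\<^sub>R z, w)) \<longlongrightarrow> M * h w * norm z powr - \<rho>) at_top"
    and D1_compact: "compact D1" and D1_int: "interior D1 \<noteq> {}"
    and D2_compact: "compact D2" and D2_int: "interior D2 \<noteq> {}" and D2_frontier: "negligible (frontier D2)"
begin

lemma meas [measurable]: "C \<in> borel_measurable borel" "h \<in> borel_measurable borel"
    "D1 \<in> sets borel" "D2 \<in> sets borel"
  using C_meas h_meas D1_compact D2_compact by (auto intro: borel_compact)

definition \<beta> :: real where "\<beta> = real R * \<rho>"

lemma beta: "0 < \<beta>" "\<beta> < real DIM('a)"
  using rho_pos R_pos R_rho by (auto simp: \<beta>_def)

lemma powr_rho_power: "0 < t \<Longrightarrow> (t powr \<rho>) ^ R = t powr \<beta>" "0 < t \<Longrightarrow> (t powr - \<rho>) ^ R = t powr - \<beta>"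
  by (simp_all add: powr_power \<beta>_def mult.commute)

text \<open>The Riesz energy of D1 with exponent beta = R rho; it is the factor of the limiting
  variance that depends on the shape of the first window.\<close>

definition riesz_energy :: ennreal where
  "riesz_energy = (\<integral>\<^sup>+u. \<integral>\<^sup>+v. indicator D1 u * indicator D1 v * ennreal (norm (u - v) powr - \<beta>) \<partial>lborel \<partial>lborel)"

lemma riesz_energy_finite: "riesz_energy < \<infinity>"
proof -
  obtain r where r: "r > 0" "D1 \<subseteq> ball 0 r"
    using compact_imp_bounded[OF D1_compact] bounded_subset_ballD by blast
  let ?c = "\<integral>\<^sup>+z\<in>ball (0::'a) (2 * r). ennreal (norm z powr - \<beta>) \<partial>lborel"
  have c: "?c < \<infinity>" using nn_integral_powr_ball_finite[OF beta, of "2 * r"] r by simp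
  have inner: "(\<integral>\<^sup>+v. indicator D1 u * indicator D1 v * ennreal (norm (u - v) powr - \<beta>) \<partial>lborel) \<le> indicator D1 u * ?c" for u
  proof (cases "u \<in> D1")
    case True
    have "(\<integral>\<^sup>+v. indicator D1 u * indicator D1 v * ennreal (norm (u - v) powr - \<beta>) \<partial>lborel)
        = (\<integral>\<^sup>+z. indicator D1 u * indicator D1 (u - z) * ennreal (norm (u - (u - z)) powr - \<beta>) \<partial>lborel)"
      by (rule nn_integral_lborel_reflect) measurable
    also have "\<dots> \<le> ?c"
    proof (rule nn_integral_mono)
      fix z
      have "z \<in> ball 0 (2 * r)" if "u - z \<in> D1"
      proof -
        have "norm u < r" "norm (u - z) < r" using that True r by auto
        then show ?thesis using norm_triangle_ineq4[of u "u - z"] by simp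
      qed
      then show "indicator D1 u * indicator D1 (u - z) * ennreal (norm (u - (u - z)) powr - \<beta>)
         \<le> ennreal (norm z powr - \<beta>) * indicator (ball 0 (2 * r)) z"
        by (auto simp: indicator_def)
    qed
    finally show ?thesis using True by simp
  qed simp
  have "riesz_energy \<le> (\<integral>\<^sup>+u. indicator D1 u * ?c \<partial>lborel)"
    unfolding riesz_energy_def by (intro nn_integral_mono inner)
  also have "\<dots> = emeasure lborel D1 * ?c"
    by (simp add: nn_integral_multc)
  also have "\<dots> < \<infinity>"
    using c emeasure_bounded_finite[OF compact_imp_bounded[OF D1_compact]] by (simp add: ennreal_mult_less_top)
  finally show ?thesis .
qed

text \<open>A majorant for all scales at once in the variables ((u, v), (a, w)). The difference w of
  the second coordinates is not rescaled and runs over the whole space, which is why h^R has to be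
  integrable there.\<close>

definition dominant :: "('a \<times> 'a) \<times> ('b \<times> 'b) \<Rightarrow> ennreal" where
  "dominant p = indicator D1 (fst (fst p)) * indicator D1 (snd (fst p)) * ennreal (norm (fst (fst p) - snd (fst p)) powr - \<beta>)
     * (indicator D2 (fst (snd p)) * (ennreal (K ^ R) * ennreal (h (snd (snd p)) ^ R)))"

lemma dominant_measurable [measurable]: "dominant \<in> borel_measurable borel"
  unfolding dominant_def by measurable

definition h_mass :: ennreal where "h_mass = (\<integral>\<^sup>+w. ennreal (h w ^ R) \<partial>lborel)"

lemma dominant_integral: "(\<integral>\<^sup>+p. dominant p \<partial>lborel) = riesz_energy * (emeasure lborel D2 * (ennreal (K ^ R) * h_mass))"
proof -
  have "(\<integral>\<^sup>+p. dominant p \<partial>lborel) = (\<integral>\<^sup>+q. \<integral>\<^sup>+s. dominant (q, s) \<partial>lborel \<partial>lborel)"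
    by (rule nn_integral_lborel_pair) measurable
  also have "\<dots> = (\<integral>\<^sup>+q. indicator D1 (fst q) * indicator D1 (snd q) * ennreal (norm (fst q - snd q) powr - \<beta>)
     * (\<integral>\<^sup>+s. indicator D2 (fst s) * (ennreal (K ^ R) * ennreal (h (snd s) ^ R)) \<partial>lborel) \<partial>lborel)"
    unfolding dominant_def fst_conv snd_conv by (intro nn_integral_cong nn_integral_cmult) measurable
  also have "(\<integral>\<^sup>+s. indicator D2 (fst s) * (ennreal (K ^ R) * ennreal (h (snd s) ^ R)) \<partial>lborel)
     = (\<integral>\<^sup>+a. \<integral>\<^sup>+w. indicator D2 a * (ennreal (K ^ R) * ennreal (h w ^ R)) \<partial>lborel \<partial>lborel)"
    by (subst nn_integral_lborel_pair) auto
  also have "\<dots> = emeasure lborel D2 * (ennreal (K ^ R) * h_mass)"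
    by (simp add: nn_integral_cmult nn_integral_multc h_mass_def)
  also have "(\<integral>\<^sup>+q. indicator D1 (fst q) * indicator D1 (snd q) * ennreal (norm (fst q - snd q) powr - \<beta>)
     * (emeasure lborel D2 * (ennreal (K ^ R) * h_mass)) \<partial>lborel) = riesz_energy * (emeasure lborel D2 * (ennreal (K ^ R) * h_mass))"
    unfolding riesz_energy_def by (subst nn_integral_multc, measurable, subst nn_integral_lborel_pair) auto
  finally show ?thesis .
qed

lemma h_mass_finite: "h_mass < \<infinity>" using h_int by (simp add: h_mass_def)

lemma dominant_finite: "(\<integral>\<^sup>+p. dominant p \<partial>lborel) < \<infinity>"
  unfolding dominant_integral using riesz_energy_finite h_mass_finite emeasure_bounded_finite[OF compact_imp_bounded[OF D2_compact]]
  by (simp add: ennreal_mult_less_top)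

definition window :: "real \<Rightarrow> real \<Rightarrow> ('a \<times> 'b) set" where
  "window T S = ((\<lambda>y. T *\<^sub>R y) ` D1) \<times> ((\<lambda>y. S *\<^sub>R y) ` D2)"

lemma window_compact: "compact (window T S)"
  unfolding window_def by (intro compact_Times compact_scaling D1_compact D2_compact)

lemma window_sets [measurable]: "(\<lambda>y. T *\<^sub>R y) ` D1 \<in> sets borel" "(\<lambda>y. S *\<^sub>R y) ` D2 \<in> sets borel" "window T S \<in> sets borel"
  by (intro borel_compact compact_scaling D1_compact D2_compact window_compact)+

text \<open>The first coordinates give the Jacobian T^(2 d_1), the base point in the second window
  gives S^d_2, and the difference w gives none. The indicator at a - w / S records that the second
  point also lies in the window.\<close>

lemma scaled_pair:
  fixes f :: "'a \<times> 'b \<Rightarrow> ennreal"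
  assumes T: "T > 0" and S: "S > 0" and [measurable]: "f \<in> borel_measurable borel"
  shows "(\<integral>\<^sup>+x. \<integral>\<^sup>+y. f (x - y) \<partial>mu (window T S) \<partial>mu (window T S))
    = ennreal (T ^ (2 * DIM('a)) * S ^ DIM('b)) * (\<integral>\<^sup>+p. indicator D1 (fst (fst p)) * indicator D1 (snd (fst p)) *
        (indicator D2 (fst (snd p)) * indicator D2 (fst (snd p) - (1 / S) *\<^sub>R snd (snd p)) *
          f (T *\<^sub>R (fst (fst p) - snd (fst p)), snd (snd p))) \<partial>lborel)"
proof -
  let ?E = "(\<lambda>y. S *\<^sub>R y) ` D2"
  define F where "F p = indicator D1 (fst (fst p)) * indicator D1 (snd (fst p)) *
        (indicator D2 (fst (snd p)) * indicator D2 (fst (snd p) - (1 / S) *\<^sub>R snd (snd p)) *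
          f (T *\<^sub>R (fst (fst p) - snd (fst p)), snd (snd p)))" for p
  have [measurable]: "F \<in> borel_measurable borel" unfolding F_def[abs_def] by measurable
  have sc: "indicator ?E (S *\<^sub>R u) = (indicator D2 u :: ennreal)" for u
    using S by (auto simp: indicator_def)
  have sc2: "indicator ?E (S *\<^sub>R a - w) = (indicator D2 (a - (1 / S) *\<^sub>R w) :: ennreal)" for a w
  proof -
    have "S *\<^sub>R a - w = S *\<^sub>R (a - (1 / S) *\<^sub>R w)" using S by (simp add: scaleR_diff_right)
    then show ?thesis by (simp only: sc)
  qed
  have inner: "(\<integral>\<^sup>+a. \<integral>\<^sup>+b. indicator ?E a * indicator ?E b * f (z, a - b) \<partial>lborel \<partial>lborel)
    = ennreal (S ^ DIM('b)) * (\<integral>\<^sup>+a. \<integral>\<^sup>+w. indicator D2 a * indicator D2 (a - (1 / S) *\<^sub>R w) * f (z, w) \<partial>lborel \<partial>lborel)" for z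
  proof -
    have "(\<integral>\<^sup>+a. \<integral>\<^sup>+b. indicator ?E a * indicator ?E b * f (z, a - b) \<partial>lborel \<partial>lborel)
      = (\<integral>\<^sup>+a. \<integral>\<^sup>+w. indicator ?E a * indicator ?E (a - w) * f (z, a - (a - w)) \<partial>lborel \<partial>lborel)"
      by (intro nn_integral_cong nn_integral_lborel_reflect) measurable
    also have "\<dots> = (\<integral>\<^sup>+a. \<integral>\<^sup>+w. indicator ?E a * indicator ?E (a - w) * f (z, w) \<partial>lborel \<partial>lborel)" by simp
    also have "\<dots> = ennreal (S ^ DIM('b)) * (\<integral>\<^sup>+a. \<integral>\<^sup>+w. indicator ?E (S *\<^sub>R a) * indicator ?E (S *\<^sub>R a - w) * f (z, w) \<partial>lborel \<partial>lborel)"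
      by (rule nn_integral_lborel_scale[OF _ S]) measurable
    finally show ?thesis unfolding sc sc2 .
  qed
  have "(\<integral>\<^sup>+x. \<integral>\<^sup>+y. f (x - y) \<partial>mu (window T S) \<partial>mu (window T S))
    = (\<integral>\<^sup>+x. \<integral>\<^sup>+y. (\<lambda>(z, a, b). f (z, a - b)) (fst x - fst y, snd x, snd y) \<partial>mu (window T S) \<partial>mu (window T S))"
    by (intro nn_integral_cong) (simp add: minus_prod_def)
  also have "\<dots> = ennreal (T ^ (2 * DIM('a))) * (\<integral>\<^sup>+u. \<integral>\<^sup>+v. indicator D1 u * indicator D1 v *
        (\<integral>\<^sup>+a. \<integral>\<^sup>+b. indicator ?E a * indicator ?E b * (\<lambda>(z, a, b). f (z, a - b)) (T *\<^sub>R (u - v), a, b) \<partial>lborel \<partial>lborel) \<partial>lborel \<partial>lborel)"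
    unfolding window_def
  proof (rule nn_integral_mu_scaled[OF T])
    have "(\<lambda>x :: 'a \<times> 'b \<times> 'b. f (fst x, fst (snd x) - snd (snd x))) \<in> borel_measurable (borel \<Otimes>\<^sub>M (borel \<Otimes>\<^sub>M borel))"
      by measurable
    then show "(\<lambda>(z, a, b). f (z, a - b)) \<in> borel_measurable borel" by (simp add: borel_prod case_prod_beta')
  qed measurable
  also have "\<dots> = ennreal (T ^ (2 * DIM('a))) * (\<integral>\<^sup>+u. \<integral>\<^sup>+v. indicator D1 u * indicator D1 v *
        (ennreal (S ^ DIM('b)) * (\<integral>\<^sup>+a. \<integral>\<^sup>+w. indicator D2 a * indicator D2 (a - (1 / S) *\<^sub>R w) * f (T *\<^sub>R (u - v), w) \<partial>lborel \<partial>lborel)) \<partial>lborel \<partial>lborel)"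
    by (simp add: inner)
  also have "\<dots> = ennreal (T ^ (2 * DIM('a))) * (\<integral>\<^sup>+u. \<integral>\<^sup>+v. ennreal (S ^ DIM('b)) * (indicator D1 u * indicator D1 v *
        (\<integral>\<^sup>+a. \<integral>\<^sup>+w. indicator D2 a * indicator D2 (a - (1 / S) *\<^sub>R w) * f (T *\<^sub>R (u - v), w) \<partial>lborel \<partial>lborel)) \<partial>lborel \<partial>lborel)"
    by (simp only: mult.left_commute mult.assoc)
  also have "\<dots> = ennreal (T ^ (2 * DIM('a))) * (ennreal (S ^ DIM('b)) * (\<integral>\<^sup>+u. \<integral>\<^sup>+v. (indicator D1 u * indicator D1 v *
        (\<integral>\<^sup>+a. \<integral>\<^sup>+w. indicator D2 a * indicator D2 (a - (1 / S) *\<^sub>R w) * f (T *\<^sub>R (u - v), w) \<partial>lborel \<partial>lborel)) \<partial>lborel \<partial>lborel))"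
    by (simp add: nn_integral_cmult)
  also have "(\<integral>\<^sup>+u. \<integral>\<^sup>+v. (indicator D1 u * indicator D1 v *
        (\<integral>\<^sup>+a. \<integral>\<^sup>+w. indicator D2 a * indicator D2 (a - (1 / S) *\<^sub>R w) * f (T *\<^sub>R (u - v), w) \<partial>lborel \<partial>lborel)) \<partial>lborel \<partial>lborel)
     = (\<integral>\<^sup>+u. \<integral>\<^sup>+v. \<integral>\<^sup>+a. \<integral>\<^sup>+w. indicator D1 u * indicator D1 v * (indicator D2 a * indicator D2 (a - (1 / S) *\<^sub>R w) * f (T *\<^sub>R (u - v), w)) \<partial>lborel \<partial>lborel \<partial>lborel \<partial>lborel)"
    by (simp add: nn_integral_cmult)
  also have "\<dots> = (\<integral>\<^sup>+p. F p \<partial>lborel)"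
  proof -
    have "(\<integral>\<^sup>+p. F p \<partial>lborel) = (\<integral>\<^sup>+q. \<integral>\<^sup>+s. F (q, s) \<partial>lborel \<partial>lborel)"
      by (rule nn_integral_lborel_pair) measurable
    also have "\<dots> = (\<integral>\<^sup>+u. \<integral>\<^sup>+v. \<integral>\<^sup>+s. F ((u, v), s) \<partial>lborel \<partial>lborel \<partial>lborel)"
      by (rule nn_integral_lborel_pair) measurable
    also have "\<dots> = (\<integral>\<^sup>+u. \<integral>\<^sup>+v. \<integral>\<^sup>+a. \<integral>\<^sup>+w. F ((u, v), (a, w)) \<partial>lborel \<partial>lborel \<partial>lborel \<partial>lborel)"
      by (intro nn_integral_cong nn_integral_lborel_pair) measurable
    finally show ?thesis by (simp add: F_def)
  qed
  finally show ?thesis using T S by (simp add: F_def ennreal_mult' mult.assoc)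
qed

text \<open>The Jacobian T^(2 d_1) S^d_2 times the decay T^(-beta) of C^R at distance T.\<close>

definition growth :: "real \<Rightarrow> real \<Rightarrow> real" where
  "growth T S = S ^ DIM('b) * T powr (2 * real DIM('a) - \<beta>)"

lemma growth_pos: "T > 0 \<Longrightarrow> S > 0 \<Longrightarrow> 0 < growth T S"
  by (simp add: growth_def)

text \<open>
  The integrand after substituting $(T u, S w)$ and $(T v, S w - w')$ for the two points and dividing by
  the expected growth: only the first coordinate of the difference is rescaled.
\<close>

definition scaled_density :: "('a \<times> 'b \<Rightarrow> ennreal) \<Rightarrow> real \<Rightarrow> real \<Rightarrow> ('a \<times> 'a) \<times> ('b \<times> 'b) \<Rightarrow> ennreal" where
  "scaled_density f T S p = ennreal (T powr \<beta>) * (indicator D1 (fst (fst p)) * indicator D1 (snd (fst p)) *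
        (indicator D2 (fst (snd p)) * indicator D2 (fst (snd p) - (1 / S) *\<^sub>R snd (snd p)) *
          f (T *\<^sub>R (fst (fst p) - snd (fst p)), snd (snd p))))"

lemma scaled_density_measurable [measurable]:
  assumes [measurable]: "f \<in> borel_measurable borel" shows "scaled_density f T S \<in> borel_measurable borel"
  unfolding scaled_density_def[abs_def] by measurable

lemma power_split: "T > 0 \<Longrightarrow> T ^ (2 * DIM('a)) * S ^ DIM('b) = growth T S * T powr \<beta>"
  by (simp add: growth_def powr_add[symmetric] powr_realpow[symmetric])

lemma scaled_pair_scaled_density:
  assumes T: "T > 0" and S: "S > 0" and [measurable]: "f \<in> borel_measurable borel"
  shows "(\<integral>\<^sup>+x. \<integral>\<^sup>+y. f (x - y) \<partial>mu (window T S) \<partial>mu (window T S)) = ennreal (growth T S) * (\<integral>\<^sup>+p. scaled_density f T S p \<partial>lborel)"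
proof -
  have "(\<integral>\<^sup>+p. scaled_density f T S p \<partial>lborel) = ennreal (T powr \<beta>) * (\<integral>\<^sup>+p. indicator D1 (fst (fst p)) * indicator D1 (snd (fst p)) *
        (indicator D2 (fst (snd p)) * indicator D2 (fst (snd p) - (1 / S) *\<^sub>R snd (snd p)) *
          f (T *\<^sub>R (fst (fst p) - snd (fst p)), snd (snd p))) \<partial>lborel)"
    unfolding scaled_density_def by (rule nn_integral_cmult) measurable
  then show ?thesis
    unfolding scaled_pair[OF assms] power_split[OF T] using growth_pos[OF T S] by (simp add: ennreal_mult' mult.assoc)
qed

lemma AE_good: "AE p in (lborel :: (('a \<times> 'a) \<times> ('b \<times> 'b)) measure). fst (fst p) \<noteq> snd (fst p) \<and> fst (snd p) \<notin> frontier D2"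
proof -
  have fr: "AE a in lborel. a \<notin> frontier D2"
  proof (rule AE_not_in)
    have "frontier D2 \<in> sets borel" by (intro borel_closed) simp
    then show "frontier D2 \<in> null_sets lborel"
      using D2_frontier unfolding negligible_iff_null_sets by (subst (asm) null_sets_completion_iff) auto
  qed
  have m1[measurable]: "Measurable.pred borel (\<lambda>q :: 'a \<times> 'a. fst q \<noteq> snd q)" by measurable
  have [measurable]: "frontier D2 \<in> sets borel" by (intro borel_closed) simp
  have 1: "AE q in (lborel :: ('a \<times> 'a) measure). fst q \<noteq> snd q"
  proof -
    have "AE q in lborel \<Otimes>\<^sub>M (lborel :: 'a measure). fst q \<noteq> (snd q :: 'a)"
    proof (rule lborel_pair.AE_pair_measure)
      show "AE x in lborel. AE y in lborel. fst (x, y) \<noteq> (snd (x, y) :: 'a)"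
      proof (rule AE_I2)
        fix x :: 'a
        show "AE y in lborel. fst (x, y) \<noteq> (snd (x, y) :: 'a)"
          using AE_lborel_singleton[of x] by eventually_elim auto
      qed
    qed measurable
    then show ?thesis unfolding lborel_prod .
  qed
  have 2: "AE s in (lborel :: ('b \<times> 'b) measure). fst s \<notin> frontier D2"
  proof -
    have "AE s in lborel \<Otimes>\<^sub>M (lborel :: 'b measure). fst s \<notin> frontier D2"
    proof (rule lborel_pair.AE_pair_measure)
      show "AE x in lborel. AE y in (lborel :: 'b measure). fst (x, y) \<notin> frontier D2"
        using fr by eventually_elim simp
    qed measurable
    then show ?thesis unfolding lborel_prod .
  qed
  have "AE p in lborel \<Otimes>\<^sub>M lborel. fst (fst p) \<noteq> (snd (fst p) :: 'a) \<and> fst (snd p :: 'b \<times> 'b) \<notin> frontier D2"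
  proof (rule lborel_pair.AE_pair_measure)
    show "AE x in lborel. AE y in (lborel :: ('b \<times> 'b) measure). fst (fst (x :: 'a \<times> 'a, y)) \<noteq> (snd (fst (x, y)) :: 'a) \<and> fst (snd (x, y)) \<notin> frontier D2"
      using 1
    proof eventually_elim
      case (elim x)
      show ?case using 2 by eventually_elim (use elim in auto)
    qed
  qed measurable
  then show ?thesis unfolding lborel_prod .
qed

lemma C_power_bound:
  assumes "z \<noteq> 0" "T > 0" "R \<le> q"
  shows "T powr \<beta> * C (T *\<^sub>R z, w) ^ q \<le> norm z powr - \<beta> * (K ^ R * h w ^ R)"
proof -
  have z: "0 < norm z" "T *\<^sub>R z \<noteq> 0" using assms by auto
  have "C (T *\<^sub>R z, w) ^ q \<le> C (T *\<^sub>R z, w) ^ R" by (intro power_decreasing assms C_nonneg C_le_1)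
  also have "\<dots> \<le> (K * h w * norm (T *\<^sub>R z) powr - \<rho>) ^ R" by (intro power_mono C_bound C_nonneg z)
  also have "\<dots> = K ^ R * h w ^ R * (T powr - \<beta> * norm z powr - \<beta>)"
    using assms z by (simp add: power_mult_distrib powr_mult powr_rho_power)
  finally have "T powr \<beta> * C (T *\<^sub>R z, w) ^ q \<le> T powr \<beta> * (K ^ R * h w ^ R * (T powr - \<beta> * norm z powr - \<beta>))"
    by (intro mult_left_mono) auto
  also have "\<dots> = norm z powr - \<beta> * (K ^ R * h w ^ R)"
  proof -
    have "T powr \<beta> * T powr - \<beta> = 1" using assms by (simp add: powr_add[symmetric])
    then show ?thesis by (simp add: mult.left_commute mult.assoc[symmetric])
  qed
  finally show ?thesis .
qed

text \<open>The factor \<open>g\<close> carries a cut-off in the second coordinate: the constant 1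
  gives plain domination, the indicator of large w gives the tail.\<close>

lemma scaled_density_le_dominant:
  assumes T: "T > 0" and good: "fst (fst p) \<noteq> snd (fst p)" and q: "R \<le> q"
    and f: "\<And>x. f x \<le> ennreal (C x ^ q) * g (snd x)"
  shows "scaled_density f T S p \<le> dominant p * g (snd (snd p))"
proof -
  let ?z = "fst (fst p) - snd (fst p)" and ?w = "snd (snd p)"
  have "ennreal (T powr \<beta>) * f (T *\<^sub>R ?z, ?w) \<le> ennreal (T powr \<beta>) * (ennreal (C (T *\<^sub>R ?z, ?w) ^ q) * g ?w)"
    using f[of "(T *\<^sub>R ?z, ?w)"] by (intro mult_left_mono) auto
  also have "\<dots> = ennreal (T powr \<beta> * C (T *\<^sub>R ?z, ?w) ^ q) * g ?w"
    using C_nonneg by (simp add: ennreal_mult' mult.assoc)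
  also have "\<dots> \<le> ennreal (norm ?z powr - \<beta> * (K ^ R * h ?w ^ R)) * g ?w"
    using good by (intro mult_right_mono ennreal_leI C_power_bound T q) auto
  finally have *: "ennreal (T powr \<beta>) * f (T *\<^sub>R ?z, ?w) \<le> ennreal (norm ?z powr - \<beta> * (K ^ R * h ?w ^ R)) * g ?w" .
  have "scaled_density f T S p \<le> indicator D1 (fst (fst p)) * indicator D1 (snd (fst p)) * indicator D2 (fst (snd p)) * (ennreal (T powr \<beta>) * f (T *\<^sub>R ?z, ?w))"
    unfolding scaled_density_def by (auto simp: indicator_def)
  also have "\<dots> \<le> indicator D1 (fst (fst p)) * indicator D1 (snd (fst p)) * indicator D2 (fst (snd p)) * (ennreal (norm ?z powr - \<beta> * (K ^ R * h ?w ^ R)) * g ?w)"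
    by (intro mult_left_mono *) auto
  also have "\<dots> = dominant p * g ?w"
    unfolding dominant_def using K_nonneg h_pos[of ?w] by (simp add: ennreal_mult' mult_ac)
  finally show ?thesis .
qed

definition limit_density :: "nat \<Rightarrow> ('a \<times> 'a) \<times> ('b \<times> 'b) \<Rightarrow> ennreal" where
  "limit_density q p = indicator D1 (fst (fst p)) * indicator D1 (snd (fst p)) * (indicator D2 (fst (snd p)) *
     ennreal (if q = R then (M * h (snd (snd p)) * norm (fst (fst p) - snd (fst p)) powr - \<rho>) ^ R else 0))"

lemma limit_density_measurable [measurable]: "limit_density q \<in> borel_measurable borel"
  unfolding limit_density_def[abs_def] by measurable

text \<open>Splitting off C^(q - R) leaves the power law to the factor C^R. The remaining factor is
  constantly 1 for q = R and tends to 0 otherwise, since C tends to 0 along the ray.\<close>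

lemma C_power_lim:
  assumes z: "z \<noteq> 0" and q: "R \<le> q"
  shows "((\<lambda>t. t powr \<beta> * C (t *\<^sub>R z, w) ^ q) \<longlongrightarrow> (if q = R then (M * h w * norm z powr - \<rho>) ^ R else 0)) at_top"
proof -
  let ?L = "M * h w * norm z powr - \<rho>"
  have 1: "((\<lambda>t. (t powr \<rho> * C (t *\<^sub>R z, w)) ^ R * C (t *\<^sub>R z, w) ^ (q - R)) \<longlongrightarrow> ?L ^ R * (if q = R then 1 else 0)) at_top"
  proof (rule tendsto_mult[OF tendsto_power[OF C_lim[OF z]]])
    show "((\<lambda>t. C (t *\<^sub>R z, w) ^ (q - R)) \<longlongrightarrow> (if q = R then 1 else 0)) at_top"
    proof (cases "q = R")
      case False
      have "((\<lambda>t. (t powr \<rho> * C (t *\<^sub>R z, w)) * t powr - \<rho>) \<longlongrightarrow> ?L * 0) at_top"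
        by (rule tendsto_mult[OF C_lim[OF z] tendsto_neg_powr]) (use rho_pos in \<open>auto simp: filterlim_ident\<close>)
      then have f0: "((\<lambda>t. (t powr \<rho> * C (t *\<^sub>R z, w)) * t powr - \<rho>) \<longlongrightarrow> 0) at_top" by (simp only: mult_zero_right)
      have "\<forall>\<^sub>F t in at_top. (t powr \<rho> * C (t *\<^sub>R z, w)) * t powr - \<rho> = C (t *\<^sub>R z, w)"
        using eventually_gt_at_top[of "0::real"]
      proof eventually_elim
        case (elim t)
        then have "t powr \<rho> * t powr - \<rho> = 1" by (simp add: powr_add[symmetric])
        then show ?case by (simp add: mult.commute mult.left_commute)
      qed
      from Lim_transform_eventually[OF f0 this] have "((\<lambda>t. C (t *\<^sub>R z, w)) \<longlongrightarrow> 0) at_top" .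
      then show ?thesis using False q by simp
    qed simp
  qed
  have ev: "\<forall>\<^sub>F t in at_top. (t powr \<rho> * C (t *\<^sub>R z, w)) ^ R * C (t *\<^sub>R z, w) ^ (q - R) = t powr \<beta> * C (t *\<^sub>R z, w) ^ q"
    using eventually_gt_at_top[of "0::real"]
  proof eventually_elim
    case (elim t)
    have "C (t *\<^sub>R z, w) ^ q = C (t *\<^sub>R z, w) ^ R * C (t *\<^sub>R z, w) ^ (q - R)"
      using q by (simp add: power_add[symmetric])
    then show ?case using elim by (simp add: power_mult_distrib powr_rho_power)
  qed
  have "?L ^ R * (if q = R then 1 else 0) = (if q = R then ?L ^ R else 0)" by simp
  then show ?thesis using Lim_transform_eventually[OF 1 ev] by simp
qed

context
  fixes T S :: "nat \<Rightarrow> real"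
  assumes T_pos: "\<And>n. T n > 0" and S_pos: "\<And>n. S n > 0"
    and T_lim: "filterlim T at_top sequentially" and S_lim: "filterlim S at_top sequentially"
begin

text \<open>Off the frontier the point lies in the interior of D2 or in its open complement, so a
  vanishing shift eventually does not change the indicator.\<close>

lemma indicator_shift_lim:
  assumes "a \<notin> frontier D2"
  shows "(\<lambda>n. indicator D2 (a - (1 / S n) *\<^sub>R w) :: ennreal) \<longlonglongrightarrow> indicator D2 a"
proof -
  have "(\<lambda>n. 1 / S n) \<longlonglongrightarrow> 0" using tendsto_inverse_0_at_top[OF S_lim] by (simp add: inverse_eq_divide)
  then have "(\<lambda>n. a - (1 / S n) *\<^sub>R w) \<longlonglongrightarrow> a - 0 *\<^sub>R w" by (intro tendsto_intros)
  then have lim: "(\<lambda>n. a - (1 / S n) *\<^sub>R w) \<longlonglongrightarrow> a" by simp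
  have "\<forall>\<^sub>F n in sequentially. indicator D2 (a - (1 / S n) *\<^sub>R w) = (indicator D2 a :: ennreal)"
  proof (cases "a \<in> D2")
    case True
    then have "a \<in> interior D2" using assms closure_subset[of D2] by (auto simp: frontier_def)
    from topological_tendstoD[OF lim open_interior this] show ?thesis
      by eventually_elim (use True interior_subset in \<open>auto simp: indicator_def\<close>)
  next
    case False
    then have "a \<in> - D2" by simp
    from topological_tendstoD[OF lim _ this] show ?thesis
      using compact_imp_closed[OF D2_compact] False
      by (simp add: open_Compl) (auto elim!: eventually_mono simp: indicator_def)
  qed
  then show ?thesis by (rule tendsto_eventually)
qed

lemma scaled_density_lim:
  assumes good: "fst (fst p) \<noteq> snd (fst p)" "fst (snd p) \<notin> frontier D2" and q: "R \<le> q"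
  shows "(\<lambda>n. scaled_density (\<lambda>x. ennreal (C x ^ q)) (T n) (S n) p) \<longlonglongrightarrow> limit_density q p"
proof -
  let ?z = "fst (fst p) - snd (fst p)" and ?w = "snd (snd p)" and ?a = "fst (snd p)"
  let ?L = "if q = R then (M * h ?w * norm ?z powr - \<rho>) ^ R else 0"
  have "(\<lambda>n. T n powr \<beta> * C (T n *\<^sub>R ?z, ?w) ^ q) \<longlonglongrightarrow> ?L"
    using filterlim_compose[OF C_power_lim[of ?z q ?w] T_lim] good q by simp
  then have 1: "(\<lambda>n. ennreal (T n powr \<beta> * C (T n *\<^sub>R ?z, ?w) ^ q)) \<longlonglongrightarrow> ennreal ?L" by (rule tendsto_ennrealI)
  have "(\<lambda>n. indicator D2 (?a - (1 / S n) *\<^sub>R ?w) * ennreal (T n powr \<beta> * C (T n *\<^sub>R ?z, ?w) ^ q)) \<longlonglongrightarrow> indicator D2 ?a * ennreal ?L"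
    by (rule tendsto_mult_ennreal[OF indicator_shift_lim[OF good(2)] 1]) (auto simp: indicator_def)
  then have "(\<lambda>n. (indicator D1 (fst (fst p)) * indicator D1 (snd (fst p)) * indicator D2 ?a) * (indicator D2 (?a - (1 / S n) *\<^sub>R ?w) * ennreal (T n powr \<beta> * C (T n *\<^sub>R ?z, ?w) ^ q)))
     \<longlonglongrightarrow> (indicator D1 (fst (fst p)) * indicator D1 (snd (fst p)) * indicator D2 ?a) * (indicator D2 ?a * ennreal ?L)"
    by (rule tendsto_mult_ennreal[OF tendsto_const]) (auto simp: indicator_def)
  moreover have "(indicator D1 (fst (fst p)) * indicator D1 (snd (fst p)) * indicator D2 ?a) * (indicator D2 (?a - (1 / S n) *\<^sub>R ?w) * ennreal (T n powr \<beta> * C (T n *\<^sub>R ?z, ?w) ^ q))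
      = scaled_density (\<lambda>x. ennreal (C x ^ q)) (T n) (S n) p" for n
    unfolding scaled_density_def using C_nonneg by (simp add: ennreal_mult' mult_ac)
  moreover have "(indicator D1 (fst (fst p)) * indicator D1 (snd (fst p)) * indicator D2 ?a) * (indicator D2 ?a * ennreal ?L) = limit_density q p"
    unfolding limit_density_def by (simp add: indicator_def)
  ultimately show ?thesis by simp
qed

lemma scaled_density_integral_lim:
  assumes q: "R \<le> q"
  shows "(\<lambda>n. \<integral>\<^sup>+p. scaled_density (\<lambda>x. ennreal (C x ^ q)) (T n) (S n) p \<partial>lborel) \<longlonglongrightarrow> (\<integral>\<^sup>+p. limit_density q p \<partial>lborel)"
proof (rule nn_integral_dominated_convergence[where w=dominant])
  show "AE p in lborel. scaled_density (\<lambda>x. ennreal (C x ^ q)) (T n) (S n) p \<le> dominant p" for n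
    using AE_good by eventually_elim (use scaled_density_le_dominant[OF T_pos, of _ q "\<lambda>x. ennreal (C x ^ q)" "\<lambda>_. 1"] q in auto)
  show "(\<integral>\<^sup>+p. dominant p \<partial>lborel) < \<infinity>" by (rule dominant_finite)
  show "AE p in lborel. (\<lambda>n. scaled_density (\<lambda>x. ennreal (C x ^ q)) (T n) (S n) p) \<longlonglongrightarrow> limit_density q p"
    using AE_good by eventually_elim (use scaled_density_lim q in auto)
qed measurable

end

text \<open>The domination passes to the limit along the concrete scales T_n = S_n = n + 1.\<close>

lemma limit_density_le_dominant_finite:
  assumes "R \<le> q" shows "(\<integral>\<^sup>+p. limit_density q p \<partial>lborel) < \<infinity>"
proof -
  have p: "\<And>n. real (Suc n) > 0" by simp
  have l: "filterlim (\<lambda>n. real (Suc n)) at_top sequentially"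
    by (intro filterlim_compose[OF filterlim_real_sequentially] filterlim_Suc)
  have "(\<integral>\<^sup>+p. limit_density q p \<partial>lborel) \<le> (\<integral>\<^sup>+p. dominant p \<partial>lborel)"
  proof (rule LIMSEQ_le_const2[OF scaled_density_integral_lim[OF p p l l assms]], intro exI[of _ 0] allI impI nn_integral_mono_AE)
    show "AE p in lborel. scaled_density (\<lambda>x. ennreal (C x ^ q)) (real (Suc n)) (real (Suc n)) p \<le> dominant p" for n
      using AE_good by eventually_elim (use scaled_density_le_dominant[of "real (Suc n)" _ q "\<lambda>x. ennreal (C x ^ q)" "\<lambda>_. 1"] assms in auto)
  qed
  then show ?thesis using dominant_finite by (rule le_less_trans)
qed

text \<open>Its value is M^R times the Riesz energy of D1, the volume of D2 and the integral of
  h^R.\<close>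

definition ell :: real where "ell = enn2real (\<integral>\<^sup>+p. limit_density R p \<partial>lborel)"

text \<open>Off the diagonal the limit density is strictly positive where u, v lie in D1 and a in
  D2. A vanishing integral would therefore make a nonempty open set null.\<close>

lemma ell_pos: "0 < ell"
proof -
  obtain u where u: "u \<in> interior D1" using D1_int by auto
  obtain a where a: "a \<in> interior D2" using D2_int by auto
  have "(\<integral>\<^sup>+p. limit_density R p \<partial>lborel) \<noteq> 0"
  proof
    assume "(\<integral>\<^sup>+p. limit_density R p \<partial>lborel) = 0"
    then have "AE p in lborel. limit_density R p = 0" by (subst (asm) nn_integral_0_iff_AE) measurable
    then have "AE p in (lborel :: (('a \<times> 'a) \<times> ('b \<times> 'b)) measure). p \<notin> (interior D1 \<times> interior D1) \<times> (interior D2 \<times> UNIV)"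
      using AE_good
    proof eventually_elim
      case (elim p)
      show ?case
      proof
        assume p: "p \<in> (interior D1 \<times> interior D1) \<times> (interior D2 \<times> UNIV)"
        then have "fst (fst p) \<in> D1" "snd (fst p) \<in> D1" "fst (snd p) \<in> D2" by (auto dest: subsetD[OF interior_subset])
        moreover have "0 < (M * h (snd (snd p)) * norm (fst (fst p) - snd (fst p)) powr - \<rho>) ^ R"
          using elim M_pos h_pos by (intro zero_less_power mult_pos_pos) auto
        ultimately show False using elim M_pos h_pos[of "snd (snd p)"] by (auto simp: limit_density_def)
      qed
    qed
    moreover have op: "open ((interior D1 \<times> interior D1) \<times> (interior D2 \<times> (UNIV :: 'b set)))" by (intro open_Times) auto
    ultimately have "(interior D1 \<times> interior D1) \<times> (interior D2 \<times> (UNIV :: 'b set)) \<in> null_sets lborel"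
      by (subst (asm) AE_iff_null_sets[symmetric]) auto
    then have "negligible ((interior D1 \<times> interior D1) \<times> (interior D2 \<times> (UNIV :: 'b set)))"
      unfolding negligible_iff_null_sets by (rule null_sets_completionI)
    then show False using open_not_negligible[OF op] u a by auto
  qed
  then show ?thesis unfolding ell_def using limit_density_le_dominant_finite[of R] by (simp add: enn2real_positive_iff zero_less_iff_neq_zero)
qed

definition energy :: "nat \<Rightarrow> real \<Rightarrow> real \<Rightarrow> real" where
  "energy q T S = (LINT p|(mu (window T S) \<Otimes>\<^sub>M mu (window T S)). C (fst p - snd p) ^ q)"

lemma energy_eq:
  assumes "T > 0" "S > 0"
  shows "ennreal (energy q T S) = ennreal (growth T S) * (\<integral>\<^sup>+p. scaled_density (\<lambda>x. ennreal (C x ^ q)) T S p \<partial>lborel)" "0 \<le> energy q T S"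
proof -
  let ?N = "mu (window T S)"
  interpret N: finite_measure ?N by (rule finite_measure_mu[OF window_compact])
  interpret NN: finite_measure "?N \<Otimes>\<^sub>M ?N" by (intro finite_measure_pair_measure finite_measure_mu[OF window_compact])
  have i: "integrable (?N \<Otimes>\<^sub>M ?N) (\<lambda>p. C (fst p - snd p) ^ q)"
    by (rule NN.integrable_const_bound[of _ 1]) (auto simp: C_nonneg C_le_1 power_abs power_le_one)
  have "ennreal (energy q T S) = (\<integral>\<^sup>+p. ennreal (C (fst p - snd p) ^ q) \<partial>(?N \<Otimes>\<^sub>M ?N))"
    unfolding energy_def by (rule nn_integral_eq_integral[OF i, symmetric]) (auto simp: C_nonneg)
  also have "\<dots> = (\<integral>\<^sup>+x. \<integral>\<^sup>+y. ennreal (C (x - y) ^ q) \<partial>?N \<partial>?N)"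
    by (subst N.nn_integral_fst[symmetric]) auto
  also have "\<dots> = ennreal (growth T S) * (\<integral>\<^sup>+p. scaled_density (\<lambda>x. ennreal (C x ^ q)) T S p \<partial>lborel)"
    by (rule scaled_pair_scaled_density[OF assms]) measurable
  finally show "ennreal (energy q T S) = ennreal (growth T S) * (\<integral>\<^sup>+p. scaled_density (\<lambda>x. ennreal (C x ^ q)) T S p \<partial>lborel)" .
  show "0 \<le> energy q T S" unfolding energy_def by (intro integral_nonneg_AE AE_I2) (auto simp: C_nonneg)
qed

text \<open>The case q = R gives the order of the variance; the case q = R + 1 bounds everything
  beyond the R-th chaos.\<close>

theorem energy_asymptotics:
  assumes "\<And>n. T n > 0" "\<And>n. S n > 0"
    and "filterlim T at_top sequentially" "filterlim S at_top sequentially" and q: "R \<le> q"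
  shows "(\<lambda>n. energy q (T n) (S n) / growth (T n) (S n)) \<longlonglongrightarrow> (if q = R then ell else 0)"
proof -
  let ?J = "\<lambda>n. \<integral>\<^sup>+p. scaled_density (\<lambda>x. ennreal (C x ^ q)) (T n) (S n) p \<partial>lborel"
  have lim: "(\<lambda>n. enn2real (?J n)) \<longlonglongrightarrow> enn2real (\<integral>\<^sup>+p. limit_density q p \<partial>lborel)"
    using scaled_density_integral_lim[OF assms] limit_density_le_dominant_finite[OF q] by (intro tendsto_enn2real) auto
  have e: "energy q (T n) (S n) / growth (T n) (S n) = enn2real (?J n)" for n
  proof -
    have v: "growth (T n) (S n) > 0" using growth_pos assms by simp
    have "energy q (T n) (S n) = enn2real (ennreal (growth (T n) (S n)) * ?J n)"
      using energy_eq[of "T n" "S n" q] assms by (metis enn2real_ennreal)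
    then show ?thesis using v by (simp add: enn2real_mult)
  qed
  have "enn2real (\<integral>\<^sup>+p. limit_density q p \<partial>lborel) = (if q = R then ell else 0)"
    by (simp add: ell_def limit_density_def)
  then show ?thesis using lim unfolding e by simp
qed

end

section \<open>Negligibility of the contractions\<close>

text \<open>A Young-type inequality with a small constant on a chosen factor, by comparing q with p
  / eta. At least one power of p is needed so that eta^r <= eta.\<close>

lemma power_mult_power_weighted:
  fixes p q \<eta> :: real
  assumes "0 \<le> p" "0 \<le> q" "1 \<le> r" "0 < \<eta>" "\<eta> \<le> 1"
  shows "p ^ r * q ^ s \<le> (1 / \<eta>) ^ (r + s) * p ^ (r + s) + \<eta> * q ^ (r + s)"
proof (cases "q \<le> p / \<eta>")
  case True
  have "p ^ r * q ^ s \<le> p ^ r * (p / \<eta>) ^ s" using assms True by (intro mult_left_mono power_mono) auto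
  also have "\<dots> = (1 / \<eta>) ^ s * p ^ (r + s)" by (simp add: power_add power_divide)
  also have "\<dots> \<le> (1 / \<eta>) ^ (r + s) * p ^ (r + s)"
    using assms by (intro mult_right_mono power_increasing) auto
  finally show ?thesis using assms by (simp add: add_increasing2)
next
  case False
  then have "p \<le> \<eta> * q" using assms by (simp add: field_simps)
  then have "p ^ r * q ^ s \<le> (\<eta> * q) ^ r * q ^ s" using assms by (intro mult_right_mono power_mono) auto
  also have "\<dots> = \<eta> ^ r * q ^ (r + s)" by (simp add: power_add power_mult_distrib)
  also have "\<dots> \<le> \<eta> ^ 1 * q ^ (r + s)" using assms by (intro mult_right_mono power_decreasing) auto
  finally show ?thesis using assms by (simp add: add_increasing)
qed

section \<open>Integrals over four points\<close>

context
  fixes N :: "'x measure"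
  assumes N: "finite_measure N"
begin

lemma four_fold_12_34:
  fixes f g :: "'x \<times> 'x \<Rightarrow> ennreal"
  assumes [measurable]: "f \<in> borel_measurable (N \<Otimes>\<^sub>M N)" "g \<in> borel_measurable (N \<Otimes>\<^sub>M N)"
  shows "(\<integral>\<^sup>+q. f (fst q) * g (snd q) \<partial>((N \<Otimes>\<^sub>M N) \<Otimes>\<^sub>M (N \<Otimes>\<^sub>M N)))
     = (\<integral>\<^sup>+p. f p \<partial>(N \<Otimes>\<^sub>M N)) * (\<integral>\<^sup>+p. g p \<partial>(N \<Otimes>\<^sub>M N))"
proof -
  interpret NN: finite_measure "N \<Otimes>\<^sub>M N" by (intro finite_measure_pair_measure N)
  have "(\<integral>\<^sup>+q. f (fst q) * g (snd q) \<partial>((N \<Otimes>\<^sub>M N) \<Otimes>\<^sub>M (N \<Otimes>\<^sub>M N))) = (\<integral>\<^sup>+p. \<integral>\<^sup>+p'. f p * g p' \<partial>(N \<Otimes>\<^sub>M N) \<partial>(N \<Otimes>\<^sub>M N))"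
    by (subst NN.nn_integral_fst[symmetric]) auto
  also have "\<dots> = (\<integral>\<^sup>+p. f p \<partial>(N \<Otimes>\<^sub>M N)) * (\<integral>\<^sup>+p. g p \<partial>(N \<Otimes>\<^sub>M N))"
    by (simp add: nn_integral_cmult nn_integral_multc)
  finally show ?thesis .
qed

lemma four_fold_13_24:
  fixes f g :: "'x \<times> 'x \<Rightarrow> ennreal"
  assumes [measurable]: "f \<in> borel_measurable (N \<Otimes>\<^sub>M N)" "g \<in> borel_measurable (N \<Otimes>\<^sub>M N)"
  shows "(\<integral>\<^sup>+q. f (fst (fst q), fst (snd q)) * g (snd (fst q), snd (snd q)) \<partial>((N \<Otimes>\<^sub>M N) \<Otimes>\<^sub>M (N \<Otimes>\<^sub>M N)))
     = (\<integral>\<^sup>+p. f p \<partial>(N \<Otimes>\<^sub>M N)) * (\<integral>\<^sup>+p. g p \<partial>(N \<Otimes>\<^sub>M N))"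
proof -
  interpret N: finite_measure N by (rule N)
  interpret NN: finite_measure "N \<Otimes>\<^sub>M N" by (intro finite_measure_pair_measure N)
  have "(\<integral>\<^sup>+q. f (fst (fst q), fst (snd q)) * g (snd (fst q), snd (snd q)) \<partial>((N \<Otimes>\<^sub>M N) \<Otimes>\<^sub>M (N \<Otimes>\<^sub>M N)))
    = (\<integral>\<^sup>+p. \<integral>\<^sup>+p'. f (fst p, fst p') * g (snd p, snd p') \<partial>(N \<Otimes>\<^sub>M N) \<partial>(N \<Otimes>\<^sub>M N))"
    by (subst NN.nn_integral_fst[symmetric]) auto
  also have "\<dots> = (\<integral>\<^sup>+p. \<integral>\<^sup>+x3. \<integral>\<^sup>+x4. f (fst p, x3) * g (snd p, x4) \<partial>N \<partial>N \<partial>(N \<Otimes>\<^sub>M N))"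
    by (intro nn_integral_cong, subst N.nn_integral_fst[symmetric]) auto
  also have "\<dots> = (\<integral>\<^sup>+p. (\<integral>\<^sup>+x3. f (fst p, x3) \<partial>N) * (\<integral>\<^sup>+x4. g (snd p, x4) \<partial>N) \<partial>(N \<Otimes>\<^sub>M N))"
    by (intro nn_integral_cong) (simp add: nn_integral_cmult nn_integral_multc)
  also have "\<dots> = (\<integral>\<^sup>+x1. \<integral>\<^sup>+x2. (\<integral>\<^sup>+x3. f (x1, x3) \<partial>N) * (\<integral>\<^sup>+x4. g (x2, x4) \<partial>N) \<partial>N \<partial>N)"
    by (subst N.nn_integral_fst[symmetric]) auto
  also have "\<dots> = (\<integral>\<^sup>+x1. \<integral>\<^sup>+x3. f (x1, x3) \<partial>N \<partial>N) * (\<integral>\<^sup>+x2. \<integral>\<^sup>+x4. g (x2, x4) \<partial>N \<partial>N)"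
    by (simp add: nn_integral_cmult nn_integral_multc)
  finally show ?thesis by (simp add: N.nn_integral_fst)
qed

text \<open>Points 3 and 4 are integrated out first for a fixed point 1; uniformity of the bound
  \<open>L\<close> in that point decouples the rest.\<close>

lemma four_fold_12_134:
  fixes f :: "'x \<times> 'x \<Rightarrow> ennreal" and g :: "'x \<Rightarrow> 'x \<times> 'x \<Rightarrow> ennreal"
  assumes [measurable]: "f \<in> borel_measurable (N \<Otimes>\<^sub>M N)" "(\<lambda>z. g (fst z) (snd z)) \<in> borel_measurable (N \<Otimes>\<^sub>M (N \<Otimes>\<^sub>M N))"
    and L: "\<And>x. x \<in> space N \<Longrightarrow> (\<integral>\<^sup>+p. g x p \<partial>(N \<Otimes>\<^sub>M N)) \<le> L"
  shows "(\<integral>\<^sup>+q. f (fst q) * g (fst (fst q)) (snd q) \<partial>((N \<Otimes>\<^sub>M N) \<Otimes>\<^sub>M (N \<Otimes>\<^sub>M N)))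
     \<le> (\<integral>\<^sup>+p. f p \<partial>(N \<Otimes>\<^sub>M N)) * L"
proof -
  interpret NN: finite_measure "N \<Otimes>\<^sub>M N" by (intro finite_measure_pair_measure N)
  have m1: "(\<lambda>q. (fst (fst q), snd q)) \<in> measurable ((N \<Otimes>\<^sub>M N) \<Otimes>\<^sub>M (N \<Otimes>\<^sub>M N)) (N \<Otimes>\<^sub>M (N \<Otimes>\<^sub>M N))"
    by measurable
  have [measurable]: "(\<lambda>q. g (fst (fst q)) (snd q)) \<in> borel_measurable ((N \<Otimes>\<^sub>M N) \<Otimes>\<^sub>M (N \<Otimes>\<^sub>M N))"
    using measurable_compose[OF m1 assms(2)] by simp
  have gm: "g x \<in> borel_measurable (N \<Otimes>\<^sub>M N)" if "x \<in> space N" for x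
    using measurable_compose[OF measurable_Pair1'[OF that] assms(2)] by simp
  have "(\<integral>\<^sup>+q. f (fst q) * g (fst (fst q)) (snd q) \<partial>((N \<Otimes>\<^sub>M N) \<Otimes>\<^sub>M (N \<Otimes>\<^sub>M N)))
    = (\<integral>\<^sup>+p. \<integral>\<^sup>+p'. f p * g (fst p) p' \<partial>(N \<Otimes>\<^sub>M N) \<partial>(N \<Otimes>\<^sub>M N))"
    by (subst NN.nn_integral_fst[symmetric]) auto
  also have "\<dots> = (\<integral>\<^sup>+p. f p * (\<integral>\<^sup>+p'. g (fst p) p' \<partial>(N \<Otimes>\<^sub>M N)) \<partial>(N \<Otimes>\<^sub>M N))"
    by (intro nn_integral_cong nn_integral_cmult gm) (auto simp: space_pair_measure)
  also have "\<dots> \<le> (\<integral>\<^sup>+p. f p * L \<partial>(N \<Otimes>\<^sub>M N))"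
    by (intro nn_integral_mono mult_left_mono L) (auto simp: space_pair_measure)
  also have "\<dots> = (\<integral>\<^sup>+p. f p \<partial>(N \<Otimes>\<^sub>M N)) * L" by (rule nn_integral_multc) simp
  finally show ?thesis .
qed

text \<open>Exchanging the points 3 and 4 turns the crossing pair 13, 24 into 14, 23, so only one of
  the two kinds of contraction terms has to be estimated.\<close>

lemma four_fold_swap:
  fixes F :: "('x \<times> 'x) \<times> ('x \<times> 'x) \<Rightarrow> ennreal"
  assumes [measurable]: "F \<in> borel_measurable ((N \<Otimes>\<^sub>M N) \<Otimes>\<^sub>M (N \<Otimes>\<^sub>M N))"
  shows "(\<integral>\<^sup>+q. F (fst q, (snd (snd q), fst (snd q))) \<partial>((N \<Otimes>\<^sub>M N) \<Otimes>\<^sub>M (N \<Otimes>\<^sub>M N)))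
     = (\<integral>\<^sup>+q. F q \<partial>((N \<Otimes>\<^sub>M N) \<Otimes>\<^sub>M (N \<Otimes>\<^sub>M N)))"
proof -
  interpret N: finite_measure N by (rule N)
  interpret NN: finite_measure "N \<Otimes>\<^sub>M N" by (intro finite_measure_pair_measure N)
  interpret P: pair_sigma_finite N N ..
  have "(\<integral>\<^sup>+q. F (fst q, (snd (snd q), fst (snd q))) \<partial>((N \<Otimes>\<^sub>M N) \<Otimes>\<^sub>M (N \<Otimes>\<^sub>M N)))
     = (\<integral>\<^sup>+p. \<integral>\<^sup>+p'. F (p, (snd p', fst p')) \<partial>(N \<Otimes>\<^sub>M N) \<partial>(N \<Otimes>\<^sub>M N))"
    by (subst NN.nn_integral_fst[symmetric]) auto
  also have "\<dots> = (\<integral>\<^sup>+p. \<integral>\<^sup>+x. \<integral>\<^sup>+y. F (p, (y, x)) \<partial>N \<partial>N \<partial>(N \<Otimes>\<^sub>M N))"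
    by (intro nn_integral_cong, subst N.nn_integral_fst[symmetric]) (auto simp: space_pair_measure)
  also have "\<dots> = (\<integral>\<^sup>+p. \<integral>\<^sup>+y. \<integral>\<^sup>+x. F (p, (y, x)) \<partial>N \<partial>N \<partial>(N \<Otimes>\<^sub>M N))"
    by (intro nn_integral_cong P.Fubini') (auto simp: space_pair_measure case_prod_beta')
  also have "\<dots> = (\<integral>\<^sup>+p. \<integral>\<^sup>+p'. F (p, p') \<partial>(N \<Otimes>\<^sub>M N) \<partial>(N \<Otimes>\<^sub>M N))"
    by (intro nn_integral_cong N.nn_integral_fst) (auto simp: space_pair_measure)
  also have "\<dots> = (\<integral>\<^sup>+q. F q \<partial>((N \<Otimes>\<^sub>M N) \<Otimes>\<^sub>M (N \<Otimes>\<^sub>M N)))"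
    by (rule NN.nn_integral_fst) simp
  finally show ?thesis .
qed

end

section \<open>Tail and strip estimates for the contraction terms\<close>

context gneiting_kernel
begin

definition dominant_tail :: "real \<Rightarrow> ennreal" where
  "dominant_tail A = (\<integral>\<^sup>+p. dominant p * indicator {w. A < norm w} (snd (snd p)) \<partial>lborel)"

lemma dominant_tail_finite: "dominant_tail A < \<infinity>"
proof -
  have "dominant_tail A \<le> (\<integral>\<^sup>+p. dominant p \<partial>lborel)" unfolding dominant_tail_def
    by (intro nn_integral_mono) (auto simp: indicator_def)
  then show ?thesis using dominant_finite by (rule le_less_trans)
qed

lemma dominant_tail_lim: "(\<lambda>n. enn2real (dominant_tail (real n))) \<longlonglongrightarrow> 0"
proof -
  have "(\<lambda>n. dominant_tail (real n)) \<longlonglongrightarrow> (\<integral>\<^sup>+p. 0 \<partial>(lborel :: (('a \<times> 'a) \<times> ('b \<times> 'b)) measure))"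
    unfolding dominant_tail_def
  proof (rule nn_integral_dominated_convergence[where w=dominant])
    show "AE p in lborel. dominant p * indicator {w. real n < norm w} (snd (snd p)) \<le> dominant p" for n
      by (intro AE_I2) (auto simp: indicator_def)
    show "AE p in lborel. (\<lambda>n. dominant p * indicator {w. real n < norm w} (snd (snd p))) \<longlonglongrightarrow> 0"
    proof (intro AE_I2 tendsto_eventually)
      fix p :: "('a \<times> 'a) \<times> ('b \<times> 'b)"
      obtain m where m: "norm (snd (snd p)) \<le> real m" using real_arch_simple by blast
      show "\<forall>\<^sub>F n in sequentially. dominant p * indicator {w. real n < norm w} (snd (snd p)) = 0"
        unfolding eventually_sequentially using m by (intro exI[of _ m]) (auto simp: indicator_def)
    qed
    show "(\<integral>\<^sup>+p. dominant p \<partial>lborel) < \<infinity>" by (rule dominant_finite)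
  qed measurable
  then have "(\<lambda>n. dominant_tail (real n)) \<longlonglongrightarrow> ennreal 0" by simp
  from tendsto_enn2real[OF this] show ?thesis by simp
qed

lemma pair_integral_dominant_tail:
  assumes T: "T > 0" and S: "S > 0"
  shows "(\<integral>\<^sup>+x. \<integral>\<^sup>+y. ennreal (C (x - y) ^ R) * indicator {w. A < norm w} (snd (x - y)) \<partial>mu (window T S) \<partial>mu (window T S))
     \<le> ennreal (growth T S) * dominant_tail A"
proof -
  let ?f = "\<lambda>x :: 'a \<times> 'b. ennreal (C x ^ R) * indicator {w. A < norm w} (snd x)"
  have "(\<integral>\<^sup>+x. \<integral>\<^sup>+y. ?f (x - y) \<partial>mu (window T S) \<partial>mu (window T S)) = ennreal (growth T S) * (\<integral>\<^sup>+p. scaled_density ?f T S p \<partial>lborel)"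
    by (rule scaled_pair_scaled_density[OF T S]) measurable
  also have "\<dots> \<le> ennreal (growth T S) * dominant_tail A"
    unfolding dominant_tail_def
  proof (intro mult_left_mono nn_integral_mono_AE)
    show "AE p in lborel. scaled_density ?f T S p \<le> dominant p * indicator {w. A < norm w} (snd (snd p))"
      using AE_good by eventually_elim (use scaled_density_le_dominant[OF T, of _ R ?f "\<lambda>w. indicator {w. A < norm w} w"] in auto)
  qed auto
  finally show ?thesis .
qed

lemma pair_integral_le:
  assumes T: "T > 0" and S: "S > 0"
  shows "(\<integral>\<^sup>+x. \<integral>\<^sup>+y. ennreal (C (x - y) ^ R) \<partial>mu (window T S) \<partial>mu (window T S)) \<le> ennreal (growth T S) * (\<integral>\<^sup>+p. dominant p \<partial>lborel)"
proof -
  let ?f = "\<lambda>x :: 'a \<times> 'b. ennreal (C x ^ R)"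
  have "(\<integral>\<^sup>+x. \<integral>\<^sup>+y. ?f (x - y) \<partial>mu (window T S) \<partial>mu (window T S)) = ennreal (growth T S) * (\<integral>\<^sup>+p. scaled_density ?f T S p \<partial>lborel)"
    by (rule scaled_pair_scaled_density[OF T S]) measurable
  also have "\<dots> \<le> ennreal (growth T S) * (\<integral>\<^sup>+p. dominant p \<partial>lborel)"
  proof (intro mult_left_mono nn_integral_mono_AE)
    show "AE p in lborel. scaled_density ?f T S p \<le> dominant p"
      using AE_good by eventually_elim (use scaled_density_le_dominant[OF T, of _ R ?f "\<lambda>_. 1"] in auto)
  qed auto
  finally show ?thesis .
qed

text \<open>The integral of \<open>dominant\<close> with the volume of D2 replaced by that of a ball
  of radius A.\<close>

definition local_bound :: "real \<Rightarrow> ennreal" where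
  "local_bound A = riesz_energy * (emeasure lborel (cball (0::'b) A) * (ennreal (K ^ R) * h_mass))"

lemma local_bound_finite: "local_bound A < \<infinity>"
  unfolding local_bound_def using riesz_energy_finite h_mass_finite emeasure_bounded_finite[of "cball (0::'b) A"]
  by (simp add: ennreal_mult_less_top)

text \<open>Confining the second coordinate of one point to a ball replaces the factor S^d_2 of the
  growth by the volume of that ball. By translation invariance the bound does not depend on the
  centre, which is what \<open>four_fold_12_134\<close> requires.\<close>

lemma pair_integral_local:
  assumes T: "T > 0" and S: "S > 0"
  shows "(\<integral>\<^sup>+x. \<integral>\<^sup>+y. ennreal (C (x - y) ^ R) * indicator (cball b A) (snd x) \<partial>mu (window T S) \<partial>mu (window T S))
     \<le> ennreal (T powr (2 * real DIM('a) - \<beta>)) * local_bound A"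
proof -
  let ?E = "(\<lambda>y. S *\<^sub>R y) ` D2"
  have [measurable]: "cball b A \<in> sets borel" by simp
  let ?g = "\<lambda>(z, a, b'). ennreal (C (z, a - b') ^ R) * indicator (cball b A) a"
  have eb: "emeasure lborel (cball b A) = emeasure lborel (cball (0::'b) A)"
  proof -
    have "emeasure lborel (cball b A) = (\<integral>\<^sup>+x. indicator (cball b A) x \<partial>lborel)" by simp
    also have "\<dots> = (\<integral>\<^sup>+x. indicator (cball b A) (b - x) \<partial>lborel)" by (rule nn_integral_lborel_reflect) simp
    also have "\<dots> = (\<integral>\<^sup>+x. indicator (cball (0::'b) A) x \<partial>lborel)" by (intro nn_integral_cong) (auto simp: indicator_def dist_norm)
    finally show ?thesis by simp
  qed
  have inner: "ennreal (T powr \<beta>) * (\<integral>\<^sup>+a. \<integral>\<^sup>+b'. indicator ?E a * indicator ?E b' * ?g (T *\<^sub>R z, a, b') \<partial>lborel \<partial>lborel)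
      \<le> ennreal (norm z powr - \<beta>) * (emeasure lborel (cball (0::'b) A) * (ennreal (K ^ R) * h_mass))" if z: "z \<noteq> 0" for z
  proof -
    \<comment> \<open>Both window indicators are dropped: the ball takes over for a, and the decay
      of C in the second coordinate makes the integral over b' finite on the whole space.\<close>
    have "(\<integral>\<^sup>+a. \<integral>\<^sup>+b'. indicator ?E a * indicator ?E b' * ?g (T *\<^sub>R z, a, b') \<partial>lborel \<partial>lborel)
      \<le> (\<integral>\<^sup>+a. indicator (cball b A) a * (\<integral>\<^sup>+b'. ennreal (C (T *\<^sub>R z, a - b') ^ R) \<partial>lborel) \<partial>lborel)"
    proof (rule nn_integral_mono)
      fix a
      have "(\<integral>\<^sup>+b'. indicator ?E a * indicator ?E b' * ?g (T *\<^sub>R z, a, b') \<partial>lborel)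
         \<le> (\<integral>\<^sup>+b'. indicator (cball b A) a * ennreal (C (T *\<^sub>R z, a - b') ^ R) \<partial>lborel)"
        by (intro nn_integral_mono) (auto simp: indicator_def)
      also have "\<dots> = indicator (cball b A) a * (\<integral>\<^sup>+b'. ennreal (C (T *\<^sub>R z, a - b') ^ R) \<partial>lborel)"
        by (rule nn_integral_cmult) measurable
      finally show "(\<integral>\<^sup>+b'. indicator ?E a * indicator ?E b' * ?g (T *\<^sub>R z, a, b') \<partial>lborel)
         \<le> indicator (cball b A) a * (\<integral>\<^sup>+b'. ennreal (C (T *\<^sub>R z, a - b') ^ R) \<partial>lborel)" .
    qed
    also have "\<dots> = (\<integral>\<^sup>+a. indicator (cball b A) a * (\<integral>\<^sup>+w. ennreal (C (T *\<^sub>R z, w) ^ R) \<partial>lborel) \<partial>lborel)"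
    proof -
      have "(\<integral>\<^sup>+b'. ennreal (C (T *\<^sub>R z, a - b') ^ R) \<partial>lborel) = (\<integral>\<^sup>+w. ennreal (C (T *\<^sub>R z, w) ^ R) \<partial>lborel)" for a
      proof -
      have "(\<integral>\<^sup>+b'. ennreal (C (T *\<^sub>R z, a - b') ^ R) \<partial>lborel) = (\<integral>\<^sup>+w. ennreal (C (T *\<^sub>R z, a - (a - w)) ^ R) \<partial>lborel)"
        by (rule nn_integral_lborel_reflect) measurable
      then show ?thesis by simp
      qed
      then show ?thesis by simp
    qed
    also have "\<dots> = emeasure lborel (cball (0::'b) A) * (\<integral>\<^sup>+w. ennreal (C (T *\<^sub>R z, w) ^ R) \<partial>lborel)"
      by (simp add: nn_integral_multc eb)
    finally have "ennreal (T powr \<beta>) * (\<integral>\<^sup>+a. \<integral>\<^sup>+b'. indicator ?E a * indicator ?E b' * ?g (T *\<^sub>R z, a, b') \<partial>lborel \<partial>lborel)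
      \<le> ennreal (T powr \<beta>) * (emeasure lborel (cball (0::'b) A) * (\<integral>\<^sup>+w. ennreal (C (T *\<^sub>R z, w) ^ R) \<partial>lborel))"
      by (intro mult_left_mono) auto
    also have "\<dots> = emeasure lborel (cball (0::'b) A) * (\<integral>\<^sup>+w. ennreal (T powr \<beta>) * ennreal (C (T *\<^sub>R z, w) ^ R) \<partial>lborel)"
      by (subst nn_integral_cmult) (auto simp: mult.left_commute)
    also have "\<dots> \<le> emeasure lborel (cball (0::'b) A) * (\<integral>\<^sup>+w. (ennreal (norm z powr - \<beta>) * ennreal (K ^ R)) * ennreal (h w ^ R) \<partial>lborel)"
    proof (intro mult_left_mono nn_integral_mono)
      fix w
      have "ennreal (T powr \<beta>) * ennreal (C (T *\<^sub>R z, w) ^ R) = ennreal (T powr \<beta> * C (T *\<^sub>R z, w) ^ R)"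
        using C_nonneg by (simp add: ennreal_mult')
      also have "\<dots> \<le> ennreal (norm z powr - \<beta> * (K ^ R * h w ^ R))" by (intro ennreal_leI C_power_bound z T) simp
      also have "\<dots> = (ennreal (norm z powr - \<beta>) * ennreal (K ^ R)) * ennreal (h w ^ R)"
        using K_nonneg h_pos[of w] by (simp add: ennreal_mult' mult.assoc)
      finally show "ennreal (T powr \<beta>) * ennreal (C (T *\<^sub>R z, w) ^ R) \<le> (ennreal (norm z powr - \<beta>) * ennreal (K ^ R)) * ennreal (h w ^ R)" .
    qed auto
    also have "\<dots> = emeasure lborel (cball (0::'b) A) * ((ennreal (norm z powr - \<beta>) * ennreal (K ^ R)) * h_mass)"
      unfolding h_mass_def by (subst nn_integral_cmult) auto
    finally show ?thesis by (simp only: mult_ac)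
  qed
  let ?J = "\<lambda>z. \<integral>\<^sup>+a. \<integral>\<^sup>+b'. indicator ?E a * indicator ?E b' * ?g (T *\<^sub>R z, a, b') \<partial>lborel \<partial>lborel"
  let ?X = "emeasure lborel (cball (0::'b) A) * (ennreal (K ^ R) * h_mass)"
  have gm[measurable]: "?g \<in> borel_measurable borel"
  proof -
    have "(\<lambda>x :: 'a \<times> 'b \<times> 'b. ennreal (C (fst x, fst (snd x) - snd (snd x)) ^ R) * indicator (cball b A) (fst (snd x))) \<in> borel_measurable borel"
      by measurable
    then show ?thesis by (simp add: case_prod_beta')
  qed
  have Jm[measurable]: "?J \<in> borel_measurable borel"
    unfolding case_prod_beta' fst_conv snd_conv by measurable
  have "(\<integral>\<^sup>+x. \<integral>\<^sup>+y. ennreal (C (x - y) ^ R) * indicator (cball b A) (snd x) \<partial>mu (window T S) \<partial>mu (window T S))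
    = (\<integral>\<^sup>+x. \<integral>\<^sup>+y. ?g (fst x - fst y, snd x, snd y) \<partial>mu (window T S) \<partial>mu (window T S))"
    by (intro nn_integral_cong) (simp add: minus_prod_def)
  also have "\<dots> = ennreal (T ^ (2 * DIM('a))) * (\<integral>\<^sup>+u. \<integral>\<^sup>+v. indicator D1 u * indicator D1 v * ?J (u - v) \<partial>lborel \<partial>lborel)"
    unfolding window_def by (rule nn_integral_mu_scaled[OF T]) measurable
  also have "T ^ (2 * DIM('a)) = T powr (2 * real DIM('a) - \<beta>) * T powr \<beta>"
    using T by (simp add: powr_add[symmetric] powr_realpow[symmetric])
  also have "ennreal (T powr (2 * real DIM('a) - \<beta>) * T powr \<beta>) * (\<integral>\<^sup>+u. \<integral>\<^sup>+v. indicator D1 u * indicator D1 v * ?J (u - v) \<partial>lborel \<partial>lborel)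
     = ennreal (T powr (2 * real DIM('a) - \<beta>)) * (\<integral>\<^sup>+u. \<integral>\<^sup>+v. ennreal (T powr \<beta>) * (indicator D1 u * indicator D1 v * ?J (u - v)) \<partial>lborel \<partial>lborel)"
    by (simp add: nn_integral_cmult ennreal_mult' mult.assoc)
  also have "\<dots> \<le> ennreal (T powr (2 * real DIM('a) - \<beta>)) * (\<integral>\<^sup>+u. \<integral>\<^sup>+v. (indicator D1 u * indicator D1 v * ennreal (norm (u - v) powr - \<beta>)) * ?X \<partial>lborel \<partial>lborel)"
  proof (rule mult_left_mono[OF nn_integral_mono[OF nn_integral_mono_AE]])
    fix u
    show "AE v in lborel. ennreal (T powr \<beta>) * (indicator D1 u * indicator D1 v * ?J (u - v))
       \<le> (indicator D1 u * indicator D1 v * ennreal (norm (u - v) powr - \<beta>)) * ?X"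
      using AE_lborel_singleton[of u]
    proof eventually_elim
      case (elim v)
      then have "u - v \<noteq> 0" by simp
      from inner[OF this] have "(indicator D1 u * indicator D1 v) * (ennreal (T powr \<beta>) * ?J (u - v)) \<le> (indicator D1 u * indicator D1 v) * (ennreal (norm (u - v) powr - \<beta>) * ?X)"
        by (intro mult_left_mono) auto
      then show ?case by (simp only: mult.assoc mult.left_commute)
    qed
  qed auto
  also have "(\<integral>\<^sup>+u. \<integral>\<^sup>+v. (indicator D1 u * indicator D1 v * ennreal (norm (u - v) powr - \<beta>)) * ?X \<partial>lborel \<partial>lborel) = riesz_energy * ?X"
  proof -
    have "(\<integral>\<^sup>+v. (indicator D1 u * indicator D1 v * ennreal (norm (u - v) powr - \<beta>)) * ?X \<partial>lborel)
       = (\<integral>\<^sup>+v. indicator D1 u * indicator D1 v * ennreal (norm (u - v) powr - \<beta>) \<partial>lborel) * ?X" for u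
      by (rule nn_integral_multc) measurable
    moreover have "(\<integral>\<^sup>+u. (\<integral>\<^sup>+v. indicator D1 u * indicator D1 v * ennreal (norm (u - v) powr - \<beta>) \<partial>lborel) * ?X \<partial>lborel) = riesz_energy * ?X"
      unfolding riesz_energy_def by (rule nn_integral_multc) measurable
    ultimately show ?thesis by simp
  qed
  finally show ?thesis unfolding local_bound_def .
qed

lemma C_diff_sym: "C (x - y) = C (y - x)"
  using C_sym[of "x - y"] by simp

text \<open>Let P = C_12 C_34, Q = C_13 C_24 and V the growth. The full powers P^R and Q^R factorize
  over pairs and have integrals of order V^2, so they may carry the small weight eta. The large
  weight goes to Q^R when the second coordinates of 1 and 3 are far apart, where the tail helps, and
  to P^R when they are close, where point 3 is confined.\<close>

lemma contraction_term_le: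
  assumes T: "T > 0" and S: "S > 0" and r: "1 \<le> r" "r < R" and eta: "0 < \<eta>" "\<eta> \<le> 1"
  shows "(\<integral>\<^sup>+q. ennreal ((C (fst (fst q) - snd (fst q)) * C (fst (snd q) - snd (snd q))) ^ r *
       (C (fst (fst q) - fst (snd q)) * C (snd (fst q) - snd (snd q))) ^ (R - r))
       \<partial>((mu (window T S) \<Otimes>\<^sub>M mu (window T S)) \<Otimes>\<^sub>M (mu (window T S) \<Otimes>\<^sub>M mu (window T S))))
    \<le> ennreal ((1 / \<eta>) ^ R) * ((ennreal (growth T S) * dominant_tail A) * (ennreal (growth T S) * (\<integral>\<^sup>+p. dominant p \<partial>lborel))
         + (ennreal (growth T S) * (\<integral>\<^sup>+p. dominant p \<partial>lborel)) * (ennreal (T powr (2 * real DIM('a) - \<beta>)) * local_bound A))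
      + ennreal \<eta> * ((ennreal (growth T S) * (\<integral>\<^sup>+p. dominant p \<partial>lborel)) * (ennreal (growth T S) * (\<integral>\<^sup>+p. dominant p \<partial>lborel))
         + (ennreal (growth T S) * (\<integral>\<^sup>+p. dominant p \<partial>lborel)) * (ennreal (growth T S) * (\<integral>\<^sup>+p. dominant p \<partial>lborel)))"
proof -
  let ?N = "mu (window T S)"
  let ?N2 = "?N \<Otimes>\<^sub>M ?N"
  let ?N4 = "?N2 \<Otimes>\<^sub>M ?N2"
  have N: "finite_measure ?N" by (rule finite_measure_mu[OF window_compact])
  interpret N: finite_measure ?N by (rule N)
  define c where "c p = ennreal (C (fst p - snd p) ^ R)" for p :: "('a \<times> 'b) \<times> ('a \<times> 'b)"
  define ct where "ct p = c p * indicator {w. A < norm w} (snd (fst p - snd p))" for p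
  define cl where "cl x p = c p * indicator (cball (snd x) A) (snd (fst p))" for x :: "'a \<times> 'b" and p
  have [measurable]: "c \<in> borel_measurable ?N2" unfolding c_def[abs_def] by measurable
  have [measurable]: "ct \<in> borel_measurable ?N2" unfolding ct_def[abs_def] by measurable
  have clm[measurable]: "(\<lambda>z. cl (fst z) (snd z)) \<in> borel_measurable (?N \<Otimes>\<^sub>M ?N2)"
  proof -
    have "(\<lambda>z. c (snd z) * indicator {t. t \<le> A} (dist (snd (fst z)) (snd (fst (snd z))))) \<in> borel_measurable (?N \<Otimes>\<^sub>M ?N2)"
      by measurable
    moreover have "(\<lambda>z. c (snd z) * indicator {t. t \<le> A} (dist (snd (fst z)) (snd (fst (snd z))))) = (\<lambda>z. cl (fst z) (snd z))"
      by (auto simp: cl_def indicator_def fun_eq_iff)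
    ultimately show ?thesis by simp
  qed
  let ?SS = "\<integral>\<^sup>+p. c p \<partial>?N2" and ?SA = "\<integral>\<^sup>+p. ct p \<partial>?N2"
  let ?V = "ennreal (growth T S)" and ?d = "\<integral>\<^sup>+p. dominant p \<partial>lborel"
  let ?L = "ennreal (T powr (2 * real DIM('a) - \<beta>)) * local_bound A"
  have SS: "?SS \<le> ?V * ?d"
    unfolding c_def using pair_integral_le[OF T S] by (subst N.nn_integral_fst[symmetric]) auto
  have SA: "?SA \<le> ?V * dominant_tail A"
  proof -
    have "?SA = (\<integral>\<^sup>+x. \<integral>\<^sup>+y. ct (x, y) \<partial>?N \<partial>?N)" by (rule N.nn_integral_fst[symmetric]) measurable
    also have "\<dots> = (\<integral>\<^sup>+x. \<integral>\<^sup>+y. ennreal (C (x - y) ^ R) * indicator {w. A < norm w} (snd (x - y)) \<partial>?N \<partial>?N)"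
      unfolding ct_def c_def fst_conv snd_conv ..
    also have "\<dots> \<le> ?V * dominant_tail A" by (rule pair_integral_dominant_tail[OF T S])
    finally show ?thesis .
  qed
  have CL: "(\<integral>\<^sup>+p. cl x p \<partial>?N2) \<le> ?L" for x
  proof -
    have "cl x \<in> borel_measurable ?N2" using measurable_compose[OF measurable_Pair1'[of x ?N ?N2] clm] by simp
    then have "(\<integral>\<^sup>+p. cl x p \<partial>?N2) = (\<integral>\<^sup>+y. \<integral>\<^sup>+z. cl x (y, z) \<partial>?N \<partial>?N)" by (rule N.nn_integral_fst[symmetric])
    also have "\<dots> = (\<integral>\<^sup>+y. \<integral>\<^sup>+z. ennreal (C (y - z) ^ R) * indicator (cball (snd x) A) (snd y) \<partial>?N \<partial>?N)"
      unfolding cl_def c_def fst_conv snd_conv ..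
    also have "\<dots> \<le> ?L" by (rule pair_integral_local[OF T S])
    finally show ?thesis .
  qed
  let ?t1 = "\<lambda>q. ct (fst (fst q), fst (snd q)) * c (snd (fst q), snd (snd q))"
  let ?t2 = "\<lambda>q. c (fst q) * cl (fst (fst q)) (snd q)"
  let ?t3 = "\<lambda>q. c (fst q) * c (snd q)"
  let ?t4 = "\<lambda>q. c (fst (fst q), fst (snd q)) * c (snd (fst q), snd (snd q))"
  have m2: "?t2 \<in> borel_measurable ?N4"
  proof -
    have m1: "(\<lambda>q. (fst (fst q), snd q)) \<in> measurable ?N4 (?N \<Otimes>\<^sub>M ?N2)" by measurable
    have "(\<lambda>q. cl (fst (fst q)) (snd q)) \<in> borel_measurable ?N4"
      using measurable_compose[OF m1 clm] by simp
    then show ?thesis by measurable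
  qed
  note [measurable] = m2
  have point: "ennreal ((C (fst (fst q) - snd (fst q)) * C (fst (snd q) - snd (snd q))) ^ r *
       (C (fst (fst q) - fst (snd q)) * C (snd (fst q) - snd (snd q))) ^ (R - r))
     \<le> ennreal ((1 / \<eta>) ^ R) * (?t1 q + ?t2 q) + ennreal \<eta> * (?t3 q + ?t4 q)" for q
  proof -
    let ?P = "C (fst (fst q) - snd (fst q)) * C (fst (snd q) - snd (snd q))"
    let ?Q = "C (fst (fst q) - fst (snd q)) * C (snd (fst q) - snd (snd q))"
    have PQ: "0 \<le> ?P" "0 \<le> ?Q" using C_nonneg by auto
    have PR: "ennreal (?P ^ R) = ?t3 q" "ennreal (?Q ^ R) = ?t4 q"
      using C_nonneg by (auto simp: c_def power_mult_distrib ennreal_mult')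
    have e: "ennreal ((1 / \<eta>) ^ R * a + \<eta> * b) = ennreal ((1 / \<eta>) ^ R) * ennreal a + ennreal \<eta> * ennreal b" if "0 \<le> a" "0 \<le> b" for a b
      using that eta by (simp add: ennreal_plus ennreal_mult')
    \<comment> \<open>If the second coordinates of the points 1 and 3 are far apart, the edge 13 carries the small tail
      of $h$; otherwise the point 3 is confined to a strip around the point 1.\<close>
    show ?thesis
    proof (cases "A < norm (snd (fst (fst q) - fst (snd q)))")
      case True
      have "?Q ^ (R - r) * ?P ^ r \<le> (1 / \<eta>) ^ (R - r + r) * ?Q ^ (R - r + r) + \<eta> * ?P ^ (R - r + r)"
        by (rule power_mult_power_weighted) (use PQ r eta in auto)
      then have "?P ^ r * ?Q ^ (R - r) \<le> (1 / \<eta>) ^ R * ?Q ^ R + \<eta> * ?P ^ R" using r by (simp add: mult.commute)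
      then have "ennreal (?P ^ r * ?Q ^ (R - r)) \<le> ennreal ((1 / \<eta>) ^ R) * ?t4 q + ennreal \<eta> * ?t3 q"
        using PQ by (subst (1) PR[symmetric], subst (1) PR[symmetric], subst e[symmetric]) (auto intro: ennreal_leI)
      moreover have "?t4 q = ?t1 q" using True by (simp add: ct_def)
      ultimately show ?thesis by (elim order_trans) (intro add_mono mult_left_mono; simp)
    next
      case False
      have "?P ^ r * ?Q ^ (R - r) \<le> (1 / \<eta>) ^ (r + (R - r)) * ?P ^ (r + (R - r)) + \<eta> * ?Q ^ (r + (R - r))"
        by (rule power_mult_power_weighted) (use PQ r eta in auto)
      then have "?P ^ r * ?Q ^ (R - r) \<le> (1 / \<eta>) ^ R * ?P ^ R + \<eta> * ?Q ^ R" using r by simp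
      then have "ennreal (?P ^ r * ?Q ^ (R - r)) \<le> ennreal ((1 / \<eta>) ^ R) * ?t3 q + ennreal \<eta> * ?t4 q"
        using PQ by (subst (1) PR[symmetric], subst (1) PR[symmetric], subst e[symmetric]) (auto intro: ennreal_leI)
      moreover have "?t3 q = ?t2 q" using False by (simp add: cl_def dist_norm)
      ultimately show ?thesis by (elim order_trans) (intro add_mono mult_left_mono; simp)
    qed
  qed
  have "(\<integral>\<^sup>+q. ennreal ((C (fst (fst q) - snd (fst q)) * C (fst (snd q) - snd (snd q))) ^ r *
       (C (fst (fst q) - fst (snd q)) * C (snd (fst q) - snd (snd q))) ^ (R - r)) \<partial>?N4)
    \<le> (\<integral>\<^sup>+q. ennreal ((1 / \<eta>) ^ R) * (?t1 q + ?t2 q) + ennreal \<eta> * (?t3 q + ?t4 q) \<partial>?N4)"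
    by (intro nn_integral_mono point)
  also have "\<dots> = ennreal ((1 / \<eta>) ^ R) * ((\<integral>\<^sup>+q. ?t1 q \<partial>?N4) + (\<integral>\<^sup>+q. ?t2 q \<partial>?N4)) + ennreal \<eta> * ((\<integral>\<^sup>+q. ?t3 q \<partial>?N4) + (\<integral>\<^sup>+q. ?t4 q \<partial>?N4))"
    by (simp add: nn_integral_add nn_integral_cmult)
  also have "\<dots> \<le> ennreal ((1 / \<eta>) ^ R) * (?SA * ?SS + ?SS * ?L) + ennreal \<eta> * (?SS * ?SS + ?SS * ?SS)"
  proof (intro add_mono mult_left_mono)
    show "(\<integral>\<^sup>+q. ?t1 q \<partial>?N4) \<le> ?SA * ?SS" by (subst four_fold_13_24[OF N]) auto
    show "(\<integral>\<^sup>+q. ?t2 q \<partial>?N4) \<le> ?SS * ?L" by (rule four_fold_12_134[OF N _ clm CL]) measurable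
    show "(\<integral>\<^sup>+q. ?t3 q \<partial>?N4) \<le> ?SS * ?SS" by (subst four_fold_12_34[OF N]) auto
    show "(\<integral>\<^sup>+q. ?t4 q \<partial>?N4) \<le> ?SS * ?SS" by (subst four_fold_13_24[OF N]) auto
  qed auto
  also have "\<dots> \<le> ennreal ((1 / \<eta>) ^ R) * ((?V * dominant_tail A) * (?V * ?d) + (?V * ?d) * ?L) + ennreal \<eta> * ((?V * ?d) * (?V * ?d) + (?V * ?d) * (?V * ?d))"
    by (intro add_mono mult_left_mono mult_mono SS SA) auto
  finally show ?thesis .
qed

text \<open>The factor 2 m counts the values of r and the two kinds of crossing pairs. All bounds
  are finite, so the estimate can be read in the reals and divided by the square of the
  growth.\<close>

lemma contraction_integral_le:
  assumes T: "T > 0" and S: "S > 0" and R: "R = Suc m" and eta: "0 < \<eta>" "\<eta> \<le> 1"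
  defines "s \<equiv> enn2real (\<integral>\<^sup>+p. dominant p \<partial>lborel)"
  shows "(LINT q|((mu (window T S) \<Otimes>\<^sub>M mu (window T S)) \<Otimes>\<^sub>M (mu (window T S) \<Otimes>\<^sub>M mu (window T S))). contraction_kernel C m q) / (growth T S)\<^sup>2
     \<le> real (2 * m) * ((1 / \<eta>) ^ R * (enn2real (dominant_tail A) * s + s * enn2real (local_bound A) / S ^ DIM('b)) + 2 * \<eta> * s\<^sup>2)"
proof -
  let ?N = "mu (window T S)"
  let ?N2 = "?N \<Otimes>\<^sub>M ?N"
  let ?N4 = "?N2 \<Otimes>\<^sub>M ?N2"
  have N: "finite_measure ?N" by (rule finite_measure_mu[OF window_compact])
  interpret N4: finite_measure ?N4 by (intro finite_measure_pair_measure N)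
  let ?P = "\<lambda>q :: (('a \<times> 'b) \<times> ('a \<times> 'b)) \<times> (('a \<times> 'b) \<times> ('a \<times> 'b)). C (fst (fst q) - snd (fst q)) * C (fst (snd q) - snd (snd q))"
  let ?Q = "\<lambda>q :: (('a \<times> 'b) \<times> ('a \<times> 'b)) \<times> (('a \<times> 'b) \<times> ('a \<times> 'b)). C (fst (fst q) - fst (snd q)) * C (snd (fst q) - snd (snd q))"
  let ?Q' = "\<lambda>q :: (('a \<times> 'b) \<times> ('a \<times> 'b)) \<times> (('a \<times> 'b) \<times> ('a \<times> 'b)). C (fst (fst q) - snd (snd q)) * C (snd (fst q) - fst (snd q))"
  have nn: "0 \<le> ?P q" "0 \<le> ?Q q" "0 \<le> ?Q' q" for q using C_nonneg by auto
  have le1: "?P q \<le> 1" "?Q q \<le> 1" "?Q' q \<le> 1" for q by (intro mult_le_one C_nonneg C_le_1)+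
  have kernel_eq: "contraction_kernel C m q = (\<Sum>r\<in>{1..m}. ?P q ^ r * ?Q q ^ (R - r) + ?P q ^ r * ?Q' q ^ (R - r))" for q
    unfolding contraction_kernel_def contraction_sum_def R ..
  have kernel_nonneg: "0 \<le> contraction_kernel C m q" for q
    unfolding kernel_eq by (intro sum_nonneg add_nonneg_nonneg mult_nonneg_nonneg zero_le_power nn)
  have kernel_le: "contraction_kernel C m q \<le> (\<Sum>r\<in>{1..m}. 1 + 1)" for q
    unfolding kernel_eq by (intro sum_mono add_mono mult_le_one power_le_one nn le1 zero_le_power)
  have [measurable]: "contraction_kernel C m \<in> borel_measurable ?N4" unfolding kernel_eq[abs_def] by measurable
  have int: "integrable ?N4 (contraction_kernel C m)"
    by (rule N4.integrable_const_bound[of _ "\<Sum>r\<in>{1..m}. 1 + 1"]) (use kernel_nonneg kernel_le in auto)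
  let ?bnd = "ennreal ((1 / \<eta>) ^ R) * ((ennreal (growth T S) * dominant_tail A) * (ennreal (growth T S) * (\<integral>\<^sup>+p. dominant p \<partial>lborel))
         + (ennreal (growth T S) * (\<integral>\<^sup>+p. dominant p \<partial>lborel)) * (ennreal (T powr (2 * real DIM('a) - \<beta>)) * local_bound A))
      + ennreal \<eta> * ((ennreal (growth T S) * (\<integral>\<^sup>+p. dominant p \<partial>lborel)) * (ennreal (growth T S) * (\<integral>\<^sup>+p. dominant p \<partial>lborel))
         + (ennreal (growth T S) * (\<integral>\<^sup>+p. dominant p \<partial>lborel)) * (ennreal (growth T S) * (\<integral>\<^sup>+p. dominant p \<partial>lborel)))"
  define e where "e = enn2real (dominant_tail A)"
  define l where "l = enn2real (local_bound A)"
  let ?V = "growth T S"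
  let ?b = "(1 / \<eta>) ^ R * ((?V * e) * (?V * s) + (?V * s) * (T powr (2 * real DIM('a) - \<beta>) * l)) + \<eta> * ((?V * s) * (?V * s) + (?V * s) * (?V * s))"
  have V: "0 < ?V" by (rule growth_pos[OF T S])
  have s0: "0 \<le> s" "0 \<le> e" "0 \<le> l" by (auto simp: s_def e_def l_def)
  have ed: "(\<integral>\<^sup>+p. dominant p \<partial>lborel) = ennreal s" "dominant_tail A = ennreal e" "local_bound A = ennreal l"
    using dominant_finite dominant_tail_finite[of A] local_bound_finite[of A] by (auto simp: s_def e_def l_def)
  have bnd: "?bnd = ennreal ?b"
    unfolding ed using V s0 eta by (simp add: ennreal_mult'[symmetric] ennreal_plus[symmetric] del: ennreal_plus)
  have b0: "0 \<le> ?b" using V s0 eta by (intro add_nonneg_nonneg mult_nonneg_nonneg) auto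
  have t1: "(\<integral>\<^sup>+q. ennreal (?P q ^ r * ?Q q ^ (R - r)) \<partial>?N4) \<le> ennreal ?b" if "r \<in> {1..m}" for r
    unfolding bnd[symmetric] by (rule contraction_term_le[OF T S]) (use that R eta in auto)
  have t2: "(\<integral>\<^sup>+q. ennreal (?P q ^ r * ?Q' q ^ (R - r)) \<partial>?N4) \<le> ennreal ?b" if "r \<in> {1..m}" for r
  proof -
    have "(\<integral>\<^sup>+q. ennreal (?P q ^ r * ?Q' q ^ (R - r)) \<partial>?N4)
       = (\<integral>\<^sup>+q. ennreal (?P (fst q, (snd (snd q), fst (snd q))) ^ r * ?Q (fst q, (snd (snd q), fst (snd q))) ^ (R - r)) \<partial>?N4)"
      by (intro nn_integral_cong) (simp add: C_diff_sym[of "fst (snd _)" "snd (snd _)"])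
    also have "\<dots> = (\<integral>\<^sup>+q. ennreal (?P q ^ r * ?Q q ^ (R - r)) \<partial>?N4)"
      by (rule four_fold_swap[OF N, of "\<lambda>q. ennreal (?P q ^ r * ?Q q ^ (R - r))"]) measurable
    finally show ?thesis using t1[OF that] by simp
  qed
  have "ennreal (LINT q|?N4. contraction_kernel C m q) = (\<integral>\<^sup>+q. ennreal (contraction_kernel C m q) \<partial>?N4)"
    by (rule nn_integral_eq_integral[OF int, symmetric]) (use kernel_nonneg in auto)
  also have "\<dots> = (\<integral>\<^sup>+q. (\<Sum>r\<in>{1..m}. ennreal (?P q ^ r * ?Q q ^ (R - r)) + ennreal (?P q ^ r * ?Q' q ^ (R - r))) \<partial>?N4)"
  proof (rule nn_integral_cong)
    fix q
    show "ennreal (contraction_kernel C m q) = (\<Sum>r\<in>{1..m}. ennreal (?P q ^ r * ?Q q ^ (R - r)) + ennreal (?P q ^ r * ?Q' q ^ (R - r)))"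
      unfolding kernel_eq by (subst sum_ennreal[symmetric]) (auto intro!: sum.cong add_nonneg_nonneg mult_nonneg_nonneg zero_le_power nn C_nonneg ennreal_plus)
  qed
  also have "\<dots> = (\<Sum>r\<in>{1..m}. (\<integral>\<^sup>+q. ennreal (?P q ^ r * ?Q q ^ (R - r)) \<partial>?N4) + (\<integral>\<^sup>+q. ennreal (?P q ^ r * ?Q' q ^ (R - r)) \<partial>?N4))"
    by (subst nn_integral_sum, measurable) (intro sum.cong refl nn_integral_add; measurable)
  also have "\<dots> \<le> (\<Sum>r\<in>{1..m}. ennreal ?b + ennreal ?b)"
    by (intro sum_mono add_mono t1 t2)
  also have "\<dots> = ennreal (real (2 * m) * ?b)"
    using b0 by (simp add: ennreal_plus[symmetric] ennreal_mult'[symmetric] ennreal_of_nat_eq_real_of_nat del: ennreal_plus)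
  finally have "(LINT q|?N4. contraction_kernel C m q) \<le> real (2 * m) * ?b" using b0 by (simp add: ennreal_le_iff)
  then have "(LINT q|?N4. contraction_kernel C m q) / ?V\<^sup>2 \<le> real (2 * m) * ?b / ?V\<^sup>2" by (intro divide_right_mono) auto
  also have "\<dots> = real (2 * m) * ((1 / \<eta>) ^ R * (e * s + s * l / S ^ DIM('b)) + 2 * \<eta> * s\<^sup>2)"
  proof -
    \<comment> \<open>The confined term has lost one factor S^d_2 against the growth; after
      normalization it decays like S^(-d_2).\<close>
    have tp: "T powr (2 * real DIM('a) - \<beta>) = ?V / S ^ DIM('b)" using S by (simp add: growth_def)
    have "?b = ?V\<^sup>2 * ((1 / \<eta>) ^ R * (e * s + s * l / S ^ DIM('b)) + 2 * \<eta> * s\<^sup>2)"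
      unfolding tp by (simp add: power2_eq_square algebra_simps)
    then show ?thesis using V by simp
  qed
  finally show ?thesis by (simp only: e_def l_def)
qed

text \<open>The order of choices matters: first the weight eta, which settles the last term, then a
  cut-off radius k making the tail small against (1 / eta)^R, and only then n, so that S_n^(-d_2)
  beats the constants depending on eta and k.\<close>

theorem contraction_negligible:
  assumes Tp: "\<And>n. T n > 0" and Sp: "\<And>n. S n > 0" and Sl: "filterlim S at_top sequentially" and R: "R = Suc m"
  shows "(\<lambda>n. (LINT q|((mu (window (T n) (S n)) \<Otimes>\<^sub>M mu (window (T n) (S n))) \<Otimes>\<^sub>M (mu (window (T n) (S n)) \<Otimes>\<^sub>M mu (window (T n) (S n)))). contraction_kernel C m q)
     / (growth (T n) (S n))\<^sup>2) \<longlonglongrightarrow> 0"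
proof (rule LIMSEQ_I)
  fix \<epsilon> :: real assume e: "\<epsilon> > 0"
  let ?X = "\<lambda>n. (LINT q|((mu (window (T n) (S n)) \<Otimes>\<^sub>M mu (window (T n) (S n))) \<Otimes>\<^sub>M (mu (window (T n) (S n)) \<Otimes>\<^sub>M mu (window (T n) (S n)))). contraction_kernel C m q)
     / (growth (T n) (S n))\<^sup>2"
  define s where "s = enn2real (\<integral>\<^sup>+p. dominant p \<partial>lborel)"
  \<comment> \<open>The summand 1 keeps the denominator positive even if the rest vanishes, and the
    minimum with 1 meets the requirement of the weighted inequality.\<close>
  define \<eta> where "\<eta> = min 1 (\<epsilon> / (3 * (real (2 * m) * (2 * s\<^sup>2) + 1)))"
  have den: "0 < 3 * (real (2 * m) * (2 * s\<^sup>2) + 1)" by (intro mult_pos_pos add_nonneg_pos) auto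
  have eta: "0 < \<eta>" "\<eta> \<le> 1" using e den by (auto simp: \<eta>_def)
  have e1: "real (2 * m) * (2 * \<eta> * s\<^sup>2) < \<epsilon> / 3 + \<epsilon> / 3"
  proof -
    have "\<eta> * (real (2 * m) * (2 * s\<^sup>2)) \<le> \<epsilon> / (3 * (real (2 * m) * (2 * s\<^sup>2) + 1)) * (real (2 * m) * (2 * s\<^sup>2) + 1)"
      using e den by (intro mult_mono) (auto simp: \<eta>_def)
    also have "\<dots> = \<epsilon> / 3" using den by (simp add: field_simps)
    finally show ?thesis using e by (simp add: mult_ac)
  qed
  have "(\<lambda>n. real (2 * m) * ((1 / \<eta>) ^ R * (enn2real (dominant_tail (real n)) * s))) \<longlonglongrightarrow> real (2 * m) * ((1 / \<eta>) ^ R * (0 * s))"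
    by (intro tendsto_intros dominant_tail_lim)
  then have "\<forall>\<^sub>F n in sequentially. real (2 * m) * ((1 / \<eta>) ^ R * (enn2real (dominant_tail (real n)) * s)) < \<epsilon> / 6"
    using e by (intro order_tendstoD(2)[of _ 0]) auto
  then obtain k where k: "real (2 * m) * ((1 / \<eta>) ^ R * (enn2real (dominant_tail (real k)) * s)) < \<epsilon> / 6"
    by (auto simp: eventually_sequentially)
  let ?l = "enn2real (local_bound (real k))"
  have "(\<lambda>n. real (2 * m) * ((1 / \<eta>) ^ R * (s * ?l * (inverse (S n)) ^ DIM('b)))) \<longlonglongrightarrow> real (2 * m) * ((1 / \<eta>) ^ R * (s * ?l * 0 ^ DIM('b)))"
    by (intro tendsto_intros tendsto_inverse_0_at_top Sl)
  moreover have "(0::real) ^ DIM('b) = 0" by (simp add: power_0_left)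
  ultimately have "\<forall>\<^sub>F n in sequentially. real (2 * m) * ((1 / \<eta>) ^ R * (s * ?l * (inverse (S n)) ^ DIM('b))) < \<epsilon> / 6"
    using e by (intro order_tendstoD(2)[of _ 0]) auto
  then obtain n0 where n0: "\<And>n. n \<ge> n0 \<Longrightarrow> real (2 * m) * ((1 / \<eta>) ^ R * (s * ?l * (inverse (S n)) ^ DIM('b))) < \<epsilon> / 6"
    by (auto simp: eventually_sequentially)
  show "\<exists>no. \<forall>n\<ge>no. norm (?X n - 0) < \<epsilon>"
  proof (intro exI[of _ n0] allI impI)
    fix n assume n: "n \<ge> n0"
    have "?X n \<le> real (2 * m) * ((1 / \<eta>) ^ R * (enn2real (dominant_tail (real k)) * s + s * ?l / S n ^ DIM('b)) + 2 * \<eta> * s\<^sup>2)"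
      unfolding s_def by (rule contraction_integral_le[OF Tp Sp R eta])
    also have "\<dots> = real (2 * m) * ((1 / \<eta>) ^ R * (enn2real (dominant_tail (real k)) * s))
        + real (2 * m) * ((1 / \<eta>) ^ R * (s * ?l * (inverse (S n)) ^ DIM('b))) + real (2 * m) * (2 * \<eta> * s\<^sup>2)"
      by (simp add: power_inverse divide_inverse algebra_simps)
    also have "\<dots> < \<epsilon> / 6 + \<epsilon> / 6 + (\<epsilon> / 3 + \<epsilon> / 3)"
      using k n0[OF n] e1 by linarith
    finally have "?X n < \<epsilon>" by simp
    moreover have "0 \<le> ?X n"
      unfolding contraction_kernel_def contraction_sum_def
      by (intro divide_nonneg_nonneg integral_nonneg_AE AE_I2 sum_nonneg add_nonneg_nonneg mult_nonneg_nonneg zero_le_power C_nonneg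
          less_imp_le[OF growth_pos[OF Tp Sp]])
    ultimately show "norm (?X n - 0) < \<epsilon>" by simp
  qed
qed

end

section \<open>The central limit theorem\<close>

locale gneiting_functional = gauss_field M B C + ker: gneiting_kernel C h \<rho> K Mc R D1 D2
  for M :: "'w measure" and B :: "'a::euclidean_space \<times> 'b::euclidean_space \<Rightarrow> 'w \<Rightarrow> real"
    and C h \<rho> K Mc R D1 D2 +
  fixes \<phi> :: "real \<Rightarrow> real"
  assumes phi_meas [measurable]: "\<phi> \<in> borel_measurable borel" and phi_L2: "integrable \<gamma> (\<lambda>u. (\<phi> u)\<^sup>2)"
    and phi_rank: "has_hermite_rank \<phi> R"
begin

definition m where "m = R - 1"

lemma R_m: "R = Suc m" using ker.R_pos by (simp add: m_def)

definition a :: "nat \<Rightarrow> real" where "a = hermite_coeff \<phi>"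

lemma a_props: "a R \<noteq> 0" "1 \<le> q \<Longrightarrow> q < R \<Longrightarrow> a q = 0"
  using phi_rank by (auto simp: has_hermite_rank_def a_def)

text \<open>The centred part of \<open>\<phi>\<close>, and \<open>\<psi>\<close> below is the
  remainder beyond the R-th chaos. Both are written as a sum with a multiple of a Hermite polynomial
  to match \<open>hermite_coeff_add\<close>.\<close>

definition \<phi>0 :: "real \<Rightarrow> real" where "\<phi>0 u = \<phi> u + (- a 0) * hermite 0 u"

definition \<psi> :: "real \<Rightarrow> real" where "\<psi> u = \<phi>0 u + (- a R) * hermite R u"

lemma hermite_L2: "integrable \<gamma> (\<lambda>u. (hermite q u)\<^sup>2)"
  by (intro integrable_poly_growth poly_growth_power poly_growth_hermite) simp

lemma hermite_scaled_L2: "integrable \<gamma> (\<lambda>u. (c * hermite q u)\<^sup>2)"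
  using hermite_L2[of q] by (simp add: power_mult_distrib)

lemma phi0_measurable [measurable]: "\<phi>0 \<in> borel_measurable borel" and phi0_L2: "integrable \<gamma> (\<lambda>u. (\<phi>0 u)\<^sup>2)"
proof -
  show "\<phi>0 \<in> borel_measurable borel" unfolding \<phi>0_def[abs_def] by measurable
  show "integrable \<gamma> (\<lambda>u. (\<phi>0 u)\<^sup>2)" unfolding \<phi>0_def by (intro integrable_L2_add phi_L2 hermite_scaled_L2) auto
qed

lemma psi_measurable [measurable]: "\<psi> \<in> borel_measurable borel" and psi_L2: "integrable \<gamma> (\<lambda>u. (\<psi> u)\<^sup>2)"
proof -
  show "\<psi> \<in> borel_measurable borel" unfolding \<psi>_def[abs_def] by measurable
  show "integrable \<gamma> (\<lambda>u. (\<psi> u)\<^sup>2)" unfolding \<psi>_def by (intro integrable_L2_add phi0_L2 hermite_scaled_L2) auto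
qed

lemma coeff_phi0: "hermite_coeff \<phi>0 q = (if q = 0 then 0 else a q)"
  unfolding \<phi>0_def[abs_def] by (subst hermite_coeff_add) (auto simp: phi_L2 hermite_L2 hermite_coeff_hermite a_def simp del: hermite.simps)

lemma coeff_psi: "hermite_coeff \<psi> q = (if q = R then 0 else hermite_coeff \<phi>0 q)"
  unfolding \<psi>_def[abs_def] using ker.R_pos
  by (subst hermite_coeff_add) (auto simp: phi0_L2 hermite_L2 hermite_coeff_hermite coeff_phi0 simp del: hermite.simps)

lemma coeff_psi_zero: "q < Suc R \<Longrightarrow> hermite_coeff \<psi> q = 0"
  using a_props(2)[of q] by (cases "q = R") (auto simp: coeff_psi coeff_phi0)

text \<open>The two Mehler series differ only in the term q = R.\<close>

lemma covariance_split:
  "expectation (\<lambda>\<omega>. \<phi>0 (B x \<omega>) * \<phi>0 (B y \<omega>)) = (a R)\<^sup>2 * fact R * C (x - y) ^ R + expectation (\<lambda>\<omega>. \<psi> (B x \<omega>) * \<psi> (B y \<omega>))"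
proof -
  have 1: "(\<lambda>q. (hermite_coeff \<phi>0 q)\<^sup>2 * fact q * C (x - y) ^ q) sums expectation (\<lambda>\<omega>. \<phi>0 (B x \<omega>) * \<phi>0 (B y \<omega>))"
    by (rule field_covariance_sums[OF phi0_measurable phi0_L2])
  have 2: "(\<lambda>q. (hermite_coeff \<psi> q)\<^sup>2 * fact q * C (x - y) ^ q) sums expectation (\<lambda>\<omega>. \<psi> (B x \<omega>) * \<psi> (B y \<omega>))"
    by (rule field_covariance_sums[OF psi_measurable psi_L2])
  have 3: "(\<lambda>q. if q = R then (a R)\<^sup>2 * fact R * C (x - y) ^ R else 0) sums ((a R)\<^sup>2 * fact R * C (x - y) ^ R)"
    using sums_single[of R "\<lambda>q. (a R)\<^sup>2 * fact R * C (x - y) ^ R"] by (simp add: eq_commute)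
  have "(\<lambda>q. (if q = R then (a R)\<^sup>2 * fact R * C (x - y) ^ R else 0) + (hermite_coeff \<psi> q)\<^sup>2 * fact q * C (x - y) ^ q)
     = (\<lambda>q. (hermite_coeff \<phi>0 q)\<^sup>2 * fact q * C (x - y) ^ q)"
    using ker.R_pos by (auto simp: coeff_psi coeff_phi0 fun_eq_iff)
  then show ?thesis using sums_unique2[OF 1] sums_add[OF 3 2] by simp
qed

text \<open>The pathwise integrals are known to exist only for almost every sample point, so
  linearity holds almost surely.\<close>

lemma functional_split:
  assumes D: "compact D"
  shows "AE \<omega> in M. field_functional D \<phi> \<omega> - expectation (field_functional D \<phi>) = field_functional D \<phi>0 \<omega>"
    and "AE \<omega> in M. field_functional D \<phi>0 \<omega> = a R * hermite_functional D m \<omega> + field_functional D \<psi> \<omega>"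
proof -
  have N: "finite_measure (mu D)" by (rule finite_measure_mu[OF D])
  have ic: "integrable (mu D) (\<lambda>_. c)" for c :: real using N by (simp add: finite_measure.integrable_const)
  have E: "expectation (field_functional D \<phi>) = a 0 * measure (mu D) UNIV"
    using field_functional_mean[OF D phi_meas phi_L2] by (simp add: a_def hermite_coeff_def)
  show "AE \<omega> in M. field_functional D \<phi> \<omega> - expectation (field_functional D \<phi>) = field_functional D \<phi>0 \<omega>"
    using field_functional_AE_integrable[OF D phi_meas phi_L2]
  proof eventually_elim
    case (elim \<omega>)
    have "field_functional D \<phi>0 \<omega> = (LINT x|mu D. \<phi> (B x \<omega>) + (- a 0))" unfolding field_functional_def \<phi>0_def by simp
    also have "\<dots> = field_functional D \<phi> \<omega> + (- a 0) * measure (mu D) UNIV"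
      unfolding field_functional_def using elim ic by (subst Bochner_Integration.integral_add) (auto simp: mult.commute)
    finally show ?case unfolding E by simp
  qed
  show "AE \<omega> in M. field_functional D \<phi>0 \<omega> = a R * hermite_functional D m \<omega> + field_functional D \<psi> \<omega>"
    using field_functional_AE_integrable[OF D psi_measurable psi_L2] field_functional_AE_integrable[OF D borel_measurable_hermite hermite_L2[of R]]
  proof eventually_elim
    case (elim \<omega>)
    have "field_functional D \<phi>0 \<omega> = (LINT x|mu D. a R * hermite R (B x \<omega>) + \<psi> (B x \<omega>))" unfolding field_functional_def \<psi>_def by simp
    also have "\<dots> = a R * (LINT x|mu D. hermite R (B x \<omega>)) + field_functional D \<psi> \<omega>"
      unfolding field_functional_def using elim by simp
    finally show ?case unfolding hermite_functional_def R_m[symmetric] .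
  qed
qed

text \<open>Different chaoses are orthogonal, so there is no cross term and the identity is
  exact.\<close>

lemma field_functional_variance:
  assumes D: "compact D"
  shows "variance (field_functional D \<phi>) = (a R)\<^sup>2 * functional_variance D m + expectation (\<lambda>\<omega>. (field_functional D \<psi> \<omega>)\<^sup>2)"
proof -
  note m1[measurable] = field_functional_measurable[OF D phi_meas phi_L2] and m2[measurable] = field_functional_measurable[OF D phi0_measurable phi0_L2]
  have "variance (field_functional D \<phi>) = expectation (\<lambda>\<omega>. (field_functional D \<phi>0 \<omega>)\<^sup>2)"
    by (rule integral_cong_AE) (use functional_split(1)[OF D] in \<open>auto elim: eventually_mono\<close>)
  also have "\<dots> = (LINT p|(mu D \<Otimes>\<^sub>M mu D). (a R)\<^sup>2 * fact R * C (fst p - snd p) ^ R + expectation (\<lambda>\<omega>. \<psi> (B (fst p) \<omega>) * \<psi> (B (snd p) \<omega>)))"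
    unfolding field_functional_sq[OF D phi0_measurable phi0_L2] covariance_split ..
  also have "\<dots> = (a R)\<^sup>2 * fact R * (LINT p|(mu D \<Otimes>\<^sub>M mu D). C (fst p - snd p) ^ R) + expectation (\<lambda>\<omega>. (field_functional D \<psi> \<omega>)\<^sup>2)"
    unfolding field_functional_sq[OF D psi_measurable psi_L2]
    by (subst Bochner_Integration.integral_add) (auto intro: integrable_mult_right C_power_integrable[OF D] field_functional_cov_integrable[OF D psi_measurable psi_L2])
  finally show ?thesis unfolding functional_variance_def R_m[symmetric] by (simp add: mult.assoc)
qed

definition L :: real where "L = (a R)\<^sup>2 * (fact R * ker.ell)"

lemma L_pos: "0 < L"
  unfolding L_def using a_props(1) ker.ell_pos by (intro mult_pos_pos) auto

definition psi2 :: real where "psi2 = (LINT u|\<gamma>. (\<psi> u)\<^sup>2)"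

lemma energy_functional_variance: "functional_variance (ker.window T S) m = fact R * ker.energy R T S"
  by (simp only: functional_variance_def ker.energy_def R_m[symmetric])

lemma psi_functional_le:
  "expectation (\<lambda>\<omega>. (field_functional (ker.window T S) \<psi> \<omega>)\<^sup>2) \<le> psi2 * ker.energy (Suc R) T S"
  unfolding psi2_def ker.energy_def by (rule field_functional_sq_le[OF ker.window_compact psi_measurable psi_L2 coeff_psi_zero])

section \<open>Limits along sequences of scales\<close>

context
  fixes T S :: "nat \<Rightarrow> real"
  assumes T_pos: "\<And>n. T n > 0" and S_pos: "\<And>n. S n > 0"
    and T_lim: "filterlim T at_top sequentially" and S_lim: "filterlim S at_top sequentially"
begin

lemma growth_pos: "0 < ker.growth (T n) (S n)" by (rule ker.growth_pos[OF T_pos S_pos])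

lemma psi_negligible: "(\<lambda>n. expectation (\<lambda>\<omega>. (field_functional (ker.window (T n) (S n)) \<psi> \<omega>)\<^sup>2) / ker.growth (T n) (S n)) \<longlonglongrightarrow> 0"
proof (rule tendsto_sandwich[OF _ _ tendsto_const])
  have "(\<lambda>n. psi2 * (ker.energy (Suc R) (T n) (S n) / ker.growth (T n) (S n))) \<longlonglongrightarrow> psi2 * (if Suc R = R then ker.ell else 0)"
    by (intro tendsto_mult tendsto_const ker.energy_asymptotics T_pos S_pos T_lim S_lim) simp
  then show "(\<lambda>n. psi2 * (ker.energy (Suc R) (T n) (S n) / ker.growth (T n) (S n))) \<longlonglongrightarrow> 0" by simp
  show "\<forall>\<^sub>F n in sequentially. expectation (\<lambda>\<omega>. (field_functional (ker.window (T n) (S n)) \<psi> \<omega>)\<^sup>2) / ker.growth (T n) (S n) \<le> psi2 * (ker.energy (Suc R) (T n) (S n) / ker.growth (T n) (S n))"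
  proof (rule eventuallyI)
    fix n
    show "expectation (\<lambda>\<omega>. (field_functional (ker.window (T n) (S n)) \<psi> \<omega>)\<^sup>2) / ker.growth (T n) (S n) \<le> psi2 * (ker.energy (Suc R) (T n) (S n) / ker.growth (T n) (S n))"
      using divide_right_mono[OF psi_functional_le[of "T n" "S n"], of "ker.growth (T n) (S n)"] growth_pos[of n] by simp
  qed
  show "\<forall>\<^sub>F n in sequentially. 0 \<le> expectation (\<lambda>\<omega>. (field_functional (ker.window (T n) (S n)) \<psi> \<omega>)\<^sup>2) / ker.growth (T n) (S n)"
    using growth_pos by (intro eventuallyI divide_nonneg_pos) auto
qed

lemma functional_variance_lim: "(\<lambda>n. functional_variance (ker.window (T n) (S n)) m / ker.growth (T n) (S n)) \<longlonglongrightarrow> fact R * ker.ell"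
proof -
  have "(\<lambda>n. fact R * (ker.energy R (T n) (S n) / ker.growth (T n) (S n))) \<longlonglongrightarrow> fact R * (if R = R then ker.ell else 0)"
    by (intro tendsto_mult tendsto_const ker.energy_asymptotics T_pos S_pos T_lim S_lim) simp
  then show ?thesis by (simp add: energy_functional_variance)
qed

lemma variance_lim: "(\<lambda>n. variance (field_functional (ker.window (T n) (S n)) \<phi>) / ker.growth (T n) (S n)) \<longlonglongrightarrow> L"
proof -
  have "(\<lambda>n. (a R)\<^sup>2 * (functional_variance (ker.window (T n) (S n)) m / ker.growth (T n) (S n)) + expectation (\<lambda>\<omega>. (field_functional (ker.window (T n) (S n)) \<psi> \<omega>)\<^sup>2) / ker.growth (T n) (S n)) \<longlonglongrightarrow> (a R)\<^sup>2 * (fact R * ker.ell) + 0"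
    by (intro tendsto_add tendsto_mult tendsto_const functional_variance_lim psi_negligible)
  then show ?thesis unfolding L_def field_functional_variance[OF ker.window_compact] by (simp add: add_divide_distrib)
qed

text \<open>The normalized functional is u_n F_n + v_n Psi_n, with F_n the Hermite functional and
  Psi_n the remainder. Dropping Psi_n, replacing F_n by a Gaussian variable of the same variance,
  and the convergence of that variance are three separate limits, each measured against the
  growth.\<close>

lemma char_lim:
  "(\<lambda>n. LINT \<omega>|M. iexp (s * normalized M (field_functional (ker.window (T n) (S n)) \<phi>) \<omega>)) \<longlonglongrightarrow> complex_of_real (exp (- s\<^sup>2 / 2))"
proof -
  define \<sigma> where "\<sigma> n = sqrt (variance (field_functional (ker.window (T n) (S n)) \<phi>))" for n
  define u where "u n = s * a R / \<sigma> n" for n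
  define v where "v n = s / \<sigma> n" for n
  have sig2: "(\<sigma> n)\<^sup>2 = variance (field_functional (ker.window (T n) (S n)) \<phi>)" for n by (simp add: \<sigma>_def)
  have Vs: "(\<lambda>n. ker.growth (T n) (S n) / (\<sigma> n)\<^sup>2) \<longlonglongrightarrow> 1 / L"
  proof -
    have "(\<lambda>n. inverse (variance (field_functional (ker.window (T n) (S n)) \<phi>) / ker.growth (T n) (S n))) \<longlonglongrightarrow> inverse L"
      by (rule tendsto_inverse[OF variance_lim]) (use L_pos in auto)
    then show ?thesis by (simp add: sig2 inverse_eq_divide)
  qed
  have Fm[measurable]: "hermite_functional (ker.window (T n) (S n)) m \<in> borel_measurable M" for n by (rule hermite_functional_measurable[OF ker.window_compact])
  have Pm[measurable]: "field_functional (ker.window (T n) (S n)) \<psi> \<in> borel_measurable M" for n by (rule field_functional_measurable[OF ker.window_compact psi_measurable psi_L2])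
  have Ym[measurable]: "field_functional (ker.window (T n) (S n)) \<phi> \<in> borel_measurable M" for n by (rule field_functional_measurable[OF ker.window_compact phi_meas phi_L2])
  have P2: "integrable M (\<lambda>\<omega>. (field_functional (ker.window (T n) (S n)) \<psi> \<omega>)\<^sup>2)" for n by (rule field_functional_L2[OF ker.window_compact psi_measurable psi_L2])
  have P1: "integrable M (field_functional (ker.window (T n) (S n)) \<psi>)" for n by (rule field_functional_integrable[OF ker.window_compact psi_measurable psi_L2])
  have eq: "(LINT \<omega>|M. iexp (s * normalized M (field_functional (ker.window (T n) (S n)) \<phi>) \<omega>)) = (LINT \<omega>|M. iexp (u n * hermite_functional (ker.window (T n) (S n)) m \<omega> + v n * field_functional (ker.window (T n) (S n)) \<psi> \<omega>))" for n
  proof (rule integral_cong_AE)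
    show "AE \<omega> in M. iexp (s * normalized M (field_functional (ker.window (T n) (S n)) \<phi>) \<omega>) = iexp (u n * hermite_functional (ker.window (T n) (S n)) m \<omega> + v n * field_functional (ker.window (T n) (S n)) \<psi> \<omega>)"
      using functional_split[OF ker.window_compact[of "T n" "S n"]]
    proof eventually_elim
      case (elim \<omega>)
      have "s * normalized M (field_functional (ker.window (T n) (S n)) \<phi>) \<omega> = s * (a R * hermite_functional (ker.window (T n) (S n)) m \<omega> + field_functional (ker.window (T n) (S n)) \<psi> \<omega>) / \<sigma> n"
        unfolding normalized_def \<sigma>_def elim(1) elim(2) by simp
      also have "\<dots> = u n * hermite_functional (ker.window (T n) (S n)) m \<omega> + v n * field_functional (ker.window (T n) (S n)) \<psi> \<omega>"
        by (simp add: u_def v_def add_divide_distrib distrib_left)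
      finally show ?case by simp
    qed
  qed (auto simp: normalized_def)
  \<comment> \<open>The exponential is 1-Lipschitz, so dropping the remainder costs at most its L1
    norm, which is bounded by the L2 norm. Inserting the growth expresses the bound through ratios
    with known limits.\<close>
  have d1: "norm ((LINT \<omega>|M. iexp (u n * hermite_functional (ker.window (T n) (S n)) m \<omega> + v n * field_functional (ker.window (T n) (S n)) \<psi> \<omega>)) - (LINT \<omega>|M. iexp (u n * hermite_functional (ker.window (T n) (S n)) m \<omega>)))
      \<le> \<bar>s\<bar> * sqrt ((expectation (\<lambda>\<omega>. (field_functional (ker.window (T n) (S n)) \<psi> \<omega>)\<^sup>2) / ker.growth (T n) (S n)) * (ker.growth (T n) (S n) / (\<sigma> n)\<^sup>2))" for n
  proof -
    have E: "(LINT \<omega>|M. iexp (u n * hermite_functional (ker.window (T n) (S n)) m \<omega> + v n * field_functional (ker.window (T n) (S n)) \<psi> \<omega>)) - (LINT \<omega>|M. iexp (u n * hermite_functional (ker.window (T n) (S n)) m \<omega>))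
      = (LINT \<omega>|M. iexp (u n * hermite_functional (ker.window (T n) (S n)) m \<omega> + v n * field_functional (ker.window (T n) (S n)) \<psi> \<omega>) - iexp (u n * hermite_functional (ker.window (T n) (S n)) m \<omega>))"
      by (rule Bochner_Integration.integral_diff[symmetric]; rule integrable_const_bound[of _ 1]) auto
    have "norm (LINT \<omega>|M. iexp (u n * hermite_functional (ker.window (T n) (S n)) m \<omega> + v n * field_functional (ker.window (T n) (S n)) \<psi> \<omega>) - iexp (u n * hermite_functional (ker.window (T n) (S n)) m \<omega>)) \<le> (LINT \<omega>|M. \<bar>v n\<bar> * \<bar>field_functional (ker.window (T n) (S n)) \<psi> \<omega>\<bar>)"
    proof (rule norm_integral_le)
      show "integrable M (\<lambda>\<omega>. iexp (u n * hermite_functional (ker.window (T n) (S n)) m \<omega> + v n * field_functional (ker.window (T n) (S n)) \<psi> \<omega>) - iexp (u n * hermite_functional (ker.window (T n) (S n)) m \<omega>))"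
        by (rule Bochner_Integration.integrable_diff; rule integrable_const_bound[of _ 1]) auto
      show "integrable M (\<lambda>\<omega>. \<bar>v n\<bar> * \<bar>field_functional (ker.window (T n) (S n)) \<psi> \<omega>\<bar>)" using P1[of n] by simp
      fix \<omega>
      have "iexp (u n * hermite_functional (ker.window (T n) (S n)) m \<omega> + v n * field_functional (ker.window (T n) (S n)) \<psi> \<omega>) - iexp (u n * hermite_functional (ker.window (T n) (S n)) m \<omega>)
         = iexp (u n * hermite_functional (ker.window (T n) (S n)) m \<omega>) * (iexp (v n * field_functional (ker.window (T n) (S n)) \<psi> \<omega>) - (\<Sum>k\<le>0. (\<i> * complex_of_real (v n * field_functional (ker.window (T n) (S n)) \<psi> \<omega>)) ^ k / fact k))"
        by (simp add: distrib_left exp_add right_diff_distrib)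
      then have "norm (iexp (u n * hermite_functional (ker.window (T n) (S n)) m \<omega> + v n * field_functional (ker.window (T n) (S n)) \<psi> \<omega>) - iexp (u n * hermite_functional (ker.window (T n) (S n)) m \<omega>))
         = norm (iexp (v n * field_functional (ker.window (T n) (S n)) \<psi> \<omega>) - (\<Sum>k\<le>0. (\<i> * complex_of_real (v n * field_functional (ker.window (T n) (S n)) \<psi> \<omega>)) ^ k / fact k))"
        by (simp only: norm_mult norm_exp_i_times mult_1)
      also have "\<dots> \<le> \<bar>v n\<bar> * \<bar>field_functional (ker.window (T n) (S n)) \<psi> \<omega>\<bar>"
        using iexp_approx1[of "v n * field_functional (ker.window (T n) (S n)) \<psi> \<omega>" 0] by (simp only: abs_mult) simp
      finally show "norm (iexp (u n * hermite_functional (ker.window (T n) (S n)) m \<omega> + v n * field_functional (ker.window (T n) (S n)) \<psi> \<omega>) - iexp (u n * hermite_functional (ker.window (T n) (S n)) m \<omega>)) \<le> \<bar>v n\<bar> * \<bar>field_functional (ker.window (T n) (S n)) \<psi> \<omega>\<bar>" .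
    qed
    also have "\<dots> \<le> \<bar>v n\<bar> * sqrt (expectation (\<lambda>\<omega>. (field_functional (ker.window (T n) (S n)) \<psi> \<omega>)\<^sup>2))"
    proof -
      have e1: "expectation (\<lambda>\<omega>. \<bar>field_functional (ker.window (T n) (S n)) \<psi> \<omega>\<bar>) \<le> sqrt (expectation (\<lambda>\<omega>. (field_functional (ker.window (T n) (S n)) \<psi> \<omega>)\<^sup>2))"
        by (rule expectation_abs_le_sqrt) (rule Pm, rule P2)
      have e2: "(LINT \<omega>|M. \<bar>v n\<bar> * \<bar>field_functional (ker.window (T n) (S n)) \<psi> \<omega>\<bar>) = \<bar>v n\<bar> * expectation (\<lambda>\<omega>. \<bar>field_functional (ker.window (T n) (S n)) \<psi> \<omega>\<bar>)"
        by (rule integral_mult_right_zero)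
      show ?thesis unfolding e2 by (rule mult_left_mono[OF e1 abs_ge_zero])
    qed
    also have "\<dots> = \<bar>s\<bar> * sqrt ((expectation (\<lambda>\<omega>. (field_functional (ker.window (T n) (S n)) \<psi> \<omega>)\<^sup>2) / ker.growth (T n) (S n)) * (ker.growth (T n) (S n) / (\<sigma> n)\<^sup>2))"
    proof -
      have q: "(expectation (\<lambda>\<omega>. (field_functional (ker.window (T n) (S n)) \<psi> \<omega>)\<^sup>2) / ker.growth (T n) (S n)) * (ker.growth (T n) (S n) / (\<sigma> n)\<^sup>2) = expectation (\<lambda>\<omega>. (field_functional (ker.window (T n) (S n)) \<psi> \<omega>)\<^sup>2) / (\<sigma> n)\<^sup>2"
        using growth_pos[of n] by simp
      show ?thesis unfolding q by (simp add: v_def real_sqrt_divide abs_divide)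
    qed
    finally show ?thesis unfolding E .
  qed
  let ?CI = "\<lambda>n. LINT q|((mu (ker.window (T n) (S n)) \<Otimes>\<^sub>M mu (ker.window (T n) (S n))) \<Otimes>\<^sub>M (mu (ker.window (T n) (S n)) \<Otimes>\<^sub>M mu (ker.window (T n) (S n)))). contraction_kernel C m q"
  have CI_lim: "(\<lambda>n. ?CI n / (ker.growth (T n) (S n))\<^sup>2) \<longlonglongrightarrow> 0"
    by (rule ker.contraction_negligible[OF T_pos S_pos S_lim R_m])
  \<comment> \<open>This is the Stein bound at frequency \<open>u n\<close>; the growth is squared
    inside the root to match the normalization of the contraction integral.\<close>
  have d2: "norm ((LINT \<omega>|M. iexp (u n * hermite_functional (ker.window (T n) (S n)) m \<omega>)) - complex_of_real (exp (- ((u n)\<^sup>2 * functional_variance (ker.window (T n) (S n)) m / 2))))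
      \<le> (s\<^sup>2 * (a R)\<^sup>2) * ((ker.growth (T n) (S n) / (\<sigma> n)\<^sup>2) * sqrt (contraction_const m * (?CI n / (ker.growth (T n) (S n))\<^sup>2)))" for n
  proof -
    have "norm ((LINT \<omega>|M. iexp (u n * hermite_functional (ker.window (T n) (S n)) m \<omega>)) - complex_of_real (exp (- ((u n)\<^sup>2 * functional_variance (ker.window (T n) (S n)) m / 2)))) \<le> (u n)\<^sup>2 * sqrt (contraction_const m * ?CI n)"
      by (rule hermite_functional_char[OF ker.window_compact])
    also have "\<dots> = (s\<^sup>2 * (a R)\<^sup>2) * ((ker.growth (T n) (S n) / (\<sigma> n)\<^sup>2) * sqrt (contraction_const m * (?CI n / (ker.growth (T n) (S n))\<^sup>2)))"
    proof -
      have "sqrt (contraction_const m * (?CI n / (ker.growth (T n) (S n))\<^sup>2)) = sqrt (contraction_const m * ?CI n) / ker.growth (T n) (S n)"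
        using growth_pos[of n] by (simp add: real_sqrt_divide real_sqrt_mult)
      then show ?thesis using growth_pos[of n] by (simp add: u_def power_divide power_mult_distrib)
    qed
    finally show ?thesis .
  qed
  have uV: "(\<lambda>n. (u n)\<^sup>2 * functional_variance (ker.window (T n) (S n)) m) \<longlonglongrightarrow> s\<^sup>2"
  proof -
    have "(\<lambda>n. (s\<^sup>2 * (a R)\<^sup>2) * ((functional_variance (ker.window (T n) (S n)) m / ker.growth (T n) (S n)) * (ker.growth (T n) (S n) / (\<sigma> n)\<^sup>2))) \<longlonglongrightarrow> (s\<^sup>2 * (a R)\<^sup>2) * ((fact R * ker.ell) * (1 / L))"
      by (intro tendsto_mult tendsto_const functional_variance_lim Vs)
    moreover have "(s\<^sup>2 * (a R)\<^sup>2) * ((functional_variance (ker.window (T n) (S n)) m / ker.growth (T n) (S n)) * (ker.growth (T n) (S n) / (\<sigma> n)\<^sup>2)) = (u n)\<^sup>2 * functional_variance (ker.window (T n) (S n)) m" for n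
      using growth_pos[of n] by (simp add: u_def power_divide power_mult_distrib)
    moreover have "(s\<^sup>2 * (a R)\<^sup>2) * ((fact R * ker.ell) * (1 / L)) = s\<^sup>2"
    proof -
      have "(s\<^sup>2 * (a R)\<^sup>2) * ((fact R * ker.ell) * (1 / L)) = s\<^sup>2 * (L / L)" by (simp add: L_def)
      then show ?thesis using L_pos by simp
    qed
    ultimately show ?thesis by simp
  qed
  have l1: "(\<lambda>n. (LINT \<omega>|M. iexp (u n * hermite_functional (ker.window (T n) (S n)) m \<omega> + v n * field_functional (ker.window (T n) (S n)) \<psi> \<omega>)) - (LINT \<omega>|M. iexp (u n * hermite_functional (ker.window (T n) (S n)) m \<omega>))) \<longlonglongrightarrow> 0"
  proof (rule Lim_null_comparison[OF eventuallyI[OF d1]])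
    have "(\<lambda>n. \<bar>s\<bar> * sqrt ((expectation (\<lambda>\<omega>. (field_functional (ker.window (T n) (S n)) \<psi> \<omega>)\<^sup>2) / ker.growth (T n) (S n)) * (ker.growth (T n) (S n) / (\<sigma> n)\<^sup>2))) \<longlonglongrightarrow> \<bar>s\<bar> * sqrt (0 * (1 / L))"
      by (intro tendsto_mult tendsto_const tendsto_real_sqrt psi_negligible Vs)
    then show "(\<lambda>n. \<bar>s\<bar> * sqrt ((expectation (\<lambda>\<omega>. (field_functional (ker.window (T n) (S n)) \<psi> \<omega>)\<^sup>2) / ker.growth (T n) (S n)) * (ker.growth (T n) (S n) / (\<sigma> n)\<^sup>2))) \<longlonglongrightarrow> 0" by simp
  qed
  have l2: "(\<lambda>n. (LINT \<omega>|M. iexp (u n * hermite_functional (ker.window (T n) (S n)) m \<omega>)) - complex_of_real (exp (- ((u n)\<^sup>2 * functional_variance (ker.window (T n) (S n)) m / 2)))) \<longlonglongrightarrow> 0"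
  proof (rule Lim_null_comparison[OF eventuallyI[OF d2]])
    have "(\<lambda>n. (s\<^sup>2 * (a R)\<^sup>2) * ((ker.growth (T n) (S n) / (\<sigma> n)\<^sup>2) * sqrt (contraction_const m * (?CI n / (ker.growth (T n) (S n))\<^sup>2)))) \<longlonglongrightarrow> (s\<^sup>2 * (a R)\<^sup>2) * ((1 / L) * sqrt (contraction_const m * 0))"
      by (intro tendsto_mult tendsto_const tendsto_real_sqrt CI_lim Vs)
    then show "(\<lambda>n. (s\<^sup>2 * (a R)\<^sup>2) * ((ker.growth (T n) (S n) / (\<sigma> n)\<^sup>2) * sqrt (contraction_const m * (?CI n / (ker.growth (T n) (S n))\<^sup>2)))) \<longlonglongrightarrow> 0" by simp
  qed
  have l3: "(\<lambda>n. complex_of_real (exp (- ((u n)\<^sup>2 * functional_variance (ker.window (T n) (S n)) m / 2)))) \<longlonglongrightarrow> complex_of_real (exp (- (s\<^sup>2 / 2)))"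
    by (intro tendsto_intros uV) simp
  show ?thesis unfolding eq using tendsto_add[OF tendsto_add[OF l1 l2] l3] by simp
qed

lemma clt_sequence:
  assumes "isCont (cdf \<gamma>) x"
  shows "(\<lambda>n. cdf (distr M borel (normalized M (field_functional (ker.window (T n) (S n)) \<phi>))) x) \<longlonglongrightarrow> cdf \<gamma> x"
proof -
  have [measurable]: "field_functional (ker.window (T n) (S n)) \<phi> \<in> borel_measurable M" for n by (rule field_functional_measurable[OF ker.window_compact phi_meas phi_L2])
  have nm: "normalized M (field_functional (ker.window (T n) (S n)) \<phi>) \<in> borel_measurable M" for n unfolding normalized_def[abs_def] by measurable
  have "weak_conv_m (\<lambda>n. distr M borel (normalized M (field_functional (ker.window (T n) (S n)) \<phi>))) \<gamma>"
  proof (rule levy_continuity)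
    show "real_distribution (distr M borel (normalized M (field_functional (ker.window (T n) (S n)) \<phi>)))" for n
      by (rule real_distribution_distr[OF nm])
    show "real_distribution \<gamma>" by (rule real_dist_normal_dist)
    show "(\<lambda>n. char (distr M borel (normalized M (field_functional (ker.window (T n) (S n)) \<phi>))) t) \<longlonglongrightarrow> char \<gamma> t" for t
    proof -
      have "char (distr M borel (normalized M (field_functional (ker.window (T n) (S n)) \<phi>))) t = (LINT \<omega>|M. iexp (t * normalized M (field_functional (ker.window (T n) (S n)) \<phi>) \<omega>))" for n
        unfolding char_def using nm[of n] by (subst integral_distr) auto
      then show ?thesis using char_lim[of t] by (simp add: char_std_normal_distribution)
    qed
  qed
  then show ?thesis using assms by (simp add: weak_conv_m_def weak_conv_def)
qed

end

end

text \<open>The two-point law at x - y and 0 is shifted by y. For x = y the index set collapses to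
  one point and the argument is unchanged.\<close>

lemma stationary_covariance:
  fixes B :: "'x::ab_group_add \<Rightarrow> 'w \<Rightarrow> real"
  assumes st: "stationary_field M B" and [measurable]: "\<And>x. B x \<in> borel_measurable M"
  shows "(LINT \<omega>|M. B x \<omega> * B y \<omega>) = (LINT \<omega>|M. B (x - y) \<omega> * B 0 \<omega>)"
proof -
  let ?J = "{x - y, 0}"
  let ?g = "\<lambda>f :: 'x \<Rightarrow> real. f (x - y) * f 0"
  have eq: "distr M (\<Pi>\<^sub>M z\<in>?J. borel) (\<lambda>\<omega>. \<lambda>z\<in>?J. B (z + y) \<omega>) = distr M (\<Pi>\<^sub>M z\<in>?J. borel) (\<lambda>\<omega>. \<lambda>z\<in>?J. B z \<omega>)"
    using st unfolding stationary_field_def by (metis finite.emptyI finite_insert)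
  have g: "?g \<in> borel_measurable (\<Pi>\<^sub>M z\<in>?J. borel)"
    by (intro borel_measurable_times measurable_component_singleton) auto
  have m: "(\<lambda>\<omega>. \<lambda>z\<in>?J. B (z + c) \<omega>) \<in> measurable M (\<Pi>\<^sub>M z\<in>?J. borel)" for c
    by (rule measurable_restrict) simp
  have "(LINT \<omega>|M. B x \<omega> * B y \<omega>) = (LINT f|distr M (\<Pi>\<^sub>M z\<in>?J. borel) (\<lambda>\<omega>. \<lambda>z\<in>?J. B (z + y) \<omega>). ?g f)"
    by (subst integral_distr[OF m g]) simp
  also have "\<dots> = (LINT \<omega>|M. B (x - y) \<omega> * B 0 \<omega>)"
    unfolding eq using integral_distr[OF m[of 0] g] by simp
  finally show ?thesis .
qed

lemma completely_monotone_nonneg: "completely_monotone f \<Longrightarrow> 0 < x \<Longrightarrow> 0 \<le> f x"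
  unfolding completely_monotone_def by (drule spec[of _ 0]) simp

text \<open>The limit controls G far away and boundedness controls it near the origin; nonnegativity
  determines the sign of the limit constant.\<close>

lemma power_law_bounds:
  fixes G :: "'a::euclidean_space \<Rightarrow> real"
  assumes pl: "asymp_power_law G \<rho>" and nonneg: "\<And>x. 0 \<le> G x" and bdd: "\<And>x. G x \<le> b"
  obtains K L where "0 \<le> K" "0 < L" "\<And>y. y \<noteq> 0 \<Longrightarrow> G y \<le> K * norm y powr - \<rho>"
    "\<And>y. y \<noteq> 0 \<Longrightarrow> ((\<lambda>t. t powr \<rho> * G (t *\<^sub>R y)) \<longlongrightarrow> L * norm y powr - \<rho>) at_top"
proof -
  obtain g L where g: "\<And>x. G x = g (norm x)" "L \<noteq> 0" and lim: "((\<lambda>r. r powr \<rho> * g r) \<longlongrightarrow> L) at_top" and rho: "0 < \<rho>"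
    using pl unfolding asymp_power_law_def by blast
  obtain e :: 'a where e: "norm e = 1" using vector_choose_size[of 1] by auto
  have gn: "0 \<le> g r" "g r \<le> b" if "0 \<le> r" for r
    using nonneg[of "r *\<^sub>R e"] bdd[of "r *\<^sub>R e"] g(1)[of "r *\<^sub>R e"] e that by simp_all
  have "0 \<le> L"
  proof (rule tendsto_lowerbound[OF lim])
    show "\<forall>\<^sub>F r in at_top. 0 \<le> r powr \<rho> * g r"
      using eventually_ge_at_top[of "0::real"] by eventually_elim (simp add: gn)
  qed simp
  then have L: "0 < L" using g(2) by simp
  have "\<forall>\<^sub>F r in at_top. r powr \<rho> * g r < L + 1" using lim by (rule order_tendstoD) simp
  then obtain r0 where r0: "\<And>r. r \<ge> r0 \<Longrightarrow> r powr \<rho> * g r < L + 1" by (auto simp: eventually_at_top_linorder)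
  \<comment> \<open>The first entry serves radii above the threshold r0; below it, r^rho is at most
    |r0|^rho and g at most b.\<close>
  define K where "K = max (L + 1) (\<bar>r0\<bar> powr \<rho> * b)"
  have K0: "0 \<le> K" using L by (simp add: K_def)
  have bK: "r powr \<rho> * g r \<le> K" if "0 < r" for r
  proof (cases "r \<ge> r0")
    case True then show ?thesis using r0[of r] by (simp add: K_def)
  next
    case False
    then have "r powr \<rho> * g r \<le> \<bar>r0\<bar> powr \<rho> * b"
      using that rho gn[of r] by (intro mult_mono powr_mono2) auto
    then show ?thesis by (simp add: K_def)
  qed
  show thesis
  proof (rule that[OF K0 L])
    fix y :: 'a assume y: "y \<noteq> 0"
    then have ny: "0 < norm y" by simp
    have pm: "norm y powr \<rho> * norm y powr - \<rho> = 1" using ny by (simp add: powr_add[symmetric])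
    have "(norm y powr \<rho> * g (norm y)) * norm y powr - \<rho> \<le> K * norm y powr - \<rho>"
      by (intro mult_right_mono bK ny) simp
    moreover have "(norm y powr \<rho> * g (norm y)) * norm y powr - \<rho> = G y"
      using pm by (simp add: g(1) mult.commute mult.left_commute)
    ultimately show "G y \<le> K * norm y powr - \<rho>" by simp
    have "filterlim (\<lambda>t. t * norm y) at_top at_top"
      using ny by (rule filterlim_at_top_mult_tendsto_pos[OF tendsto_const _ filterlim_ident])
    from filterlim_compose[OF lim this] have "((\<lambda>t. ((t * norm y) powr \<rho> * g (t * norm y)) * norm y powr - \<rho>) \<longlongrightarrow> L * norm y powr - \<rho>) at_top"
      by (intro tendsto_mult tendsto_const)
    moreover have "\<forall>\<^sub>F t in at_top. ((t * norm y) powr \<rho> * g (t * norm y)) * norm y powr - \<rho> = t powr \<rho> * G (t *\<^sub>R y)"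
      using eventually_gt_at_top[of "0::real"]
    proof eventually_elim
      case (elim t)
      then have "(t * norm y) powr \<rho> = t powr \<rho> * norm y powr \<rho>" by (simp add: powr_mult)
      then have "((t * norm y) powr \<rho> * g (t * norm y)) * norm y powr - \<rho> = t powr \<rho> * g (t * norm y) * (norm y powr \<rho> * norm y powr - \<rho>)"
        by (simp only: mult_ac)
      then show ?case using elim unfolding pm by (simp add: g(1))
    qed
    ultimately show "((\<lambda>t. t powr \<rho> * G (t *\<^sub>R y)) \<longlongrightarrow> L * norm y powr - \<rho>) at_top"
      by (rule Lim_transform_eventually)
  qed
qed

theorem theorem1p2:
  fixes M :: "'w measure"
    and B :: "'a::euclidean_space \<times> 'b::euclidean_space \<Rightarrow> 'w \<Rightarrow> real"
    and C :: "'a \<times> 'b \<Rightarrow> real"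
    and C1 :: "'a \<Rightarrow> real" and C2 :: "'b \<Rightarrow> real"
    and c1 c2 :: "real \<Rightarrow> real"
    and \<phi> :: "real \<Rightarrow> real"
    and R :: nat
    and D1 :: "'a set" and D2 :: "'b set"
    and t1 t2 :: "real \<Rightarrow> real"
    and \<rho>1 :: real
    and Y :: "real \<Rightarrow> 'w \<Rightarrow> real"
  assumes "prob_space M"
    and "gaussian_field M B"
    and "continuous_field M B"
    and "stationary_field M B"
    and "centered_field M B"
    and "unit_variance_field M B"
    and "\<And>x. C x = covariance M (B x) (B 0)"
    and "\<phi> \<in> borel_measurable borel"
    and "\<not> \<phi> constant_on UNIV"
    and "integrable std_normal_distribution (\<lambda>x. (\<phi> x)\<^sup>2)"
    and "convex_body D1" and "convex_body D2"
    and "\<And>t. t > 0 \<Longrightarrow> t1 t > 0" and "\<And>t. t > 0 \<Longrightarrow> t2 t > 0"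
    and "filterlim t1 at_top at_top" and "filterlim t2 at_top at_top"
    and "\<And>t. Y t = additive_functional B \<phi> D1 D2 t1 t2 t"
    and "gneiting_type C C1 C2 c1 c2"
    and "filterlim (\<lambda>t. t1 t * c2 (t2 t) powr (1 / real DIM('a))) at_top at_top"
    and "has_hermite_rank \<phi> R" and "R \<ge> 2"
    and "\<not> in_Lp (real R) C1"
    and "asymp_power_law C1 \<rho>1" and "real R * \<rho>1 < real DIM('a)"
    and "in_Lp (real R * (1 - \<rho>1 / real DIM('a))) C2"
  shows "converges_in_distribution M (\<lambda>t. normalized M (Y t)) std_normal_distribution at_top \<and>
    (\<exists>l>0. (\<lambda>t. prob_space.variance M (Y t)) \<sim>[at_top]
       (\<lambda>t. l * t2 t ^ DIM('b) * t1 t powr (2 * real DIM('a) - real R * \<rho>1)))"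
proof -
  let ?d = "real DIM('a)"
  interpret prob_space M by (rule assms(1))
  have Bm: "B x \<in> borel_measurable M" for x
    using assms(2)[unfolded gaussian_field_def, rule_format, of "{x}" "\<lambda>_. 1"]
    by (simp add: gaussian_rv_def)
  have cent: "expectation (B x) = 0" for x
    using assms(5)[unfolded centered_field_def, rule_format, of x] .
  have unit: "expectation (\<lambda>\<omega>. (B x \<omega>)\<^sup>2) = 1" for x
    using assms(6)[unfolded unit_variance_field_def, rule_format, of x] by (simp add: cent)
  have C0: "C x = expectation (\<lambda>\<omega>. B x \<omega> * B 0 \<omega>)" for x
    unfolding assms(7) covariance_def by (simp add: cent)
  have cov: "expectation (\<lambda>\<omega>. B x \<omega> * B y \<omega>) = C (x - y)" for x y
    unfolding C0 by (rule stationary_covariance[OF assms(4) Bm])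
  have Cz: "C 0 = 1" using unit[of 0] by (simp add: C0 power2_eq_square)
  from assms(18) have Cg: "\<And>x1 x2. C (x1, x2) = C2 x2 * C1 ((C2 x2 powr (1 / ?d)) *\<^sub>R x1)"
    and C1r: "\<And>x1. C1 x1 = c1 (norm x1)" and cm1: "completely_monotone c1" and C2p: "\<And>x2. C2 x2 > 0"
    unfolding gneiting_type_def by blast+
  \<comment> \<open>Complete monotonicity speaks of positive radii only. At the origin the sign
    follows from C(0) = C2(0) C1(0) = 1.\<close>
  have C1_nonneg: "0 \<le> C1 x" for x
  proof (cases "x = 0")
    case True
    have "C2 0 * C1 0 = 1" using Cg[of 0 0] Cz by (simp add: zero_prod_def)
    then show ?thesis using C2p[of 0] True by (metis zero_less_mult_pos zero_less_one less_imp_le)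
  next
    case False
    then show ?thesis unfolding C1r by (intro completely_monotone_nonneg cm1) simp
  qed
  have C_nonneg: "0 \<le> C x" for x
    using Cg[of "fst x" "snd x"] C1_nonneg C2p by (simp add: less_imp_le)
  interpret gauss_field M B C
    by unfold_locales (use assms(2,3) cent unit cov C_nonneg in auto)
  \<comment> \<open>Evaluating the Gneiting formula at second coordinate 0 and at y divided by the
    scaling factor turns C <= 1 into a bound for C1.\<close>
  have C1_le: "C1 y \<le> 1 / C2 0" for y
  proof -
    let ?s = "C2 0 powr (1 / ?d)"
    have s: "?s > 0" using C2p[of 0] by simp
    have "C ((1 / ?s) *\<^sub>R y, 0) = C2 0 * C1 y" unfolding Cg using s by simp
    then have "C2 0 * C1 y \<le> 1" using C_le_1 by metis
    then show ?thesis using C2p[of 0] by (simp add: field_simps)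
  qed
  obtain K L where K: "0 \<le> K" and L: "0 < L" and C1K: "\<And>y. y \<noteq> 0 \<Longrightarrow> C1 y \<le> K * norm y powr - \<rho>1"
    and C1L: "\<And>y. y \<noteq> 0 \<Longrightarrow> ((\<lambda>t. t powr \<rho>1 * C1 (t *\<^sub>R y)) \<longlongrightarrow> L * norm y powr - \<rho>1) at_top"
    using power_law_bounds[OF assms(23) C1_nonneg C1_le] by blast
  have rho: "0 < \<rho>1" using assms(23) by (simp add: asymp_power_law_def)
  define h where "h w = C2 w powr (1 - \<rho>1 / ?d)" for w
  have C2m[measurable]: "C2 \<in> borel_measurable borel" using assms(25) by (simp add: in_Lp_def)
  have hR: "h w ^ R = \<bar>C2 w\<bar> powr (real R * (1 - \<rho>1 / ?d))" for w
    using C2p[of w] by (simp add: h_def powr_power mult.commute)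
  \<comment> \<open>The prefactor contributes the exponent 1 and the scaled argument -rho1/d_1,
    which together give \<open>h\<close>.\<close>
  have scale: "C2 w * (C2 w powr (1 / ?d)) powr - \<rho>1 = h w" for w
  proof -
    have "C2 w * (C2 w powr (1 / ?d)) powr - \<rho>1 = C2 w powr 1 * C2 w powr (- \<rho>1 / ?d)"
      using C2p[of w] by (simp add: powr_powr)
    also have "\<dots> = h w" unfolding h_def powr_add[symmetric] by simp
    finally show ?thesis .
  qed
  have kernel: "gneiting_kernel C h \<rho>1 K L R D1 D2"
  proof
    show "C \<in> borel_measurable borel" by (rule C_measurable)
    show "0 \<le> C x" "C x \<le> 1" "C (- x) = C x" for x by (simp_all add: C_nonneg C_le_1)
    show "h \<in> borel_measurable borel" unfolding h_def[abs_def] by measurable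
    show "0 < h w" for w using C2p[of w] by (simp add: h_def)
    have "integrable lborel (\<lambda>w. h w ^ R)" unfolding hR using assms(25) by (simp add: in_Lp_def)
    then have "(\<integral>\<^sup>+w. ennreal (h w ^ R) \<partial>lborel) = ennreal (LINT w|lborel. h w ^ R)"
      by (rule nn_integral_eq_integral) (simp add: h_def)
    then show "(\<integral>\<^sup>+w. ennreal (h w ^ R) \<partial>lborel) < \<infinity>" by simp
    show "0 < \<rho>1" by (rule rho)
    show "0 < R" "real R * \<rho>1 < ?d" using assms(21,24) by auto
    show "0 \<le> K" "0 < L" by (rule K L)+
    show "compact D1" "interior D1 \<noteq> {}" "compact D2" "interior D2 \<noteq> {}"
      using assms(11,12) by (auto simp: convex_body_def)
    \<comment> \<open>Convexity of the second window makes its frontier a null set.\<close>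
    show "negligible (frontier D2)" using assms(12) by (auto simp: convex_body_def intro: negligible_convex_frontier)
    fix z :: 'a and w :: 'b assume z: "z \<noteq> 0"
    let ?s = "C2 w powr (1 / ?d)"
    have s: "0 < ?s" "?s *\<^sub>R z \<noteq> 0" using C2p[of w] z by auto
    have np: "norm (?s *\<^sub>R z) powr - \<rho>1 = ?s powr - \<rho>1 * norm z powr - \<rho>1" using s z by (simp add: powr_mult)
    have "C (z, w) \<le> C2 w * (K * norm (?s *\<^sub>R z) powr - \<rho>1)"
      unfolding Cg using C2p[of w] by (intro mult_left_mono C1K s) auto
    also have "\<dots> = K * (C2 w * ?s powr - \<rho>1) * norm z powr - \<rho>1" unfolding np by (simp only: mult_ac)
    finally show "C (z, w) \<le> K * h w * norm z powr - \<rho>1" unfolding scale .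
    have "((\<lambda>t. C2 w * (t powr \<rho>1 * C1 (t *\<^sub>R (?s *\<^sub>R z)))) \<longlongrightarrow> C2 w * (L * norm (?s *\<^sub>R z) powr - \<rho>1)) at_top"
      by (intro tendsto_mult tendsto_const C1L s)
    moreover have "C2 w * (L * norm (?s *\<^sub>R z) powr - \<rho>1) = L * (C2 w * ?s powr - \<rho>1) * norm z powr - \<rho>1"
      unfolding np by (simp only: mult_ac)
    moreover have "C2 w * (t powr \<rho>1 * C1 (t *\<^sub>R (?s *\<^sub>R z))) = t powr \<rho>1 * C (t *\<^sub>R z, w)" for t
      unfolding Cg by (simp add: mult.commute)
    ultimately show "((\<lambda>t. t powr \<rho>1 * C (t *\<^sub>R z, w)) \<longlongrightarrow> L * h w * norm z powr - \<rho>1) at_top"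
      by (simp only: scale)
  qed
  interpret G: gneiting_functional M B C h \<rho>1 K L R D1 D2 \<phi>
    by (intro gneiting_functional.intro gneiting_functional_axioms.intro gauss_field_axioms kernel assms(8,10,20))
  \<comment> \<open>The sample path is continuous and \<open>\<phi>\<close> is Borel, so the
    integrand is measurable and the integral over the window may be written with
    \<open>mu\<close>.\<close>
  have Y_eq: "Y t \<omega> = field_functional (G.ker.window (t1 t) (t2 t)) \<phi> \<omega>" if "\<omega> \<in> space M" for t \<omega>
  proof -
    have "(\<lambda>x. \<phi> (B x \<omega>)) \<in> borel_measurable borel"
      using borel_measurable_continuous_onI[OF continuous_sample[OF that, of UNIV]] assms(8) by measurable
    then show ?thesis unfolding assms(17) additive_functional_def field_functional_def G.ker.window_def[symmetric]
      by (intro integral_mu[symmetric]) auto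
  qed
  have EY: "expectation (Y t) = expectation (field_functional (G.ker.window (t1 t) (t2 t)) \<phi>)" for t
    by (intro Bochner_Integration.integral_cong Y_eq refl)
  have VY: "variance (Y t) = variance (field_functional (G.ker.window (t1 t) (t2 t)) \<phi>)" for t
    unfolding EY by (intro Bochner_Integration.integral_cong refl) (simp add: Y_eq)
  have NY: "distr M borel (normalized M (Y t)) = distr M borel (normalized M (field_functional (G.ker.window (t1 t) (t2 t)) \<phi>))" for t
    by (rule distr_cong) (simp_all add: normalized_def Y_eq EY VY[unfolded EY])
  \<comment> \<open>The scales t1 and t2 are known to be positive only at positive times. A sequence
    tending to infinity eventually agrees with its maximum with 1, which is positive
    throughout.\<close>
  have seq: "\<exists>X'. (\<forall>n. X' n > 0) \<and> filterlim X' at_top sequentially \<and> (\<forall>\<^sub>F n in sequentially. X' n = X n)"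
    if X: "filterlim X at_top sequentially" for X :: "nat \<Rightarrow> real"
  proof (intro exI[of _ "\<lambda>n. max 1 (X n)"] conjI allI)
    show ev: "\<forall>\<^sub>F n in sequentially. max 1 (X n) = X n"
      using X[unfolded filterlim_at_top, rule_format, of 1] by eventually_elim simp
    show "filterlim (\<lambda>n. max 1 (X n)) at_top sequentially"
      by (rule filterlim_at_top_mono[OF X]) simp
  qed auto
  \<comment> \<open>Dominated convergence and Levy's continuity theorem were used along sequences;
    the limit in the real parameter follows by testing on all sequences that tend to
    infinity.\<close>
  have lim_at_top: "(f \<longlongrightarrow> l) at_top"
    if "\<And>X. (\<And>n. X n > 0) \<Longrightarrow> filterlim X at_top sequentially \<Longrightarrow> (\<lambda>n. f (X n)) \<longlonglongrightarrow> l" for f :: "real \<Rightarrow> real" and l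
  proof (rule tendsto_at_topI_sequentially)
    fix X :: "nat \<Rightarrow> real" assume "filterlim X at_top sequentially"
    from seq[OF this] obtain X' where X': "\<And>n. X' n > 0" "filterlim X' at_top sequentially" "\<forall>\<^sub>F n in sequentially. X' n = X n"
      by blast
    have "\<forall>\<^sub>F n in sequentially. f (X' n) = f (X n)" using X'(3) by eventually_elim simp
    then show "(\<lambda>n. f (X n)) \<longlonglongrightarrow> l" by (rule Lim_transform_eventually[OF that[OF X'(1,2)]])
  qed
  have clt: "converges_in_distribution M (\<lambda>t. normalized M (Y t)) std_normal_distribution at_top"
    unfolding converges_in_distribution_def
  proof (intro allI impI lim_at_top)
    fix x :: real and X :: "nat \<Rightarrow> real"
    assume "isCont (cdf std_normal_distribution) x" and X: "\<And>n. X n > 0" "filterlim X at_top sequentially"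
    then show "(\<lambda>n. cdf (distr M borel (normalized M (Y (X n)))) x) \<longlonglongrightarrow> cdf std_normal_distribution x"
      unfolding NY by (intro G.clt_sequence assms(13,14) filterlim_compose[OF assms(15)] filterlim_compose[OF assms(16)])
  qed
  let ?V = "\<lambda>t. t2 t ^ DIM('b) * t1 t powr (2 * ?d - real R * \<rho>1)"
  have growth: "G.ker.growth (t1 t) (t2 t) = ?V t" for t by (simp add: G.ker.growth_def G.ker.\<beta>_def)
  have "((\<lambda>t. variance (Y t) / ?V t) \<longlongrightarrow> G.L) at_top"
  proof (rule lim_at_top)
    fix X :: "nat \<Rightarrow> real" assume X: "\<And>n. X n > 0" "filterlim X at_top sequentially"
    show "(\<lambda>n. variance (Y (X n)) / ?V (X n)) \<longlonglongrightarrow> G.L"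
      unfolding VY growth[symmetric]
      by (intro G.variance_lim assms(13,14) filterlim_compose[OF assms(15)] filterlim_compose[OF assms(16)] X)
  qed
  then have "((\<lambda>t. (variance (Y t) / ?V t) * (1 / G.L)) \<longlongrightarrow> G.L * (1 / G.L)) at_top" by (intro tendsto_mult tendsto_const)
  then have "((\<lambda>t. variance (Y t) / (G.L * t2 t ^ DIM('b) * t1 t powr (2 * ?d - real R * \<rho>1))) \<longlongrightarrow> 1) at_top"
    using G.L_pos by (simp add: mult_ac)
  then have "(\<lambda>t. variance (Y t)) \<sim>[at_top] (\<lambda>t. G.L * t2 t ^ DIM('b) * t1 t powr (2 * ?d - real R * \<rho>1))"
    by (rule asymp_equivI')
  then show ?thesis using clt G.L_pos by blast
qed

end
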